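(* Let $\alpha\in(0,1/2]$ and let $F$ satisfy the tail conditions (i) and (ii) below with this $\alpha$. Suppose that for some $L\in\mathcal{R}$ with $L\ge 1$ on $(0,\infty)$ and some constants $T\ge 0$, $\eta\in(0,1]$, the following hold as $x\to\infty$: (a) $L(x)/r(x)\to 0$ and $$\frac{x}{r(x)}\sum_{n<L(x)}F^{*n}(x+I)\to 0;$$ (b) if $\alpha\in(0,1/2)$, then $\Phi_\eta(x,T)=o\big(r(x)^2\,r^-(L(x))/L(x)^2\big)$; (c) if $\alpha=1/2$, then, with $u(x)=\int_1^x (r(s)/s)^2\,ds$ and $k(x)=r(x)^2/u(x)$, $$\Phi_\eta(x,T)=\begin{cases}O(k(x)), & \text{if } u(x)/u(r^-(L(x)))\to 1,\\ o(k(x)), & \text{otherwise.}\end{cases}$$ Then the strong renewal theorem holds: $$\lim_{x\to\infty}x\bar F(x)\,U(x+I)=\alpha h\int_0^\infty x^{-\alpha}g(x)\,dx .$$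
   Context: $F$ is a probability measure on $\mathbb{R}$, $F(x)=F((-\infty,x])$, $\bar F(x)=1-F(x)$. $\mathcal{R}_\alpha$ denotes the class of functions strictly positive on $(0,\infty)$ and regularly varying at $\infty$ with exponent $\alpha$, and $\mathcal{R}=\bigcup_\alpha\mathcal{R}_\alpha$. Tail conditions: (i) for some $r\in\mathcal{R}_\alpha$, $\bar F(x)\sim 1/r(x)$ as $x\to\infty$; (ii) $\lim_{x\to\infty}F(-x)/\bar F(x)$ exists and is finite. $F$ is arithmetic if concentrated on $h\mathbb{Z}$ for some $h>0$; its span is the largest such $h$. Fix $h>0$: if $F$ is arithmetic, $h$ is its span; otherwise $h>0$ is arbitrary. $I=(0,h]$ and $F(x+I)=F((x,x+h])$. $F^{*n}$ is the $n$-fold convolution of $F$ ($F^{*0}$ = unit mass at $0$), and $U=\sum_{n\ge0}F^{*n}$ is the renewal measure. $r^-(x)=\inf\{t\ge1:r(t)>x\}$ and $a_n=r^-(n)$. If $X_1,X_2,\dots$ are i.i.d. with law $F$ and $S_n=X_1+\dots+X_n$, then under (i),(ii) $S_n/a_n$ converges in distribution to a stable random variable $\zeta$ of exponent $\alpha$; $g$ denotes the density of $\zeta$. Define $\omega(x)=xF(x+I)/\bar F(x)$ and, for $\eta\in(0,1]$, $T\ge0$, $\Phi_\eta(x,T)=\int_{(1-\eta)x}^x[\omega(y)-T]^+\,dy$, where $c^+=\max(c,0)$. *)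

theory Defs
  imports "HOL-Probability.Probability" "HOL-Probability.Convolution" "HOL-Library.Landau_Symbols"
begin

text \<open>Distribution function and tail of a measure on the reals.\<close>
definition Fdist :: "real measure \<Rightarrow> real \<Rightarrow> real" where
  "Fdist F x = measure F {..x}"

definition Ftail :: "real measure \<Rightarrow> real \<Rightarrow> real" where
  "Ftail F x = 1 - Fdist F x"

text \<open>F(x+I) = F((x, x+h]).\<close>
definition FI :: "real measure \<Rightarrow> real \<Rightarrow> real \<Rightarrow> real" where
  "FI F h x = measure F {x<..x+h}"

text \<open>Regularly varying functions with index a (strictly positive on (0,oo), measurable).\<close>
definition reg_var :: "real \<Rightarrow> (real \<Rightarrow> real) \<Rightarrow> bool" where
  "reg_var a f \<longleftrightarrow> f \<in> borel_measurable borel \<and> (\<forall>x>0. f x > 0) \<and>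
     (\<forall>c>0. ((\<lambda>x. f (c * x) / f x) \<longlongrightarrow> c powr a) at_top)"

definition reg_var_any :: "(real \<Rightarrow> real) \<Rightarrow> bool" where
  "reg_var_any f \<longleftrightarrow> (\<exists>a. reg_var a f)"

text \<open>Generalized inverse r^-(x) = inf {t >= 1 : r t > x}.\<close>
definition ginv :: "(real \<Rightarrow> real) \<Rightarrow> real \<Rightarrow> real" where
  "ginv r x = Inf {t. t \<ge> 1 \<and> r t > x}"

text \<open>Lattice / arithmetic distributions and span.\<close>
definition lattice_on :: "real measure \<Rightarrow> real \<Rightarrow> bool" where
  "lattice_on F h \<longleftrightarrow> measure F (range (\<lambda>k::int. h * of_int k)) = 1"

definition arithmetic :: "real measure \<Rightarrow> bool" where
  "arithmetic F \<longleftrightarrow> (\<exists>h>0. lattice_on F h)"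

definition is_span :: "real measure \<Rightarrow> real \<Rightarrow> bool" where
  "is_span F h \<longleftrightarrow> h > 0 \<and> lattice_on F h \<and> (\<forall>h'>h. \<not> lattice_on F h')"

text \<open>n-fold convolution, F^{*0} = unit mass at 0.\<close>
fun conv_pow :: "real measure \<Rightarrow> nat \<Rightarrow> real measure" where
  "conv_pow F 0 = return borel 0"
| "conv_pow F (Suc n) = convolution F (conv_pow F n)"

text \<open>Renewal measure of x + I: U(x+I) = sum_n F^{*n}((x,x+h]) (possibly infinite).\<close>
definition renewal_I :: "real measure \<Rightarrow> real \<Rightarrow> real \<Rightarrow> ennreal" where
  "renewal_I F h x = (\<Sum>n. emeasure (conv_pow F n) {x<..x+h})"

definition omega :: "real measure \<Rightarrow> real \<Rightarrow> real \<Rightarrow> real" where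
  "omega F h x = x * FI F h x / Ftail F x"

definition Phi :: "real measure \<Rightarrow> real \<Rightarrow> real \<Rightarrow> real \<Rightarrow> real \<Rightarrow> real" where
  "Phi F h \<eta> x T = (LBINT y=(1 - \<eta>) * x..x. max (omega F h y - T) 0)"

end

theory Submission
  imports Defs "HOL-Real_Asymp.Real_Asymp"
begin

text \<open>The sum over \<open>n\<close> defining the renewal measure is replaced by an integral over Poisson time: since
\<open>t ^ n / n! * exp (- t)\<close> has integral \<open>1\<close> over \<open>t > 0\<close>, the renewal measure is
\<open>\<integral> P\<^sub>t dt\<close>, where the compound Poisson law \<open>P\<^sub>t\<close> has characteristic function
\<open>exp (t (\<phi> - 1))\<close> and obeys a local limit theorem in the continuous time \<open>t = s / W x\<close>. Times with
\<open>s > \<delta>\<close> contribute \<open>h \<integral> s powr (-1/\<alpha>) g (s powr (-1/\<alpha>)) ds\<close> in the limit, which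
is the claimed constant after substituting \<open>s = y powr (- \<alpha>)\<close>. For \<open>s \<le> \<delta>\<close> one returns to the sum over
\<open>n \<le> 4 \<delta> / W x\<close>: terms \<open>n < L x\<close> vanish by hypothesis. For the others, truncation at a small
multiple of \<open>x\<close> is harmless by exponential tilting, and a single big jump costs \<open>O (\<delta>)\<close> plus
\<open>\<Sum> n / a n\<close> times the integral over \<open>w > c x\<close> of the excess of \<open>\<omega>\<close> over \<open>T\<close>, weighted by \<open>W w / w\<close>. Cutting that
integral into the windows of \<open>\<Phi>\<close> with geometric ratio and the sum into geometric blocks, Potter
bounds turn the growth condition on \<open>\<Phi>\<close> into the required smallness.\<close>

text \<open>In integer time |char F \<theta>| = 1 can occur without char F \<theta> = 1 (shifted
  lattices, periodic walks), and then the n-fold laws have no local limit theorem with span h. At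
  Poisson time t the modulus is exp (- t * Re (1 - char F \<theta>)), so only char F \<theta> = 1
  obstructs, and this forces \<open>lattice_on F (2 * pi / \<bar>\<theta>\<bar>)\<close>. The cut at
  \<delta> is forced as well: the majorant of the rescaled mass is s^(-1/\<beta>) with \<alpha> <
  \<beta> < 1, integrable at infinity but not at 0. Regular variation of \<open>r\<close> gives
  neither monotonicity nor local boundedness. The working function is therefore the tail
  \<open>W\<close>, which is monotone: its Potter bounds iterate a single ratio along powers of 2.
  \<open>L\<close> is not monotone, so it is compared only along one geometric grid z / q^k, and the
  windows of \<open>Phi\<close> as well as x itself are put on that grid. A locally unbounded
  \<open>r\<close> could keep \<open>ginv r\<close> bounded, so its divergence is extracted from the
  weak limit; likewise the integral u may diverge and take its default value 0, which is a case of
  its own.\<close>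

locale heavy_tail =
  fixes F :: "real measure" and \<alpha> :: real and r :: "real \<Rightarrow> real"
  assumes F_prob: "prob_space F" and F_sets [measurable_cong, simp]: "sets F = sets borel"
    and alpha_pos: "0 < \<alpha>" and alpha_less_1: "\<alpha> < 1"
    and r_rv: "reg_var \<alpha> r"
    and tail_asymp: "Ftail F \<sim>[at_top] (\<lambda>x. 1 / r x)"
    and tail_balance: "\<exists>c. ((\<lambda>x. Fdist F (- x) / Ftail F x) \<longlongrightarrow> c) at_top"
begin

sublocale prob_space F by (rule F_prob)

abbreviation W :: "real \<Rightarrow> real" where "W \<equiv> Ftail F"
abbreviation a :: "real \<Rightarrow> real" where "a \<equiv> ginv r"

section \<open>The tail function: positivity, regular variation, Potter bounds\<close>

lemma space_F [simp]: "space F = UNIV"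
  using sets_eq_imp_space_eq[OF F_sets] by simp

lemma tail_eq: "W x = measure F {x<..}"
proof -
  have "measure F {x<..} = 1 - measure F (space F - {x<..})"
    by (subst prob_compl) auto
  also have "space F - {x<..} = {..x}" by auto
  finally show ?thesis by (simp add: Ftail_def Fdist_def)
qed

lemma tail_antimono: "x \<le> y \<Longrightarrow> W y \<le> W x"
  unfolding tail_eq by (rule finite_measure_mono) auto

lemma tail_le_1: "W x \<le> 1"
  unfolding tail_eq by simp

lemma r_pos: "x > 0 \<Longrightarrow> r x > 0"
  using r_rv by (auto simp: reg_var_def)

lemma r_measurable [measurable]: "r \<in> borel_measurable borel"
  using r_rv by (auto simp: reg_var_def)

lemma tail_r: "((\<lambda>x. W x * r x) \<longlongrightarrow> 1) at_top"
proof -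
  have "((\<lambda>x. if W x = 0 \<and> 1 / r x = 0 then 1 else W x / (1 / r x)) \<longlongrightarrow> 1) at_top"
    using tail_asymp by (simp add: asymp_equiv_def)
  then show ?thesis
    by (rule Lim_transform_eventually)
       (use eventually_gt_at_top[of 0] in eventually_elim, auto dest: r_pos)
qed

text \<open>Near infinity \<open>W y * r y\<close> is close to 1, which forces
  \<open>W y > 0\<close>; monotonicity carries this back to every x. Divisions by \<open>W x\<close>
  are harmless from here on.\<close>

lemma tail_pos: "W x > 0"
proof -
  have "eventually (\<lambda>y. W y * r y > 1/2) at_top"
    by (rule order_tendstoD[OF tail_r]) simp
  then have "eventually (\<lambda>y. W y * r y > 1/2 \<and> y > x \<and> y > 0) at_top"
    using eventually_gt_at_top[of x] eventually_gt_at_top[of 0] by eventually_elim auto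
  then obtain y where y: "W y * r y > 1/2" "y > x" "y > 0"
    using eventually_happens by force
  then have "W y * r y > 0" by linarith
  then have "W y > 0" using r_pos[of y] y(3) zero_less_mult_pos2 by blast
  then show ?thesis using tail_antimono[of x y] y by simp
qed

lemma tail_nonneg [simp]: "W x \<ge> 0" using tail_pos[of x] by simp

lemma tail_rv:
  assumes c: "c > 0"
  shows "((\<lambda>x. W (c * x) / W x) \<longlongrightarrow> c powr (-\<alpha>)) at_top"
proof -
  have fl: "filterlim (\<lambda>x. c * x) at_top at_top"
    using c by (simp add: filterlim_tendsto_pos_mult_at_top[OF tendsto_const] filterlim_ident)
  have 1: "((\<lambda>x. W (c * x) * r (c * x)) \<longlongrightarrow> 1) at_top"
    using filterlim_compose[OF tail_r fl] .
  have 2: "((\<lambda>x. r (c * x) / r x) \<longlongrightarrow> c powr \<alpha>) at_top"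
    using r_rv c by (auto simp: reg_var_def)
  have "((\<lambda>x. (W (c * x) * r (c * x)) / (W x * r x) / (r (c * x) / r x)) \<longlongrightarrow> 1 / 1 / (c powr \<alpha>)) at_top"
    by (intro tendsto_divide 1 2 tail_r) (use c in auto)
  moreover have "eventually (\<lambda>x. (W (c * x) * r (c * x)) / (W x * r x) / (r (c * x) / r x) = W (c * x) / W x) at_top"
    using eventually_gt_at_top[of 0]
  proof eventually_elim
    case (elim x)
    then have "r x > 0" "r (c * x) > 0" using r_pos c by auto
    then show ?case using tail_pos[of x] by (simp add: field_simps)
  qed
  ultimately have "((\<lambda>x. W (c * x) / W x) \<longlongrightarrow> 1 / 1 / (c powr \<alpha>)) at_top"
    by (rule Lim_transform_eventually)
  then show ?thesis by (simp add: powr_minus_divide)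
qed

text \<open>The doubling ratio tends to 2^(-\<alpha>), so \<beta> > \<alpha> leaves strict room for
  a one-step bound beyond a threshold, and this step iterates. Monotonicity of \<open>W\<close>
  later fills in between the powers of 2.\<close>

lemma tail_iterate_upper:
  assumes "\<beta> > \<alpha>"
  obtains x0 where "x0 \<ge> 1" "\<And>y n. y \<ge> x0 \<Longrightarrow> W y \<le> (2 ^ n) powr \<beta> * W (2 ^ n * y)"
proof -
  have "2 powr (-\<beta>) < 2 powr (-\<alpha>)" using assms by simp
  from order_tendstoD(1)[OF tail_rv[of 2] this]
  have "eventually (\<lambda>x. W (2 * x) / W x > 2 powr (-\<beta>)) at_top" by simp
  then obtain x1 where x1: "\<And>x. x \<ge> x1 \<Longrightarrow> W (2 * x) / W x > 2 powr (-\<beta>)"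
    by (auto simp: eventually_at_top_linorder)
  have step: "W x \<le> 2 powr \<beta> * W (2 * x)" if "x \<ge> x1" for x
    using x1[OF that] tail_pos[of x] by (simp add: field_simps powr_minus)
  show ?thesis
  proof (rule that[of "max 1 x1"])
    fix y :: real and n :: nat
    assume y: "y \<ge> max 1 x1"
    show "W y \<le> (2 ^ n) powr \<beta> * W (2 ^ n * y)"
    proof (induction n)
      case (Suc n)
      have "2 ^ n * y \<ge> 1 * y" using y by (intro mult_right_mono) auto
      then have "W (2 ^ n * y) \<le> 2 powr \<beta> * W (2 * (2 ^ n * y))"
        using y by (intro step) linarith
      then have "(2 ^ n) powr \<beta> * W (2 ^ n * y) \<le> (2 ^ n) powr \<beta> * (2 powr \<beta> * W (2 * (2 ^ n * y)))"
        by (intro mult_left_mono) auto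
      with Suc have "W y \<le> (2 ^ n) powr \<beta> * (2 powr \<beta> * W (2 * (2 ^ n * y)))" by linarith
      then show ?case by (simp add: powr_mult mult_ac)
    qed simp
  qed simp
qed

lemma tail_iterate_lower:
  assumes "\<beta> < \<alpha>"
  obtains x0 where "x0 \<ge> 1" "\<And>y n. y \<ge> x0 \<Longrightarrow> W (2 ^ n * y) \<le> (2 ^ n) powr (-\<beta>) * W y"
proof -
  have "2 powr (-\<alpha>) < 2 powr (-\<beta>)" using assms by simp
  from order_tendstoD(2)[OF tail_rv[of 2] this]
  have "eventually (\<lambda>x. W (2 * x) / W x < 2 powr (-\<beta>)) at_top" by simp
  then obtain x1 where x1: "\<And>x. x \<ge> x1 \<Longrightarrow> W (2 * x) / W x < 2 powr (-\<beta>)"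
    by (auto simp: eventually_at_top_linorder)
  have step: "W (2 * x) \<le> 2 powr (-\<beta>) * W x" if "x \<ge> x1" for x
    using x1[OF that] tail_pos[of x] by (simp add: field_simps)
  show ?thesis
  proof (rule that[of "max 1 x1"])
    fix y :: real and n :: nat
    assume y: "y \<ge> max 1 x1"
    show "W (2 ^ n * y) \<le> (2 ^ n) powr (-\<beta>) * W y"
    proof (induction n)
      case (Suc n)
      have "2 ^ n * y \<ge> 1 * y" using y by (intro mult_right_mono) auto
      then have "W (2 * (2 ^ n * y)) \<le> 2 powr (-\<beta>) * W (2 ^ n * y)"
        using y by (intro step) linarith
      also have "\<dots> \<le> 2 powr (-\<beta>) * ((2 ^ n) powr (-\<beta>) * W y)"
        using Suc by (intro mult_left_mono) auto
      finally show ?case by (simp add: powr_mult mult_ac)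
    qed simp
  qed simp
qed

lemma ex_dyadic:
  fixes q :: real assumes "q \<ge> 1"
  obtains n :: nat where "2 ^ n \<le> q" "q \<le> 2 * 2 ^ n"
proof -
  have "2 ^ nat \<lfloor>log 2 q\<rfloor> \<le> q \<and> q \<le> 2 * 2 ^ nat \<lfloor>log 2 q\<rfloor>"
  proof -
    have l: "log 2 q \<ge> 0" using assms by simp
    have "2 powr (of_int \<lfloor>log 2 q\<rfloor>) \<le> 2 powr (log 2 q)" "2 powr (log 2 q) \<le> 2 powr (of_int \<lfloor>log 2 q\<rfloor> + 1)"
      by (intro powr_mono; linarith)+
    moreover have "(2::real) powr (of_int \<lfloor>log 2 q\<rfloor>) = 2 ^ nat \<lfloor>log 2 q\<rfloor>"
      using l by (simp add: powr_realpow[symmetric])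
    ultimately show ?thesis using assms by (simp add: powr_add mult.commute)
  qed
  then show ?thesis using that by blast
qed

text \<open>Rounding x / y to a power of 2 costs only a factor 2^\<beta>. The bound is wanted for
  all y down to 0, because \<open>tail_integral\<close> integrates it from 0, so the constant must
  also cover y below the threshold.\<close>

lemma tail_potter_upper:
  assumes "\<beta> > \<alpha>"
  obtains C where "C > 0" "\<And>x y. 0 < y \<Longrightarrow> y \<le> x \<Longrightarrow> 1 \<le> x \<Longrightarrow> W y \<le> C * (x / y) powr \<beta> * W x"
proof -
  have bpos: "\<beta> > 0" using assms alpha_pos by simp
  obtain x0 where x0: "x0 \<ge> 1" "\<And>y n. y \<ge> x0 \<Longrightarrow> W y \<le> (2 ^ n) powr \<beta> * W (2 ^ n * y)"
    using tail_iterate_upper[OF assms] by blast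
  have main: "W y \<le> 2 powr \<beta> * (x / y) powr \<beta> * W x" if "x0 \<le> y" "y \<le> x" for x y
  proof -
    have y: "y > 0" using that x0 by simp
    have "x / y \<ge> 1" using that y by simp
    then obtain n where n: "2 ^ n \<le> x / y" "x / y \<le> 2 * 2 ^ n" by (rule ex_dyadic)
    have "W y \<le> (2 ^ Suc n) powr \<beta> * W (2 ^ Suc n * y)" using x0 that by blast
    also have "\<dots> \<le> (2 * (x / y)) powr \<beta> * W x"
      using n y bpos by (intro mult_mono powr_mono2 tail_antimono) (auto simp: field_simps)
    also have "(2 * (x / y)) powr \<beta> = 2 powr \<beta> * (x / y) powr \<beta>"
      by (rule powr_mult)
    finally show ?thesis .
  qed
  \<comment> \<open>The factor \<open>1 / W x0\<close> pays for y < x0, where only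
    \<open>W y \<le> 1\<close> is available.\<close>
  define C where "C = 2 powr \<beta> / W x0"
  have W0: "W x0 > 0" "W x0 \<le> 1" using tail_pos tail_le_1 by auto
  have p1: "1 \<le> 2 powr \<beta>" using bpos by (simp add: ge_one_powr_ge_zero)
  have C: "C \<ge> 2 powr \<beta>" using W0 p1 by (simp add: C_def field_simps)
  show ?thesis
  proof (rule that[of C])
    show "C > 0" using C p1 by linarith
    fix x y :: real assume xy: "0 < y" "y \<le> x" "1 \<le> x"
    have q1: "(x / y) powr \<beta> \<ge> 1" using xy bpos by (simp add: ge_one_powr_ge_zero)
    consider "x0 \<le> y" | "y < x0" "x0 \<le> x" | "x < x0" by linarith
    then show "W y \<le> C * (x / y) powr \<beta> * W x"
    proof cases
      case 1
      then have "W y \<le> 2 powr \<beta> * (x / y) powr \<beta> * W x" using main xy by blast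
      also have "\<dots> \<le> C * (x / y) powr \<beta> * W x"
        using C by (intro mult_right_mono) auto
      finally show ?thesis .
    next
      case 2
      have "W y \<le> 1" by (rule tail_le_1)
      also have "1 \<le> (2 powr \<beta> * (x / x0) powr \<beta> * W x) / W x0"
        using main[of x0 x] 2 W0 by simp
      also have "\<dots> = C * (x / x0) powr \<beta> * W x" by (simp add: C_def)
      also have "\<dots> \<le> C * (x / y) powr \<beta> * W x"
        using 2 xy x0 bpos C p1 by (intro mult_right_mono mult_left_mono powr_mono2 divide_left_mono) auto
      finally show ?thesis .
    next
      case 3
      have "W y \<le> 1" by (rule tail_le_1)
      also have "\<dots> \<le> 1 / W x0 * W x" using tail_antimono[of x x0] 3 W0 by simp
      also have "\<dots> \<le> C * (x / y) powr \<beta> * W x"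
      proof (intro mult_right_mono)
        have "1 / W x0 \<le> C * 1" using W0 p1 by (simp add: C_def divide_right_mono)
        also have "\<dots> \<le> C * (x/y) powr \<beta>" using q1 C p1 by (intro mult_left_mono) auto
        finally show "1 / W x0 \<le> C * (x/y) powr \<beta>" .
      qed simp
      finally show ?thesis .
    qed
  qed
qed

lemma tail_potter_lower:
  assumes b: "0 < \<beta>" "\<beta> < \<alpha>"
  obtains C where "C > 0" "\<And>x y. 1 \<le> y \<Longrightarrow> y \<le> x \<Longrightarrow> W x \<le> C * (y / x) powr \<beta> * W y"
proof -
  obtain x0 where x0: "x0 \<ge> 1" "\<And>y n. y \<ge> x0 \<Longrightarrow> W (2 ^ n * y) \<le> (2 ^ n) powr (-\<beta>) * W y"
    using tail_iterate_lower[OF b(2)] by blast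
  have main: "W x \<le> 2 powr \<beta> * (y / x) powr \<beta> * W y" if "x0 \<le> y" "y \<le> x" for x y
  proof -
    have y: "y > 0" using that x0 by simp
    have "x / y \<ge> 1" using that y by simp
    then obtain n where n: "2 ^ n \<le> x / y" "x / y \<le> 2 * 2 ^ n" by (rule ex_dyadic)
    have "W x \<le> W (2 ^ n * y)" using n y by (intro tail_antimono) (simp add: field_simps)
    also have "\<dots> \<le> (2 ^ n) powr (-\<beta>) * W y" using x0 that by blast
    also have "(2 ^ n) powr (-\<beta>) = (1 / 2 ^ n) powr \<beta>"
      by (simp add: powr_minus powr_divide inverse_eq_divide)
    also have "(1 / 2 ^ n) powr \<beta> \<le> (2 * (y / x)) powr \<beta>"
      using n y that b by (intro powr_mono2) (auto simp: field_simps)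
    also have "(2 * (y / x)) powr \<beta> = 2 powr \<beta> * (y / x) powr \<beta>"
      by (rule powr_mult)
    finally show ?thesis by (simp add: mult_right_mono)
  qed
  \<comment> \<open>For 1 \<le> y < x0 the extra factor turns y / x into x0 * (y / x), which
    dominates x0 / x and exceeds 1 as soon as x < x0.\<close>
  define C where "C = 2 powr \<beta> * x0 powr \<beta>"
  have p1: "1 \<le> 2 powr \<beta>" "1 \<le> x0 powr \<beta>" using b x0 by (simp_all add: ge_one_powr_ge_zero)
  have C: "C \<ge> 2 powr \<beta>" "C \<ge> x0 powr \<beta>"
    using mult_mono[OF p1(1) order_refl[of "x0 powr \<beta>"]] mult_mono[OF order_refl[of "2 powr \<beta>"] p1(2)]
    by (simp_all add: C_def)
  show ?thesis
  proof (rule that[of C])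
    show "C > 0" using C p1 by linarith
    fix x y :: real assume xy: "1 \<le> y" "y \<le> x"
    consider "x0 \<le> y" | "y < x0" "x0 \<le> x" | "x < x0" by linarith
    then show "W x \<le> C * (y / x) powr \<beta> * W y"
    proof cases
      case 1
      then have "W x \<le> 2 powr \<beta> * (y / x) powr \<beta> * W y" using main xy by blast
      also have "\<dots> \<le> C * (y / x) powr \<beta> * W y"
        using C by (intro mult_right_mono) auto
      finally show ?thesis .
    next
      case 2
      have "W x \<le> 2 powr \<beta> * (x0 / x) powr \<beta> * W x0" using main[of x0 x] 2 by simp
      also have "\<dots> \<le> 2 powr \<beta> * (x0 * (y / x)) powr \<beta> * W y"
        using 2 xy x0 b by (intro mult_mono powr_mono2 tail_antimono) (auto simp: field_simps)
      also have "\<dots> = C * (y / x) powr \<beta> * W y"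
        by (simp only: powr_mult C_def mult.assoc)
      finally show ?thesis .
    next
      case 3
      have "W x \<le> W y" using xy by (intro tail_antimono)
      also have "\<dots> \<le> (x0 * (y / x)) powr \<beta> * W y"
      proof -
        have "x0 * (y / x) \<ge> 1" using 3 xy x0 mult_mono[of x x0 1 y] by (simp add: field_simps)
        then have "(x0 * (y / x)) powr \<beta> \<ge> 1" using b by (simp add: ge_one_powr_ge_zero)
        then show ?thesis using mult_right_mono[of 1 "(x0 * (y / x)) powr \<beta>" "W y"] by simp
      qed
      also have "\<dots> = x0 powr \<beta> * ((y / x) powr \<beta> * W y)"
        by (simp only: powr_mult mult.assoc)
      also have "\<dots> \<le> C * ((y / x) powr \<beta> * W y)"
        using C by (intro mult_right_mono) auto
      finally show ?thesis by simp
    qed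
  qed
qed

lemma tail_tendsto_0: "(W \<longlongrightarrow> 0) at_top"
proof -
  obtain C where C: "C > 0" "\<And>x y. 1 \<le> y \<Longrightarrow> y \<le> x \<Longrightarrow> W x \<le> C * (y / x) powr (\<alpha>/2) * W y"
    using tail_potter_lower[of "\<alpha>/2"] alpha_pos by auto
  have "((\<lambda>x. C * (1 / x) powr (\<alpha>/2) * W 1) \<longlongrightarrow> 0) at_top"
    using alpha_pos by real_asymp
  moreover have "eventually (\<lambda>x. norm (W x) \<le> C * (1 / x) powr (\<alpha>/2) * W 1) at_top"
    using eventually_ge_at_top[of 1] by eventually_elim (use C in auto)
  ultimately show ?thesis
    by (rule Lim_null_comparison[rotated])
qed

section \<open>The generalized inverse of r\<close>

lemma r_at_top: "filterlim r at_top at_top"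
proof -
  have 1: "filterlim (\<lambda>x. inverse (W x)) at_top at_top"
    by (rule filterlim_inverse_at_top[OF tail_tendsto_0]) (simp add: tail_pos)
  have "filterlim (\<lambda>x. (W x * r x) * inverse (W x)) at_top at_top"
    by (rule filterlim_tendsto_pos_mult_at_top[OF tail_r _ 1]) simp
  moreover have "(\<lambda>x. (W x * r x) * inverse (W x)) = r"
    using tail_pos by (auto simp: fun_eq_iff field_simps less_imp_neq[THEN not_sym])
  ultimately show ?thesis by simp
qed

text \<open>Makes the set under the infimum in \<open>ginv\<close> nonempty, so that
  \<open>Inf\<close> has its intended meaning.\<close>

lemma r_exceeds: "\<exists>s\<ge>1. r s > t"
proof -
  have "eventually (\<lambda>s. r s > t \<and> s \<ge> 1) at_top"
    using r_at_top eventually_ge_at_top[of 1]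
    by (auto simp: filterlim_at_top_dense eventually_conj)
  then show ?thesis using eventually_happens by force
qed

lemma a_ge_1: "a t \<ge> 1"
  unfolding ginv_def using r_exceeds[of t] by (intro cInf_greatest) auto

lemma a_pos [simp]: "a t > 0" using a_ge_1[of t] by simp

lemma a_nonneg [simp]: "a t \<ge> 0" and a_neq_0 [simp]: "a t \<noteq> 0" and abs_a [simp]: "\<bar>a t\<bar> = a t"
  using a_pos[of t] by linarith+

lemma a_mono: "s \<le> t \<Longrightarrow> a s \<le> a t"
  unfolding ginv_def using r_exceeds[of t]
  by (intro cInf_superset_mono) (auto intro!: bdd_belowI[of _ 1])

text \<open>Without monotonicity or continuity of \<open>r\<close> the infimum may fail to be
  attained and \<open>r (a t)\<close> says nothing about t. What survives is a point with
  \<open>r v > t\<close> arbitrarily close above \<open>a t\<close>, together with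
  \<open>r s \<le> t\<close> below it (\<open>a_greaterD\<close>).\<close>

lemma a_lessD: "a t < s \<Longrightarrow> \<exists>v. a t \<le> v \<and> v < s \<and> v \<ge> 1 \<and> r v > t"
proof -
  assume s: "a t < s"
  have ne: "{v. v \<ge> 1 \<and> r v > t} \<noteq> {}" using r_exceeds[of t] by auto
  have bd: "bdd_below {v. v \<ge> 1 \<and> r v > t}" by (auto intro!: bdd_belowI[of _ 1])
  from s obtain v where "v \<in> {v. v \<ge> 1 \<and> r v > t}" "v < s"
    unfolding ginv_def using cInf_less_iff[OF ne bd] by blast
  moreover from this have "a t \<le> v" unfolding ginv_def using bd by (intro cInf_lower)
  ultimately show ?thesis by blast
qed

lemma a_greaterD: "1 \<le> s \<Longrightarrow> s < a t \<Longrightarrow> r s \<le> t"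
proof (rule ccontr)
  assume s: "1 \<le> s" "s < a t" "\<not> r s \<le> t"
  then have "a t \<le> s" unfolding ginv_def
    by (intro cInf_lower) (auto intro!: bdd_belowI[of _ 1])
  with s show False by simp
qed

end

text \<open>Regular variation constrains \<open>r\<close> only near infinity. If \<open>r\<close> is
  unbounded on a bounded set, \<open>a\<close> stays bounded, so the divergence is assumed here;
  \<open>normalizer_at_top\<close> obtains it from the convergence in distribution.\<close>

locale heavy_tail_norm = heavy_tail +
  assumes a_at_top: "filterlim a at_top at_top"
begin

text \<open>Some v in [a t, c * a t) has \<open>r v > t\<close>, and \<open>W\<close> is decreasing,
  so \<open>W (c * a t) * t\<close> is at most \<open>W v * r v\<close>, which is near 1.
  \<open>tail_a_below\<close> is the mirror image, with \<open>r \<le> t\<close> at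
  \<open>a t / c\<close>.\<close>

lemma tail_a_above:
  assumes c: "c > 1" and e: "e > 1"
  shows "eventually (\<lambda>t. W (c * a t) * t \<le> e) at_top"
proof -
  have "eventually (\<lambda>s. W s * r s < e) at_top"
    by (rule order_tendstoD(2)[OF tail_r e])
  then obtain s0 where s0: "\<And>s. s \<ge> s0 \<Longrightarrow> W s * r s < e"
    by (auto simp: eventually_at_top_linorder)
  have "eventually (\<lambda>t. a t \<ge> s0) at_top"
    using a_at_top by (auto simp: filterlim_at_top)
  then show ?thesis
    using eventually_gt_at_top[of 0]
  proof eventually_elim
    case (elim t)
    have "1 * a t < c * a t" using c a_pos by (intro mult_strict_right_mono) auto
    then obtain v where v: "a t \<le> v" "v < c * a t" "v \<ge> 1" "r v > t"
      using a_lessD[of t "c * a t"] by auto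
    have "W (c * a t) * t \<le> W v * r v"
      using v elim by (intro mult_mono tail_antimono) auto
    also have "\<dots> \<le> e" using s0[of v] v elim by simp
    finally show ?case .
  qed
qed

lemma tail_a_below:
  assumes c: "c > 1" and e: "e > 1"
  shows "eventually (\<lambda>t. W (a t / c) * t \<ge> 1 / e) at_top"
proof -
  have "eventually (\<lambda>s. W s * r s > 1 / e) at_top"
    by (rule order_tendstoD(1)[OF tail_r]) (use e in auto)
  then obtain s0 where s0: "\<And>s. s \<ge> s0 \<Longrightarrow> W s * r s > 1 / e"
    by (auto simp: eventually_at_top_linorder)
  have "eventually (\<lambda>t. a t \<ge> c * max 1 s0) at_top"
    using a_at_top by (auto simp: filterlim_at_top)
  then show ?thesis
    using eventually_gt_at_top[of 0]
  proof eventually_elim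
    case (elim t)
    have s: "a t / c \<ge> max 1 s0" using elim c by (simp only: field_simps)
    have "a t / c < a t" using c a_pos[of t] by (simp add: field_simps)
    then have "r (a t / c) \<le> t" using s by (intro a_greaterD) auto
    then have "W (a t / c) * r (a t / c) \<le> W (a t / c) * t" by (intro mult_left_mono) auto
    moreover have "W (a t / c) * r (a t / c) > 1 / e" using s by (intro s0) auto
    ultimately show ?case by linarith
  qed
qed

text \<open>The factor 2 in the two one-sided estimates is removed by the Potter bound with exponent
  1, admissible because \<alpha> < 1.\<close>

lemma tail_a_bounds:
  obtains C where "C > 0" "\<And>t. t \<ge> 1 \<Longrightarrow> W (a t) * t \<le> C" "\<And>t. t \<ge> 1 \<Longrightarrow> 1 \<le> C * (W (a t) * t)"
proof -
  obtain C1 where C1: "C1 > 0" "\<And>x y. 0 < y \<Longrightarrow> y \<le> x \<Longrightarrow> 1 \<le> x \<Longrightarrow> W y \<le> C1 * (x / y) powr 1 * W x"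
    using tail_potter_upper[of 1] alpha_less_1 by blast
  have "eventually (\<lambda>t. W (2 * a t) * t \<le> 2 \<and> W (a t / 2) * t \<ge> 1 / 2 \<and> t \<ge> 1) at_top"
    by (intro eventually_conj tail_a_above tail_a_below eventually_ge_at_top) auto
  then obtain t0 where t0: "\<And>t. t \<ge> t0 \<Longrightarrow> W (2 * a t) * t \<le> 2 \<and> W (a t / 2) * t \<ge> 1 / 2 \<and> t \<ge> 1"
    by (auto simp: eventually_at_top_linorder)
  have big: "W (a t) * t \<le> 4 * C1" "1 \<le> 4 * C1 * (W (a t) * t)" if "t \<ge> t0" for t
  proof -
    have t: "W (2 * a t) * t \<le> 2" "W (a t / 2) * t \<ge> 1 / 2" "t \<ge> 1" using t0[OF that] by auto
    have "W (a t) \<le> C1 * (2 * a t / a t) powr 1 * W (2 * a t)"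
      using a_ge_1[of t] by (intro C1) auto
    then have "W (a t) * t \<le> (2 * C1 * W (2 * a t)) * t"
      using t a_pos[of t] by (intro mult_right_mono) (auto split: if_splits)
    also have "\<dots> = 2 * C1 * (W (2 * a t) * t)" by simp
    also have "\<dots> \<le> 2 * C1 * 2" using t C1 by (intro mult_left_mono) auto
    finally show "W (a t) * t \<le> 4 * C1" by simp
    have "W (a t / 2) \<le> C1 * (a t / (a t / 2)) powr 1 * W (a t)"
      using a_ge_1[of t] by (intro C1) auto
    then have "W (a t / 2) * t \<le> (2 * C1 * W (a t)) * t"
      using t a_pos[of t] by (intro mult_right_mono) (auto split: if_splits)
    then show "1 \<le> 4 * C1 * (W (a t) * t)" using t(2) by (simp add: mult_ac)
  qed
  \<comment> \<open>The last two summands cover 1 \<le> t < t0: there \<open>W \<le> 1\<close>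
    bounds the product by t0, and \<open>W (a t) \<ge> W (a t0)\<close> bounds it from
    below.\<close>
  define C where "C = 4 * C1 + \<bar>t0\<bar> + 1 / W (a t0)"
  have W0: "W (a t0) > 0" by (rule tail_pos)
  have Cpos: "C > 0" using C1 W0 by (simp add: C_def add_pos_nonneg)
  have C: "C \<ge> 4 * C1" "C \<ge> \<bar>t0\<bar>" "C \<ge> 1 / W (a t0)" using C1 W0 by (simp_all add: C_def)
  show ?thesis
  proof (rule that[OF Cpos])
    fix t :: real assume t: "t \<ge> 1"
    show "W (a t) * t \<le> C"
    proof (cases "t \<ge> t0")
      case True then show ?thesis using big[of t] C by linarith
    next
      case False
      have "W (a t) * t \<le> 1 * t" using t tail_le_1 by (intro mult_right_mono) auto
      then show ?thesis using False C by linarith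
    qed
    show "1 \<le> C * (W (a t) * t)"
    proof (cases "t \<ge> t0")
      case True
      have "4 * C1 * (W (a t) * t) \<le> C * (W (a t) * t)" using C t by (intro mult_right_mono) auto
      then show ?thesis using big[OF True] by linarith
    next
      case False
      have "1 = 1 / W (a t0) * (W (a t0) * 1)" using W0 by simp
      also have "\<dots> \<le> C * (W (a t) * t)"
        using C Cpos False t W0 by (intro mult_mono tail_antimono a_mono) auto
      finally show ?thesis .
    qed
  qed
qed

text \<open>As \<open>W (a t) * t\<close> stays between positive constants, t / s is comparable to
  \<open>W (a s) / W (a t)\<close>. The Potter bound for \<open>W\<close> is then inverted by taking
  the power 1 / \<beta>.\<close>

lemma a_potter_upper:
  assumes b: "0 < \<beta>" "\<beta> < \<alpha>"
  obtains C where "C > 0" "\<And>s t. 1 \<le> s \<Longrightarrow> s \<le> t \<Longrightarrow> a t \<le> C * (t / s) powr (1 / \<beta>) * a s"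
proof -
  obtain C1 where C1: "C1 > 0" "\<And>x y. 1 \<le> y \<Longrightarrow> y \<le> x \<Longrightarrow> W x \<le> C1 * (y / x) powr \<beta> * W y"
    using tail_potter_lower[OF b] by blast
  obtain C2 where C2: "C2 > 0" "\<And>t. t \<ge> 1 \<Longrightarrow> W (a t) * t \<le> C2" "\<And>t. t \<ge> 1 \<Longrightarrow> 1 \<le> C2 * (W (a t) * t)"
    using tail_a_bounds by blast
  define D where "D = C1 * C2 * C2"
  have D: "D > 0" using C1 C2 by (simp add: D_def)
  show ?thesis
  proof (rule that[of "D powr (1/\<beta>)"])
    show "D powr (1/\<beta>) > 0" using D by simp
    fix s t :: real assume st: "1 \<le> s" "s \<le> t"
    have aa: "a s > 0" "a t > 0" "a s \<le> a t" using a_mono st by auto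
    have "1 \<le> C2 * (W (a t) * t)" using C2 st by auto
    also have "\<dots> \<le> C2 * ((C1 * (a s / a t) powr \<beta> * W (a s)) * t)"
      using C1 C2 st a_mono a_ge_1 by (intro mult_left_mono mult_right_mono) auto
    also have "\<dots> = C2 * C1 * (a s / a t) powr \<beta> * ((W (a s) * s) * (t / s))" using st by simp
    also have "\<dots> \<le> C2 * C1 * (a s / a t) powr \<beta> * (C2 * (t / s))"
      using C1 C2 st by (intro mult_left_mono mult_right_mono) auto
    also have "\<dots> = D * (t / s) * (a s / a t) powr \<beta>" by (simp add: D_def)
    finally have "1 * (a t / a s) powr \<beta> \<le> D * (t / s) * (a s / a t) powr \<beta> * (a t / a s) powr \<beta>"
      by (rule mult_right_mono) simp
    also have "\<dots> = D * (t / s)" using aa by (simp add: powr_divide)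
    finally have "(a t / a s) powr \<beta> \<le> D * (t / s)" by simp
    then have "((a t / a s) powr \<beta>) powr (1/\<beta>) \<le> (D * (t / s)) powr (1/\<beta>)"
      using b by (intro powr_mono2) auto
    then have "a t / a s \<le> D powr (1/\<beta>) * (t / s) powr (1/\<beta>)"
      using b aa by (simp only: powr_powr powr_mult) simp
    then show "a t \<le> D powr (1/\<beta>) * (t / s) powr (1 / \<beta>) * a s"
      using aa by (simp add: field_simps)
  qed
qed

lemma a_potter_lower:
  assumes b: "\<alpha> < \<beta>"
  obtains C where "C > 0" "\<And>s t. 1 \<le> s \<Longrightarrow> s \<le> t \<Longrightarrow> (t / s) powr (1 / \<beta>) * a s \<le> C * a t"
proof -
  have bpos: "\<beta> > 0" using b alpha_pos by simp
  obtain C1 where C1: "C1 > 0" "\<And>x y. 0 < y \<Longrightarrow> y \<le> x \<Longrightarrow> 1 \<le> x \<Longrightarrow> W y \<le> C1 * (x / y) powr \<beta> * W x"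
    using tail_potter_upper[OF b] by blast
  obtain C2 where C2: "C2 > 0" "\<And>t. t \<ge> 1 \<Longrightarrow> W (a t) * t \<le> C2" "\<And>t. t \<ge> 1 \<Longrightarrow> 1 \<le> C2 * (W (a t) * t)"
    using tail_a_bounds by blast
  define D where "D = C1 * C2 * C2"
  have D: "D > 0" using C1 C2 by (simp add: D_def)
  show ?thesis
  proof (rule that[of "D powr (1/\<beta>)"])
    show "D powr (1/\<beta>) > 0" using D by simp
    fix s t :: real assume st: "1 \<le> s" "s \<le> t"
    have aa: "a s > 0" "a t > 0" "a s \<le> a t" using a_mono st by auto
    have "t / s \<le> t / s * (C2 * (W (a s) * s))"
      using C2(3)[of s] st mult_left_mono[of 1 "C2 * (W (a s) * s)" "t / s"] by simp
    also have "\<dots> \<le> t / s * (C2 * ((C1 * (a t / a s) powr \<beta> * W (a t)) * s))"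
      using C1 C2 st a_mono a_ge_1 by (intro mult_left_mono mult_right_mono) auto
    also have "\<dots> = C2 * C1 * (a t / a s) powr \<beta> * (W (a t) * t)" using st by simp
    also have "\<dots> \<le> C2 * C1 * (a t / a s) powr \<beta> * C2"
      using C1 C2 st by (intro mult_left_mono mult_right_mono) auto
    also have "\<dots> = D * (a t / a s) powr \<beta>" by (simp add: D_def)
    finally have "(t / s) powr (1/\<beta>) \<le> (D * (a t / a s) powr \<beta>) powr (1/\<beta>)"
      using bpos st by (intro powr_mono2) auto
    also have "\<dots> = D powr (1/\<beta>) * (a t / a s)"
      using bpos aa(1,2) by (simp add: powr_powr powr_mult)
    finally show "(t / s) powr (1 / \<beta>) * a s \<le> D powr (1/\<beta>) * a t"
      using aa by (simp add: field_simps)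
  qed
qed

text \<open>\<open>a\<close> is an asymptotic inverse of 1 / W. If \<open>a (t x)\<close> were above
  c^2 * \<sigma> * x, then the lower bound of \<open>tail_a_below\<close> would contradict the limit
  of \<open>t x * W (c * \<sigma> * x)\<close>; the other side is symmetric. It is applied with t x
  close to s / W x, which gives the scale of the walk at rescaled time s.\<close>

lemma a_asymp:
  assumes s: "s > 0" and t: "((\<lambda>x. t x * W x) \<longlongrightarrow> s) at_top"
  shows "((\<lambda>x. a (t x) / x) \<longlongrightarrow> s powr (1/\<alpha>)) at_top"
proof -
  define \<sigma> where "\<sigma> = s powr (1/\<alpha>)"
  have sig: "\<sigma> > 0" "\<sigma> powr \<alpha> = s" using s alpha_pos by (auto simp: \<sigma>_def powr_powr)
  have t_top: "filterlim t at_top at_top"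
  proof -
    have 1: "filterlim (\<lambda>x. inverse (W x)) at_top at_top"
      by (rule filterlim_inverse_at_top[OF tail_tendsto_0]) (simp add: tail_pos)
    have "filterlim (\<lambda>x. (t x * W x) * inverse (W x)) at_top at_top"
      by (rule filterlim_tendsto_pos_mult_at_top[OF t s 1])
    moreover have "(\<lambda>x. (t x * W x) * inverse (W x)) = t"
      using tail_pos by (auto simp: fun_eq_iff field_simps less_imp_neq[THEN not_sym])
    ultimately show ?thesis by simp
  qed
  have lim: "((\<lambda>x. t x * W (d * x)) \<longlongrightarrow> s * d powr (-\<alpha>)) at_top" if d: "d > 0" for d
  proof -
    have "((\<lambda>x. (t x * W x) * (W (d * x) / W x)) \<longlongrightarrow> s * d powr (-\<alpha>)) at_top"
      by (intro tendsto_mult t tail_rv d)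
    moreover have "(\<lambda>x. (t x * W x) * (W (d * x) / W x)) = (\<lambda>x. t x * W (d * x))"
      using tail_pos by (auto simp: fun_eq_iff field_simps less_imp_neq[THEN not_sym])
    ultimately show ?thesis by simp
  qed
  have up: "eventually (\<lambda>x. a (t x) / x < c\<^sup>2 * \<sigma>) at_top" if c: "c > 1" for c
  proof -
    \<comment> \<open>Half the exponent leaves a strict gap between the limit c^(-\<alpha>) and the
      bound 1 / e = c^(-\<alpha>/2).\<close>
    define e where "e = c powr (\<alpha>/2)"
    have e: "e > 1" using c alpha_pos by (simp add: e_def gr_one_powr)
    have "s * (c * \<sigma>) powr (-\<alpha>) = c powr (-\<alpha>)"
      using sig c s by (simp add: powr_mult powr_minus)
    also have "\<dots> < c powr (-(\<alpha>/2))" using c alpha_pos by simp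
    also have "\<dots> = 1 / e" using c by (simp add: e_def powr_minus_divide)
    finally have "eventually (\<lambda>x. t x * W (c * \<sigma> * x) < 1 / e) at_top"
      by (intro order_tendstoD(2)[OF lim]) (use c sig in auto)
    moreover have "eventually (\<lambda>x. W (a (t x) / c) * t x \<ge> 1 / e) at_top"
      using eventually_compose_filterlim[OF tail_a_below[OF c e] t_top] .
    moreover have "eventually (\<lambda>x. t x > 0) at_top" using t_top by (auto simp: filterlim_at_top_dense)
    ultimately show ?thesis using eventually_gt_at_top[of 0]
    proof eventually_elim
      case (elim x)
      show ?case
      proof (rule ccontr)
        assume "\<not> a (t x) / x < c\<^sup>2 * \<sigma>"
        then have "c * \<sigma> * x \<le> a (t x) / c" using c elim by (simp add: field_simps power2_eq_square)
        then have "W (a (t x) / c) \<le> W (c * \<sigma> * x)" by (rule tail_antimono)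
        then have "W (a (t x) / c) * t x \<le> t x * W (c * \<sigma> * x)" using elim by simp
        then show False using elim by linarith
      qed
    qed
  qed
  have low: "eventually (\<lambda>x. a (t x) / x > \<sigma> / c\<^sup>2) at_top" if c: "c > 1" for c
  proof -
    define e where "e = c powr (\<alpha>/2)"
    have e: "e > 1" using c alpha_pos by (simp add: e_def gr_one_powr)
    have "e < c powr \<alpha>" using c alpha_pos by (simp add: e_def)
    also have "s * (\<sigma> / c) powr (-\<alpha>) = c powr \<alpha>"
      using sig c s by (simp add: powr_divide powr_minus field_simps)
    then have "c powr \<alpha> = s * (\<sigma> / c) powr (-\<alpha>)" by simp
    finally have "eventually (\<lambda>x. t x * W (\<sigma> / c * x) > e) at_top"
      by (intro order_tendstoD(1)[OF lim]) (use c sig in auto)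
    moreover have "eventually (\<lambda>x. W (c * a (t x)) * t x \<le> e) at_top"
      using eventually_compose_filterlim[OF tail_a_above[OF c e] t_top] .
    moreover have "eventually (\<lambda>x. t x > 0) at_top" using t_top by (auto simp: filterlim_at_top_dense)
    ultimately show ?thesis using eventually_gt_at_top[of 0]
    proof eventually_elim
      case (elim x)
      show ?case
      proof (rule ccontr)
        assume "\<not> a (t x) / x > \<sigma> / c\<^sup>2"
        then have "c * a (t x) \<le> \<sigma> / c * x" using c elim by (simp add: field_simps power2_eq_square)
        then have "W (\<sigma> / c * x) \<le> W (c * a (t x))" by (rule tail_antimono)
        then have "t x * W (\<sigma> / c * x) \<le> W (c * a (t x)) * t x" using elim by simp
        then show False using elim by linarith
      qed
    qed
  qed
  show ?thesis unfolding \<sigma>_def[symmetric]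
  proof (rule order_tendstoI)
    fix l assume l: "l < \<sigma>"
    show "eventually (\<lambda>x. l < a (t x) / x) at_top"
    proof (cases "l > 0")
      case True
      define c where "c = sqrt (\<sigma> / l)"
      have "c > 1" "c\<^sup>2 = \<sigma> / l" using True l by (auto simp: c_def)
      then show ?thesis using low[of c] sig by simp
    next
      case False
      show ?thesis using eventually_gt_at_top[of 0]
        by eventually_elim (use False a_pos in \<open>smt (verit) divide_pos_pos\<close>)
    qed
  next
    fix l assume l: "\<sigma> < l"
    define c where "c = sqrt (l / \<sigma>)"
    have "c > 1" "c\<^sup>2 = l / \<sigma>" using l sig by (auto simp: c_def)
    then show "eventually (\<lambda>x. a (t x) / x < l) at_top" using up[of c] sig by simp
  qed
qed

end

section \<open>Characteristic functions near the origin\<close>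

text \<open>1 - cos (\<theta> * X) is nonnegative with mean 0, hence vanishes almost surely, so
  \<theta> * X lies in 2 * pi * Z. Note that the hypothesis concerns the real part and not the
  modulus; this is what Poisson time requires.\<close>

lemma lattice_onI_char:
  assumes "real_distribution M" and th: "\<theta> \<noteq> 0" and re: "Re (char M \<theta>) = 1"
  shows "lattice_on M (2 * pi / \<bar>\<theta>\<bar>)"
proof -
  interpret real_distribution M by fact
  have int: "integrable M (\<lambda>x. cos (\<theta> * x))"
    by (rule integrable_const_bound[where B = 1]) auto
  have "Re (char M \<theta>) = (\<integral>x. cos (\<theta> * x) \<partial>M)"
    unfolding char_def by (subst integral_Re[symmetric, OF integrable_iexp]) (auto simp: Re_exp)
  then have "(\<integral>x. 1 - cos (\<theta> * x) \<partial>M) = 0"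
    using re int prob_space by (simp add: Bochner_Integration.integral_diff)
  then have "AE x in M. 1 - cos (\<theta> * x) = 0"
    using int by (subst (asm) integral_nonneg_eq_0_iff_AE) auto
  then have "AE x in M. x \<in> range (\<lambda>k::int. (2 * pi / \<bar>\<theta>\<bar>) * of_int k)"
  proof eventually_elim
    case (elim x)
    then have "cos (\<bar>\<theta>\<bar> * x) = 1" by (cases "\<theta> \<ge> 0") auto
    then obtain n :: int where n: "\<bar>\<theta>\<bar> * x = of_int n * 2 * pi" using cos_one_2pi_int by blast
    have "x = (2 * pi / \<bar>\<theta>\<bar>) * of_int n" using n th by (simp add: field_simps)
    then show ?case by blast
  qed
  moreover have "range (\<lambda>k::int. (2 * pi / \<bar>\<theta>\<bar>) * of_int k) \<in> sets M"
    by (rule sets.countable) auto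
  ultimately show ?thesis
    unfolding lattice_on_def by (subst prob_eq_1) auto
qed

context heavy_tail
begin

sublocale real_distribution F
  by (intro real_distribution.intro real_distribution_axioms.intro F_prob) auto

lemma tail_measurable [measurable]: "W \<in> borel_measurable borel"
proof -
  have "(\<lambda>x. - W x) \<in> borel_measurable borel"
    by (rule borel_measurable_mono) (auto simp: mono_def tail_antimono)
  then have "(\<lambda>x. - (- W x)) \<in> borel_measurable borel" by measurable
  then show ?thesis by simp
qed

text \<open>A Karamata bound: with a Potter exponent \<beta> < 1 the integrand is dominated by a
  multiple of y^(-\<beta>), whose integral over [0, x] is governed by the upper end. The exponent
  exists because \<alpha> < 1.\<close>

lemma tail_integral:
  obtains C where "C > 0" "\<And>x. x \<ge> 1 \<Longrightarrow> (\<integral>\<^sup>+y. ennreal (W y) * indicator {0..x} y \<partial>lborel) \<le> ennreal (C * x * W x)"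
proof -
  define \<beta> where "\<beta> = (1 + \<alpha>) / 2"
  have b: "\<alpha> < \<beta>" "\<beta> < 1" using alpha_less_1 by (auto simp: \<beta>_def)
  obtain C where C: "C > 0" "\<And>x y. 0 < y \<Longrightarrow> y \<le> x \<Longrightarrow> 1 \<le> x \<Longrightarrow> W y \<le> C * (x / y) powr \<beta> * W x"
    using tail_potter_upper[OF b(1)] by blast
  show ?thesis
  proof (rule that[of "C / (1 - \<beta>)"])
    show "C / (1 - \<beta>) > 0" using C b by simp
    fix x :: real assume x: "x \<ge> 1"
    have "(\<integral>\<^sup>+y. ennreal (W y) * indicator {0..x} y \<partial>lborel)
        \<le> (\<integral>\<^sup>+y. ennreal (C * x powr \<beta> * W x) * ennreal (y powr (-\<beta>) * indicator {0..x} y) \<partial>lborel)"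
    proof (rule nn_integral_mono_AE)
      have "AE y in lborel. y \<noteq> (0::real)" by (rule AE_lborel_singleton)
      then show "AE y in lborel. ennreal (W y) * indicator {0..x} y
           \<le> ennreal (C * x powr \<beta> * W x) * ennreal (y powr (-\<beta>) * indicator {0..x} y)"
      proof eventually_elim
        case (elim y)
        show ?case
        proof (cases "y \<in> {0..x}")
          case True
          then have "W y \<le> C * (x / y) powr \<beta> * W x" using elim x by (intro C) auto
          also have "(x / y) powr \<beta> = x powr \<beta> * y powr (-\<beta>)"
            using True elim x by (simp add: powr_divide powr_minus_divide)
          finally show ?thesis using True C by (simp add: ennreal_mult[symmetric] mult_ac ennreal_leI)
        qed auto
      qed
    qed
    also have "\<dots> = ennreal (C * x powr \<beta> * W x) * (\<integral>\<^sup>+y. ennreal (y powr (-\<beta>) * indicator {0..x} y) \<partial>lborel)"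
      by (rule nn_integral_cmult) auto
    also have "(\<integral>\<^sup>+y. ennreal (y powr (-\<beta>) * indicator {0..x} y) \<partial>lborel) = ennreal (x powr (-\<beta> + 1) / (-\<beta> + 1))"
    proof (rule nn_integral_has_integral_lborel)
      have eq: "(\<lambda>y. y powr (-\<beta>) * indicator {0..x} y) = (\<lambda>y. if y \<in> {0..x} then y powr (-\<beta>) else 0)"
        by (auto simp: indicator_def fun_eq_iff)
      show "((\<lambda>y. y powr (-\<beta>) * indicator {0..x} y) has_integral (x powr (-\<beta> + 1) / (-\<beta> + 1))) UNIV"
        unfolding eq has_integral_restrict_UNIV
        using b x by (intro has_integral_powr_from_0) auto
    qed auto
    also have "ennreal (C * x powr \<beta> * W x) * ennreal (x powr (-\<beta> + 1) / (-\<beta> + 1)) = ennreal (C / (1 - \<beta>) * x * W x)"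
    proof -
      have "x powr \<beta> * x powr (-\<beta> + 1) = x" using x by (simp add: powr_add[symmetric])
      then have "C * x powr \<beta> * W x * (x powr (-\<beta> + 1) / (-\<beta> + 1)) = C / (1 - \<beta>) * x * W x"
        by (metis (no_types, opaque_lifting) add.commute mult.assoc mult.commute times_divide_eq_left times_divide_eq_right uminus_add_conv_diff)
      then show ?thesis using C b x by (subst ennreal_mult[symmetric]) auto
    qed
    finally show "(\<integral>\<^sup>+y. ennreal (W y) * indicator {0..x} y \<partial>lborel) \<le> ennreal (C / (1 - \<beta>) * x * W x)" .
  qed
qed

text \<open>The finite limit in the balance condition makes the left tail O(W y) for large y; the
  summand \<open>1 / W y0\<close> of the constant covers the remaining y.\<close>

lemma two_sided_tail:
  obtains K where "K > 0" "\<And>y. y \<ge> 0 \<Longrightarrow> measure F {x. \<bar>x\<bar> > y} \<le> K * W y"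
proof -
  from tail_balance obtain c where c: "((\<lambda>x. Fdist F (- x) / W x) \<longlongrightarrow> c) at_top" by blast
  have "eventually (\<lambda>x. Fdist F (- x) / W x < c + 1) at_top"
    by (rule order_tendstoD(2)[OF c]) simp
  then obtain y0 where y0: "\<And>y. y \<ge> y0 \<Longrightarrow> Fdist F (- y) / W y < c + 1"
    by (auto simp: eventually_at_top_linorder)
  define K where "K = \<bar>c\<bar> + 2 + 1 / W y0"
  have W0: "W y0 > 0" by (rule tail_pos)
  show ?thesis
  proof (rule that[of K])
    show "K > 0" using W0 by (simp add: K_def add_nonneg_pos)
    fix y :: real assume y: "y \<ge> 0"
    show "measure F {x. \<bar>x\<bar> > y} \<le> K * W y"
    proof (cases "y \<ge> y0")
      case True
      have "measure F {x. \<bar>x\<bar> > y} \<le> measure F ({y<..} \<union> {..-y})"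
        by (rule finite_measure_mono) auto
      also have "\<dots> \<le> W y + Fdist F (- y)"
        unfolding tail_eq Fdist_def by (rule measure_Un_le) auto
      also have "\<dots> \<le> W y + (\<bar>c\<bar> + 1) * W y"
      proof -
        have "Fdist F (- y) \<le> (c + 1) * W y"
          using y0[OF True] tail_pos[of y] by (simp add: field_simps)
        also have "\<dots> \<le> (\<bar>c\<bar> + 1) * W y" by (intro mult_right_mono) auto
        finally show ?thesis by simp
      qed
      also have "\<dots> = (\<bar>c\<bar> + 2) * W y" by (simp add: algebra_simps)
      also have "\<dots> \<le> K * W y" using W0 by (intro mult_right_mono) (auto simp: K_def)
      finally show ?thesis .
    next
      case False
      have "measure F {x. \<bar>x\<bar> > y} \<le> 1" by simp
      also have "\<dots> \<le> 1 / W y0 * W y" using False W0 tail_antimono[of y y0] by simp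
      also have "\<dots> \<le> K * W y" by (intro mult_right_mono) (auto simp: K_def)
      finally show ?thesis .
    qed
  qed
qed

text \<open>Layer cake: min 1 (\<theta> * |x|) is \<theta> times the length of {y in
  [0, 1 / \<theta>] : y < |x|}. Fubini reduces the expectation to the integrated two-sided tail up
  to 1 / \<theta>, and the factors \<theta> and 1 / \<theta> cancel.\<close>

lemma truncated_moment:
  obtains C where "C > 0" "\<And>\<theta>. 0 < \<theta> \<Longrightarrow> \<theta> \<le> 1 \<Longrightarrow> (\<integral>x. min 1 (\<theta> * \<bar>x\<bar>) \<partial>F) \<le> C * W (1 / \<theta>)"
proof -
  obtain K where K: "K > 0" "\<And>y. y \<ge> 0 \<Longrightarrow> measure F {x. \<bar>x\<bar> > y} \<le> K * W y"
    using two_sided_tail by blast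
  obtain C where C: "C > 0" "\<And>x. x \<ge> 1 \<Longrightarrow> (\<integral>\<^sup>+y. ennreal (W y) * indicator {0..x} y \<partial>lborel) \<le> ennreal (C * x * W x)"
    using tail_integral by blast
  interpret pair_sigma_finite F lborel ..
  show ?thesis
  proof (rule that[of "K * C"])
    show "K * C > 0" using K C by simp
    fix \<theta> :: real assume th: "0 < \<theta>" "\<theta> \<le> 1"
    have layer: "ennreal (min 1 (\<theta> * \<bar>x\<bar>)) = (\<integral>\<^sup>+y. ennreal \<theta> * (indicator {0..1/\<theta>} y * indicator {y. y < \<bar>x\<bar>} y) \<partial>lborel)" for x :: real
    proof -
      have "(\<integral>\<^sup>+y. ennreal \<theta> * (indicator {0..1/\<theta>} y * indicator {y. y < \<bar>x\<bar>} y) \<partial>lborel)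
          = ennreal \<theta> * emeasure lborel ({0..1/\<theta>} \<inter> {y. y < \<bar>x\<bar>})"
        by (simp add: nn_integral_cmult indicator_inter_arith[symmetric])
      also have "emeasure lborel ({0..1/\<theta>} \<inter> {y. y < \<bar>x\<bar>}) = ennreal (min (1/\<theta>) \<bar>x\<bar>)"
      proof (cases "1 / \<theta> < \<bar>x\<bar>")
        case True
        then have "{0..1/\<theta>} \<inter> {y. y < \<bar>x\<bar>} = {0..1/\<theta>}" by auto
        then show ?thesis using True th by simp
      next
        case False
        then have "{0..1/\<theta>} \<inter> {y. y < \<bar>x\<bar>} = {0..<\<bar>x\<bar>}" by auto
        then show ?thesis using False by simp
      qed
      also have "ennreal \<theta> * ennreal (min (1/\<theta>) \<bar>x\<bar>) = ennreal (min 1 (\<theta> * \<bar>x\<bar>))"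
        using th by (subst ennreal_mult[symmetric]) (auto simp: min_def field_simps)
      finally show ?thesis by simp
    qed
    have "ennreal (\<integral>x. min 1 (\<theta> * \<bar>x\<bar>) \<partial>F) = (\<integral>\<^sup>+x. ennreal (min 1 (\<theta> * \<bar>x\<bar>)) \<partial>F)"
      using th by (intro nn_integral_eq_integral[symmetric] integrable_const_bound[where B = 1]) auto
    also have "\<dots> = (\<integral>\<^sup>+x. (\<integral>\<^sup>+y. ennreal \<theta> * (indicator {0..1/\<theta>} y * indicator {y. y < \<bar>x\<bar>} y) \<partial>lborel) \<partial>F)"
      by (simp add: layer)
    also have "\<dots> = (\<integral>\<^sup>+y. (\<integral>\<^sup>+x. ennreal \<theta> * (indicator {0..1/\<theta>} y * indicator {y. y < \<bar>x\<bar>} y) \<partial>F) \<partial>lborel)"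
      by (rule Fubini'[symmetric]) (simp add: measurable_split_conv, measurable)
    also have "\<dots> = (\<integral>\<^sup>+y. ennreal \<theta> * (indicator {0..1/\<theta>} y * emeasure F {x. y < \<bar>x\<bar>}) \<partial>lborel)"
    proof (rule nn_integral_cong)
      fix y :: real
      have "(\<integral>\<^sup>+x. ennreal \<theta> * (indicator {0..1/\<theta>} y * indicator {y. y < \<bar>x\<bar>} y) \<partial>F)
          = (\<integral>\<^sup>+x. (ennreal \<theta> * indicator {0..1/\<theta>} y) * indicator {x. y < \<bar>x\<bar>} x \<partial>F)"
        by (intro nn_integral_cong) (auto simp: indicator_def)
      also have "\<dots> = ennreal \<theta> * indicator {0..1/\<theta>} y * emeasure F {x. y < \<bar>x\<bar>}"
        by (rule nn_integral_cmult_indicator) measurable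
      finally show "(\<integral>\<^sup>+x. ennreal \<theta> * (indicator {0..1/\<theta>} y * indicator {y. y < \<bar>x\<bar>} y) \<partial>F)
          = ennreal \<theta> * (indicator {0..1/\<theta>} y * emeasure F {x. y < \<bar>x\<bar>})" by (simp add: mult.assoc)
    qed
    also have "\<dots> \<le> (\<integral>\<^sup>+y. ennreal (\<theta> * K) * (ennreal (W y) * indicator {0..1/\<theta>} y) \<partial>lborel)"
      using K th by (intro nn_integral_mono)
        (auto simp: indicator_def emeasure_eq_measure ennreal_mult[symmetric] mult.assoc intro!: ennreal_leI mult_left_mono)
    also have "\<dots> = ennreal (\<theta> * K) * (\<integral>\<^sup>+y. ennreal (W y) * indicator {0..1/\<theta>} y \<partial>lborel)"
      by (rule nn_integral_cmult) auto
    also have "\<dots> \<le> ennreal (\<theta> * K) * ennreal (C * (1/\<theta>) * W (1/\<theta>))"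
      using th by (intro mult_left_mono C) auto
    also have "\<dots> = ennreal (K * C * W (1 / \<theta>))"
      using th K C by (subst ennreal_mult[symmetric]) auto
    finally show "(\<integral>x. min 1 (\<theta> * \<bar>x\<bar>) \<partial>F) \<le> K * C * W (1 / \<theta>)"
      using K C by (subst (asm) ennreal_le_iff) auto
  qed
qed

text \<open>|1 - exp (i * u)| is at most 2 * min 1 |u|, so the truncated moment at scale 1 /
  |\<theta>| controls the defect of the characteristic function.\<close>

lemma char_upper:
  obtains C where "C > 0" "\<And>\<theta>. \<theta> \<noteq> 0 \<Longrightarrow> \<bar>\<theta>\<bar> \<le> 1 \<Longrightarrow> norm (1 - char F \<theta>) \<le> C * W (1 / \<bar>\<theta>\<bar>)"
proof -
  obtain C where C: "C > 0" "\<And>\<theta>. 0 < \<theta> \<Longrightarrow> \<theta> \<le> 1 \<Longrightarrow> (\<integral>x. min 1 (\<theta> * \<bar>x\<bar>) \<partial>F) \<le> C * W (1 / \<theta>)"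
    using truncated_moment by blast
  show ?thesis
  proof (rule that[of "2 * C"])
    show "2 * C > 0" using C by simp
    fix \<theta> :: real assume th: "\<theta> \<noteq> 0" "\<bar>\<theta>\<bar> \<le> 1"
    have "1 - char F \<theta> = (\<integral>x. 1 - iexp (\<theta> * x) \<partial>F)"
      unfolding char_def using prob_space
      by (subst Bochner_Integration.integral_diff) (auto intro: integrable_iexp)
    also have "norm \<dots> \<le> (\<integral>x. 2 * min 1 (\<bar>\<theta>\<bar> * \<bar>x\<bar>) \<partial>F)"
    proof (rule Bochner_Integration.integral_norm_bound_integral)
      show "integrable F (\<lambda>x. 1 - iexp (\<theta> * x))"
        by (intro Bochner_Integration.integrable_diff integrable_iexp) auto
      show "integrable F (\<lambda>x. 2 * min 1 (\<bar>\<theta>\<bar> * \<bar>x\<bar>))"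
        by (rule integrable_const_bound[where B = 2]) auto
      fix x
      have "norm (1 - iexp (\<theta> * x)) \<le> norm (1::complex) + norm (iexp (\<theta> * x))" by (rule norm_triangle_ineq4)
      then have "norm (1 - iexp (\<theta> * x)) \<le> 2" by simp
      moreover have "norm (1 - iexp (\<theta> * x)) \<le> \<bar>\<theta> * x\<bar>"
        using iexp_approx1[of "\<theta> * x" 0] by (simp add: norm_minus_commute)
      ultimately show "norm (1 - iexp (\<theta> * x)) \<le> 2 * min 1 (\<bar>\<theta>\<bar> * \<bar>x\<bar>)"
        using mult_nonneg_nonneg[OF abs_ge_zero[of \<theta>] abs_ge_zero[of x]]
        unfolding min_def abs_mult by (cases "1 \<le> \<bar>\<theta>\<bar> * \<bar>x\<bar>"; simp only: if_True if_False; linarith)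
    qed
    also have "\<dots> = 2 * (\<integral>x. min 1 (\<bar>\<theta>\<bar> * \<bar>x\<bar>) \<partial>F)" by simp
    also have "\<dots> \<le> 2 * (C * W (1 / \<bar>\<theta>\<bar>))" using th by (intro mult_left_mono C) auto
    finally show "norm (1 - char F \<theta>) \<le> 2 * C * W (1 / \<bar>\<theta>\<bar>)" by simp
  qed
qed

text \<open>With y = 1 / |\<theta>|, jumps in (y, 2 * y] have phase |\<theta>| * X in [1, 2], where
  cosine is at most cos 1. They carry mass \<open>W y - W (2 * y)\<close>, a fixed fraction of
  \<open>W y\<close> by regular variation.\<close>

lemma char_lower:
  obtains c \<epsilon> where "c > 0" "0 < \<epsilon>" "\<epsilon> \<le> 1"
    "\<And>\<theta>. \<theta> \<noteq> 0 \<Longrightarrow> \<bar>\<theta>\<bar> \<le> \<epsilon> \<Longrightarrow> c * W (1 / \<bar>\<theta>\<bar>) \<le> Re (1 - char F \<theta>)"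
proof -
  \<comment> \<open>A number strictly between the limit 2^(-\<alpha>) of
    \<open>W (2 * y) / W y\<close> and 1.\<close>
  define q where "q = (1 + 2 powr (-\<alpha>)) / 2"
  have "2 powr (-\<alpha>) < 2 powr 0" using alpha_pos by (subst powr_less_cancel_iff) auto
  then have q: "2 powr (-\<alpha>) < q" "q < 1" by (auto simp: q_def)
  have "eventually (\<lambda>x. W (2 * x) / W x < q) at_top"
    by (rule order_tendstoD(2)[OF tail_rv]) (use q in auto)
  then obtain y0 where y0: "\<And>y. y \<ge> y0 \<Longrightarrow> W (2 * y) / W y < q"
    by (auto simp: eventually_at_top_linorder)
  define Y where "Y = max 1 y0"
  have cos1: "cos 1 < (1::real)" using cos_monotone_0_pi[of 0 1] pi_gt3 by simp
  show ?thesis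
  proof (rule that[of "(1 - cos 1) * (1 - q)" "1 / Y"])
    show "(1 - cos 1) * (1 - q) > 0" using q cos1 by simp
    show "0 < 1 / Y" "1 / Y \<le> 1" by (auto simp: Y_def)
    fix \<theta> :: real assume th: "\<theta> \<noteq> 0" "\<bar>\<theta>\<bar> \<le> 1 / Y"
    define y where "y = 1 / \<bar>\<theta>\<bar>"
    have "Y > 0" by (simp add: Y_def)
    then have yY: "y \<ge> Y" using th by (simp add: y_def field_simps)
    then have y: "y \<ge> y0" "y > 0" by (auto simp: Y_def)
    have "W (2 * y) < q * W y" using y0[OF y(1)] tail_pos[of y] by (simp add: field_simps)
    then have "(1 - q) * W y \<le> W y - W (2 * y)" by (simp add: algebra_simps)
    then have "(1 - cos 1) * ((1 - q) * W y) \<le> (1 - cos 1) * (W y - W (2 * y))"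
      using cos1 by (intro mult_left_mono) auto
    then have "(1 - cos 1) * (1 - q) * W y \<le> (1 - cos 1) * (W y - W (2 * y))" by simp
    also have "W y - W (2 * y) = measure F {y<..2*y}"
    proof -
      have "{y<..} = {y<..2*y} \<union> {2*y<..}" using y by auto
      then have "W y = measure F ({y<..2*y} \<union> {2*y<..})" by (simp add: tail_eq)
      also have "\<dots> = measure F {y<..2*y} + W (2 * y)"
        unfolding tail_eq by (rule finite_measure_Union) auto
      finally show ?thesis by simp
    qed
    also have "(1 - cos 1) * measure F {y<..2*y} = (\<integral>x. (1 - cos 1) * indicator {y<..2*y} x \<partial>F)"
      by simp
    also have "\<dots> \<le> (\<integral>x. 1 - cos (\<theta> * x) \<partial>F)"
    proof (rule integral_mono)
      show "integrable F (\<lambda>x. (1 - cos 1) * indicator {y<..2*y} x :: real)"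
        by (rule integrable_const_bound[where B = "1 - cos 1"]) (use cos1 in \<open>auto simp: indicator_def\<close>)
      show "integrable F (\<lambda>x. 1 - cos (\<theta> * x))"
        by (intro Bochner_Integration.integrable_diff integrable_const integrable_const_bound[where B = 1]) auto
      fix x
      show "(1 - cos 1) * indicator {y<..2*y} x \<le> 1 - cos (\<theta> * x)"
      proof (cases "x \<in> {y<..2*y}")
        case True
        have "1 \<le> \<bar>\<theta>\<bar> * x" "\<bar>\<theta>\<bar> * x \<le> 2" using True th by (auto simp: y_def field_simps)
        then have "cos (\<bar>\<theta>\<bar> * x) \<le> cos 1"
          using pi_gt3 by (intro cos_monotone_0_pi_le) auto
        moreover have "cos (\<bar>\<theta>\<bar> * x) = cos (\<theta> * x)" by (cases "\<theta> \<ge> 0") auto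
        ultimately show ?thesis using True by simp
      qed simp
    qed
    also have "\<dots> = 1 - (\<integral>x. cos (\<theta> * x) \<partial>F)"
      using prob_space by (subst Bochner_Integration.integral_diff) (auto intro!: integrable_const_bound[where B = 1])
    also have "(\<integral>x. cos (\<theta> * x) \<partial>F) = Re (char F \<theta>)"
      unfolding char_def by (subst integral_Re[symmetric, OF integrable_iexp]) (auto simp: Re_exp)
    finally show "(1 - cos 1) * (1 - q) * W (1 / \<bar>\<theta>\<bar>) \<le> Re (1 - char F \<theta>)" by (simp add: y_def)
  qed
qed

text \<open>For z = 1 - char F \<theta> one has |1 - z|^2 = 1 - 2 * Re z + |z|^2. Here Re z is at
  least of order w = W (1 / |\<theta>|), while |z|^2 is of order w^2 and is absorbed once w < c /
  C^2.\<close>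

lemma char_norm_bound:
  obtains c \<epsilon> where "c > 0" "0 < \<epsilon>" "\<epsilon> \<le> 1"
    "\<And>\<theta>. \<theta> \<noteq> 0 \<Longrightarrow> \<bar>\<theta>\<bar> \<le> \<epsilon> \<Longrightarrow> norm (char F \<theta>) \<le> exp (- c * W (1 / \<bar>\<theta>\<bar>))"
proof -
  obtain C where C: "C > 0" "\<And>\<theta>. \<theta> \<noteq> 0 \<Longrightarrow> \<bar>\<theta>\<bar> \<le> 1 \<Longrightarrow> norm (1 - char F \<theta>) \<le> C * W (1 / \<bar>\<theta>\<bar>)"
    using char_upper by blast
  obtain c \<epsilon> where c: "c > 0" "0 < \<epsilon>" "\<epsilon> \<le> 1"
    "\<And>\<theta>. \<theta> \<noteq> 0 \<Longrightarrow> \<bar>\<theta>\<bar> \<le> \<epsilon> \<Longrightarrow> c * W (1 / \<bar>\<theta>\<bar>) \<le> Re (1 - char F \<theta>)"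
    using char_lower by blast
  have "eventually (\<lambda>y. W y < c / C\<^sup>2) at_top"
    by (rule order_tendstoD(2)[OF tail_tendsto_0]) (use C c in auto)
  then obtain y0 where y0: "\<And>y. y \<ge> y0 \<Longrightarrow> W y < c / C\<^sup>2"
    by (auto simp: eventually_at_top_linorder)
  define Y where "Y = max 1 y0"
  have Y: "Y > 0" by (simp add: Y_def)
  show ?thesis
  proof (rule that[of "c / 2" "min \<epsilon> (1 / Y)"])
    show "c / 2 > 0" "0 < min \<epsilon> (1 / Y)" "min \<epsilon> (1 / Y) \<le> 1" using c Y by auto
    fix \<theta> :: real assume th: "\<theta> \<noteq> 0" "\<bar>\<theta>\<bar> \<le> min \<epsilon> (1 / Y)"
    define w where "w = W (1 / \<bar>\<theta>\<bar>)"
    have w: "w \<ge> 0" by (simp add: w_def)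
    have "1 / \<bar>\<theta>\<bar> \<ge> Y" using th Y by (simp add: field_simps)
    then have "w < c / C\<^sup>2" unfolding w_def by (intro y0) (simp add: Y_def)
    then have wC: "C\<^sup>2 * w \<le> c" using C by (simp add: field_simps)
    define z where "z = 1 - char F \<theta>"
    have z1: "norm z \<le> C * w" unfolding z_def w_def using th c by (intro C) auto
    have z2: "c * w \<le> Re z" unfolding z_def w_def using th by (intro c) auto
    have "(norm z)\<^sup>2 \<le> (C * w)\<^sup>2" using z1 by (intro power_mono) auto
    also have "\<dots> = C\<^sup>2 * w * w" by (simp add: power2_eq_square)
    also have "\<dots> \<le> c * w" using wC w by (intro mult_right_mono)
    finally have z3: "(norm z)\<^sup>2 \<le> c * w" .
    have "(norm (char F \<theta>))\<^sup>2 = (norm (1 - z))\<^sup>2" by (simp add: z_def)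
    also have "\<dots> = 1 - 2 * Re z + (norm z)\<^sup>2"
      by (simp only: cmod_power2) (simp add: power2_eq_square algebra_simps)
    also have "\<dots> \<le> 1 + (- (c * w))" using z2 z3 by linarith
    also have "\<dots> \<le> exp (- (c * w))" by (rule exp_ge_add_one_self)
    also have "\<dots> = (exp (- (c / 2) * w))\<^sup>2" by (simp add: exp_double[symmetric])
    finally have "norm (char F \<theta>) \<le> exp (- (c / 2) * w)"
      by (rule power2_le_imp_le) simp
    then show "norm (char F \<theta>) \<le> exp (- (c / 2) * W (1 / \<bar>\<theta>\<bar>))" by (simp add: w_def)
  qed
qed

end

context heavy_tail_norm
begin

text \<open>Provides one integrable majorant for all times. The Potter bound and
  \<open>tail_a_bounds\<close> make t * W (a t / |s|) at least a multiple of |s|^\<beta> for |s| >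
  1, and the exponential of a positive power beats every polynomial.\<close>

lemma exp_tail_bound:
  assumes c: "c > 0"
  obtains C where "C > 0" "\<And>t s. t \<ge> 1 \<Longrightarrow> s \<noteq> 0 \<Longrightarrow> \<bar>s\<bar> \<le> a t \<Longrightarrow> exp (- c * (t * W (a t / \<bar>s\<bar>))) \<le> C / (1 + s\<^sup>2)"
proof -
  define \<beta> where "\<beta> = \<alpha> / 2"
  have b: "0 < \<beta>" "\<beta> < \<alpha>" using alpha_pos by (auto simp: \<beta>_def)
  obtain C1 where C1: "C1 > 0" "\<And>x y. 1 \<le> y \<Longrightarrow> y \<le> x \<Longrightarrow> W x \<le> C1 * (y / x) powr \<beta> * W y"
    using tail_potter_lower[OF b] by blast
  obtain C2 where C2: "C2 > 0" "\<And>t. t \<ge> 1 \<Longrightarrow> W (a t) * t \<le> C2" "\<And>t. t \<ge> 1 \<Longrightarrow> 1 \<le> C2 * (W (a t) * t)"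
    using tail_a_bounds by blast
  define d where "d = c / (C1 * C2)"
  have d: "d > 0" using c C1 C2 by (simp add: d_def)
  \<comment> \<open>Chosen so that \<beta> * m \<ge> 2: the m-th power of |s|^\<beta> in the bound
    (z / m)^m \<le> exp z then dominates s^2.\<close>
  define m where "m = nat \<lceil>2 / \<beta>\<rceil>"
  have mb: "real m \<ge> 2 / \<beta>" using of_nat_ceiling m_def by blast
  then have mb2: "\<beta> * real m \<ge> 2" using b by (simp add: field_simps)
  have m: "m > 0" using mb b by (smt (verit) divide_pos_pos of_nat_0 gr0I)
  define D where "D = (real m / d) ^ m"
  have D: "D > 0" using m d by (simp add: D_def)
  show ?thesis
  proof (rule that[of "2 * (D + 1)"])
    show "2 * (D + 1) > 0" using D by simp
    fix t s :: real assume t: "t \<ge> 1" and s: "s \<noteq> 0" "\<bar>s\<bar> \<le> a t"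
    have pos: "1 + s\<^sup>2 > 0" by (simp add: add_pos_nonneg)
    show "exp (- c * (t * W (a t / \<bar>s\<bar>))) \<le> 2 * (D + 1) / (1 + s\<^sup>2)"
    proof (cases "\<bar>s\<bar> \<le> 1")
      case True
      then have "s\<^sup>2 \<le> 1" by (simp add: abs_square_le_1)
      then have "1 \<le> 2 / (1 + s\<^sup>2)" using pos by simp
      also have "\<dots> \<le> 2 * (D + 1) / (1 + s\<^sup>2)" using D pos by (intro divide_right_mono) auto
      finally have 1: "1 \<le> 2 * (D + 1) / (1 + s\<^sup>2)" .
      have "exp (- c * (t * W (a t / \<bar>s\<bar>))) \<le> 1" using c t by simp
      then show ?thesis using 1 by linarith
    next
      case False
      define v where "v = \<bar>s\<bar>"
      have v: "v > 1" "v \<le> a t" "s\<^sup>2 = v\<^sup>2" using False s by (auto simp: v_def)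
      have "W (a t) \<le> C1 * ((a t / v) / a t) powr \<beta> * W (a t / v)"
        using v by (intro C1) (auto simp: field_simps)
      also have "(a t / v) / a t = 1 / v" by simp
      finally have "v powr \<beta> * W (a t) \<le> C1 * W (a t / v)"
        using v by (simp add: powr_divide field_simps)
      then have "C2 * t * (v powr \<beta> * W (a t)) \<le> C2 * t * (C1 * W (a t / v))"
        using C2 t by (intro mult_left_mono) auto
      moreover have "v powr \<beta> * 1 \<le> v powr \<beta> * (C2 * (W (a t) * t))"
        using C2 t by (intro mult_left_mono) auto
      ultimately have "v powr \<beta> \<le> C1 * C2 * (t * W (a t / v))" by (simp add: mult_ac)
      then have low: "d * v powr \<beta> \<le> c * (t * W (a t / v))"
        using C1 C2 c by (simp add: d_def field_simps)
      define z where "z = d * v powr \<beta>"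
      have z: "z > 0" using d v by (simp add: z_def)
      have "(z / m) ^ m \<le> (exp (z / m)) ^ m"
      proof (rule power_mono)
        show "z / m \<le> exp (z / m)" using exp_ge_add_one_self[of "z / m"] by linarith
      qed (use z in simp)
      also have "\<dots> = exp z" using m by (simp add: exp_of_nat_mult[symmetric])
      finally have ez: "(z / m) ^ m \<le> exp z" .
      have "exp (- c * (t * W (a t / v))) \<le> exp (- z)" using low by (simp add: z_def)
      also have "\<dots> \<le> 1 / (z / m) ^ m"
        using ez z m by (simp add: exp_minus field_simps)
      also have "\<dots> = D / (v powr \<beta>) ^ m"
        by (simp add: D_def z_def power_mult_distrib power_divide)
      also have "(v powr \<beta>) ^ m = v powr (\<beta> * m)"
        using v powr_realpow[of "v powr \<beta>" m] by (simp add: powr_powr)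
      also have "D / v powr (\<beta> * m) \<le> D / v powr 2"
        using D v mb2 by (intro divide_left_mono powr_mono) auto
      also have "v powr 2 = v\<^sup>2" using v by simp
      also have "D / v\<^sup>2 \<le> 2 * (D + 1) / (1 + v\<^sup>2)"
      proof -
        have "v\<^sup>2 \<ge> 1" using v by (simp add: one_le_power)
        then have "D * (1 + v\<^sup>2) \<le> 2 * (D + 1) * v\<^sup>2"
          using D mult_left_mono[of 1 "v\<^sup>2" D] \<open>v\<^sup>2 \<ge> 1\<close> unfolding distrib_left distrib_right by linarith
        moreover have "v\<^sup>2 > 0" "1 + v\<^sup>2 > 0" using v by (auto simp: add_pos_pos)
        ultimately show ?thesis
          by (intro mult_imp_div_pos_le) (simp_all only: times_divide_eq_left mult_imp_le_div_pos)
      qed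
      finally show ?thesis by (simp only: v(3) v_def[symmetric])
    qed
  qed
qed

end

section \<open>Fourier inversion and concentration\<close>

definition inv_fourier :: "(real \<Rightarrow> complex) \<Rightarrow> real \<Rightarrow> real" where
  "inv_fourier \<psi> y = Re (\<integral>t. iexp (- (t * y)) * \<psi> t \<partial>lborel) / (2 * pi)"

lemma integrable_iexp_mult:
  assumes "integrable lborel \<psi>"
  shows "integrable lborel (\<lambda>t. iexp (- (t * y)) * \<psi> t)"
proof (rule Bochner_Integration.integrable_bound[OF assms])
  have [measurable]: "\<psi> \<in> borel_measurable borel" using assms by auto
  show "(\<lambda>t. iexp (- (t * y)) * \<psi> t) \<in> borel_measurable lborel" by measurable
qed (simp add: norm_mult)

lemma inv_fourier_bound:
  assumes "integrable lborel \<psi>"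
  shows "\<bar>inv_fourier \<psi> y\<bar> \<le> (\<integral>t. norm (\<psi> t) \<partial>lborel) / (2 * pi)"
proof -
  have "\<bar>Re (\<integral>t. iexp (- (t * y)) * \<psi> t \<partial>lborel)\<bar> \<le> norm (\<integral>t. iexp (- (t * y)) * \<psi> t \<partial>lborel)"
    by (rule abs_Re_le_cmod)
  also have "\<dots> \<le> (\<integral>t. norm (iexp (- (t * y)) * \<psi> t) \<partial>lborel)"
    by (rule integral_norm_bound)
  finally show ?thesis by (simp add: inv_fourier_def norm_mult divide_right_mono)
qed

lemma isCont_inv_fourier:
  assumes "integrable lborel \<psi>"
  shows "isCont (inv_fourier \<psi>) y"
  unfolding continuous_at_sequentially comp_def
proof (intro allI impI)
  fix u :: "nat \<Rightarrow> real" assume u: "u \<longlonglongrightarrow> y"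
  have [measurable]: "\<psi> \<in> borel_measurable borel" using assms by auto
  have "(\<lambda>n. \<integral>t. iexp (- (t * u n)) * \<psi> t \<partial>lborel) \<longlonglongrightarrow> (\<integral>t. iexp (- (t * y)) * \<psi> t \<partial>lborel)"
    by (rule integral_dominated_convergence[where w = "\<lambda>t. norm (\<psi> t)"])
       (use assms in \<open>auto simp: norm_mult intro!: tendsto_intros u\<close>)
  then show "(\<lambda>n. inv_fourier \<psi> (u n)) \<longlonglongrightarrow> inv_fourier \<psi> y"
    unfolding inv_fourier_def by (intro tendsto_intros) auto
qed

text \<open>The kernel of the Levy inversion formula is the integral of exp (- i * t * y) over
  [a, b], hence bounded by b - a. Integrability of the characteristic function therefore lets the
  symmetric limit become an integral, and Fubini exposes the density.\<close>

lemma (in real_distribution) char_inversion_interval: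
  assumes ab: "a \<le> b" and null: "measure M {a} = 0" "measure M {b} = 0"
    and int: "integrable lborel (char M)"
  shows "measure M {a<..b} = (\<integral>y. indicator {a..b} y * inv_fourier (char M) y \<partial>lborel)"
proof -
  define H where "H t = (\<integral>y. indicator {a..b} y *\<^sub>R iexp (- (t * y)) \<partial>lborel)" for t :: real
  have Hint: "integrable lborel (\<lambda>y. indicator {a..b} y *\<^sub>R iexp (- (t * y)))" for t :: real
    by (rule Bochner_Integration.integrable_bound[where f = "indicator {a..b} :: real \<Rightarrow> real"])
       (auto simp: indicator_def emeasure_lborel_Icc_eq intro!: integrable_real_indicator)
  have Hbound: "norm (H t) \<le> b - a" for t
  proof -
    have "norm (H t) \<le> (\<integral>y. norm (indicator {a..b} y *\<^sub>R iexp (- (t * y))) \<partial>lborel)"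
      unfolding H_def by (rule integral_norm_bound)
    also have "\<dots> = (\<integral>y. indicator {a..b} y \<partial>lborel)" by (intro Bochner_Integration.integral_cong) (auto simp: indicator_def)
    also have "\<dots> = b - a" using ab by simp
    finally show ?thesis .
  qed
  have H_eq: "(iexp (- (t * a)) - iexp (- (t * b))) / (\<i> * t) = H t" if t: "t \<noteq> 0" for t
  proof -
    have "((\<lambda>y. iexp (- (t * y))) has_integral (iexp (- (t * b)) / (- \<i> * t) - iexp (- (t * a)) / (- \<i> * t))) {a..b}"
    proof (rule fundamental_theorem_of_calculus[OF ab])
      fix y :: real
      have "((\<lambda>z. exp (\<i> * - (of_real t * z)) / (- \<i> * t)) has_field_derivative exp (\<i> * - (of_real t * of_real y))) (at (of_real y))"
        using t by (auto intro!: derivative_eq_intros simp: field_simps)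
      from has_vector_derivative_real_field[OF this]
      show "((\<lambda>y. iexp (- (t * y)) / (- \<i> * t)) has_vector_derivative iexp (- (t * y))) (at y within {a..b})"
        by simp
    qed
    moreover have "((\<lambda>y. iexp (- (t * y))) has_integral H t) {a..b}"
    proof -
      have si: "set_integrable lborel {a..b} (\<lambda>y. iexp (- (t * y)))"
        unfolding set_integrable_def by (rule Hint)
      have "H t = integral {a..b} (\<lambda>y. iexp (- (t * y)))"
        using set_borel_integral_eq_integral(2)[OF si] unfolding set_lebesgue_integral_def H_def .
      then show ?thesis
        using integrable_integral[OF set_borel_integral_eq_integral(1)[OF si]] by (simp only:)
    qed
    ultimately have "H t = iexp (- (t * b)) / (- \<i> * t) - iexp (- (t * a)) / (- \<i> * t)"
      by (rule has_integral_unique[rotated])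
    then show ?thesis using t by (simp add: field_simps)
  qed
  have [measurable]: "H \<in> borel_measurable borel" unfolding H_def by measurable
  have intH: "integrable lborel (\<lambda>t. H t * char M t)"
  proof (rule Bochner_Integration.integrable_bound)
    show "integrable lborel (\<lambda>t. (b - a) * norm (char M t))" using int by auto
    show "AE t in lborel. norm (H t * char M t) \<le> norm ((b - a) * norm (char M t))"
      using Hbound ab by (auto simp: norm_mult intro!: mult_right_mono)
  qed auto
  have "(\<lambda>T. 1 / (2 * pi) * (CLBINT t=-real T..real T. (iexp (- (t * a)) - iexp (- (t * b))) / (\<i> * t) * char M t)) \<longlonglongrightarrow> measure M {a<..b}"
    using Levy_Inversion[OF ab null] by simp
  moreover have "(CLBINT t=-real T..real T. (iexp (- (t * a)) - iexp (- (t * b))) / (\<i> * t) * char M t)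
      = (\<integral>t. indicator {-real T<..<real T} t *\<^sub>R (H t * char M t) \<partial>lborel)" for T
  proof -
    have "(CLBINT t=-real T..real T. (iexp (- (t * a)) - iexp (- (t * b))) / (\<i> * t) * char M t)
       = (\<integral>t. indicator {-real T<..<real T} t *\<^sub>R ((iexp (- (t * a)) - iexp (- (t * b))) / (\<i> * t) * char M t) \<partial>lborel)"
      unfolding interval_lebesgue_integral_def set_lebesgue_integral_def by simp
    also have "\<dots> = (\<integral>t. indicator {-real T<..<real T} t *\<^sub>R (H t * char M t) \<partial>lborel)"
    proof (rule integral_cong_AE)
      have "AE t in lborel. t \<noteq> (0::real)" by (rule AE_lborel_singleton)
      then show "AE t in lborel. indicator {-real T<..<real T} t *\<^sub>R ((iexp (- (t * a)) - iexp (- (t * b))) / (\<i> * t) * char M t)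
        = indicator {-real T<..<real T} t *\<^sub>R (H t * char M t)"
      proof eventually_elim
        case (elim t)
        show ?case by (simp only: H_eq[OF elim])
      qed
    qed auto
    finally show ?thesis .
  qed
  ultimately have lim1: "(\<lambda>T. 1 / (2 * pi) * (\<integral>t. indicator {-real T<..<real T} t *\<^sub>R (H t * char M t) \<partial>lborel)) \<longlonglongrightarrow> measure M {a<..b}"
    by simp
  have "(\<lambda>T. \<integral>t. indicator {-real T<..<real T} t *\<^sub>R (H t * char M t) \<partial>lborel) \<longlonglongrightarrow> (\<integral>t. H t * char M t \<partial>lborel)"
  proof (rule integral_dominated_convergence[where w = "\<lambda>t. norm (H t * char M t)"])
    show "AE t in lborel. (\<lambda>T. indicator {-real T<..<real T} t *\<^sub>R (H t * char M t)) \<longlonglongrightarrow> H t * char M t"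
    proof (rule AE_I2)
      fix t :: real
      have "eventually (\<lambda>T. real T > \<bar>t\<bar>) sequentially"
        using filterlim_real_sequentially by (auto simp: filterlim_at_top_dense)
      then have "eventually (\<lambda>T. indicator {-real T<..<real T} t *\<^sub>R (H t * char M t) = H t * char M t) sequentially"
        by eventually_elim (auto simp: indicator_def)
      then show "(\<lambda>T. indicator {-real T<..<real T} t *\<^sub>R (H t * char M t)) \<longlonglongrightarrow> H t * char M t"
        by (rule tendsto_eventually)
    qed
    show "integrable lborel (\<lambda>t. norm (H t * char M t))" using intH by (rule integrable_norm)
  qed (auto simp: indicator_def)
  then have "(\<lambda>T. 1 / (2 * pi) * (\<integral>t. indicator {-real T<..<real T} t *\<^sub>R (H t * char M t) \<partial>lborel)) \<longlonglongrightarrow> 1 / (2 * pi) * (\<integral>t. H t * char M t \<partial>lborel)"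
    by (intro tendsto_intros)
  with lim1 have m1: "complex_of_real (measure M {a<..b}) = 1 / (2 * pi) * (\<integral>t. H t * char M t \<partial>lborel)"
    by (rule LIMSEQ_unique)
  have "(\<integral>t. H t * char M t \<partial>lborel) = (\<integral>t. (\<integral>y. indicator {a..b} y *\<^sub>R (iexp (- (t * y)) * char M t) \<partial>lborel) \<partial>lborel)"
  proof (rule Bochner_Integration.integral_cong[OF refl])
    fix t :: real
    have "H t * char M t = (\<integral>y. (indicator {a..b} y *\<^sub>R iexp (- (t * y))) * char M t \<partial>lborel)"
      unfolding H_def by (rule Bochner_Integration.integral_mult_left[OF Hint, symmetric])
    then show "H t * char M t = (\<integral>y. indicator {a..b} y *\<^sub>R (iexp (- (t * y)) * char M t) \<partial>lborel)"
      by simp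
  qed
  also have "\<dots> = (\<integral>y. (\<integral>t. indicator {a..b} y *\<^sub>R (iexp (- (t * y)) * char M t) \<partial>lborel) \<partial>lborel)"
  proof (rule lborel_pair.Fubini_integral[symmetric])
    show "integrable (lborel \<Otimes>\<^sub>M lborel) (\<lambda>(x, y). indicator {a..b} y *\<^sub>R (iexp (- (x * y)) * char M x))"
    proof (rule lborel_pair.Fubini_integrable)
      have "(\<integral>y. norm (indicator {a..b} y *\<^sub>R (iexp (- (x * y)) * char M x)) \<partial>lborel) = (b - a) * norm (char M x)" for x :: real
      proof -
        have "(\<integral>y. norm (indicator {a..b} y *\<^sub>R (iexp (- (x * y)) * char M x)) \<partial>lborel) = (\<integral>y. indicator {a..b} y * norm (char M x) \<partial>lborel)"
          by (intro Bochner_Integration.integral_cong) (auto simp: indicator_def norm_mult)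
        then show ?thesis using ab by simp
      qed
      then show "integrable lborel (\<lambda>x. \<integral>y. norm (case (x, y) of (x, y) \<Rightarrow> indicator {a..b} y *\<^sub>R (iexp (- (x * y)) * char M x)) \<partial>lborel)"
        using int by simp
      show "AE x in lborel. integrable lborel (\<lambda>y. case (x, y) of (x, y) \<Rightarrow> indicator {a..b} y *\<^sub>R (iexp (- (x * y)) * char M x))"
      proof (rule AE_I2)
        fix x :: real
        have "integrable lborel (\<lambda>y. (indicator {a..b} y *\<^sub>R iexp (- (x * y))) * char M x)"
          by (rule integrable_mult_left) (rule Hint)
        then show "integrable lborel (\<lambda>y. case (x, y) of (x, y) \<Rightarrow> indicator {a..b} y *\<^sub>R (iexp (- (x * y)) * char M x))"
          by simp
      qed
    qed (simp add: split_beta', measurable)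
  qed
  also have "\<dots> = (\<integral>y. indicator {a..b} y *\<^sub>R (\<integral>t. iexp (- (t * y)) * char M t \<partial>lborel) \<partial>lborel)"
    by simp
  finally have m2: "measure M {a<..b} = Re (1 / (2 * pi) * (\<integral>y. indicator {a..b} y *\<^sub>R (\<integral>t. iexp (- (t * y)) * char M t \<partial>lborel) \<partial>lborel))"
    using m1 by (metis Re_complex_of_real)
  have [measurable]: "(\<lambda>y. \<integral>t. iexp (- (t * y)) * char M t \<partial>lborel) \<in> borel_measurable borel"
    by measurable
  have intI: "integrable lborel (\<lambda>y. indicator {a..b} y *\<^sub>R (\<integral>t. iexp (- (t * y)) * char M t \<partial>lborel))"
  proof (rule Bochner_Integration.integrable_bound)
    show "integrable lborel (\<lambda>y. indicator {a..b} y * (\<integral>t. norm (char M t) \<partial>lborel))"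
      by (auto simp: emeasure_lborel_Icc_eq intro!: integrable_mult_left integrable_real_indicator)
    have "norm (\<integral>t. iexp (- (t * y)) * char M t \<partial>lborel) \<le> (\<integral>t. norm (char M t) \<partial>lborel)" for y
      using integral_norm_bound[of lborel "\<lambda>t. iexp (- (t * y)) * char M t"] by (simp add: norm_mult)
    then show "AE y in lborel. norm (indicator {a..b} y *\<^sub>R (\<integral>t. iexp (- (t * y)) * char M t \<partial>lborel))
        \<le> norm (indicator {a..b} y * (\<integral>t. norm (char M t) \<partial>lborel))"
      by (auto simp: indicator_def intro: order_trans)
  qed auto
  have "measure M {a<..b} = 1 / (2 * pi) * Re (\<integral>y. indicator {a..b} y *\<^sub>R (\<integral>t. iexp (- (t * y)) * char M t \<partial>lborel) \<partial>lborel)"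
    using m2 by (simp add: Re_divide_of_real)
  also have "Re (\<integral>y. indicator {a..b} y *\<^sub>R (\<integral>t. iexp (- (t * y)) * char M t \<partial>lborel) \<partial>lborel)
     = (\<integral>y. indicator {a..b} y * Re (\<integral>t. iexp (- (t * y)) * char M t \<partial>lborel) \<partial>lborel)"
    using intI by (subst integral_Re[symmetric]) auto
  also have "1 / (2 * pi) * \<dots> = (\<integral>y. indicator {a..b} y * inv_fourier (char M) y \<partial>lborel)"
    unfolding inv_fourier_def by (subst integral_mult_right_zero[symmetric]) (simp add: field_simps)
  finally show ?thesis .
qed

text \<open>Both densities give the same mass to half-open intervals, so they agree almost
  everywhere. Nonnegativity comes first: a negative value of the continuous function would persist
  on a short interval and give it negative mass.\<close>

lemma char_inversion_density:
  fixes g :: "real \<Rightarrow> real"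
  assumes [measurable]: "g \<in> borel_measurable borel" and nonneg: "\<And>x. g x \<ge> 0"
    and prob: "prob_space (density lborel g)"
    and int: "integrable lborel (char (density lborel g))"
  shows "(\<forall>y. inv_fourier (char (density lborel g)) y \<ge> 0) \<and> (AE y in lborel. g y = inv_fourier (char (density lborel g)) y)"
proof -
  define f where "f = inv_fourier (char (density lborel g))"
  interpret D: real_distribution "density lborel g"
    by (intro real_distribution.intro real_distribution_axioms.intro prob) auto
  have cont: "isCont f y" for y unfolding f_def by (rule isCont_inv_fourier[OF int])
  then have contf: "continuous_on S f" for S by (simp add: continuous_at_imp_continuous_on)
  have [measurable]: "f \<in> borel_measurable borel" using contf by (rule borel_measurable_continuous_onI)
  have null: "measure (density lborel g) {a} = 0" for a :: real
    by (simp add: measure_def emeasure_density nn_integral_0_iff_AE AE_lborel_singleton)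
  have interval: "measure (density lborel g) {a<..b} = (\<integral>y. indicator {a..b} y * f y \<partial>lborel)" if "a \<le> b" for a b
    unfolding f_def by (rule D.char_inversion_interval[OF that null null int])
  have fint: "integrable lborel (\<lambda>y. indicator {a..b} y * f y)" for a b
    using borel_integrable_compact[OF compact_Icc contf, of a b]
    by (rule back_subst[of "integrable lborel"]) (auto simp: indicator_def fun_eq_iff)
  have f_nonneg: "f y \<ge> 0" for y
  proof (rule ccontr)
    assume neg: "\<not> f y \<ge> 0"
    then have "eventually (\<lambda>z. f z < f y / 2) (nhds y)"
      using cont[of y] by (intro order_tendstoD(2)[of f "f y"]) (auto simp: isCont_def continuous_at tendsto_at_iff_tendsto_nhds)
    then obtain d where d: "d > 0" "\<And>z. dist z y < d \<Longrightarrow> f z < f y / 2"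
      by (auto simp: eventually_nhds_metric)
    have "0 \<le> measure (density lborel g) {y<..y + d/2}" by simp
    also have "\<dots> = (\<integral>z. indicator {y..y+d/2} z * f z \<partial>lborel)" using d by (intro interval) auto
    also have "\<dots> \<le> (\<integral>z. indicator {y..y+d/2} z * (f y / 2) \<partial>lborel)"
    proof (rule integral_mono[OF fint])
      show "integrable lborel (\<lambda>z. indicator {y..y+d/2} z * (f y / 2))"
        by (intro integrable_mult_left integrable_real_indicator) (auto simp: emeasure_lborel_Icc_eq)
      fix z show "indicator {y..y+d/2} z * f z \<le> indicator {y..y+d/2} z * (f y / 2)"
        using d(2)[of z] d(1) by (auto simp: indicator_def dist_real_def)
    qed
    also have "\<dots> = d / 2 * (f y / 2)" using d by simp
    also have "\<dots> < 0" using d neg by (simp add: mult_pos_neg)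
    finally show False by simp
  qed
  have "density lborel g = density lborel f"
  proof (rule measure_eqI_generator_eq_countable[where \<Omega> = UNIV and E = "range (\<lambda>(a, b). {a<..b::real})" and A = "range (\<lambda>n::nat. {-real n<..real n})"])
    show "Int_stable (range (\<lambda>(a, b). {a<..b::real}))"
      by (auto simp: Int_stable_def)
    show "sets (density lborel g) = sigma_sets UNIV (range (\<lambda>(a, b). {a<..b::real}))"
      "sets (density lborel f) = sigma_sets UNIV (range (\<lambda>(a, b). {a<..b::real}))"
      by (auto simp: borel_sigma_sets_Ioc)
    fix X assume "X \<in> range (\<lambda>(a, b). {a<..b::real})"
    then obtain a b where X: "X = {a<..b}" by auto
    show "emeasure (density lborel g) X = emeasure (density lborel f) X"
    proof (cases "a \<le> b")
      case True
      have "emeasure (density lborel f) X = (\<integral>\<^sup>+y. ennreal (indicator {a..b} y * f y) \<partial>lborel)"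
      proof -
        have "emeasure (density lborel f) X = (\<integral>\<^sup>+ x. ennreal (f x) * indicator {a<..b} x \<partial>lborel)"
          unfolding X by (rule emeasure_density) auto
        also have "\<dots> = (\<integral>\<^sup>+ y. ennreal (indicator {a..b} y * f y) \<partial>lborel)"
        proof (rule nn_integral_cong_AE)
          have "AE t in lborel. t \<noteq> a" by (rule AE_lborel_singleton)
          then show "AE x in lborel. ennreal (f x) * indicator {a<..b} x = ennreal (indicator {a..b} x * f x)"
            by eventually_elim (auto simp: indicator_def)
        qed
        finally show ?thesis .
      qed
      also have "\<dots> = ennreal (\<integral>y. indicator {a..b} y * f y \<partial>lborel)"
        by (rule nn_integral_eq_integral[OF fint]) (auto simp: f_nonneg)
      also have "\<dots> = emeasure (density lborel g) X"
        unfolding X D.emeasure_eq_measure interval[OF True] ..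
      finally show ?thesis ..
    next
      case False then show ?thesis by (simp add: X)
    qed
  next
    show "(\<Union>(range (\<lambda>n::nat. {-real n<..real n}))) = UNIV"
    proof (intro equalityI subsetI UNIV_I)
      fix x :: real
      obtain n :: nat where "real n > \<bar>x\<bar>" using reals_Archimedean2 by blast
      then show "x \<in> (\<Union>(range (\<lambda>n::nat. {-real n<..real n})))" by (intro UN_I[of n]) auto
    qed
    fix X assume "X \<in> range (\<lambda>n::nat. {-real n<..real n})"
    then show "emeasure (density lborel g) X \<noteq> \<infinity>" by (auto simp: D.emeasure_eq_measure)
  qed auto
  then have "AE y in lborel. ennreal (g y) = ennreal (f y)"
    by (subst sigma_finite_measure.density_unique_iff[OF sigma_finite_lborel, symmetric]) auto
  then have "AE y in lborel. g y = f y"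
    by eventually_elim (simp add: nonneg f_nonneg)
  then show ?thesis using f_nonneg by (auto simp: f_def)
qed

text \<open>Core of both local limit theorems, by splitting the range of s. For |s| \<le> \<epsilon>
  * b n there is a fixed majorant and dominated convergence applies. For \<epsilon> * b n < |s|
  \<le> K * b n the integrand is at most |d n| / b n on a set of length at most 2 * K * b n, so this
  part is O(d n). Beyond K * b n the weight \<open>w\<close> vanishes.\<close>

lemma tendsto_fourier_integral:
  fixes \<phi> :: "nat \<Rightarrow> real \<Rightarrow> complex" and \<psi> :: "real \<Rightarrow> complex" and w :: "nat \<Rightarrow> real \<Rightarrow> real" and b q d :: "nat \<Rightarrow> real"
  assumes [measurable]: "\<And>n. \<phi> n \<in> borel_measurable borel" "\<And>n. w n \<in> borel_measurable borel"
    and b_pos: "\<And>n. b n > 0" and b_top: "filterlim b at_top sequentially" and q: "q \<longlonglongrightarrow> y"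
    and lim: "\<And>s. (\<lambda>n. \<phi> n s) \<longlonglongrightarrow> \<psi> s"
    and eps: "\<epsilon> > 0" and dom: "\<And>n s. \<bar>s\<bar> \<le> \<epsilon> * b n \<Longrightarrow> norm (\<phi> n s) \<le> C / (1 + s\<^sup>2)"
    and K: "K > 0" and away: "\<And>n s. \<epsilon> * b n < \<bar>s\<bar> \<Longrightarrow> \<bar>s\<bar> \<le> K * b n \<Longrightarrow> b n * norm (\<phi> n s) \<le> d n" and d: "d \<longlonglongrightarrow> 0"
    and w: "\<And>n s. \<bar>w n s\<bar> \<le> 1" "\<And>n s. \<bar>s\<bar> > K * b n \<Longrightarrow> w n s = 0" "\<And>s. (\<lambda>n. w n s) \<longlonglongrightarrow> c"
  shows "integrable lborel \<psi>"
    "(\<lambda>n. \<integral>s. of_real (w n s) * (iexp (- (s * q n)) * \<phi> n s) \<partial>lborel) \<longlonglongrightarrow> of_real c * (\<integral>s. iexp (- (s * y)) * \<psi> s \<partial>lborel)"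
proof -
  have Cint: "integrable lborel (\<lambda>s::real. C / (1 + s\<^sup>2))"
    using integrable_mult_right[OF integrable_inverse_1_plus_square[unfolded interval_lebesgue_integrable_def set_integrable_def], of C]
    by (simp add: field_simps)
  have psi_m [measurable]: "\<psi> \<in> borel_measurable borel"
    by (rule borel_measurable_LIMSEQ_metric[where f = \<phi>]) (auto intro: lim)
  have evs: "eventually (\<lambda>n. \<bar>s\<bar> \<le> \<epsilon> * b n) sequentially" for s
  proof -
    have "eventually (\<lambda>n. b n \<ge> \<bar>s\<bar> / \<epsilon>) sequentially" using b_top by (auto simp: filterlim_at_top)
    then show ?thesis by eventually_elim (use eps in \<open>simp add: field_simps\<close>)
  qed
  have psi_bound: "norm (\<psi> s) \<le> C / (1 + s\<^sup>2)" for s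
    by (rule tendsto_upperbound[OF tendsto_norm[OF lim]]) (use evs[of s] dom in \<open>auto elim: eventually_mono\<close>)
  show psi_int: "integrable lborel \<psi>"
    by (rule Bochner_Integration.integrable_bound[OF Cint]) (simp, rule AE_I2, rule order_trans[OF psi_bound], simp only: real_norm_def abs_ge_self)
  define G1 where "G1 n s = of_bool (\<bar>s\<bar> \<le> \<epsilon> * b n) * (of_real (w n s) * (iexp (- (s * q n)) * \<phi> n s))" for n s
  define G2 where "G2 n s = of_bool (\<bar>s\<bar> > \<epsilon> * b n) * (of_real (w n s) * (iexp (- (s * q n)) * \<phi> n s))" for n s
  have [measurable]: "G1 n \<in> borel_measurable borel" "G2 n \<in> borel_measurable borel" for n
    unfolding G1_def G2_def by measurable
  have G1b: "norm (G1 n s) \<le> C / (1 + s\<^sup>2)" for n s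
  proof (cases "\<bar>s\<bar> \<le> \<epsilon> * b n")
    case True
    have "norm (G1 n s) = \<bar>w n s\<bar> * norm (\<phi> n s)" using True by (simp add: G1_def norm_mult)
    also have "\<dots> \<le> 1 * (C / (1 + s\<^sup>2))" using w(1) dom[OF True] by (intro mult_mono) auto
    finally show ?thesis by simp
  next
    case False
    then have "norm (G1 n s) = 0" by (simp add: G1_def)
    also have "\<dots> \<le> C / (1 + s\<^sup>2)" using psi_bound[of s] norm_ge_zero order_trans by blast
    finally show ?thesis .
  qed
  have G1_int: "integrable lborel (G1 n)" for n
    by (rule Bochner_Integration.integrable_bound[OF Cint]) (simp, rule AE_I2, rule order_trans[OF G1b], simp only: real_norm_def abs_ge_self)
  have G1_lim: "(\<lambda>n. \<integral>s. G1 n s \<partial>lborel) \<longlonglongrightarrow> (\<integral>s. of_real c * (iexp (- (s * y)) * \<psi> s) \<partial>lborel)"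
  proof (rule integral_dominated_convergence[OF _ _ Cint])
    show "AE s in lborel. (\<lambda>n. G1 n s) \<longlonglongrightarrow> of_real c * (iexp (- (s * y)) * \<psi> s)"
    proof (rule AE_I2)
      fix s :: real
      have "(\<lambda>n. of_real (w n s) * (iexp (- (s * q n)) * \<phi> n s)) \<longlonglongrightarrow> of_real c * (iexp (- (s * y)) * \<psi> s)"
        by (intro tendsto_intros w(3) q lim)
      moreover have "eventually (\<lambda>n. of_real (w n s) * (iexp (- (s * q n)) * \<phi> n s) = G1 n s) sequentially"
        using evs[of s] by eventually_elim (simp add: G1_def)
      ultimately show "(\<lambda>n. G1 n s) \<longlonglongrightarrow> of_real c * (iexp (- (s * y)) * \<psi> s)"
        by (rule Lim_transform_eventually)
    qed
  qed (auto intro: G1b)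
  have G2b: "norm (G2 n s) \<le> \<bar>d n\<bar> / b n * indicator {- (K * b n)..K * b n} s" for n s
  proof (cases "\<bar>s\<bar> > \<epsilon> * b n \<and> \<bar>s\<bar> \<le> K * b n")
    case True
    have "norm (G2 n s) = \<bar>w n s\<bar> * norm (\<phi> n s)" using True by (simp add: G2_def norm_mult)
    also have "\<dots> \<le> 1 * (\<bar>d n\<bar> / b n)"
      using w(1) away[of n s] True b_pos[of n] by (intro mult_mono) (auto simp: field_simps)
    finally show ?thesis using True by (auto simp: indicator_def)
  next
    case False
    then have "G2 n s = 0" using w(2)[of n s] by (auto simp: G2_def)
    then show ?thesis using b_pos[of n] by (simp add: indicator_def)
  qed
  have ind_int: "integrable lborel (\<lambda>s. \<bar>d n\<bar> / b n * indicator {- (K * b n)..K * b n} s)" for n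
    by (intro integrable_mult_right integrable_real_indicator) (auto simp: emeasure_lborel_Icc_eq)
  have G2_int: "integrable lborel (G2 n)" for n
    by (rule Bochner_Integration.integrable_bound[OF ind_int[of n]]) (simp, rule AE_I2, rule order_trans[OF G2b], simp only: real_norm_def abs_ge_self)
  have G2_lim: "(\<lambda>n. \<integral>s. G2 n s \<partial>lborel) \<longlonglongrightarrow> 0"
  proof (rule Lim_null_comparison)
    show "eventually (\<lambda>n. norm (\<integral>s. G2 n s \<partial>lborel) \<le> 2 * K * \<bar>d n\<bar>) sequentially"
    proof (rule always_eventually, rule allI)
      fix n
      have "norm (\<integral>s. G2 n s \<partial>lborel) \<le> (\<integral>s. \<bar>d n\<bar> / b n * indicator {- (K * b n)..K * b n} s \<partial>lborel)"
        by (rule Bochner_Integration.integral_norm_bound_integral[OF G2_int ind_int]) (rule G2b)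
      also have "\<dots> = \<bar>d n\<bar> / b n * (2 * K * b n)"
        using K b_pos[of n] by simp
      finally show "norm (\<integral>s. G2 n s \<partial>lborel) \<le> 2 * K * \<bar>d n\<bar>" using b_pos[of n] by (simp add: mult_ac)
    qed
    show "(\<lambda>n. 2 * K * \<bar>d n\<bar>) \<longlonglongrightarrow> 0" using d by (auto intro!: tendsto_eq_intros)
  qed
  have "(\<integral>s. of_real (w n s) * (iexp (- (s * q n)) * \<phi> n s) \<partial>lborel) = (\<integral>s. G1 n s \<partial>lborel) + (\<integral>s. G2 n s \<partial>lborel)" for n
  proof -
    have "(\<integral>s. G1 n s \<partial>lborel) + (\<integral>s. G2 n s \<partial>lborel) = (\<integral>s. G1 n s + G2 n s \<partial>lborel)"
      by (rule Bochner_Integration.integral_add[OF G1_int G2_int, symmetric])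
    also have "\<dots> = (\<integral>s. of_real (w n s) * (iexp (- (s * q n)) * \<phi> n s) \<partial>lborel)"
      by (intro Bochner_Integration.integral_cong) (auto simp: G1_def G2_def)
    finally show ?thesis ..
  qed
  then show "(\<lambda>n. \<integral>s. of_real (w n s) * (iexp (- (s * q n)) * \<phi> n s) \<partial>lborel) \<longlonglongrightarrow> of_real c * (\<integral>s. iexp (- (s * y)) * \<psi> s \<partial>lborel)"
    using tendsto_add[OF G1_lim G2_lim] integrable_iexp_mult[OF psi_int] by simp
qed

section \<open>The Fejer kernel, its transform, and smoothing\<close>

definition tri :: "real \<Rightarrow> real" where "tri x = max 0 (1 - \<bar>x\<bar>)"
text \<open>This is (sin (v/2) / (v/2))^2, the Fourier transform of \<open>tri\<close>, continued by
  1 at the origin. Being nonnegative with a compactly supported transform, it localizes mass while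
  looking only at a bounded range of frequencies.\<close>

definition fejer :: "real \<Rightarrow> real" where "fejer v = (if v = 0 then 1 else 2 * (1 - cos v) / v\<^sup>2)"

lemma tri_measurable [measurable]: "tri \<in> borel_measurable borel"
  unfolding tri_def by measurable

lemma fejer_measurable [measurable]: "fejer \<in> borel_measurable borel"
  unfolding fejer_def by measurable

lemma tri_nonneg [simp]: "tri x \<ge> 0" and tri_le_1: "tri x \<le> 1" and tri_minus [simp]: "tri (- x) = tri x"
  and tri_0 [simp]: "tri 0 = 1" and tri_eq_0: "\<bar>x\<bar> \<ge> 1 \<Longrightarrow> tri x = 0"
  by (auto simp: tri_def)

lemma fejer_nonneg [simp]: "fejer x \<ge> 0" and fejer_minus [simp]: "fejer (- x) = fejer x" and fejer_0 [simp]: "fejer 0 = 1"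
  by (auto simp: fejer_def)

lemma integrable_tri: "integrable lborel (\<lambda>t. of_real (tri t) * iexp (v * t))"
proof (rule Bochner_Integration.integrable_bound[where f = "indicator {-1..1} :: real \<Rightarrow> real"])
  show "AE t in lborel. norm (of_real (tri t) * iexp (v * t)) \<le> norm (indicator {-1..1} t :: real)"
    using tri_le_1 by (auto simp: norm_mult indicator_def tri_eq_0)
qed (auto simp: emeasure_lborel_Icc_eq)

lemma fejer_eq_integral: "(\<integral>t. of_real (tri t) * iexp (v * t) \<partial>lborel) = of_real (fejer v)"
proof -
  have eqs: "(\<integral>t. of_real (tri t) * iexp (v * t) \<partial>lborel) = integral {-1..1} (\<lambda>t. of_real (tri t) * iexp (v * t))"
  proof -
    have si: "set_integrable lborel {-1..1} (\<lambda>t. of_real (tri t) * iexp (v * t))"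
      unfolding set_integrable_def by (rule Bochner_Integration.integrable_bound[OF integrable_tri[of v]]) (auto simp: indicator_def)
    have "(\<integral>t. of_real (tri t) * iexp (v * t) \<partial>lborel) = (LINT t:{-1..1}|lborel. of_real (tri t) * iexp (v * t))"
      unfolding set_lebesgue_integral_def
      by (intro Bochner_Integration.integral_cong) (auto simp: indicator_def tri_eq_0)
    also have "\<dots> = integral {-1..1} (\<lambda>t. of_real (tri t) * iexp (v * t))"
      by (rule set_borel_integral_eq_integral(2)[OF si])
    finally show ?thesis .
  qed
  show ?thesis
  proof (cases "v = 0")
    case True
    have 1: "((\<lambda>t. of_real (tri t) * iexp (v * t)) has_integral ((of_real 0 + (of_real 0)\<^sup>2/2) - (of_real (-1) + (of_real (-1))\<^sup>2/2))) {-1..0}"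
    proof (rule fundamental_theorem_of_calculus)
      fix t :: real assume t: "t \<in> {-1..0}"
      have "((\<lambda>z. z + z\<^sup>2/2) has_field_derivative (1 + of_real t)) (at (complex_of_real t))"
        by (auto intro!: derivative_eq_intros)
      from has_vector_derivative_real_field[OF this]
      show "((\<lambda>t. of_real t + (of_real t)\<^sup>2/2) has_vector_derivative of_real (tri t) * iexp (v * t)) (at t within {-1..0})"
        using t by (simp add: tri_def True)
    qed simp
    have 2: "((\<lambda>t. of_real (tri t) * iexp (v * t)) has_integral ((of_real 1 - (of_real 1)\<^sup>2/2) - (of_real 0 - (of_real 0)\<^sup>2/2))) {0..1}"
    proof (rule fundamental_theorem_of_calculus)
      fix t :: real assume t: "t \<in> {0..1}"
      have "((\<lambda>z. z - z\<^sup>2/2) has_field_derivative (1 - of_real t)) (at (complex_of_real t))"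
        by (auto intro!: derivative_eq_intros)
      from has_vector_derivative_real_field[OF this]
      show "((\<lambda>t. of_real t - (of_real t)\<^sup>2/2) has_vector_derivative of_real (tri t) * iexp (v * t)) (at t within {0..1})"
        using t by (simp add: tri_def True)
    qed simp
    have "integral {-1..1} (\<lambda>t. of_real (tri t) * iexp (v * t)) = 1"
      using has_integral_combine[OF _ _ 1 2] by (auto intro!: integral_unique)
    then show ?thesis using eqs True by simp
  next
    case False
    define c where "c = \<i> * complex_of_real v"
    have c: "c \<noteq> 0" using False by (simp add: c_def)
    have csq: "c\<^sup>2 = - (of_real v)\<^sup>2" by (simp add: c_def power_mult_distrib)
    have 1: "((\<lambda>t. of_real (tri t) * iexp (v * t)) has_integral
       (((1 + of_real 0) * exp (c * of_real 0) / c - exp (c * of_real 0) / c\<^sup>2) - ((1 + of_real (-1)) * exp (c * of_real (-1)) / c - exp (c * of_real (-1)) / c\<^sup>2))) {-1..0}"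
    proof (rule fundamental_theorem_of_calculus)
      fix t :: real assume t: "t \<in> {-1..0}"
      have "((\<lambda>z. (1 + z) * exp (c * z) / c - exp (c * z) / c\<^sup>2) has_field_derivative (1 + of_real t) * exp (c * of_real t)) (at (of_real t))"
        using c by (auto intro!: derivative_eq_intros simp: field_simps power2_eq_square)
      from has_vector_derivative_real_field[OF this]
      show "((\<lambda>t. (1 + of_real t) * exp (c * of_real t) / c - exp (c * of_real t) / c\<^sup>2) has_vector_derivative of_real (tri t) * iexp (v * t)) (at t within {-1..0})"
        using t by (simp add: tri_def c_def mult.assoc)
    qed simp
    have 2: "((\<lambda>t. of_real (tri t) * iexp (v * t)) has_integral
       (((1 - of_real 1) * exp (c * of_real 1) / c + exp (c * of_real 1) / c\<^sup>2) - ((1 - of_real 0) * exp (c * of_real 0) / c + exp (c * of_real 0) / c\<^sup>2))) {0..1}"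
    proof (rule fundamental_theorem_of_calculus)
      fix t :: real assume t: "t \<in> {0..1}"
      have "((\<lambda>z. (1 - z) * exp (c * z) / c + exp (c * z) / c\<^sup>2) has_field_derivative (1 - of_real t) * exp (c * of_real t)) (at (of_real t))"
        using c by (auto intro!: derivative_eq_intros simp: field_simps power2_eq_square)
      from has_vector_derivative_real_field[OF this]
      show "((\<lambda>t. (1 - of_real t) * exp (c * of_real t) / c + exp (c * of_real t) / c\<^sup>2) has_vector_derivative of_real (tri t) * iexp (v * t)) (at t within {0..1})"
        using t by (simp add: tri_def c_def mult.assoc)
    qed simp
    have "integral {-1..1} (\<lambda>t. of_real (tri t) * iexp (v * t)) = (exp c + exp (- c) - 2) / c\<^sup>2"
      by (subst integral_unique[OF has_integral_combine[OF _ _ 1 2]]) (simp_all add: diff_divide_distrib add_divide_distrib)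
    also have "exp c + exp (- c) = 2 * of_real (cos v)"
      by (simp add: c_def complex_eq_iff Re_exp Im_exp)
    also have "(2 * of_real (cos v) - 2) / c\<^sup>2 = of_real (fejer v)"
      using False by (simp add: csq fejer_def field_simps)
    finally show ?thesis using eqs by simp
  qed
qed

lemma real_distribution_density:
  assumes [measurable]: "f \<in> borel_measurable borel" and nonneg: "\<And>x. f x \<ge> (0::real)"
    and int: "integrable lborel f" and one: "(\<integral>x. f x \<partial>lborel) = 1"
  shows "real_distribution (density lborel f)"
proof (intro real_distribution.intro real_distribution_axioms.intro)
  show "prob_space (density lborel f)"
  proof
    have "emeasure (density lborel f) (space (density lborel f)) = (\<integral>\<^sup>+x. ennreal (f x) \<partial>lborel)"
      by (simp add: emeasure_density)
    also have "\<dots> = ennreal (\<integral>x. f x \<partial>lborel)"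
      by (rule nn_integral_eq_integral[OF int]) (simp add: nonneg)
    finally show "emeasure (density lborel f) (space (density lborel f)) = 1" by (simp add: one)
  qed
qed auto

lemma char_density:
  assumes [measurable]: "f \<in> borel_measurable borel" and nonneg: "\<And>x. f x \<ge> (0::real)"
  shows "char (density lborel f) t = (\<integral>x. of_real (f x) * iexp (t * x) \<partial>lborel)"
  unfolding char_def by (subst integral_density) (auto simp: nonneg scaleR_conv_of_real)

lemma integrable_tri': "integrable lborel tri"
proof -
  have "integrable lborel (\<lambda>t. norm (of_real (tri t) * iexp (0 * t)))"
    by (rule integrable_norm) (rule integrable_tri)
  then show ?thesis by simp
qed

lemma real_distribution_tri: "real_distribution (density lborel tri)"
proof (rule real_distribution_density)
  have "complex_of_real (\<integral>t. tri t \<partial>lborel) = (\<integral>t. of_real (tri t) * iexp (0 * t) \<partial>lborel)"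
    by simp
  also have "\<dots> = 1" by (subst fejer_eq_integral) simp
  finally show "(\<integral>t. tri t \<partial>lborel) = 1" using of_real_eq_1_iff by blast
qed (auto simp: integrable_tri')

lemma char_tri: "char (density lborel tri) v = of_real (fejer v)"
  using fejer_eq_integral[of v] by (simp add: char_density)

lemma isCont_fejer: "isCont fejer v"
proof -
  have "isCont (\<lambda>v. Re (char (density lborel tri) v)) v"
    by (intro isCont_Re real_distribution.isCont_char real_distribution_tri)
  then show ?thesis by (simp add: char_tri)
qed

lemma fejer_le_1: "fejer v \<le> 1"
proof -
  have "norm (char (density lborel tri) v) \<le> 1"
    by (rule real_distribution.cmod_char_le_1[OF real_distribution_tri])
  then show ?thesis by (simp add: char_tri)
qed

lemma integrable_fejer: "integrable lborel fejer"
proof (rule Bochner_Integration.integrable_bound)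
  show "integrable lborel (\<lambda>s::real. 5 / (1 + s\<^sup>2))"
    using integrable_mult_right[OF integrable_inverse_1_plus_square[unfolded interval_lebesgue_integrable_def set_integrable_def], of 5]
    by (simp add: field_simps)
  show "AE v in lborel. norm (fejer v) \<le> norm (5 / (1 + v\<^sup>2))"
  proof (rule AE_I2)
    fix v :: real
    have pos: "1 + v\<^sup>2 > 0" by (simp add: add_pos_nonneg)
    have "fejer v * v\<^sup>2 \<le> 4"
    proof (cases "v = 0")
      case False
      have "2 * (1 - cos v) \<le> 4" using cos_ge_minus_one[of v] by argo
      then show ?thesis using False by (simp add: fejer_def)
    qed simp
    then have "fejer v * (1 + v\<^sup>2) \<le> 5" using fejer_le_1[of v] by (simp add: distrib_left)
    then have "fejer v \<le> 5 / (1 + v\<^sup>2)" using pos by (simp add: pos_le_divide_eq)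
    then show "norm (fejer v) \<le> norm (5 / (1 + v\<^sup>2))" using pos by simp
  qed
qed simp

text \<open>The set where the functions differ is open and Lebesgue null, hence empty.\<close>

lemma continuous_AE_eq:
  fixes f g :: "real \<Rightarrow> real"
  assumes f: "\<And>x. isCont f x" and g: "\<And>x. isCont g x" and ae: "AE x in lborel. f x = g x"
  shows "f = g"
proof -
  have op: "open {x. f x \<noteq> g x}"
    using f g by (intro open_Collect_neq) (auto intro: continuous_at_imp_continuous_on)
  then have "{x. f x \<noteq> g x} \<in> null_sets lborel"
    using ae by (subst AE_iff_null_sets) auto
  then have "negligible {x. f x \<noteq> g x}"
    by (simp add: negligible_iff_null_sets null_sets_completionI)
  then have "{x. f x \<noteq> g x} = {}" using op open_not_negligible by blast
  then show ?thesis by auto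
qed

text \<open>The transform pair is read backwards: \<open>fejer\<close> is integrable, so inversion
  applies to the density \<open>tri\<close> and gives equality almost everywhere, which continuity
  makes pointwise.\<close>

lemma tri_eq_inv_fourier: "tri y = inv_fourier (\<lambda>t. of_real (fejer t)) y"
proof -
  have ch: "char (density lborel tri) = (\<lambda>t. of_real (fejer t))" by (auto simp: char_tri)
  have int: "integrable lborel (\<lambda>t. complex_of_real (fejer t))" using integrable_fejer by simp
  have "AE y in lborel. tri y = inv_fourier (\<lambda>t. of_real (fejer t)) y"
    using char_inversion_density[of tri] real_distribution.axioms(1)[OF real_distribution_tri] int
    by (simp add: ch)
  then have "tri = inv_fourier (\<lambda>t. of_real (fejer t))"
    by (intro continuous_AE_eq isCont_inv_fourier int) (auto simp: tri_def[abs_def] intro!: continuous_intros)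
  then show ?thesis by simp
qed

text \<open>The law whose characteristic function is \<open>tri\<close>. It is the weak limit of the
  localized laws in \<open>local_limit_nonlattice\<close>.\<close>

definition fejer_dist :: "real measure" where "fejer_dist = density lborel (\<lambda>v. fejer v / (2 * pi))"

text \<open>Inversion identifies only the real part, since \<open>inv_fourier\<close> takes
  \<open>Re\<close>; the imaginary part vanishes because \<open>fejer\<close> is even.\<close>

lemma fejer_integral: "(\<integral>v. of_real (fejer v) * iexp (\<tau> * v) \<partial>lborel) = of_real (2 * pi * tri \<tau>)"
proof -
  define J where "J \<tau> = (\<integral>v. of_real (fejer v) * iexp (\<tau> * v) \<partial>lborel)" for \<tau>
  have J_minus: "J (- \<tau>) = J \<tau>" for \<tau>
    unfolding J_def by (subst lborel_integral_real_affine[where c = "-1" and t = 0]) auto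
  have J_cnj: "cnj (J \<tau>) = J (- \<tau>)" for \<tau>
    unfolding J_def by (subst Bochner_Integration.integral_cnj[symmetric]) (simp add: exp_cnj)
  have "Im (J \<tau>) = 0" using J_minus[of \<tau>] J_cnj[of \<tau>] by (simp add: complex_eq_iff)
  moreover have "Re (J (- \<tau>)) = 2 * pi * tri \<tau>"
    unfolding tri_eq_inv_fourier inv_fourier_def J_def by (simp add: mult.commute)
  ultimately have "J \<tau> = of_real (2 * pi * tri \<tau>)" using J_minus[of \<tau>] by (simp add: complex_eq_iff)
  then show ?thesis by (simp add: J_def)
qed

lemma real_distribution_fejer: "real_distribution fejer_dist"
  unfolding fejer_dist_def
proof (rule real_distribution_density)
  have "complex_of_real (\<integral>v. fejer v \<partial>lborel) = of_real (2 * pi)"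
    using fejer_integral[of 0] by simp
  then have "(\<integral>v. fejer v \<partial>lborel) = 2 * pi" using of_real_eq_iff by blast
  then show "(\<integral>v. fejer v / (2 * pi) \<partial>lborel) = 1" by simp
qed (auto intro: integrable_fejer)

lemma char_fejer: "char fejer_dist \<tau> = of_real (tri \<tau>)"
  unfolding fejer_dist_def
proof (subst char_density)
  have "(\<integral>x. of_real (fejer x / (2 * pi)) * iexp (\<tau> * x) \<partial>lborel) = (\<integral>x. of_real (1 / (2 * pi)) * (of_real (fejer x) * iexp (\<tau> * x)) \<partial>lborel)"
    by (intro Bochner_Integration.integral_cong refl) simp
  also have "\<dots> = of_real (1 / (2 * pi)) * of_real (2 * pi * tri \<tau>)"
    by (subst integral_mult_right_zero) (simp only: fejer_integral)
  finally show "(\<integral>x. of_real (fejer x / (2 * pi)) * iexp (\<tau> * x) \<partial>lborel) = of_real (tri \<tau>)"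
    by simp
qed auto

lemma fejer_lower:
  obtains c where "c > 0" "\<And>v. \<bar>v\<bar> \<le> 1 \<Longrightarrow> fejer v \<ge> c"
proof -
  have "\<exists>u\<in>{-1..1}. \<forall>v\<in>{-1..1}. fejer u \<le> fejer v"
    by (intro continuous_attains_inf) (auto intro!: continuous_at_imp_continuous_on isCont_fejer)
  then obtain u where u: "u \<in> {-1..1}" "\<And>v. v \<in> {-1..1} \<Longrightarrow> fejer u \<le> fejer v" by blast
  have "fejer u > 0"
  proof (cases "u = 0")
    case False
    have "cos \<bar>u\<bar> < cos 0" using u False pi_gt3 by (intro cos_monotone_0_pi) auto
    then have "cos u < 1" by (simp add: abs_if split: if_splits)
    then show ?thesis using False by (simp add: fejer_def)
  qed simp
  then show ?thesis using u(2) by (intro that[of "fejer u"]) (auto simp: abs_le_iff)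
qed

text \<open>Replacing \<open>fejer\<close> by its Fourier integral and exchanging integrals brings
  in \<open>char M\<close> only at frequencies s / b of modulus at most (1 + |\<sigma>|) / h.
  Nothing is known about its decay, so this compact support matters. The modulation by \<sigma>
  yields the whole transform of the weighted law and not just its mass.\<close>

lemma (in real_distribution) fejer_smoothing:
  assumes h: "h > 0" and b: "b > 0"
  shows "of_real b * (\<integral>v. iexp (\<sigma> * ((v - x) / h)) * of_real (fejer ((v - x) / h)) \<partial>M)
    = of_real h * (\<integral>s. of_real (tri (h * s / b - \<sigma>)) * (iexp (- (s * (x / b))) * char M (s / b)) \<partial>lborel)"
proof -
  interpret P: pair_sigma_finite M lborel ..
  have "(\<integral>v. iexp (\<sigma> * ((v - x) / h)) * of_real (fejer ((v - x) / h)) \<partial>M)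
      = (\<integral>v. (\<integral>t. of_real (tri t) * iexp ((\<sigma> + t) * ((v - x) / h)) \<partial>lborel) \<partial>M)"
  proof (rule Bochner_Integration.integral_cong[OF refl])
    fix v
    have "iexp (\<sigma> * ((v - x) / h)) * of_real (fejer ((v - x) / h))
        = (\<integral>t. iexp (\<sigma> * ((v - x) / h)) * (of_real (tri t) * iexp ((v - x) / h * t)) \<partial>lborel)"
      by (subst integral_mult_right_zero) (simp only: fejer_eq_integral)
    also have "\<dots> = (\<integral>t. of_real (tri t) * iexp ((\<sigma> + t) * ((v - x) / h)) \<partial>lborel)"
      by (intro Bochner_Integration.integral_cong refl) (simp add: ring_distribs add_divide_distrib exp_add[symmetric] mult_ac add_ac)
    finally show "iexp (\<sigma> * ((v - x) / h)) * of_real (fejer ((v - x) / h)) = (\<integral>t. of_real (tri t) * iexp ((\<sigma> + t) * ((v - x) / h)) \<partial>lborel)" .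
  qed
  also have "\<dots> = (\<integral>t. (\<integral>v. of_real (tri t) * iexp ((\<sigma> + t) * ((v - x) / h)) \<partial>M) \<partial>lborel)"
  proof (rule P.Fubini_integral[symmetric])
    show "integrable (M \<Otimes>\<^sub>M lborel) (\<lambda>(v, t). of_real (tri t) * iexp ((\<sigma> + t) * ((v - x) / h)))"
    proof (rule P.Fubini_integrable)
      show "integrable M (\<lambda>v. \<integral>t. norm (case (v, t) of (v, t) \<Rightarrow> of_real (tri t) * iexp ((\<sigma> + t) * ((v - x) / h))) \<partial>lborel)"
        by (simp add: norm_mult)
      show "AE v in M. integrable lborel (\<lambda>t. case (v, t) of (v, t) \<Rightarrow> of_real (tri t) * iexp ((\<sigma> + t) * ((v - x) / h)))"
      proof (rule AE_I2)
        fix v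
        show "integrable lborel (\<lambda>t. case (v, t) of (v, t) \<Rightarrow> of_real (tri t) * iexp ((\<sigma> + t) * ((v - x) / h)))"
          by (rule Bochner_Integration.integrable_bound[OF integrable_tri']) (auto simp: norm_mult)
      qed
    qed (simp add: split_beta', measurable)
  qed
  also have "\<dots> = (\<integral>t. of_real (tri t) * (iexp (- ((\<sigma> + t) * (x / h))) * char M ((\<sigma> + t) / h)) \<partial>lborel)"
  proof (rule Bochner_Integration.integral_cong[OF refl])
    fix t :: real
    have "(\<integral>v. of_real (tri t) * iexp ((\<sigma> + t) * ((v - x) / h)) \<partial>M)
        = (\<integral>v. (of_real (tri t) * iexp (- ((\<sigma> + t) * (x / h)))) * iexp ((\<sigma> + t) / h * v) \<partial>M)"
      by (intro Bochner_Integration.integral_cong refl)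
         (simp add: exp_add[symmetric] diff_divide_distrib right_diff_distrib mult_ac)
    also have "\<dots> = (of_real (tri t) * iexp (- ((\<sigma> + t) * (x / h)))) * char M ((\<sigma> + t) / h)"
      unfolding char_def by (rule integral_mult_right_zero)
    finally show "(\<integral>v. of_real (tri t) * iexp ((\<sigma> + t) * ((v - x) / h)) \<partial>M)
      = of_real (tri t) * (iexp (- ((\<sigma> + t) * (x / h))) * char M ((\<sigma> + t) / h))" by simp
  qed
  also have "\<dots> = \<bar>h / b\<bar> *\<^sub>R (\<integral>s. of_real (tri (- \<sigma> + h / b * s)) * (iexp (- ((\<sigma> + (- \<sigma> + h / b * s)) * (x / h))) * char M ((\<sigma> + (- \<sigma> + h / b * s)) / h)) \<partial>lborel)"
    using h b by (intro lborel_integral_real_affine) auto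
  also have "\<dots> = of_real (h / b) * (\<integral>s. of_real (tri (h * s / b - \<sigma>)) * (iexp (- (s * (x / b))) * char M (s / b)) \<partial>lborel)"
    using h b by (simp add: scaleR_conv_of_real mult_ac)
  finally show ?thesis using b by simp
qed

lemma (in real_distribution) integrable_fejer_M: "integrable M (\<lambda>v. fejer ((v - x) / h))"
  by (rule integrable_const_bound[where B = 1]) (auto simp: fejer_le_1)

text \<open>Esseen's concentration inequality: \<open>fejer\<close> is bounded below on [-1, 1],
  hence its rescaling dominates a multiple of the indicator of the interval, and its transform lives
  on |s| \<le> 1 / h.\<close>

lemma concentration_bound:
  obtains c where "c > 0" "\<And>M h x. real_distribution M \<Longrightarrow> h > 0 \<Longrightarrow>
     measure M {x-h..x+h} \<le> c * h * (\<integral>s. indicator {-(1/h)..1/h} s * norm (char M s) \<partial>lborel)"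
proof -
  obtain c where c: "c > 0" "\<And>v. \<bar>v\<bar> \<le> 1 \<Longrightarrow> fejer v \<ge> c" using fejer_lower by blast
  show ?thesis
  proof (rule that[of "1 / c"])
    show "1 / c > 0" using c by simp
    fix M :: "real measure" and h x :: real
    assume "real_distribution M" and h: "h > 0"
    then interpret real_distribution M by simp
    have "c * measure M {x-h..x+h} = (\<integral>v. c * indicator {x-h..x+h} v \<partial>M)" by simp
    also have "\<dots> \<le> (\<integral>v. fejer ((v - x) / h) \<partial>M)"
    proof (rule integral_mono[OF _ integrable_fejer_M])
      show "integrable M (\<lambda>v. c * indicator {x-h..x+h} v)"
        by (intro integrable_mult_right integrable_real_indicator) (auto simp: emeasure_eq_measure)
      fix v
      show "c * indicator {x-h..x+h} v \<le> fejer ((v - x) / h)"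
        using c(2)[of "(v - x) / h"] h by (auto simp: indicator_def field_simps abs_le_iff)
    qed
    also have "\<dots> = norm (complex_of_real (\<integral>v. fejer ((v - x) / h) \<partial>M))"
      by (simp add: integral_nonneg)
    also have "complex_of_real (\<integral>v. fejer ((v - x) / h) \<partial>M) = of_real 1 * (\<integral>v. iexp (0 * ((v - x) / h)) * of_real (fejer ((v - x) / h)) \<partial>M)"
      by simp
    also have "\<dots> = of_real h * (\<integral>s. of_real (tri (h * s / 1 - 0)) * (iexp (- (s * (x / 1))) * char M (s / 1)) \<partial>lborel)"
      using h by (intro fejer_smoothing) auto
    also have "norm \<dots> \<le> h * (\<integral>s. indicator {-(1/h)..1/h} s * norm (char M s) \<partial>lborel)"
    proof -
      have "norm (\<integral>s. of_real (tri (h * s / 1 - 0)) * (iexp (- (s * (x / 1))) * char M (s / 1)) \<partial>lborel)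
          \<le> (\<integral>s. indicator {-(1/h)..1/h} s * norm (char M s) \<partial>lborel)"
      proof (rule Bochner_Integration.integral_norm_bound_integral)
        have i0: "integrable lborel (indicator {-(1/h)..1/h} :: real \<Rightarrow> real)" by (auto simp: emeasure_lborel_Icc_eq)
        show int: "integrable lborel (\<lambda>s. indicator {-(1/h)..1/h} s * norm (char M s))"
          by (rule Bochner_Integration.integrable_bound[OF i0]) (auto simp: indicator_def cmod_char_le_1)
        have le: "norm (of_real (tri (h * s / 1 - 0)) * (iexp (- (s * (x / 1))) * char M (s / 1))) \<le> indicator {-(1/h)..1/h} s * norm (char M s)" for s
        proof (cases "s \<in> {-(1/h)..1/h}")
          case True
          then show ?thesis using tri_le_1[of "h * s"] by (simp add: norm_mult mult_left_le_one_le)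
        next
          case False
          then have "\<bar>s\<bar> > 1 / h" by auto
          then have "\<bar>h * s\<bar> \<ge> 1" using h by (simp add: abs_mult field_simps)
          then show ?thesis using False by (simp add: tri_eq_0)
        qed
        show "norm (of_real (tri (h * s / 1 - 0)) * (iexp (- (s * (x / 1))) * char M (s / 1))) \<le> indicator {-(1/h)..1/h} s * norm (char M s)" for s
          by (rule le)
        show "integrable lborel (\<lambda>s. of_real (tri (h * s / 1 - 0)) * (iexp (- (s * (x / 1))) * char M (s / 1)))"
          by (rule Bochner_Integration.integrable_bound[OF int]) (use le in auto)
      qed
      then show ?thesis using h by (simp add: norm_mult mult_left_mono)
    qed
    finally show "measure M {x-h..x+h} \<le> 1 / c * h * (\<integral>s. indicator {-(1/h)..1/h} s * norm (char M s) \<partial>lborel)"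
      using c by (simp add: field_simps)
  qed
qed

section \<open>Local limit theorems\<close>

text \<open>\<open>dom\<close> reaches only the frequencies |\<theta>| \<le> \<epsilon>. Further out
  the behaviour depends on the arithmetic of the laws, so each of the two limit theorems adds its
  own hypothesis there.\<close>

locale local_limit_setup =
  fixes M :: "nat \<Rightarrow> real measure" and b x :: "nat \<Rightarrow> real" and h \<epsilon> C y :: real and \<psi> :: "real \<Rightarrow> complex"
  assumes rd: "\<And>n. real_distribution (M n)"
    and b_pos: "\<And>n. b n > 0" and b_top: "filterlim b at_top sequentially"
    and x_lim: "(\<lambda>n. x n / b n) \<longlonglongrightarrow> y" and h_pos: "h > 0"
    and char_lim: "\<And>s. (\<lambda>n. char (M n) (s / b n)) \<longlonglongrightarrow> \<psi> s"
    and eps_pos: "\<epsilon> > 0"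
    and dom: "\<And>n s. \<bar>s\<bar> \<le> \<epsilon> * b n \<Longrightarrow> norm (char (M n) (s / b n)) \<le> C / (1 + s\<^sup>2)"
begin

sublocale Mn: real_distribution "M n" for n by (rule rd)

definition I :: complex where "I = (\<integral>s. iexp (- (s * y)) * \<psi> s \<partial>lborel)"

lemma fourier_limit:
  fixes d :: "nat \<Rightarrow> real"
  assumes "\<And>n. w n \<in> borel_measurable borel"
    and K: "K > 0" and q: "q \<longlonglongrightarrow> y" and away: "\<And>n \<theta>. \<epsilon> < \<bar>\<theta>\<bar> \<Longrightarrow> \<bar>\<theta>\<bar> \<le> K \<Longrightarrow> b n * norm (char (M n) \<theta>) \<le> d n" and d: "d \<longlonglongrightarrow> 0"
    and w: "\<And>n s. \<bar>w n s\<bar> \<le> 1" "\<And>n s. \<bar>s\<bar> > K * b n \<Longrightarrow> w n s = 0" "\<And>s. (\<lambda>n. w n s) \<longlonglongrightarrow> c"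
  shows "(\<lambda>n. \<integral>s. of_real (w n s) * (iexp (- (s * q n)) * char (M n) (s / b n)) \<partial>lborel) \<longlonglongrightarrow> of_real c * I"
  unfolding I_def
proof (rule tendsto_fourier_integral(2)[where \<phi> = "\<lambda>n s. char (M n) (s / b n)" and \<epsilon> = \<epsilon> and K = K and b = b and d = d and C = C])
  fix n s assume *: "\<epsilon> * b n < \<bar>s\<bar>" "\<bar>s\<bar> \<le> K * b n"
  then have "\<epsilon> < \<bar>s / b n\<bar>" "\<bar>s / b n\<bar> \<le> K" using b_pos[of n] by (auto simp: field_simps)
  then show "b n * norm (char (M n) (s / b n)) \<le> d n" by (rule away)
next
  show "(\<lambda>s. char (M n) (s / b n)) \<in> borel_measurable borel" for n by measurable
qed (use assms b_pos b_top char_lim eps_pos dom in auto)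

lemma eventually_less_b: "eventually (\<lambda>n. r < b n) sequentially"
  using b_top by (auto simp: filterlim_at_top_dense)

text \<open>The indicator of an interval has no compactly supported transform, so it cannot be
  inserted directly. Instead each law is localized at x n with weight \<open>fejer\<close>. The
  transforms J n \<sigma> converge to a multiple of \<open>tri \<sigma>\<close>, so by Levy
  continuity the normalized localized laws tend weakly to \<open>fejer_dist\<close>; a test function
  then removes the weight.\<close>

theorem local_limit_nonlattice:
  assumes away: "\<And>K. \<exists>d. d \<longlonglongrightarrow> 0 \<and> (\<forall>n \<theta>. \<epsilon> < \<bar>\<theta>\<bar> \<longrightarrow> \<bar>\<theta>\<bar> \<le> K \<longrightarrow> b n * norm (char (M n) \<theta>) \<le> (d n :: real))"
  shows "(\<lambda>n. b n * measure (M n) {x n<..x n + h}) \<longlonglongrightarrow> h * inv_fourier \<psi> y"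
proof -
  define J where "J n \<sigma> = of_real (b n) * (\<integral>v. iexp (\<sigma> * ((v - x n) / h)) * of_real (fejer ((v - x n) / h)) \<partial>M n)" for n \<sigma>
  have J_lim: "(\<lambda>n. J n \<sigma>) \<longlonglongrightarrow> of_real h * (of_real (tri \<sigma>) * I)" for \<sigma>
  proof -
    define K where "K = (1 + \<bar>\<sigma>\<bar>) / h"
    obtain d where d: "d \<longlonglongrightarrow> 0" "\<And>n \<theta>. \<epsilon> < \<bar>\<theta>\<bar> \<Longrightarrow> \<bar>\<theta>\<bar> \<le> K \<Longrightarrow> b n * norm (char (M n) \<theta>) \<le> d n"
      using away[of K] by blast
    have "J n \<sigma> = of_real h * (\<integral>s. of_real (tri (h * s / b n - \<sigma>)) * (iexp (- (s * (x n / b n))) * char (M n) (s / b n)) \<partial>lborel)" for n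
      unfolding J_def by (rule Mn.fejer_smoothing[OF h_pos b_pos])
    moreover have "(\<lambda>n. \<integral>s. of_real (tri (h * s / b n - \<sigma>)) * (iexp (- (s * (x n / b n))) * char (M n) (s / b n)) \<partial>lborel) \<longlonglongrightarrow> of_real (tri \<sigma>) * I"
    proof (rule fourier_limit[OF _ _ x_lim d(2) d(1)])
      show "K > 0" using h_pos by (simp add: K_def add_pos_nonneg)
      show "\<bar>tri (h * s / b n - \<sigma>)\<bar> \<le> 1" for n s using tri_le_1 by simp
      show "tri (h * s / b n - \<sigma>) = 0" if "\<bar>s\<bar> > K * b n" for n s
      proof (rule tri_eq_0)
        have "h * \<bar>s\<bar> / b n > 1 + \<bar>\<sigma>\<bar>" using that h_pos b_pos[of n] by (simp add: K_def field_simps)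
        moreover have "\<bar>h * s / b n\<bar> = h * \<bar>s\<bar> / b n" using h_pos b_pos[of n] by (simp add: abs_mult)
        ultimately show "\<bar>h * s / b n - \<sigma>\<bar> \<ge> 1" by linarith
      qed
      show "(\<lambda>n. tri (h * s / b n - \<sigma>)) \<longlonglongrightarrow> tri \<sigma>" for s
      proof -
        have "(\<lambda>n. h * s / b n - \<sigma>) \<longlonglongrightarrow> 0 - \<sigma>"
          by (intro tendsto_diff tendsto_const tendsto_divide_0[OF tendsto_const] filterlim_at_top_imp_at_infinity b_top)
        moreover have "isCont tri (- \<sigma>)" unfolding tri_def[abs_def] by (intro continuous_intros)
        ultimately show ?thesis using isCont_tendsto_compose[of "-\<sigma>" tri] by simp
      qed
    qed auto
    ultimately show ?thesis by (auto intro!: tendsto_intros)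
  qed
  define m where "m n = (\<integral>v. fejer ((v - x n) / h) \<partial>M n)" for n
  have m_nonneg: "m n \<ge> 0" for n unfolding m_def by (rule Bochner_Integration.integral_nonneg) simp
  have J0: "J n 0 = of_real (b n * m n)" for n unfolding J_def m_def by simp
  have I_lim: "(\<lambda>n. complex_of_real (b n * m n)) \<longlonglongrightarrow> of_real h * I" using J_lim[of 0] by (simp add: J0)
  \<comment> \<open>At \<sigma> = 0 the smoothed quantities are real, hence so is their limit. This
    makes I equal to 2 * pi * f although \<open>inv_fourier\<close> keeps only a real part.\<close>
  have "(\<lambda>n. Im (complex_of_real (b n * m n))) \<longlonglongrightarrow> Im (of_real h * I)" by (rule tendsto_Im[OF I_lim])
  then have "Im I = 0" using h_pos by (simp add: LIMSEQ_const_iff)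
  define f where "f = inv_fourier \<psi> y"
  have "Re I = 2 * pi * f" by (simp add: f_def inv_fourier_def I_def)
  with \<open>Im I = 0\<close> have I_f: "I = of_real (2 * pi * f)" by (simp add: complex_eq_iff)
  have m_lim: "(\<lambda>n. b n * m n) \<longlonglongrightarrow> h * (2 * pi * f)"
    using tendsto_Re[OF I_lim] by (simp add: I_f)
  have f_nonneg: "f \<ge> 0"
  proof -
    have "0 \<le> h * (2 * pi * f)" by (rule tendsto_lowerbound[OF m_lim]) (auto intro!: always_eventually mult_nonneg_nonneg m_nonneg less_imp_le[OF b_pos])
    then show ?thesis using h_pos pi_gt_zero by (simp add: zero_le_mult_iff)
  qed
  obtain c where c: "c > 0" "\<And>v. \<bar>v\<bar> \<le> 1 \<Longrightarrow> fejer v \<ge> c" using fejer_lower by blast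
  show ?thesis
  proof (cases "f = 0")
    \<comment> \<open>Normalizing by the total weight breaks down when the limit density is 0. The
      lower bound of \<open>fejer\<close> on [-1, 1] then bounds the interval mass by the smoothed
      mass, which tends to 0.\<close>
    case True
    have le: "b n * measure (M n) {x n<..x n + h} \<le> 1 / c * (b n * m n)" for n
    proof -
      have "c * measure (M n) {x n<..x n + h} = (\<integral>v. c * indicator {x n<..x n + h} v \<partial>M n)" by simp
      also have "\<dots> \<le> m n" unfolding m_def
      proof (rule integral_mono[OF _ Mn.integrable_fejer_M])
        show "integrable (M n) (\<lambda>v. c * indicator {x n<..x n + h} v)"
          by (intro integrable_mult_right integrable_real_indicator) (auto simp: Mn.emeasure_eq_measure)
        show "c * indicator {x n<..x n + h} v \<le> fejer ((v - x n) / h)" for v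
          using c(2)[of "(v - x n) / h"] h_pos by (auto simp: indicator_def field_simps abs_le_iff)
      qed
      finally have "c * (b n * measure (M n) {x n<..x n + h}) \<le> b n * m n"
        using b_pos[of n] by (simp add: mult.left_commute)
      then show ?thesis using c by (simp add: field_simps)
    qed
    have "(\<lambda>n. 1 / c * (b n * m n)) \<longlonglongrightarrow> 1 / c * (h * (2 * pi * f))" by (intro tendsto_intros m_lim)
    then have z: "(\<lambda>n. 1 / c * (b n * m n)) \<longlonglongrightarrow> 0" using True by simp
    have "(\<lambda>n. b n * measure (M n) {x n<..x n + h}) \<longlonglongrightarrow> 0"
      by (rule Lim_null_comparison[OF _ z]) (use le b_pos in \<open>auto intro!: always_eventually simp: abs_mult less_imp_le\<close>)
    then show ?thesis using True by (simp add: f_def)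
  next
    case False
    then have f_pos: "f > 0" using f_nonneg by simp
    have "eventually (\<lambda>n. b n * m n > 0) sequentially"
      by (rule order_tendstoD(1)[OF m_lim]) (use f_pos h_pos in simp)
    then have m_ev: "eventually (\<lambda>n. m n > 0) sequentially"
      by eventually_elim (use b_pos in \<open>simp add: zero_less_mult_iff not_less less_imp_le\<close>, metis b_pos less_asym)
    \<comment> \<open>The alternative only keeps \<open>Q n\<close> a probability law for the
      finitely many n with total weight 0.\<close>
    define Q where "Q n = (if m n > 0 then distr (density (M n) (\<lambda>v. ennreal (fejer ((v - x n) / h) / m n))) borel (\<lambda>v. (v - x n) / h) else fejer_dist)" for n
    have Q_rd: "real_distribution (Q n)" for n
    proof (cases "m n > 0")
      case True
      have "prob_space (density (M n) (\<lambda>v. ennreal (fejer ((v - x n) / h) / m n)))"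
      proof
        have "emeasure (density (M n) (\<lambda>v. ennreal (fejer ((v - x n) / h) / m n))) (space (density (M n) (\<lambda>v. ennreal (fejer ((v - x n) / h) / m n))))
          = (\<integral>\<^sup>+v. ennreal (fejer ((v - x n) / h) / m n) \<partial>M n)"
          by (simp add: emeasure_density cong: nn_integral_cong)
        also have "\<dots> = ennreal (\<integral>v. fejer ((v - x n) / h) / m n \<partial>M n)"
          using True Mn.integrable_fejer_M by (intro nn_integral_eq_integral) auto
        also have "\<dots> = 1" using True by (simp add: m_def)
        finally show "emeasure (density (M n) (\<lambda>v. ennreal (fejer ((v - x n) / h) / m n))) (space (density (M n) (\<lambda>v. ennreal (fejer ((v - x n) / h) / m n)))) = 1" .
      qed
      then have "prob_space (distr (density (M n) (\<lambda>v. ennreal (fejer ((v - x n) / h) / m n))) borel (\<lambda>v. (v - x n) / h))"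
        by (rule prob_space.prob_space_distr) simp
      then show ?thesis using True
        by (auto simp: Q_def intro!: real_distribution.intro real_distribution_axioms.intro)
    qed (simp add: Q_def real_distribution_fejer)
    have Q_int: "(\<integral>v. g v \<partial>Q n) = (\<integral>v. (fejer ((v - x n) / h) / m n) *\<^sub>R g ((v - x n) / h) \<partial>M n)"
      if "m n > 0" and [measurable]: "g \<in> borel_measurable borel" for n and g :: "real \<Rightarrow> 'z :: {banach, second_countable_topology}"
      using that(1) unfolding Q_def
      by (simp add: integral_distr integral_density)
    have Q_char: "char (Q n) \<sigma> = J n \<sigma> / of_real (b n * m n)" if "m n > 0" for n \<sigma>
    proof -
      have "char (Q n) \<sigma> = (\<integral>v. (fejer ((v - x n) / h) / m n) *\<^sub>R iexp (\<sigma> * ((v - x n) / h)) \<partial>M n)"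
        unfolding char_def by (rule Q_int[OF that]) measurable
      also have "\<dots> = (\<integral>v. (1 / of_real (m n)) * (iexp (\<sigma> * ((v - x n) / h)) * of_real (fejer ((v - x n) / h))) \<partial>M n)"
        by (intro Bochner_Integration.integral_cong refl) (simp add: scaleR_conv_of_real)
      also have "\<dots> = (1 / of_real (m n)) * (\<integral>v. iexp (\<sigma> * ((v - x n) / h)) * of_real (fejer ((v - x n) / h)) \<partial>M n)"
        by (rule integral_mult_right_zero)
      also have "\<dots> = J n \<sigma> / of_real (b n * m n)"
        unfolding J_def using b_pos[of n] by simp
      finally show ?thesis .
    qed
    have "(\<lambda>n. char (Q n) \<sigma>) \<longlonglongrightarrow> char fejer_dist \<sigma>" for \<sigma>
    proof -
      have "(\<lambda>n. J n \<sigma> / of_real (b n * m n)) \<longlonglongrightarrow> of_real h * (of_real (tri \<sigma>) * I) / (of_real h * I)"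
        by (intro tendsto_divide J_lim I_lim) (use f_pos h_pos in \<open>simp add: I_f\<close>)
      also have "of_real h * (of_real (tri \<sigma>) * I) / (of_real h * I) = char fejer_dist \<sigma>"
        using f_pos h_pos by (simp add: char_fejer I_f)
      finally show ?thesis
        by (rule Lim_transform_eventually) (use m_ev in \<open>eventually_elim, simp add: Q_char\<close>)
    qed
    then have weak: "weak_conv_m Q fejer_dist"
      by (intro levy_continuity Q_rd real_distribution_fejer)
    \<comment> \<open>Dividing by \<open>fejer\<close> cancels the weight, so the integral against
      \<open>Q n\<close> is the interval mass over \<open>m n\<close>. It is bounded since
      \<open>fejer\<close> is bounded below on (0, 1], and discontinuous at most at 0 and 1, which
      are null for the limit law.\<close>
    define f0 where "f0 w = indicator {0<..1} w / fejer w" for w :: real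
    have [measurable]: "f0 \<in> borel_measurable borel" unfolding f0_def by measurable
    have f0_lim: "(\<lambda>n. \<integral>v. f0 v \<partial>Q n) \<longlonglongrightarrow> (\<integral>v. f0 v \<partial>fejer_dist)"
    proof (rule weak_conv_imp_bdd_ae_continuous_conv[OF Q_rd real_distribution_fejer weak])
      show "norm (f0 v) \<le> 1 / c" for v
        using c(2)[of v] c(1) by (auto simp: f0_def indicator_def intro!: divide_left_mono)
      have "isCont f0 v" if v: "v \<noteq> 0" "v \<noteq> 1" for v
      proof (cases "0 < v \<and> v < 1")
        case True
        have "isCont (\<lambda>v. 1 / fejer v) v"
          by (intro isCont_divide continuous_const isCont_fejer) (use c(2)[of v] c(1) True in auto)
        moreover have "eventually (\<lambda>w. w \<in> {0<..<1}) (nhds v)"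
          using True by (intro eventually_nhds_in_open) auto
        then have "eventually (\<lambda>w. 1 / fejer w = f0 w) (nhds v)"
          by eventually_elim (simp add: f0_def)
        ultimately show ?thesis using isCont_cong by fast
      next
        case False
        have "eventually (\<lambda>w. w \<in> {..<0} \<union> {1<..}) (nhds v)"
          using False v by (intro eventually_nhds_in_open) auto
        then have "eventually (\<lambda>w. 0 = f0 w) (nhds v)"
          by eventually_elim (auto simp: f0_def)
        then show ?thesis using isCont_cong[of "\<lambda>_. 0" f0 v] by simp
      qed
      then have "{v. \<not> isCont f0 v} \<subseteq> {0, 1}" by auto
      then have "emeasure fejer_dist {v. \<not> isCont f0 v} \<le> emeasure fejer_dist {0, 1}"
        by (rule emeasure_mono) (simp add: fejer_dist_def)
      also have "\<dots> = 0"
      proof -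
        have "AE v in lborel. v \<notin> {0, 1::real}"
          using AE_lborel_singleton[of 0] AE_lborel_singleton[of 1] by eventually_elim auto
        then have "(\<integral>\<^sup>+v. ennreal (fejer v / (2 * pi)) * indicator {0, 1} v \<partial>lborel) = (\<integral>\<^sup>+v. 0 \<partial>(lborel :: real measure))"
        proof (intro nn_integral_cong_AE, eventually_elim)
          case (elim v)
          then show ?case by (simp add: indicator_def)
        qed
        then show ?thesis unfolding fejer_dist_def by (subst emeasure_density) auto
      qed
      finally show "emeasure fejer_dist {v. \<not> isCont f0 v} = 0" by simp
    qed measurable
    have fejer_ne: "fejer u \<noteq> 0" if "u \<in> {0<..1}" for u using c(2)[of u] c(1) that by auto
    have "(\<integral>v. f0 v \<partial>fejer_dist) = (\<integral>v. fejer v / (2 * pi) * f0 v \<partial>lborel)"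
      unfolding fejer_dist_def by (subst integral_density) auto
    also have "\<dots> = (\<integral>v. 1 / (2 * pi) * indicator {0<..(1::real)} v \<partial>lborel)"
    proof (rule Bochner_Integration.integral_cong[OF refl])
      fix v :: real
      have "fejer v \<noteq> 0" if "v \<in> {0<..1}" using c(2)[of v] c(1) that by auto
      then show "fejer v / (2 * pi) * f0 v = 1 / (2 * pi) * indicator {0<..1} v"
        by (cases "v \<in> {0<..1}") (simp_all add: f0_def)
    qed
    also have "\<dots> = 1 / (2 * pi)" by simp
    finally have f0_val: "(\<integral>v. f0 v \<partial>fejer_dist) = 1 / (2 * pi)" .
    have f0_Q: "(\<integral>v. f0 v \<partial>Q n) = measure (M n) {x n<..x n + h} / m n" if "m n > 0" for n
    proof -
      have "(\<integral>v. f0 v \<partial>Q n) = (\<integral>v. (fejer ((v - x n) / h) / m n) *\<^sub>R f0 ((v - x n) / h) \<partial>M n)"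
        by (rule Q_int[OF that]) measurable
      also have "\<dots> = (\<integral>v. 1 / m n * indicator {x n<..x n + h} v \<partial>M n)"
      proof (intro Bochner_Integration.integral_cong refl)
        fix v
        have "(v - x n) / h \<in> {0<..1} \<longleftrightarrow> v \<in> {x n<..x n + h}" using h_pos by (auto simp: field_simps)
        then have ind: "indicator {x n<..x n + h} v = (indicator {0<..1} ((v - x n) / h) :: real)"
          by (simp only: indicator_def)
        show "(fejer ((v - x n) / h) / m n) *\<^sub>R f0 ((v - x n) / h) = 1 / m n * indicator {x n<..x n + h} v"
          unfolding ind using fejer_ne[of "(v - x n) / h"]
          by (cases "(v - x n) / h \<in> {0<..1}") (simp_all add: f0_def)
      qed
      also have "\<dots> = measure (M n) {x n<..x n + h} / m n" by simp
      finally show ?thesis .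
    qed
    have "(\<lambda>n. (b n * m n) * (\<integral>v. f0 v \<partial>Q n)) \<longlonglongrightarrow> (h * (2 * pi * f)) * (1 / (2 * pi))"
      using f0_lim unfolding f0_val by (intro tendsto_mult m_lim)
    also have "(h * (2 * pi * f)) * (1 / (2 * pi)) = h * inv_fourier \<psi> y" by (simp add: f_def)
    finally show ?thesis
      by (rule Lim_transform_eventually) (use m_ev in \<open>eventually_elim, simp add: f0_Q\<close>)
  qed
qed

lemma lattice_orthogonality:
  fixes k :: int
  shows "(\<integral>\<theta>. of_real (indicator {- (pi / h)..pi / h} \<theta>) * iexp (\<theta> * (h * k)) \<partial>lborel) = of_real (if k = 0 then 2 * pi / h else 0)"
proof (cases "k = 0")
  case True
  have "(\<integral>\<theta>. complex_of_real (indicator {- (pi / h)..pi / h} \<theta>) \<partial>lborel) = of_real (\<integral>\<theta>. indicator {- (pi / h)..pi / h} \<theta> \<partial>lborel)"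
    by (rule integral_complex_of_real)
  also have "(\<integral>\<theta>. indicator {- (pi / h)..pi / h} \<theta> \<partial>lborel) = 2 * pi / h" using h_pos by simp
  finally show ?thesis using True by simp
next
  case False
  define c where "c = \<i> * complex_of_real (h * k)"
  have c: "c \<noteq> 0" using False h_pos by (simp add: c_def)
  have si: "set_integrable lborel {- (pi / h)..pi / h} (\<lambda>\<theta>. exp (c * of_real \<theta>))"
  proof -
    have "integrable lborel (indicator {- (pi / h)..pi / h} :: real \<Rightarrow> real)" by (auto simp: emeasure_lborel_Icc_eq)
    then show ?thesis unfolding set_integrable_def
      by (rule Bochner_Integration.integrable_bound) (auto simp: indicator_def c_def)
  qed
  have "((\<lambda>\<theta>. exp (c * of_real \<theta>)) has_integral (exp (c * of_real (pi / h)) / c - exp (c * of_real (- (pi / h))) / c)) {- (pi / h)..pi / h}"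
  proof (rule fundamental_theorem_of_calculus)
    show "- (pi / h) \<le> pi / h" using h_pos pi_ge_zero by simp
    fix \<theta> :: real
    have "((\<lambda>z. exp (c * z) / c) has_field_derivative exp (c * of_real \<theta>)) (at (of_real \<theta>))"
      using c by (auto intro!: derivative_eq_intros)
    from has_vector_derivative_real_field[OF this]
    show "((\<lambda>\<theta>. exp (c * of_real \<theta>) / c) has_vector_derivative exp (c * of_real \<theta>)) (at \<theta> within {- (pi / h)..pi / h})" .
  qed
  moreover have "exp (c * of_real (pi / h)) = exp (c * of_real (- (pi / h)))"
  proof -
    have "sin (of_int k * pi) = 0" by (metis sin_npi_int mult.commute)
    then show ?thesis using h_pos by (simp add: c_def exp_eq_polar complex_eq_iff Re_exp Im_exp)
  qed
  ultimately have "integral {- (pi / h)..pi / h} (\<lambda>\<theta>. exp (c * of_real \<theta>)) = 0"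
    by (auto intro!: integral_unique)
  then have "(LINT \<theta>:{- (pi / h)..pi / h}|lborel. exp (c * of_real \<theta>)) = 0"
    using set_borel_integral_eq_integral(2)[OF si] by simp
  then show ?thesis using False
    unfolding set_lebesgue_integral_def by (simp add: c_def scaleR_conv_of_real mult_ac)
qed

text \<open>A half-open interval of length h contains exactly one lattice point, so its mass is a
  point mass, that is, a Fourier coefficient over one period |\<theta>| \<le> pi / h. The sharp
  indicator of the period plays the part of \<open>tri\<close>, and the exponential is taken at the
  lattice point instead of x n; both have the same rescaled limit y.\<close>

theorem local_limit_lattice:
  assumes conc: "\<And>n. AE v in M n. v \<in> range (\<lambda>k::int. h * of_int k)"
    and away: "d \<longlonglongrightarrow> 0" "\<And>n \<theta>. \<epsilon> < \<bar>\<theta>\<bar> \<Longrightarrow> \<bar>\<theta>\<bar> \<le> pi / h \<Longrightarrow> b n * norm (char (M n) \<theta>) \<le> (d n :: real)"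
  shows "(\<lambda>n. b n * measure (M n) {x n<..x n + h}) \<longlonglongrightarrow> h * inv_fourier \<psi> y"
proof -
  \<comment> \<open>The index of the only multiple of h in (x n, x n + h].\<close>
  define j where "j n = \<lfloor>(x n + h) / h\<rfloor>" for n
  define p where "p n = h * of_int (j n)" for n
  have p_in: "x n < p n" "p n \<le> x n + h" for n
  proof -
    have "of_int (j n) \<le> (x n + h) / h" "(x n + h) / h < of_int (j n) + 1" by (auto simp: j_def)
    then show "x n < p n" "p n \<le> x n + h" using h_pos by (auto simp: p_def field_simps)
  qed
  have p_unique: "k = j n" if "h * of_int k \<in> {x n<..x n + h}" for n and k :: int
  proof -
    have "of_int k \<le> (x n + h) / h" "(x n + h) / h < of_int k + 1" using that h_pos by (auto simp: field_simps)
    then show ?thesis unfolding j_def by (intro floor_unique[symmetric])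
  qed
  have p_lim: "(\<lambda>n. p n / b n) \<longlonglongrightarrow> y"
  proof -
    have "(\<lambda>n. h / b n) \<longlonglongrightarrow> 0"
      by (intro tendsto_divide_0[OF tendsto_const] filterlim_at_top_imp_at_infinity b_top)
    moreover have "eventually (\<lambda>n. norm (p n / b n - x n / b n) \<le> h / b n) sequentially"
    proof (rule always_eventually, rule allI)
      fix n
      have "\<bar>p n - x n\<bar> \<le> h" using p_in[of n] by auto
      then show "norm (p n / b n - x n / b n) \<le> h / b n"
        using b_pos[of n] by (simp add: diff_divide_distrib[symmetric] divide_right_mono)
    qed
    ultimately have "(\<lambda>n. p n / b n - x n / b n) \<longlonglongrightarrow> 0" by (rule Lim_null_comparison[rotated])
    from tendsto_add[OF this x_lim] show ?thesis by simp
  qed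
  have inv: "complex_of_real (b n * measure (M n) {x n<..x n + h})
     = of_real (h / (2 * pi)) * (\<integral>s. of_real (indicator {- (pi / h)..pi / h} (s / b n)) * (iexp (- (s * (p n / b n))) * char (M n) (s / b n)) \<partial>lborel)" for n
  proof -
    interpret P: pair_sigma_finite lborel "M n" ..
    have "(\<integral>\<theta>. of_real (indicator {- (pi / h)..pi / h} \<theta>) * (iexp (- (\<theta> * p n)) * char (M n) \<theta>) \<partial>lborel)
       = (\<integral>\<theta>. (\<integral>v. of_real (indicator {- (pi / h)..pi / h} \<theta>) * iexp (\<theta> * (v - p n)) \<partial>M n) \<partial>lborel)"
    proof (rule Bochner_Integration.integral_cong[OF refl])
      fix \<theta> :: real
      have "of_real (indicator {- (pi / h)..pi / h} \<theta>) * (iexp (- (\<theta> * p n)) * char (M n) \<theta>)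
         = (\<integral>v. (of_real (indicator {- (pi / h)..pi / h} \<theta>) * iexp (- (\<theta> * p n))) * iexp (\<theta> * v) \<partial>M n)"
        unfolding char_def by (subst integral_mult_right_zero) (simp add: mult.assoc)
      also have "\<dots> = (\<integral>v. of_real (indicator {- (pi / h)..pi / h} \<theta>) * iexp (\<theta> * (v - p n)) \<partial>M n)"
        by (intro Bochner_Integration.integral_cong refl) (simp add: exp_add[symmetric] right_diff_distrib)
      finally show "of_real (indicator {- (pi / h)..pi / h} \<theta>) * (iexp (- (\<theta> * p n)) * char (M n) \<theta>)
         = (\<integral>v. of_real (indicator {- (pi / h)..pi / h} \<theta>) * iexp (\<theta> * (v - p n)) \<partial>M n)" .
    qed
    also have "\<dots> = (\<integral>v. (\<integral>\<theta>. of_real (indicator {- (pi / h)..pi / h} \<theta>) * iexp (\<theta> * (v - p n)) \<partial>lborel) \<partial>M n)"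
    proof (rule P.Fubini_integral[symmetric])
      show "integrable (lborel \<Otimes>\<^sub>M M n) (\<lambda>(\<theta>, v). of_real (indicator {- (pi / h)..pi / h} \<theta>) * iexp (\<theta> * (v - p n)))"
      proof (rule P.Fubini_integrable)
        have "(\<integral>v. norm (case (\<theta>, v) of (\<theta>, v) \<Rightarrow> of_real (indicator {- (pi / h)..pi / h} \<theta>) * iexp (\<theta> * (v - p n))) \<partial>M n) = indicator {- (pi / h)..pi / h} \<theta>" for \<theta>
          using Mn.prob_space[of n] by (simp add: norm_mult)
        then show "integrable lborel (\<lambda>\<theta>. \<integral>v. norm (case (\<theta>, v) of (\<theta>, v) \<Rightarrow> of_real (indicator {- (pi / h)..pi / h} \<theta>) * iexp (\<theta> * (v - p n))) \<partial>M n)"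
          by (simp add: emeasure_lborel_Icc_eq)
        show "AE \<theta> in lborel. integrable (M n) (\<lambda>v. case (\<theta>, v) of (\<theta>, v) \<Rightarrow> of_real (indicator {- (pi / h)..pi / h} \<theta>) * iexp (\<theta> * (v - p n)))"
          by (intro AE_I2 Mn.integrable_const_bound[where B = 1]) (auto simp: norm_mult indicator_def)
      qed (simp add: split_beta', measurable)
    qed
    also have "\<dots> = (\<integral>v. of_real (2 * pi / h * indicator {x n<..x n + h} v) \<partial>M n)"
    proof (rule integral_cong_AE)
      show "AE v in M n. (\<integral>\<theta>. of_real (indicator {- (pi / h)..pi / h} \<theta>) * iexp (\<theta> * (v - p n)) \<partial>lborel) = of_real (2 * pi / h * indicator {x n<..x n + h} v)"
        using conc[of n]
      proof eventually_elim
        case (elim v)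
        then obtain k :: int where k: "v = h * of_int k" by auto
        have "v - p n = h * of_int (k - j n)" by (simp add: k p_def right_diff_distrib)
        moreover have "v \<in> {x n<..x n + h} \<longleftrightarrow> k - j n = 0"
          using p_unique[of k n] p_in[of n] by (auto simp: k p_def)
        ultimately show ?case
          using lattice_orthogonality[of "k - j n"] by (simp only:) (simp add: indicator_def)
      qed
    qed measurable
    also have "\<dots> = of_real (2 * pi / h) * of_real (measure (M n) {x n<..x n + h})" by simp
    finally have 1: "(\<integral>\<theta>. of_real (indicator {- (pi / h)..pi / h} \<theta>) * (iexp (- (\<theta> * p n)) * char (M n) \<theta>) \<partial>lborel) = of_real (2 * pi / h) * of_real (measure (M n) {x n<..x n + h})" .
    have "(\<integral>\<theta>. of_real (indicator {- (pi / h)..pi / h} \<theta>) * (iexp (- (\<theta> * p n)) * char (M n) \<theta>) \<partial>lborel)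
       = \<bar>1 / b n\<bar> *\<^sub>R (\<integral>s. of_real (indicator {- (pi / h)..pi / h} (0 + 1 / b n * s)) * (iexp (- ((0 + 1 / b n * s) * p n)) * char (M n) (0 + 1 / b n * s)) \<partial>lborel)"
      using b_pos[of n] by (intro lborel_integral_real_affine) auto
    also have "\<dots> = of_real (1 / b n) * (\<integral>s. of_real (indicator {- (pi / h)..pi / h} (s / b n)) * (iexp (- (s * (p n / b n))) * char (M n) (s / b n)) \<partial>lborel)"
      using b_pos[of n] by (simp add: scaleR_conv_of_real)
    finally have "of_real (1 / b n) * (\<integral>s. of_real (indicator {- (pi / h)..pi / h} (s / b n)) * (iexp (- (s * (p n / b n))) * char (M n) (s / b n)) \<partial>lborel)
      = of_real (2 * pi / h) * of_real (measure (M n) {x n<..x n + h})" using 1 by simp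
    then show ?thesis using b_pos[of n] h_pos by (simp add: field_simps)
  qed
  have "(\<lambda>n. \<integral>s. of_real (indicator {- (pi / h)..pi / h} (s / b n)) * (iexp (- (s * (p n / b n))) * char (M n) (s / b n)) \<partial>lborel) \<longlonglongrightarrow> of_real 1 * I"
  proof (rule fourier_limit[OF _ _ p_lim away(2) away(1)])
    show "pi / h > 0" using h_pos by simp
    show "indicator {- (pi / h)..pi / h} (s / b n) = (0::real)" if "\<bar>s\<bar> > pi / h * b n" for n s
    proof -
      have "\<bar>s / b n\<bar> > pi / h" using that b_pos[of n] h_pos by (simp add: field_simps)
      then show ?thesis by (auto simp: indicator_def)
    qed
    show "(\<lambda>n. indicator {- (pi / h)..pi / h} (s / b n) :: real) \<longlonglongrightarrow> 1" for s
    proof (rule tendsto_eventually)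
      show "eventually (\<lambda>n. indicator {- (pi / h)..pi / h} (s / b n) = (1::real)) sequentially"
        using eventually_less_b[of "\<bar>s\<bar> * h / pi"]
      proof eventually_elim
        case (elim n)
        then have "\<bar>s / b n\<bar> \<le> pi / h" using b_pos[of n] h_pos by (simp add: field_simps)
        then have "- (pi / h) \<le> s / b n" "s / b n \<le> pi / h" by linarith+
        then show ?case by (simp add: indicator_def)
      qed
    qed
  qed (auto simp: indicator_def)
  then have "(\<lambda>n. complex_of_real (b n * measure (M n) {x n<..x n + h})) \<longlonglongrightarrow> of_real (h / (2 * pi)) * (of_real 1 * I)"
    unfolding inv by (intro tendsto_intros)
  from tendsto_Re[OF this] show ?thesis
    by (simp add: inv_fourier_def I_def field_simps)
qed

end

section \<open>Compound Poisson laws\<close>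

lemma real_distribution_convolution:
  assumes "real_distribution M" "real_distribution N"
  shows "real_distribution (convolution M N)"
proof -
  interpret M: real_distribution M by fact
  interpret N: real_distribution N by fact
  interpret P: pair_prob_space M N ..
  have "prob_space (convolution M N)"
    unfolding convolution_def by (rule P.prob_space_distr) measurable
  then show ?thesis by (intro real_distribution.intro real_distribution_axioms.intro) auto
qed

lemma char_convolution:
  assumes "real_distribution M" "real_distribution N"
  shows "char (convolution M N) t = char M t * char N t"
proof -
  interpret M: real_distribution M by fact
  interpret N: real_distribution N by fact
  interpret P: pair_prob_space M N ..
  have "char (convolution M N) t = (\<integral>z. iexp (t * (fst z + snd z)) \<partial>(M \<Otimes>\<^sub>M N))"
    unfolding char_def convolution_def by (subst integral_distr) (auto simp: split_beta')
  also have "\<dots> = (\<integral>z. iexp (t * fst z) * iexp (t * snd z) \<partial>(M \<Otimes>\<^sub>M N))"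
    by (intro Bochner_Integration.integral_cong refl) (simp add: distrib_left exp_add[symmetric])
  also have "\<dots> = (\<integral>x. (\<integral>y. iexp (t * x) * iexp (t * y) \<partial>N) \<partial>M)"
  proof -
    have "integrable (M \<Otimes>\<^sub>M N) (\<lambda>z. iexp (t * fst z) * iexp (t * snd z))"
      by (rule P.integrable_const_bound[where B = 1]) (auto simp: norm_mult)
    from P.integral_fst'[OF this] show ?thesis by simp
  qed
  also have "\<dots> = char M t * char N t"
    unfolding char_def by (simp only: integral_mult_right_zero integral_mult_left_zero)
  finally show ?thesis .
qed

lemma real_distribution_conv_pow:
  assumes "real_distribution M"
  shows "real_distribution (conv_pow M n)"
proof (induction n)
  case 0
  have "prob_space (return borel (0::real))" by (rule prob_space_return) simp
  then show ?case by (auto intro!: real_distribution.intro real_distribution_axioms.intro)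
next
  case (Suc n) then show ?case using real_distribution_convolution[OF assms] by simp
qed

lemma sets_conv_pow [simp, measurable_cong]: "sets (conv_pow M n) = sets borel"
  by (cases n) auto

lemma space_conv_pow [simp]: "space (conv_pow M n) = UNIV"
  by (cases n) auto

lemma char_conv_pow:
  assumes "real_distribution M"
  shows "char (conv_pow M n) t = char M t ^ n"
proof (induction n)
  case 0
  have "char (return borel 0) t = 1" unfolding char_def by (subst integral_return) auto
  then show ?case by simp
next
  case (Suc n)
  then show ?case using char_convolution[OF assms real_distribution_conv_pow[OF assms]] by simp
qed

lemma AE_convolution:
  assumes "real_distribution M" "real_distribution N" and [measurable]: "A \<in> sets borel"
    and M: "AE x in M. x \<in> A" and N: "AE x in N. x \<in> A" and add: "\<And>x y. x \<in> A \<Longrightarrow> y \<in> A \<Longrightarrow> x + y \<in> A"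
  shows "AE x in convolution M N. (x::real) \<in> A"
proof -
  interpret M: real_distribution M by fact
  interpret N: real_distribution N by fact
  have "emeasure (convolution M N) (- A) = (\<integral>\<^sup>+x. (\<integral>\<^sup>+y. indicator (- A) (x + y) \<partial>N) \<partial>M)"
    by (rule convolution_emeasure') (auto simp: M.finite_measure_axioms N.finite_measure_axioms)
  also have "\<dots> = (\<integral>\<^sup>+x. 0 \<partial>M)"
  proof (rule nn_integral_cong_AE)
    show "AE x in M. (\<integral>\<^sup>+y. indicator (- A) (x + y) \<partial>N) = 0"
      using M
    proof eventually_elim
      case (elim x)
      have "AE y in N. indicator (- A) (x + y) = (0::ennreal)"
        using N by eventually_elim (use add elim in \<open>simp add: indicator_def\<close>)
      then have "(\<integral>\<^sup>+y. indicator (- A) (x + y) \<partial>N) = (\<integral>\<^sup>+y. 0 \<partial>N)" by (rule nn_integral_cong_AE)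
      then show ?case by simp
    qed
  qed
  finally have "emeasure (convolution M N) (- A) = 0" by simp
  then show ?thesis by (intro AE_I[of _ _ "- A"]) auto
qed

lemma countable_range_lattice [measurable]: "range (\<lambda>k::int. (h::real) * of_int k) \<in> sets borel"
  by (rule sets.countable) auto

lemma AE_conv_pow_lattice:
  assumes "real_distribution M" and l: "lattice_on M h"
  shows "AE v in conv_pow M n. v \<in> range (\<lambda>k::int. h * of_int k)"
proof (induction n)
  case 0
  have z: "0 \<in> range (\<lambda>k::int. h * of_int k)" by (rule image_eqI[of _ _ 0]) auto
  have "Measurable.pred borel (\<lambda>v. v \<in> range (\<lambda>k::int. h * of_int k))" by measurable
  then show ?case unfolding conv_pow.simps using z by (subst AE_return) auto
next
  case (Suc n)
  interpret M: real_distribution M by fact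
  have "AE v in M. v \<in> range (\<lambda>k::int. h * of_int k)"
    using l unfolding lattice_on_def by (subst (asm) M.prob_eq_1) auto
  moreover have "u + v \<in> range (\<lambda>k::int. h * of_int k)"
    if uv: "u \<in> range (\<lambda>k::int. h * of_int k)" "v \<in> range (\<lambda>k::int. h * of_int k)" for u v
  proof -
    from uv obtain k l :: int where "u = h * of_int k" "v = h * of_int l" by blast
    then have "u + v = h * of_int (k + l)" by (simp add: distrib_left)
    then show ?thesis by blast
  qed
  ultimately show ?case unfolding conv_pow.simps
    by (intro AE_convolution[OF assms(1) real_distribution_conv_pow[OF assms(1)] countable_range_lattice _ Suc])
qed

definition cpoisson :: "real measure \<Rightarrow> real \<Rightarrow> real measure" where
  "cpoisson M t = measure_pmf (poisson_pmf t) \<bind> conv_pow M"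

lemma conv_pow_kernel:
  assumes "real_distribution M"
  shows "conv_pow M \<in> measurable (measure_pmf p) (subprob_algebra borel)"
  using real_distribution_conv_pow[OF assms]
  by (auto simp: measurable_def space_subprob_algebra real_distribution_def intro: prob_space_imp_subprob_space)

lemma sets_cpoisson [simp, measurable_cong]:
  assumes "real_distribution M" shows "sets (cpoisson M t) = sets borel"
  unfolding cpoisson_def by (rule sets_bind) (auto simp: sets_conv_pow)

lemma real_distribution_cpoisson:
  assumes "real_distribution M"
  shows "real_distribution (cpoisson M t)"
proof -
  have "prob_space (cpoisson M t)" unfolding cpoisson_def
    by (rule measure_pmf.prob_space_bind[OF _ conv_pow_kernel[OF assms]])
       (use real_distribution_conv_pow[OF assms] in \<open>auto simp: real_distribution_def\<close>)
  then show ?thesis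
    using sets_cpoisson[OF assms] by (intro real_distribution.intro real_distribution_axioms.intro) auto
qed

lemma integral_cpoisson:
  fixes f :: "real \<Rightarrow> real"
  assumes "real_distribution M" and f [measurable]: "f \<in> borel_measurable borel" and B: "\<And>x. \<bar>f x\<bar> \<le> B"
  shows "(\<integral>x. f x \<partial>cpoisson M t) = (\<integral>k. (\<integral>x. f x \<partial>conv_pow M k) \<partial>measure_pmf (poisson_pmf t))"
  unfolding cpoisson_def
proof (rule integral_bind[OF f _ conv_pow_kernel[OF assms(1)]])
  show "AE k in measure_pmf (poisson_pmf t). emeasure (conv_pow M k) (space (conv_pow M k)) \<le> ennreal 1"
    using real_distribution_conv_pow[OF assms(1)]
    by (intro AE_I2 ) (metis (full_types) ennreal_1 order_refl prob_space.emeasure_space_1 real_distribution.axioms(1))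
qed (use B in auto)

lemma emeasure_cpoisson:
  assumes "real_distribution M" and A: "A \<in> sets borel" and t: "t > 0"
  shows "emeasure (cpoisson M t) A = (\<Sum>k. ennreal (t ^ k / fact k * exp (- t)) * emeasure (conv_pow M k) A)"
proof -
  have "emeasure (cpoisson M t) A = (\<integral>\<^sup>+k. emeasure (conv_pow M k) A \<partial>measure_pmf (poisson_pmf t))"
    unfolding cpoisson_def by (rule emeasure_bind[OF _ conv_pow_kernel[OF assms(1)] A]) simp
  also have "\<dots> = (\<Sum>k. ennreal (t ^ k / fact k * exp (- t)) * emeasure (conv_pow M k) A)"
    using t by (simp add: nn_integral_measure_pmf nn_integral_count_space_nat)
  finally show ?thesis .
qed

text \<open>The generating function of the Poisson law is an exponential series. Real and imaginary
  parts are conditioned separately because \<open>integral_cpoisson\<close> is for real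
  integrands.\<close>

lemma char_cpoisson:
  assumes rd: "real_distribution M" and t: "t > 0"
  shows "char (cpoisson M t) \<theta> = exp (of_real t * (char M \<theta> - 1))"
proof -
  let ?p = "measure_pmf (poisson_pmf t)"
  interpret C: real_distribution "cpoisson M t" by (rule real_distribution_cpoisson[OF rd])
  interpret K: real_distribution "conv_pow M k" for k by (rule real_distribution_conv_pow[OF rd])
  interpret M: real_distribution M by (rule rd)
  have Re_char: "Re (char N \<theta>) = (\<integral>x. cos (\<theta> * x) \<partial>N)" "Im (char N \<theta>) = (\<integral>x. sin (\<theta> * x) \<partial>N)"
    if "real_distribution N" for N
  proof -
    interpret N: real_distribution N by fact
    have i: "integrable N (\<lambda>x. iexp (\<theta> * x))" by (rule N.integrable_iexp) auto
    show "Re (char N \<theta>) = (\<integral>x. cos (\<theta> * x) \<partial>N)" "Im (char N \<theta>) = (\<integral>x. sin (\<theta> * x) \<partial>N)"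
      unfolding char_def using integral_Re[OF i] integral_Im[OF i] by (simp_all add: Re_exp Im_exp)
  qed
  have int: "integrable ?p (\<lambda>k. char M \<theta> ^ k)"
    by (rule measure_pmf.integrable_const_bound[where B = 1]) (auto simp: norm_power power_le_one M.cmod_char_le_1)
  have "Re (char (cpoisson M t) \<theta>) = (\<integral>k. Re (char M \<theta> ^ k) \<partial>?p)"
    using integral_cpoisson[OF rd, of "\<lambda>x. cos (\<theta> * x)" 1 t]
    by (simp add: Re_char(1)[OF real_distribution_cpoisson[OF rd]] Re_char(1)[OF real_distribution_conv_pow[OF rd], symmetric] char_conv_pow[OF rd])
  moreover have "Im (char (cpoisson M t) \<theta>) = (\<integral>k. Im (char M \<theta> ^ k) \<partial>?p)"
    using integral_cpoisson[OF rd, of "\<lambda>x. sin (\<theta> * x)" 1 t]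
    by (simp add: Re_char(2)[OF real_distribution_cpoisson[OF rd]] Re_char(2)[OF real_distribution_conv_pow[OF rd], symmetric] char_conv_pow[OF rd])
  ultimately have "char (cpoisson M t) \<theta> = (\<integral>k. char M \<theta> ^ k \<partial>?p)"
    using integral_Re[OF int] integral_Im[OF int] by (simp add: complex_eq_iff)
  also have "\<dots> = (\<integral>k. (t ^ k / fact k * exp (- t)) *\<^sub>R char M \<theta> ^ k \<partial>count_space UNIV)"
    using t unfolding measure_pmf_eq_density by (subst integral_density) auto
  also have "\<dots> = (\<Sum>k. (t ^ k / fact k * exp (- t)) *\<^sub>R char M \<theta> ^ k)"
  proof (rule integral_count_space_nat)
    have "integrable (density (count_space UNIV) (\<lambda>k. ennreal (pmf (poisson_pmf t) k))) (\<lambda>k. char M \<theta> ^ k)"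
      using int unfolding measure_pmf_eq_density .
    then show "integrable (count_space UNIV) (\<lambda>k. (t ^ k / fact k * exp (- t)) *\<^sub>R char M \<theta> ^ k)"
      using t by (subst (asm) integrable_density) auto
  qed
  also have "(\<lambda>k. (t ^ k / fact k * exp (- t)) *\<^sub>R char M \<theta> ^ k) = (\<lambda>k. of_real (exp (- t)) * ((of_real t * char M \<theta>) ^ k /\<^sub>R fact k))"
    by (auto simp: fun_eq_iff scaleR_conv_of_real power_mult_distrib field_simps)
  also have "(\<Sum>k. of_real (exp (- t)) * ((of_real t * char M \<theta>) ^ k /\<^sub>R fact k)) = of_real (exp (- t)) * exp (of_real t * char M \<theta>)"
    using sums_mult[OF exp_converges, of "of_real (exp (- t))" "of_real t * char M \<theta>"] by (rule sums_unique[symmetric])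
  also have "\<dots> = exp (of_real t * (char M \<theta> - 1))"
    by (simp add: exp_of_real[symmetric] exp_add[symmetric] algebra_simps)
  finally show ?thesis .
qed

lemma AE_cpoisson_lattice:
  assumes rd: "real_distribution M" and l: "lattice_on M h"
  shows "AE v in cpoisson M t. v \<in> range (\<lambda>k::int. h * of_int k)"
  unfolding cpoisson_def
  by (subst AE_bind[OF conv_pow_kernel[OF rd]]) (auto simp: pred_def AE_conv_pow_lattice[OF rd l])

text \<open>Feeds the majorant C / (1 + s^2) into the concentration inequality; the substitution s /
  b produces the factor 1 / b, and D is independent of the law, the scale and the position.\<close>

lemma concentration_scaled:
  assumes h: "h > 0" and eps: "\<epsilon> > 0" and C: "C > 0"
  obtains D where "D > 0" "\<And>M b x. real_distribution M \<Longrightarrow> b > 0 \<Longrightarrow>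
    (\<And>s. \<bar>s\<bar> \<le> \<epsilon> * b \<Longrightarrow> norm (char M (s / b)) \<le> C / (1 + s\<^sup>2)) \<Longrightarrow> measure M {x-h..x+h} \<le> D / b"
proof -
  obtain c where c: "c > 0" "\<And>M h x. real_distribution M \<Longrightarrow> h > 0 \<Longrightarrow>
     measure M {x-h..x+h} \<le> c * h * (\<integral>s. indicator {-(1/h)..1/h} s * norm (char M s) \<partial>lborel)"
    using concentration_bound by blast
  \<comment> \<open>Widening the interval to half-length at least 1 / \<epsilon> restricts the
    inequality to frequencies of modulus at most \<epsilon>, where the majorant is known.\<close>
  define H where "H = max h (1 / \<epsilon>)"
  have H: "H > 0" "h \<le> H" "1 / H \<le> \<epsilon>" using h eps by (auto simp: H_def max_def field_simps)
  have Cint: "integrable lborel (\<lambda>s::real. C / (1 + s\<^sup>2))"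
    using integrable_mult_right[OF integrable_inverse_1_plus_square[unfolded interval_lebesgue_integrable_def set_integrable_def], of C]
    by (simp add: field_simps)
  define E where "E = (\<integral>s. C / (1 + s\<^sup>2) \<partial>(lborel :: real measure))"
  have E: "E \<ge> 0" unfolding E_def using C by (intro Bochner_Integration.integral_nonneg) (simp add: add_nonneg_nonneg)
  show ?thesis
  proof (rule that[of "c * H * E + 1"])
    show "c * H * E + 1 > 0" using c H E by (simp add: add_nonneg_pos)
    fix M b x assume rd: "real_distribution M" and b: "b > (0::real)"
      and dom: "\<And>s. \<bar>s\<bar> \<le> \<epsilon> * b \<Longrightarrow> norm (char M (s / b)) \<le> C / (1 + s\<^sup>2)"
    interpret M: real_distribution M by (rule rd)
    have "measure M {x-h..x+h} \<le> measure M {x-H..x+H}" using H by (intro M.finite_measure_mono) auto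
    also have "\<dots> \<le> c * H * (\<integral>s. indicator {-(1/H)..1/H} s * norm (char M s) \<partial>lborel)"
      by (rule c(2)[OF rd H(1)])
    also have "(\<integral>s. indicator {-(1/H)..1/H} s * norm (char M s) \<partial>lborel)
       = \<bar>1 / b\<bar> *\<^sub>R (\<integral>s. indicator {-(1/H)..1/H} (0 + 1 / b * s) * norm (char M (0 + 1 / b * s)) \<partial>lborel)"
      using b by (intro lborel_integral_real_affine) auto
    also have "\<dots> = 1 / b * (\<integral>s. indicator {-(1/H)..1/H} (s / b) * norm (char M (s / b)) \<partial>lborel)"
      using b by simp
    also have "\<dots> \<le> 1 / b * E"
    proof (rule mult_left_mono)
      have le: "indicator {-(1/H)..1/H} (s / b) * norm (char M (s / b)) \<le> C / (1 + s\<^sup>2)" for s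
      proof (cases "s / b \<in> {-(1/H)..1/H}")
        case True
        then have "\<bar>s / b\<bar> \<le> \<epsilon>" using H by auto
        then have "\<bar>s\<bar> \<le> \<epsilon> * b" using b by (simp add: field_simps)
        then show ?thesis using True dom by simp
      next
        case False
        then show ?thesis using C by (simp add: add_nonneg_nonneg)
      qed
      show "(\<integral>s. indicator {-(1/H)..1/H} (s / b) * norm (char M (s / b)) \<partial>lborel) \<le> E"
        unfolding E_def
      proof (rule integral_mono[OF _ Cint])
        show "integrable lborel (\<lambda>s. indicator {-(1/H)..1/H} (s / b) * norm (char M (s / b)))"
        proof (rule Bochner_Integration.integrable_bound[OF Cint])
          show "AE s in lborel. norm (indicator {-(1/H)..1/H} (s / b) * norm (char M (s / b))) \<le> norm (C / (1 + s\<^sup>2))"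
          proof (rule AE_I2)
            fix s
            have "norm (indicator {-(1/H)..1/H} (s / b) * norm (char M (s / b))) = indicator {-(1/H)..1/H} (s / b) * norm (char M (s / b))"
              by (simp add: abs_mult)
            also have "\<dots> \<le> C / (1 + s\<^sup>2)" by (rule le)
            also have "\<dots> \<le> norm (C / (1 + s\<^sup>2))" by (simp only: real_norm_def abs_ge_self)
            finally show "norm (indicator {-(1/H)..1/H} (s / b) * norm (char M (s / b))) \<le> norm (C / (1 + s\<^sup>2))" .
          qed
        qed measurable
      qed (rule le)
    qed (use b in simp)
    finally have "measure M {x-h..x+h} \<le> c * H * (1 / b * E)"
      using c H by (simp add: mult_left_mono)
    also have "\<dots> \<le> (c * H * E + 1) / b" using b by (simp add: divide_right_mono)
    finally show "measure M {x-h..x+h} \<le> (c * H * E + 1) / b" .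
  qed
qed

context heavy_tail_norm
begin

text \<open>Convolution powers need the bound on |char F| and Poisson laws the bound on Re (1 - char
  F). Both end in exp (- c * n * W (a n / |s|)), so a single majorant serves. In the Poisson case
  the scale belongs to an integer n \<le> t.\<close>

lemma dominated_chars:
  obtains \<epsilon> C where "\<epsilon> > 0" "\<epsilon> \<le> 1" "C > 0"
    "\<And>n s. n \<ge> 1 \<Longrightarrow> \<bar>s\<bar> \<le> \<epsilon> * a (real n) \<Longrightarrow> norm (char (conv_pow F n) (s / a (real n))) \<le> C / (1 + s\<^sup>2)"
    "\<And>t n s. n \<ge> 1 \<Longrightarrow> t \<ge> real n \<Longrightarrow> \<bar>s\<bar> \<le> \<epsilon> * a (real n) \<Longrightarrow> norm (char (cpoisson F t) (s / a (real n))) \<le> C / (1 + s\<^sup>2)"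
proof -
  have rdF: "real_distribution F" by (rule real_distribution_axioms)
  obtain c1 e1 where 1: "c1 > 0" "0 < e1" "e1 \<le> 1"
    "\<And>\<theta>. \<theta> \<noteq> 0 \<Longrightarrow> \<bar>\<theta>\<bar> \<le> e1 \<Longrightarrow> c1 * W (1 / \<bar>\<theta>\<bar>) \<le> Re (1 - char F \<theta>)"
    using char_lower by blast
  obtain c2 e2 where 2: "c2 > 0" "0 < e2" "e2 \<le> 1"
    "\<And>\<theta>. \<theta> \<noteq> 0 \<Longrightarrow> \<bar>\<theta>\<bar> \<le> e2 \<Longrightarrow> norm (char F \<theta>) \<le> exp (- c2 * W (1 / \<bar>\<theta>\<bar>))"
    using char_norm_bound by blast
  define c where "c = min c1 c2"
  define \<epsilon> where "\<epsilon> = min e1 e2"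
  have c: "c > 0" "c \<le> c1" "c \<le> c2" and e: "\<epsilon> > 0" "\<epsilon> \<le> 1" "\<epsilon> \<le> e1" "\<epsilon> \<le> e2"
    using 1 2 by (auto simp: c_def \<epsilon>_def)
  obtain C where C: "C > 0" "\<And>t s. t \<ge> 1 \<Longrightarrow> s \<noteq> 0 \<Longrightarrow> \<bar>s\<bar> \<le> a t \<Longrightarrow> exp (- c * (t * W (a t / \<bar>s\<bar>))) \<le> C / (1 + s\<^sup>2)"
    using exp_tail_bound[OF c(1)] by blast
  have scale: "norm Z \<le> max C 1 / (1 + s\<^sup>2)"
    if n: "n \<ge> 1" and s: "\<bar>s\<bar> \<le> \<epsilon> * a (real n)" and Z1: "norm Z \<le> 1"
     and Z: "s \<noteq> 0 \<Longrightarrow> norm Z \<le> exp (- c * (real n * W (a (real n) / \<bar>s\<bar>)))" for n :: nat and s :: real and Z :: complex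
  proof (cases "s = 0")
    case True then show ?thesis using Z1 by simp
  next
    case False
    have "\<bar>s\<bar> \<le> 1 * a (real n)" using s e a_pos[of "real n"] by (meson less_imp_le mult_right_mono order_trans)
    then have "exp (- c * (real n * W (a (real n) / \<bar>s\<bar>))) \<le> C / (1 + s\<^sup>2)"
      using n False by (intro C) auto
    also have "\<dots> \<le> max C 1 / (1 + s\<^sup>2)" by (intro divide_right_mono) auto
    finally show ?thesis using Z[OF False] by linarith
  qed
  have small: "\<bar>s / a (real n)\<bar> \<le> \<epsilon>" if "\<bar>s\<bar> \<le> \<epsilon> * a (real n)" for s n
    using that by (simp add: field_simps)
  show ?thesis
  proof (rule that[of \<epsilon> "max C 1"])
    show "\<epsilon> > 0" "\<epsilon> \<le> 1" "max C 1 > 0" using e by auto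
    fix n :: nat and s :: real assume n: "n \<ge> 1" and s: "\<bar>s\<bar> \<le> \<epsilon> * a (real n)"
    show "norm (char (conv_pow F n) (s / a (real n))) \<le> max C 1 / (1 + s\<^sup>2)"
    proof (rule scale[OF n s])
      show "norm (char (conv_pow F n) (s / a (real n))) \<le> 1"
        by (rule real_distribution.cmod_char_le_1[OF real_distribution_conv_pow[OF rdF]])
      assume s0: "s \<noteq> 0"
      have "norm (char (conv_pow F n) (s / a (real n))) = norm (char F (s / a (real n))) ^ n"
        by (simp add: char_conv_pow[OF rdF] norm_power)
      also have "\<dots> \<le> exp (- c2 * W (1 / \<bar>s / a (real n)\<bar>)) ^ n"
        using s0 small[OF s] e by (intro power_mono 2) auto
      also have "\<dots> = exp (- c2 * (real n * W (a (real n) / \<bar>s\<bar>)))"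
        by (simp add: exp_of_nat_mult[symmetric] mult_ac)
      also have "\<dots> \<le> exp (- c * (real n * W (a (real n) / \<bar>s\<bar>)))"
        using c by (auto intro!: mult_right_mono)
      finally show "norm (char (conv_pow F n) (s / a (real n))) \<le> exp (- c * (real n * W (a (real n) / \<bar>s\<bar>)))" .
    qed
    fix t assume t: "t \<ge> real n"
    then have t0: "t > 0" using n by simp
    show "norm (char (cpoisson F t) (s / a (real n))) \<le> max C 1 / (1 + s\<^sup>2)"
    proof (rule scale[OF n s])
      show "norm (char (cpoisson F t) (s / a (real n))) \<le> 1"
        by (rule real_distribution.cmod_char_le_1[OF real_distribution_cpoisson[OF rdF]])
      assume s0: "s \<noteq> 0"
      have "c1 * W (1 / \<bar>s / a (real n)\<bar>) \<le> Re (1 - char F (s / a (real n)))"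
        using s0 small[OF s] e by (intro 1) auto
      then have "c * W (a (real n) / \<bar>s\<bar>) \<le> Re (1 - char F (s / a (real n)))"
        using mult_right_mono[OF c(2), of "W (a (real n) / \<bar>s\<bar>)"] by simp
      then have "real n * (c * W (a (real n) / \<bar>s\<bar>)) \<le> t * Re (1 - char F (s / a (real n)))"
        using t c by (intro mult_mono) auto
      then show "norm (char (cpoisson F t) (s / a (real n))) \<le> exp (- c * (real n * W (a (real n) / \<bar>s\<bar>)))"
        by (simp add: char_cpoisson[OF rdF t0] algebra_simps)
    qed
  qed
qed

lemma local_concentration:
  assumes h: "h > 0"
  obtains D where "D > 0"
    "\<And>n x. n \<ge> 1 \<Longrightarrow> measure (conv_pow F n) {x-h..x+h} \<le> D / a (real n)"
    "\<And>n t x. n \<ge> 1 \<Longrightarrow> t \<ge> real n \<Longrightarrow> measure (cpoisson F t) {x-h..x+h} \<le> D / a (real n)"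
proof -
  have rdF: "real_distribution F" by (rule real_distribution_axioms)
  obtain \<epsilon> C where C: "\<epsilon> > 0" "\<epsilon> \<le> 1" "C > 0"
    "\<And>n s. n \<ge> 1 \<Longrightarrow> \<bar>s\<bar> \<le> \<epsilon> * a (real n) \<Longrightarrow> norm (char (conv_pow F n) (s / a (real n))) \<le> C / (1 + s\<^sup>2)"
    "\<And>t n s. n \<ge> 1 \<Longrightarrow> t \<ge> real n \<Longrightarrow> \<bar>s\<bar> \<le> \<epsilon> * a (real n) \<Longrightarrow> norm (char (cpoisson F t) (s / a (real n))) \<le> C / (1 + s\<^sup>2)"
    using dominated_chars by blast
  obtain D where D: "D > 0" "\<And>M b x. real_distribution M \<Longrightarrow> b > 0 \<Longrightarrow>
    (\<And>s. \<bar>s\<bar> \<le> \<epsilon> * b \<Longrightarrow> norm (char M (s / b)) \<le> C / (1 + s\<^sup>2)) \<Longrightarrow> measure M {x-h..x+h} \<le> D / b"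
    using concentration_scaled[OF h C(1,3)] by blast
  show ?thesis
    by (rule that[OF D(1)])
       (intro D(2) real_distribution_conv_pow real_distribution_cpoisson rdF a_pos C(4,5); assumption)+
qed

end

section \<open>From integer to Poisson time: characteristic functions and the local limit\<close>

lemma char_distr_divide:
  assumes [measurable_cong]: "sets M = sets borel"
  shows "char (distr M borel (\<lambda>x. x / c)) u = char M (u / c)"
  unfolding char_def by (subst integral_distr) (auto simp: mult_ac)

lemma real_distribution_distr_divide:
  assumes "real_distribution M"
  shows "real_distribution (distr M borel (\<lambda>x. x / c))"
proof -
  interpret real_distribution M by fact
  show ?thesis by (intro real_distribution.intro real_distribution_axioms.intro prob_space_distr) auto
qed

text \<open>If \<open>a\<close> were bounded by B, then for small u \<noteq> 0 the factors char F (u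
  / a n) would have modulus at most a fixed q < 1, so their n-th powers would tend to 0. The
  limiting characteristic function would vanish near 0 except at 0 itself, against its
  continuity.\<close>

lemma (in heavy_tail) normalizer_at_top:
  assumes G: "real_distribution G"
    and lim: "weak_conv_m (\<lambda>n. distr (conv_pow F n) borel (\<lambda>x. x / a (real n))) G"
  shows "filterlim a at_top at_top"
proof (rule ccontr)
  have rdF: "real_distribution F" by (rule real_distribution_axioms)
  interpret G: real_distribution G by fact
  assume "\<not> filterlim a at_top at_top"
  then obtain B where "\<not> eventually (\<lambda>t. a t \<ge> B) at_top" by (auto simp: filterlim_at_top)
  then have aB: "a t \<le> B" for t
    by (metis (mono_tags, lifting) a_mono eventually_at_top_linorderI linorder_linear order_trans)
  obtain c \<epsilon> where c: "c > 0" "0 < \<epsilon>" "\<epsilon> \<le> 1"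
    "\<And>\<theta>. \<theta> \<noteq> 0 \<Longrightarrow> \<bar>\<theta>\<bar> \<le> \<epsilon> \<Longrightarrow> norm (char F \<theta>) \<le> exp (- c * W (1 / \<bar>\<theta>\<bar>))"
    using char_norm_bound by blast
  have conv: "(\<lambda>n. char F (u / a (real n)) ^ n) \<longlonglongrightarrow> char G u" for u
    using levy_continuity1[OF real_distribution_distr_divide[OF real_distribution_conv_pow[OF rdF]] G lim]
    by (simp add: char_distr_divide char_conv_pow[OF rdF])
  have zero: "char G u = 0" if u: "u \<noteq> 0" "\<bar>u\<bar> \<le> \<epsilon>" for u
  proof (rule LIMSEQ_unique[OF conv])
    define q where "q = exp (- c * W (B / \<bar>u\<bar>))"
    have q: "0 \<le> q" "q < 1" using c tail_pos[of "B / \<bar>u\<bar>"] by (auto simp: q_def)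
    show "(\<lambda>n. char F (u / a (real n)) ^ n) \<longlonglongrightarrow> 0"
    proof (rule Lim_null_comparison[OF always_eventually LIMSEQ_realpow_zero[OF q]], rule allI)
      fix n
      have "\<bar>u\<bar> / a (real n) \<le> \<bar>u\<bar> / 1" using a_ge_1[of "real n"] by (intro divide_left_mono) auto
      then have "norm (char F (u / a (real n))) \<le> exp (- c * W (1 / \<bar>u / a (real n)\<bar>))"
        using u by (intro c) auto
      also have "\<dots> \<le> q"
        unfolding q_def using aB[of "real n"] c(1) by (auto intro!: mult_left_mono tail_antimono divide_right_mono)
      finally show "norm (char F (u / a (real n)) ^ n) \<le> q ^ n" by (simp add: norm_power power_mono)
    qed
  qed
  have "(\<lambda>n. char G (\<epsilon> / real (Suc n))) \<longlonglongrightarrow> char G 0"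
  proof (rule isCont_tendsto_compose[OF G.isCont_char])
    show "(\<lambda>n. \<epsilon> / real (Suc n)) \<longlonglongrightarrow> 0"
      using tendsto_mult_right_zero[OF LIMSEQ_inverse_real_of_nat, of \<epsilon>] by (simp add: field_simps)
  qed
  moreover have "char G (\<epsilon> / real (Suc n)) = 0" for n
  proof (rule zero)
    have "\<epsilon> / real (Suc n) \<le> \<epsilon> / 1" using c by (intro divide_left_mono) auto
    then show "\<bar>\<epsilon> / real (Suc n)\<bar> \<le> \<epsilon>" using c by simp
  qed (use c in auto)
  ultimately have "(\<lambda>n::nat. 0) \<longlonglongrightarrow> (1::complex)" by (simp add: G.char_zero)
  then show False by (simp add: LIMSEQ_const_iff)
qed

text \<open>For z = char F \<theta> - 1 this compares Poisson time t with n = floor t. Replacing t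
  by n costs O(|z|), and replacing exp z by 1 + z in n factors of modulus at most 1 costs O(n *
  |z|^2). Both vanish when n * |z| stays bounded and z tends to 0.\<close>

lemma exp_error_bound:
  fixes z :: complex
  assumes t: "real n \<le> t" "t \<le> real n + 1" and z: "norm z \<le> 1" "Re z \<le> 0" "norm (1 + z) \<le> 1"
  shows "norm (exp (of_real t * z) - (1 + z) ^ n) \<le> exp 1 * norm z * (1 + real n * norm z)"
proof -
  have t0: "t \<ge> 0" using t by linarith
  have e: "exp \<bar>Re w\<bar> \<le> exp (1::real)" if "norm w \<le> 1" for w :: complex
    using abs_Re_le_cmod[of w] that by simp
  define d where "d = t - real n"
  have d01: "0 \<le> d" "d \<le> 1" using t by (auto simp: d_def)
  have nd: "norm (of_real d * z) = d * norm z" using d01 by (simp add: norm_mult)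
  have d: "0 \<le> d" "d \<le> 1" "norm (of_real d * z) \<le> 1"
    unfolding nd using d01 z mult_mono[of d 1 "norm z" 1] by auto
  have "norm (exp (of_real d * z) - 1) \<le> exp \<bar>Re (of_real d * z)\<bar> * norm (of_real d * z)"
    using Taylor_exp[of "of_real d * z" 0] by simp
  also have "\<dots> \<le> exp 1 * norm z"
    using e[OF d(3)] d mult_right_mono[of d 1 "norm z"] by (intro mult_mono) (auto simp: norm_mult)
  finally have 1: "norm (exp (of_real d * z) - 1) \<le> exp 1 * norm z" .
  have ez: "norm (exp z) \<le> 1" using z by simp
  have "exp (of_real t * z) - exp z ^ n = exp z ^ n * (exp (of_real d * z) - 1)"
    by (simp add: d_def exp_of_nat_mult[symmetric] right_diff_distrib exp_add[symmetric] left_diff_distrib)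
  then have "norm (exp (of_real t * z) - exp z ^ n) = norm (exp z) ^ n * norm (exp (of_real d * z) - 1)"
    by (simp only: norm_mult norm_power)
  also have "\<dots> \<le> 1 * (exp 1 * norm z)"
    using 1 ez by (intro mult_mono power_le_one) auto
  finally have 2: "norm (exp (of_real t * z) - exp z ^ n) \<le> exp 1 * norm z" by simp
  have "norm (exp z - (1 + z)) \<le> exp \<bar>Re z\<bar> * (norm z)\<^sup>2"
    using Taylor_exp[of z 1] by (simp add: numeral_2_eq_2 diff_diff_add)
  also have "\<dots> \<le> exp 1 * (norm z)\<^sup>2" using e[OF z(1)] by (intro mult_right_mono) auto
  finally have 3: "norm (exp z - (1 + z)) \<le> exp 1 * (norm z)\<^sup>2" .
  have "norm (exp z ^ n - (1 + z) ^ n) \<le> real n * norm (exp z - (1 + z))"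
    by (rule norm_power_diff[OF ez z(3)])
  also have "\<dots> \<le> real n * (exp 1 * (norm z)\<^sup>2)" using 3 by (intro mult_left_mono) auto
  finally have 4: "norm (exp z ^ n - (1 + z) ^ n) \<le> real n * (exp 1 * (norm z)\<^sup>2)" .
  have "norm (exp (of_real t * z) - (1 + z) ^ n) \<le> exp 1 * norm z + real n * (exp 1 * (norm z)\<^sup>2)"
    using norm_triangle_ineq[of "exp (of_real t * z) - exp z ^ n" "exp z ^ n - (1 + z) ^ n"] 2 4 by simp
  then show ?thesis by (simp add: algebra_simps power2_eq_square)
qed

locale stable_renewal = heavy_tail_norm F \<alpha> r for F \<alpha> r +
  fixes h :: real and g :: "real \<Rightarrow> real"
  assumes h_pos: "h > 0" and h_span: "arithmetic F \<longrightarrow> is_span F h"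
    and g_meas [measurable]: "g \<in> borel_measurable borel" and g_nonneg: "\<And>x. g x \<ge> 0"
    and g_prob: "prob_space (density lborel g)"
    and g_limit: "weak_conv_m (\<lambda>n. distr (conv_pow F n) borel (\<lambda>x. x / ginv r (real n))) (density lborel g)"
begin

lemma rdF: "real_distribution F" by (rule real_distribution_axioms)

lemma rdG: "real_distribution (density lborel g)"
  by (intro real_distribution.intro real_distribution_axioms.intro g_prob) auto

abbreviation \<psi> :: "real \<Rightarrow> complex" where "\<psi> \<equiv> char (density lborel g)"
text \<open>The continuous version of \<open>g\<close>.\<close>
abbreviation gc :: "real \<Rightarrow> real" where "gc \<equiv> inv_fourier \<psi>"

lemma char_limit: "(\<lambda>n. char F (u / a (real n)) ^ n) \<longlonglongrightarrow> \<psi> u"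
  using levy_continuity1[OF real_distribution_distr_divide[OF real_distribution_conv_pow[OF rdF]] rdG g_limit]
  by (simp add: char_distr_divide char_conv_pow[OF rdF])

lemma a_sequentially: "filterlim (\<lambda>n. a (real n)) at_top sequentially"
  by (rule filterlim_compose[OF a_at_top filterlim_real_sequentially])

text \<open>\<open>char_upper\<close> gives n * W (a n / |u|) up to a constant; the Potter bound
  removes |u| and \<open>tail_a_bounds\<close> the rest. This is the boundedness of n * |z| that
  \<open>exp_error_bound\<close> asks for.\<close>

lemma char_defect_bound:
  obtains K n0 where "K > 0" "\<And>n. n \<ge> n0 \<Longrightarrow> real n * norm (char F (u / a (real n)) - 1) \<le> K"
proof (cases "u = 0")
  case True
  then show ?thesis using that[of 1] by (simp add: char_zero)
next
  case False
  obtain C where C: "C > 0" "\<And>\<theta>. \<theta> \<noteq> 0 \<Longrightarrow> \<bar>\<theta>\<bar> \<le> 1 \<Longrightarrow> norm (1 - char F \<theta>) \<le> C * W (1 / \<bar>\<theta>\<bar>)"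
    using char_upper by blast
  obtain C1 where C1: "C1 > 0" "\<And>x y. 0 < y \<Longrightarrow> y \<le> x \<Longrightarrow> 1 \<le> x \<Longrightarrow> W y \<le> C1 * (x / y) powr 1 * W x"
    using tail_potter_upper[of 1] alpha_less_1 by blast
  obtain C2 where C2: "C2 > 0" "\<And>t. t \<ge> 1 \<Longrightarrow> W (a t) * t \<le> C2" "\<And>t. t \<ge> 1 \<Longrightarrow> 1 \<le> C2 * (W (a t) * t)"
    using tail_a_bounds by blast
  define v where "v = max 1 \<bar>u\<bar>"
  have v: "v \<ge> 1" "v \<ge> \<bar>u\<bar>" by (auto simp: v_def)
  have "eventually (\<lambda>n. a (real n) \<ge> v \<and> n \<ge> 1) sequentially"
    using a_sequentially by (auto simp: filterlim_at_top intro!: eventually_conj eventually_ge_at_top)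
  then obtain n0 where n0: "\<And>n. n \<ge> n0 \<Longrightarrow> a (real n) \<ge> v \<and> n \<ge> 1"
    by (auto simp: eventually_sequentially)
  show ?thesis
  proof (rule that[of "C * (C1 * v * C2)" n0])
    show "C * (C1 * v * C2) > 0" using C C1 C2 v by simp
    fix n assume "n \<ge> n0"
    then have n: "a (real n) \<ge> v" "n \<ge> 1" using n0 by auto
    have "norm (char F (u / a (real n)) - 1) \<le> C * W (1 / \<bar>u / a (real n)\<bar>)"
      using False n v by (subst norm_minus_commute, intro C) (auto simp: field_simps)
    also have "\<dots> \<le> C * (C1 * (a (real n) / (a (real n) / v)) powr 1 * W (a (real n)))"
    proof (intro mult_left_mono)
      have "W (1 / \<bar>u / a (real n)\<bar>) \<le> W (a (real n) / v)"
        using v False by (intro tail_antimono) (auto intro!: divide_left_mono)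
      also have "\<dots> \<le> C1 * (a (real n) / (a (real n) / v)) powr 1 * W (a (real n))"
        using v n a_ge_1 by (intro C1) (auto simp: divide_le_eq mult_le_cancel_left1)
      finally show "W (1 / \<bar>u / a (real n)\<bar>) \<le> C1 * (a (real n) / (a (real n) / v)) powr 1 * W (a (real n))" .
    qed (use C in simp)
    also have "\<dots> = C * (C1 * v * W (a (real n)))" using v by simp
    finally have "real n * norm (char F (u / a (real n)) - 1) \<le> real n * (C * (C1 * v * W (a (real n))))"
      by (intro mult_left_mono) auto
    also have "\<dots> = C * (C1 * v * (W (a (real n)) * real n))" by simp
    also have "\<dots> \<le> C * (C1 * v * C2)"
      using C C1 C2 v n by (intro mult_left_mono C2) auto
    finally show "real n * norm (char F (u / a (real n)) - 1) \<le> C * (C1 * v * C2)" .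
  qed
qed

lemma char_cpoisson_limit:
  assumes N: "filterlim N at_top sequentially" and t: "\<And>n. real (N n) \<le> t n" "\<And>n. t n \<le> real (N n) + 1" "\<And>n. t n > 0"
  shows "(\<lambda>n. char (cpoisson F (t n)) (u / a (real (N n)))) \<longlonglongrightarrow> \<psi> u"
proof -
  define z where "z n = char F (u / a (real (N n))) - 1" for n
  have lim1: "(\<lambda>n. (1 + z n) ^ N n) \<longlonglongrightarrow> \<psi> u"
    using filterlim_compose[OF char_limit N] by (simp add: z_def)
  obtain K n0 where K: "K > 0" "\<And>n. n \<ge> n0 \<Longrightarrow> real n * norm (char F (u / a (real n)) - 1) \<le> K"
    using char_defect_bound by blast
  have z_lim: "(\<lambda>n. norm (z n)) \<longlonglongrightarrow> 0"
  proof -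
    have "(\<lambda>n. u / a (real (N n))) \<longlonglongrightarrow> 0"
      by (intro tendsto_divide_0[OF tendsto_const] filterlim_at_top_imp_at_infinity filterlim_compose[OF a_sequentially N])
    then have "(\<lambda>n. char F (u / a (real (N n)))) \<longlonglongrightarrow> char F 0"
      by (rule isCont_tendsto_compose[OF isCont_char])
    then have "(\<lambda>n. z n) \<longlonglongrightarrow> 0"
      unfolding z_def by (simp add: char_zero LIM_zero_iff)
    then show ?thesis by (rule tendsto_norm_zero)
  qed
  have ev: "eventually (\<lambda>n. norm (exp (of_real (t n) * z n) - (1 + z n) ^ N n) \<le> exp 1 * norm (z n) * (1 + K)) sequentially"
  proof -
    have "eventually (\<lambda>n. N n \<ge> n0) sequentially" using N by (auto simp: filterlim_at_top)
    moreover have "eventually (\<lambda>n. norm (z n) < 1) sequentially"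
      by (rule order_tendstoD(2)[OF z_lim]) simp
    ultimately show ?thesis
    proof eventually_elim
      case (elim n)
      have nc: "norm (1 + z n) \<le> 1" using cmod_char_le_1 by (simp add: z_def)
      have "Re (1 + z n) \<le> 1" using nc complex_Re_le_cmod[of "1 + z n"] by linarith
      then have "norm (exp (of_real (t n) * z n) - (1 + z n) ^ N n) \<le> exp 1 * norm (z n) * (1 + real (N n) * norm (z n))"
        using t[of n] elim nc by (intro exp_error_bound) auto
      also have "\<dots> \<le> exp 1 * norm (z n) * (1 + K)"
        using K(2)[OF elim(1)] by (intro mult_left_mono) (auto simp: z_def)
      finally show ?case .
    qed
  qed
  have "(\<lambda>n. exp 1 * norm (z n) * (1 + K)) \<longlonglongrightarrow> exp 1 * 0 * (1 + K)"
    by (intro tendsto_intros z_lim)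
  then have "(\<lambda>n. exp 1 * norm (z n) * (1 + K)) \<longlonglongrightarrow> 0" by simp
  from Lim_null_comparison[OF ev this]
  have "(\<lambda>n. exp (of_real (t n) * z n) - (1 + z n) ^ N n) \<longlonglongrightarrow> 0" .
  from tendsto_add[OF this lim1] show ?thesis
    by (simp add: z_def char_cpoisson[OF rdF t(3)])
qed

text \<open>On the compact set \<epsilon> \<le> |\<theta>| \<le> K the continuous function Re (1 -
  char F \<theta>) is positive, hence at least some \<delta>. The Poisson transform then decays
  exponentially in the time, whereas \<open>a\<close> grows at most polynomially.\<close>

lemma char_away:
  assumes eps: "\<epsilon> > 0" and nl: "\<And>\<theta>. \<epsilon> \<le> \<bar>\<theta>\<bar> \<Longrightarrow> \<bar>\<theta>\<bar> \<le> K \<Longrightarrow> \<not> lattice_on F (2 * pi / \<bar>\<theta>\<bar>)"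
    and N: "filterlim N at_top sequentially" and t: "\<And>n. real (N n) \<le> t n" "\<And>n. N n \<ge> 1"
  shows "\<exists>d. d \<longlonglongrightarrow> 0 \<and> (\<forall>n \<theta>. \<epsilon> < \<bar>\<theta>\<bar> \<longrightarrow> \<bar>\<theta>\<bar> \<le> K \<longrightarrow> a (real (N n)) * norm (char (cpoisson F (t n)) \<theta>) \<le> (d n :: real))"
proof -
  define S where "S = {- K..- \<epsilon>} \<union> {\<epsilon>..K}"
  have SI: "\<theta> \<in> S" if "\<epsilon> \<le> \<bar>\<theta>\<bar>" "\<bar>\<theta>\<bar> \<le> K" for \<theta> using that by (auto simp: S_def abs_if split: if_splits)
  have SD: "\<epsilon> \<le> \<bar>\<theta>\<bar>" "\<bar>\<theta>\<bar> \<le> K" if "\<theta> \<in> S" for \<theta> using that eps by (auto simp: S_def)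
  have pos: "Re (1 - char F \<theta>) > 0" if "\<theta> \<in> S" for \<theta>
  proof (rule ccontr)
    assume "\<not> Re (1 - char F \<theta>) > 0"
    moreover have "Re (char F \<theta>) \<le> 1"
      using complex_Re_le_cmod[of "char F \<theta>"] cmod_char_le_1[of \<theta>] by linarith
    ultimately have "Re (char F \<theta>) = 1" by simp
    moreover have "\<theta> \<noteq> 0" using SD[OF that] eps by auto
    ultimately show False using lattice_onI_char[OF rdF] nl[OF SD[OF that]] by blast
  qed
  obtain \<delta> where \<delta>: "\<delta> > 0" "\<And>\<theta>. \<theta> \<in> S \<Longrightarrow> Re (1 - char F \<theta>) \<ge> \<delta>"
  proof (cases "S = {}")
    case True then show ?thesis using that[of 1] by auto
  next
    case False
    have "\<exists>u\<in>S. \<forall>v\<in>S. Re (1 - char F u) \<le> Re (1 - char F v)"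
      by (rule continuous_attains_inf[OF _ False])
         (auto simp: S_def intro!: continuous_at_imp_continuous_on isCont_diff isCont_Re isCont_char)
    then show ?thesis using that pos by blast
  qed
  obtain C where C: "C > 0" "\<And>s t. 1 \<le> s \<Longrightarrow> s \<le> t \<Longrightarrow> a t \<le> C * (t / s) powr (1 / (\<alpha>/2)) * a s"
    using a_potter_upper[of "\<alpha>/2"] alpha_pos by auto
  define d where "d n = C * real (N n) powr (1 / (\<alpha>/2)) * a 1 * exp (- \<delta> * real (N n))" for n
  have "((\<lambda>x. x powr p * exp (- \<delta> * x)) \<longlongrightarrow> 0) at_top" for p :: real
    using \<delta>(1) by real_asymp
  from tendsto_mult_right_zero[OF this, of "C * a 1" "1 / (\<alpha>/2)"]
  have "((\<lambda>x. C * x powr (1 / (\<alpha>/2)) * a 1 * exp (- \<delta> * x)) \<longlongrightarrow> 0) at_top"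
    by (simp add: mult_ac)
  from filterlim_compose[OF this filterlim_compose[OF filterlim_real_sequentially N]]
  have "d \<longlonglongrightarrow> 0" unfolding d_def .
  moreover have "a (real (N n)) * norm (char (cpoisson F (t n)) \<theta>) \<le> d n" if th: "\<epsilon> < \<bar>\<theta>\<bar>" "\<bar>\<theta>\<bar> \<le> K" for n \<theta>
  proof -
    have tp: "t n > 0" using t[of n] by (smt (verit) of_nat_1 of_nat_mono)
    have "real (N n) * \<delta> \<le> t n * Re (1 - char F \<theta>)"
      using t[of n] \<delta> th by (intro mult_mono \<delta>(2) SI) auto
    then have "norm (char (cpoisson F (t n)) \<theta>) \<le> exp (- \<delta> * real (N n))"
      by (simp add: char_cpoisson[OF rdF tp] algebra_simps)
    moreover have "a (real (N n)) \<le> C * (real (N n) / 1) powr (1 / (\<alpha>/2)) * a 1"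
      using t(2)[of n] by (intro C) auto
    ultimately show ?thesis unfolding d_def using C by (intro mult_mono) auto
  qed
  ultimately show ?thesis by blast
qed

text \<open>With N = floor (s / W x) the scale b = a N satisfies x / b \<longrightarrow> y =
  s^(-1/\<alpha>) by \<open>a_asymp\<close>. Multiplying the local limit h * gc y of b times the
  mass by x / b gives the factor y.\<close>

lemma local_limit:
  assumes s: "s > 0"
  shows "((\<lambda>x. x * measure (cpoisson F (s / W x)) {x<..x + h}) \<longlongrightarrow> h * (s powr (- 1/\<alpha>) * gc (s powr (- 1/\<alpha>)))) at_top"
proof -
  define y where "y = s powr (- 1/\<alpha>)"
  define T where "T x = real (nat \<lfloor>s / W x\<rfloor>)" for x
  have T: "T x \<le> s / W x" "s / W x \<le> T x + 1" for x
    using s by (auto simp: T_def)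
  have "((\<lambda>x. T x * W x) \<longlongrightarrow> s) at_top"
  proof (rule tendsto_sandwich[where f = "\<lambda>x. s - W x" and h = "\<lambda>_. s"])
    show "((\<lambda>x. s - W x) \<longlongrightarrow> s) at_top"
      using tendsto_diff[OF tendsto_const tail_tendsto_0, of s] by simp
    show "eventually (\<lambda>x. s - W x \<le> T x * W x) at_top" "eventually (\<lambda>x. T x * W x \<le> s) at_top"
      using T tail_pos by (auto intro!: always_eventually simp: field_simps)
  qed simp
  from a_asymp[OF s this] have "((\<lambda>x. a (T x) / x) \<longlongrightarrow> s powr (1/\<alpha>)) at_top" .
  from tendsto_inverse[OF this] have x_a: "((\<lambda>x. x / a (T x)) \<longlongrightarrow> y) at_top"
    using s by (simp add: y_def powr_minus)
  have "filterlim (\<lambda>x. s / W x) at_top at_top"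
  proof -
    have "filterlim (\<lambda>x. inverse (W x)) at_top at_top"
      by (rule filterlim_inverse_at_top[OF tail_tendsto_0]) (simp add: tail_pos)
    from filterlim_tendsto_pos_mult_at_top[OF tendsto_const s this] show ?thesis by (simp add: divide_inverse)
  qed
  then have sW_top: "eventually (\<lambda>x. s / W x \<ge> k) at_top" for k by (auto simp: filterlim_at_top)
  obtain X0 where X0: "\<And>x. x \<ge> X0 \<Longrightarrow> s / W x \<ge> 1"
    using sW_top[of 1] by (auto simp: eventually_at_top_linorder)
  obtain \<epsilon> C where C: "\<epsilon> > 0" "\<epsilon> \<le> 1" "C > 0"
    "\<And>n s. n \<ge> 1 \<Longrightarrow> \<bar>s\<bar> \<le> \<epsilon> * a (real n) \<Longrightarrow> norm (char (conv_pow F n) (s / a (real n))) \<le> C / (1 + s\<^sup>2)"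
    "\<And>t n s. n \<ge> 1 \<Longrightarrow> t \<ge> real n \<Longrightarrow> \<bar>s\<bar> \<le> \<epsilon> * a (real n) \<Longrightarrow> norm (char (cpoisson F t) (s / a (real n))) \<le> C / (1 + s\<^sup>2)"
    using dominated_chars by blast
  show ?thesis unfolding y_def[symmetric]
  proof (rule tendsto_at_topI_sequentially)
    fix X0' :: "nat \<Rightarrow> real" assume X0': "filterlim X0' at_top sequentially"
    \<comment> \<open>The set-up asks for its bounds at every index, so the sequence is raised until
      s / W (X n) \<ge> 1; it agrees with the given one eventually.\<close>
    define X where "X n = max (X0' n) X0" for n
    have X: "filterlim X at_top sequentially"
      by (rule filterlim_at_top_mono[OF X0']) (simp add: X_def)
    have Xge: "s / W (X n) \<ge> 1" for n by (intro X0) (simp add: X_def)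
    define N where "N n = nat \<lfloor>s / W (X n)\<rfloor>" for n
    have N1: "N n \<ge> 1" for n using Xge[of n] by (simp add: N_def le_nat_floor)
    have TN: "T (X n) = real (N n)" for n by (simp add: T_def N_def)
    have N_top: "filterlim N at_top sequentially"
    proof -
      have "eventually (\<lambda>n. N n \<ge> k) sequentially" for k
        using eventually_compose_filterlim[OF sW_top[of "real k"] X]
        by eventually_elim (simp add: N_def le_nat_floor)
      then show ?thesis by (simp add: filterlim_at_top)
    qed
    define M where "M n = cpoisson F (s / W (X n))" for n
    define b where "b n = a (real (N n))" for n
    have xb: "(\<lambda>n. X n / b n) \<longlonglongrightarrow> y"
      using filterlim_compose[OF x_a X] by (simp add: TN b_def)
    have tN: "real (N n) \<le> s / W (X n)" "s / W (X n) \<le> real (N n) + 1" "s / W (X n) > 0" for n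
      using T[of "X n"] s tail_pos by (auto simp: TN)
    interpret LL: local_limit_setup M b X h \<epsilon> C y \<psi>
    proof (rule local_limit_setup.intro)
      show "real_distribution (M n)" for n unfolding M_def by (rule real_distribution_cpoisson[OF rdF])
      show "filterlim b at_top sequentially" unfolding b_def by (rule filterlim_compose[OF a_sequentially N_top])
      show "(\<lambda>n. char (M n) (s' / b n)) \<longlonglongrightarrow> \<psi> s'" for s'
        unfolding M_def b_def by (rule char_cpoisson_limit[OF N_top tN])
      show "norm (char (M n) (s' / b n)) \<le> C / (1 + s'\<^sup>2)" if "\<bar>s'\<bar> \<le> \<epsilon> * b n" for n s'
        unfolding M_def b_def using that N1[of n] tN(1)[of n] by (intro C) (auto simp: b_def)
    qed (use h_pos C xb in \<open>auto simp: b_def\<close>)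
    have "(\<lambda>n. b n * measure (M n) {X n<..X n + h}) \<longlonglongrightarrow> h * gc y"
    proof (cases "arithmetic F")
      case False
      show ?thesis
      proof (rule LL.local_limit_nonlattice)
        fix K
        show "\<exists>d. d \<longlonglongrightarrow> 0 \<and> (\<forall>n \<theta>. \<epsilon> < \<bar>\<theta>\<bar> \<longrightarrow> \<bar>\<theta>\<bar> \<le> K \<longrightarrow> b n * norm (char (M n) \<theta>) \<le> (d n :: real))"
          unfolding M_def b_def
        proof (rule char_away[OF C(1) _ N_top tN(1) N1])
          fix \<theta> assume "\<epsilon> \<le> \<bar>\<theta>\<bar>"
          then have "2 * pi / \<bar>\<theta>\<bar> > 0" using C(1) by simp
          then show "\<not> lattice_on F (2 * pi / \<bar>\<theta>\<bar>)" using False by (auto simp: arithmetic_def)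
        qed
      qed
    next
      case True
      then have sp: "lattice_on F h" "\<And>h'. h' > h \<Longrightarrow> \<not> lattice_on F h'" using h_span by (auto simp: is_span_def)
      have "\<exists>d. d \<longlonglongrightarrow> 0 \<and> (\<forall>n \<theta>. \<epsilon> < \<bar>\<theta>\<bar> \<longrightarrow> \<bar>\<theta>\<bar> \<le> pi / h \<longrightarrow> b n * norm (char (M n) \<theta>) \<le> (d n :: real))"
        unfolding M_def b_def
      proof (rule char_away[OF C(1) _ N_top tN(1) N1])
        fix \<theta> assume th: "\<epsilon> \<le> \<bar>\<theta>\<bar>" "\<bar>\<theta>\<bar> \<le> pi / h"
        then have "\<bar>\<theta>\<bar> > 0" using C(1) by simp
        moreover have "\<bar>\<theta>\<bar> * h \<le> pi" using th h_pos by (simp add: field_simps)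
        \<comment> \<open>Within one period 2 * pi / |\<theta>| is at least 2 * h, which exceeds the
          span, so \<open>F\<close> is not on that lattice.\<close>
        then have "\<bar>\<theta>\<bar> * h < 2 * pi" using pi_gt_zero by linarith
        ultimately show "\<not> lattice_on F (2 * pi / \<bar>\<theta>\<bar>)" by (intro sp(2)) (simp add: field_simps)
      qed
      then obtain d where d: "d \<longlonglongrightarrow> 0" "\<And>n \<theta>. \<epsilon> < \<bar>\<theta>\<bar> \<Longrightarrow> \<bar>\<theta>\<bar> \<le> pi / h \<Longrightarrow> b n * norm (char (M n) \<theta>) \<le> (d n :: real)"
        by blast
      show ?thesis
        by (rule LL.local_limit_lattice[OF _ d(1)], unfold M_def, rule AE_cpoisson_lattice[OF rdF sp(1)], fold M_def, rule d(2))
    qed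
    from tendsto_mult[OF xb this]
    have "(\<lambda>n. X n * measure (M n) {X n<..X n + h}) \<longlonglongrightarrow> h * (y * gc y)"
      by (simp add: mult_ac b_def)
    moreover have "eventually (\<lambda>n. X n * measure (M n) {X n<..X n + h} = X0' n * measure (cpoisson F (s / W (X0' n))) {X0' n<..X0' n + h}) sequentially"
    proof -
      have "eventually (\<lambda>n. X0' n \<ge> X0) sequentially" using X0' by (auto simp: filterlim_at_top)
      then show ?thesis by eventually_elim (simp add: X_def M_def max_def)
    qed
    ultimately show "(\<lambda>n. X0' n * measure (cpoisson F (s / W (X0' n))) {X0' n<..X0' n + h}) \<longlonglongrightarrow> h * (y * gc y)"
      by (rule Lim_transform_eventually)
  qed
qed

lemma psi_integrable: "integrable lborel \<psi>"
proof -
  obtain \<epsilon> C where C: "\<epsilon> > 0" "\<epsilon> \<le> 1" "C > 0"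
    "\<And>n s. n \<ge> 1 \<Longrightarrow> \<bar>s\<bar> \<le> \<epsilon> * a (real n) \<Longrightarrow> norm (char (conv_pow F n) (s / a (real n))) \<le> C / (1 + s\<^sup>2)"
    "\<And>t n s. n \<ge> 1 \<Longrightarrow> t \<ge> real n \<Longrightarrow> \<bar>s\<bar> \<le> \<epsilon> * a (real n) \<Longrightarrow> norm (char (cpoisson F t) (s / a (real n))) \<le> C / (1 + s\<^sup>2)"
    using dominated_chars by blast
  have Cint: "integrable lborel (\<lambda>s::real. C / (1 + s\<^sup>2))"
    using integrable_mult_right[OF integrable_inverse_1_plus_square[unfolded interval_lebesgue_integrable_def set_integrable_def], of C]
    by (simp add: field_simps)
  interpret G: real_distribution "density lborel g" by (rule rdG)
  have bound: "norm (\<psi> s) \<le> C / (1 + s\<^sup>2)" for s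
  proof (rule tendsto_upperbound[OF tendsto_norm[OF char_limit]])
    have "eventually (\<lambda>n. a (real n) \<ge> \<bar>s\<bar> / \<epsilon> \<and> n \<ge> 1) sequentially"
      using a_sequentially by (auto simp: filterlim_at_top intro!: eventually_conj eventually_ge_at_top)
    then show "eventually (\<lambda>n. norm (char F (s / a (real n)) ^ n) \<le> C / (1 + s\<^sup>2)) sequentially"
    proof eventually_elim
      case (elim n)
      then have "\<bar>s\<bar> \<le> \<epsilon> * a (real n)" using C(1) by (simp add: field_simps)
      then show ?case using C(4)[of n s] elim by (simp add: char_conv_pow[OF rdF])
    qed
  qed simp
  show ?thesis
    by (rule Bochner_Integration.integrable_bound[OF Cint]) (simp, rule AE_I2, rule order_trans[OF bound], simp only: real_norm_def abs_ge_self)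
qed

lemma gc_nonneg: "gc y \<ge> 0" and gc_AE: "AE y in lborel. g y = gc y"
  using char_inversion_density[OF g_meas g_nonneg g_prob psi_integrable] by auto

lemma gc_bounded: obtains B where "B > 0" "\<And>y. gc y \<le> B"
  using inv_fourier_bound[OF psi_integrable] that[of "(\<integral>t. norm (\<psi> t) \<partial>lborel) / (2 * pi) + 1"]
  by (smt (verit, best) Bochner_Integration.integral_nonneg divide_nonneg_pos norm_ge_zero pi_gt_zero)

lemma gc_isCont: "isCont gc y" by (rule isCont_inv_fourier[OF psi_integrable])

lemma gc_measurable [measurable]: "gc \<in> borel_measurable borel"
  using gc_isCont by (intro borel_measurable_continuous_onI) (simp add: continuous_at_imp_continuous_on)

lemma cpoisson_bound:
  obtains D where "D > 0" "\<And>t x. t \<ge> 1 \<Longrightarrow> measure (cpoisson F t) {x<..x+h} \<le> D / a t"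
proof -
  obtain D where D: "D > 0"
    "\<And>n x. n \<ge> 1 \<Longrightarrow> measure (conv_pow F n) {x-h..x+h} \<le> D / a (real n)"
    "\<And>n t x. n \<ge> 1 \<Longrightarrow> t \<ge> real n \<Longrightarrow> measure (cpoisson F t) {x-h..x+h} \<le> D / a (real n)"
    using local_concentration[OF h_pos] by blast
  obtain C where C: "C > 0" "\<And>s t. 1 \<le> s \<Longrightarrow> s \<le> t \<Longrightarrow> a t \<le> C * (t / s) powr (1 / (\<alpha>/2)) * a s"
    using a_potter_upper[of "\<alpha>/2"] alpha_pos by auto
  define E where "E = C * 2 powr (1 / (\<alpha>/2))"
  have E: "E > 0" using C by (simp add: E_def)
  show ?thesis
  proof (rule that[of "D * E"])
    show "D * E > 0" using D E by simp
    fix t x :: real assume t: "t \<ge> 1"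
    define n where "n = nat \<lfloor>t\<rfloor>"
    have n: "n \<ge> 1" "real n \<le> t" "t \<le> real n + 1" using t by (auto simp: n_def le_nat_floor)
    interpret P: real_distribution "cpoisson F t" by (rule real_distribution_cpoisson[OF rdF])
    have "measure (cpoisson F t) {x<..x+h} \<le> measure (cpoisson F t) {x-h..x+h}"
      using h_pos by (intro P.finite_measure_mono) auto
    also have "\<dots> \<le> D / a (real n)" by (rule D(3)[OF n(1,2)])
    also have "\<dots> \<le> D * E / a t"
    proof -
      have "a t \<le> C * (t / real n) powr (1 / (\<alpha>/2)) * a (real n)" using n by (intro C) auto
      also have "\<dots> \<le> E * a (real n)" unfolding E_def
        using C n alpha_pos by (intro mult_right_mono mult_left_mono powr_mono2) (auto simp: divide_le_eq)
      finally have "D * a t \<le> D * (E * a (real n))" using D by (intro mult_left_mono) auto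
      then show ?thesis by (simp add: field_simps)
    qed
    finally show "measure (cpoisson F t) {x<..x+h} \<le> D * E / a t" .
  qed
qed

end

lemma (in heavy_tail) recip_tail_at_top: "filterlim (\<lambda>x. s / W x) at_top at_top" if "s > 0"
proof -
  have "filterlim (\<lambda>x. inverse (W x)) at_top at_top"
    by (rule filterlim_inverse_at_top[OF tail_tendsto_0]) (simp add: tail_pos)
  from filterlim_tendsto_pos_mult_at_top[OF tendsto_const that this] show ?thesis by (simp add: divide_inverse)
qed

context stable_renewal
begin

section \<open>The renewal measure as an integral over Poisson time\<close>

text \<open>Spelled out as a series so that measurability in t is visible; it agrees with the
  compound Poisson mass for t > 0.\<close>

definition pois_mass :: "real \<Rightarrow> real \<Rightarrow> ennreal" where
  "pois_mass x t = (\<Sum>k. ennreal (t ^ k / fact k * exp (- t)) * emeasure (conv_pow F k) {x<..x+h})"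

lemma pois_mass_measurable [measurable]: "pois_mass x \<in> borel_measurable borel"
  unfolding pois_mass_def by measurable

lemma pois_mass_eq: "t > 0 \<Longrightarrow> pois_mass x t = emeasure (cpoisson F t) {x<..x+h}"
  unfolding pois_mass_def by (subst emeasure_cpoisson[OF rdF]) auto

lemma pois_mass_eq_measure: "t > 0 \<Longrightarrow> pois_mass x t = ennreal (measure (cpoisson F t) {x<..x+h})"
proof -
  assume t: "t > 0"
  interpret P: real_distribution "cpoisson F t" by (rule real_distribution_cpoisson[OF rdF])
  show ?thesis using t by (simp add: pois_mass_eq P.emeasure_eq_measure)
qed

lemma nn_integral_poisson_weight:
  "(\<integral>\<^sup>+t. ennreal (t ^ k / fact k * exp (- t)) * indicator {0<..} t \<partial>lborel) = 1"
proof -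
  interpret E: prob_space "density lborel (erlang_density k 1)" by (rule prob_space_erlang_density) simp
  have "(\<integral>\<^sup>+t. ennreal (t ^ k / fact k * exp (- t)) * indicator {0<..} t \<partial>lborel) = (\<integral>\<^sup>+t. ennreal (erlang_density k 1 t) \<partial>lborel)"
  proof (rule nn_integral_cong_AE)
    have "AE t in lborel. t \<noteq> (0::real)" by (rule AE_lborel_singleton)
    then show "AE t in lborel. ennreal (t ^ k / fact k * exp (- t)) * indicator {0<..} t = ennreal (erlang_density k 1 t)"
      by eventually_elim (auto simp: erlang_density_def indicator_def)
  qed
  also have "\<dots> = emeasure (density lborel (erlang_density k 1)) (space (density lborel (erlang_density k 1)))"
    by (simp add: emeasure_density)
  also have "\<dots> = 1" by (rule E.emeasure_space_1)
  finally show ?thesis .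
qed

lemma renewal_eq: "renewal_I F h x = (\<integral>\<^sup>+t. pois_mass x t * indicator {0<..} t \<partial>lborel)"
proof -
  have "(\<integral>\<^sup>+t. pois_mass x t * indicator {0<..} t \<partial>lborel)
    = (\<integral>\<^sup>+t. (\<Sum>k. (ennreal (t ^ k / fact k * exp (- t)) * indicator {0<..} t) * emeasure (conv_pow F k) {x<..x+h}) \<partial>lborel)"
    unfolding pois_mass_def
    by (intro nn_integral_cong) (simp add: ennreal_suminf_multc[symmetric] mult_ac)
  also have "\<dots> = (\<Sum>k. \<integral>\<^sup>+t. (ennreal (t ^ k / fact k * exp (- t)) * indicator {0<..} t) * emeasure (conv_pow F k) {x<..x+h} \<partial>lborel)"
    by (rule nn_integral_suminf) measurable
  also have "\<dots> = (\<Sum>k. emeasure (conv_pow F k) {x<..x+h})"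
  proof (rule suminf_cong)
    fix k
    have "(\<integral>\<^sup>+t. (ennreal (t ^ k / fact k * exp (- t)) * indicator {0<..} t) * emeasure (conv_pow F k) {x<..x+h} \<partial>lborel)
      = (\<integral>\<^sup>+t. ennreal (t ^ k / fact k * exp (- t)) * indicator {0<..} t \<partial>lborel) * emeasure (conv_pow F k) {x<..x+h}"
      by (rule nn_integral_multc) measurable
    then show "(\<integral>\<^sup>+t. (ennreal (t ^ k / fact k * exp (- t)) * indicator {0<..} t) * emeasure (conv_pow F k) {x<..x+h} \<partial>lborel)
      = emeasure (conv_pow F k) {x<..x+h}"
      by (simp only: nn_integral_poisson_weight mult_1)
  qed
  finally show ?thesis by (simp add: renewal_I_def)
qed

text \<open>A Chernoff bound, and the origin of the constant 4: for k > 4 * \<tau> one has exp (4 *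
  \<tau>) \<le> exp k \<le> 3^k, so \<tau>^k is at most exp (- 4 * \<tau>) * (3 * \<tau>)^k, and the
  exponential series sums to exp (- 4 * \<tau> + 3 * \<tau>).\<close>

lemma poisson_weight_tail:
  assumes t: "0 \<le> \<tau>"
  shows "(\<Sum>k. if real k \<le> 4 * \<tau> then 0 else \<tau> ^ k / fact k) \<le> exp (- \<tau>)" "summable (\<lambda>k. if real k \<le> 4 * \<tau> then 0 else \<tau> ^ k / fact k)"
proof -
  have le: "(if real k \<le> 4 * \<tau> then 0 else \<tau> ^ k / fact k) \<le> exp (- (4 * \<tau>)) * ((3 * \<tau>) ^ k /\<^sub>R fact k)" for k :: nat
  proof (cases "real k \<le> 4 * \<tau>")
    case False
    have "exp (4 * \<tau>) \<le> exp (real k)" using False by simp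
    also have "\<dots> = exp 1 ^ k" by (simp add: exp_of_nat_mult[symmetric])
    also have "\<dots> \<le> 3 ^ k" using exp_le by (intro power_mono) auto
    finally have "\<tau> ^ k * exp (4 * \<tau>) \<le> \<tau> ^ k * 3 ^ k" using t by (intro mult_left_mono) auto
    then have "\<tau> ^ k \<le> exp (- (4 * \<tau>)) * (3 * \<tau>) ^ k"
      by (simp add: exp_minus field_simps power_mult_distrib)
    then have "\<tau> ^ k / fact k \<le> exp (- (4 * \<tau>)) * (3 * \<tau>) ^ k / fact k" by (rule divide_right_mono) simp
    then show ?thesis using False by (simp add: divide_inverse mult_ac)
  qed (use t in simp)
  have s: "(\<lambda>k. exp (- (4 * \<tau>)) * ((3 * \<tau>) ^ k /\<^sub>R fact k)) sums (exp (- (4 * \<tau>)) * exp (3 * \<tau>))"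
    by (intro sums_mult exp_converges)
  show sm: "summable (\<lambda>k. if real k \<le> 4 * \<tau> then 0 else \<tau> ^ k / fact k)"
    by (rule summable_comparison_test'[OF sums_summable[OF s], of 0]) (use le t in auto)
  have "(\<Sum>k. if real k \<le> 4 * \<tau> then 0 else \<tau> ^ k / fact k) \<le> (\<Sum>k. exp (- (4 * \<tau>)) * ((3 * \<tau>) ^ k /\<^sub>R fact k))"
    by (rule suminf_le[OF le sm sums_summable[OF s]])
  also have "\<dots> = exp (- (4 * \<tau>)) * exp (3 * \<tau>)" using s by (rule sums_unique[symmetric])
  also have "\<dots> = exp (- \<tau>)" by (simp add: exp_add[symmetric])
  finally show "(\<Sum>k. if real k \<le> 4 * \<tau> then 0 else \<tau> ^ k / fact k) \<le> exp (- \<tau>)" .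
qed

text \<open>Up to time \<tau> a Poisson clock rarely makes more than 4 * \<tau> jumps. For k \<le> 4
  * \<tau> the weight integrates to at most 1 over all times; for larger k the convolution mass is
  bounded by 1 and the weights sum to an exponentially small error.\<close>

lemma small_time_bound:
  assumes \<tau>: "\<tau> \<ge> 0"
  shows "(\<integral>\<^sup>+t. pois_mass x t * indicator {0<..\<tau>} t \<partial>lborel)
    \<le> (\<Sum>k\<in>{k. real k \<le> 4 * \<tau>}. emeasure (conv_pow F k) {x<..x+h}) + ennreal (\<tau> * exp (- \<tau>))"
proof -
  let ?e = "\<lambda>k. emeasure (conv_pow F k) {x<..x+h}"
  let ?w = "\<lambda>k. (\<integral>\<^sup>+t. ennreal (t ^ k / fact k * exp (- t)) * indicator {0<..\<tau>} t \<partial>lborel)"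
  have fin: "finite {k::nat. real k \<le> 4 * \<tau>}"
    by (rule finite_subset[of _ "{..nat \<lceil>4 * \<tau>\<rceil>}"]) (auto simp: le_nat_iff, linarith)
  have e1: "?e k \<le> 1" for k
    using prob_space.emeasure_le_1[OF real_distribution.axioms(1)[OF real_distribution_conv_pow[OF rdF]]] .
  have w1: "?w k \<le> 1" for k
    using nn_integral_poisson_weight[of k]
    by (rule ord_le_eq_trans[rotated]) (auto intro!: nn_integral_mono simp: indicator_def)
  have w2: "?w k \<le> ennreal (\<tau> * (\<tau> ^ k / fact k))" for k
  proof -
    have "?w k \<le> (\<integral>\<^sup>+t. ennreal (\<tau> ^ k / fact k) * indicator {0<..\<tau>} t \<partial>lborel)"
    proof (rule nn_integral_mono)
      fix t :: real
      show "ennreal (t ^ k / fact k * exp (- t)) * indicator {0<..\<tau>} t \<le> ennreal (\<tau> ^ k / fact k) * indicator {0<..\<tau>} t"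
      proof (cases "t \<in> {0<..\<tau>}")
        case True
        have "t ^ k / fact k * exp (- t) \<le> \<tau> ^ k / fact k * 1"
          using True by (intro mult_mono divide_right_mono power_mono) auto
        then show ?thesis using True by (simp add: ennreal_leI)
      qed simp
    qed
    also have "\<dots> = ennreal (\<tau> ^ k / fact k) * ennreal \<tau>" using \<tau> by (simp add: nn_integral_cmult_indicator)
    also have "\<dots> = ennreal (\<tau> * (\<tau> ^ k / fact k))" using \<tau> by (subst ennreal_mult[symmetric]) (auto simp: mult_ac)
    finally show ?thesis .
  qed
  have "(\<integral>\<^sup>+t. pois_mass x t * indicator {0<..\<tau>} t \<partial>lborel)
    = (\<integral>\<^sup>+t. (\<Sum>k. (ennreal (t ^ k / fact k * exp (- t)) * indicator {0<..\<tau>} t) * ?e k) \<partial>lborel)"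
    unfolding pois_mass_def
    by (intro nn_integral_cong) (simp add: ennreal_suminf_multc[symmetric] mult_ac)
  also have "\<dots> = (\<Sum>k. \<integral>\<^sup>+t. (ennreal (t ^ k / fact k * exp (- t)) * indicator {0<..\<tau>} t) * ?e k \<partial>lborel)"
    by (rule nn_integral_suminf) measurable
  also have "\<dots> = (\<Sum>k. ?w k * ?e k)"
    by (subst nn_integral_multc) auto
  also have "\<dots> \<le> (\<Sum>k. (if real k \<le> 4 * \<tau> then ?e k else 0) + ennreal \<tau> * ennreal (if real k \<le> 4 * \<tau> then 0 else \<tau> ^ k / fact k))"
  proof (intro suminf_le)
    fix k
    show "?w k * ?e k \<le> (if real k \<le> 4 * \<tau> then ?e k else 0) + ennreal \<tau> * ennreal (if real k \<le> 4 * \<tau> then 0 else \<tau> ^ k / fact k)"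
    proof (cases "real k \<le> 4 * \<tau>")
      case True
      then show ?thesis using mult_right_mono[OF w1[of k], of "?e k"] by simp
    next
      case False
      have "?w k * ?e k \<le> ennreal (\<tau> * (\<tau> ^ k / fact k)) * 1" using w2 e1 by (intro mult_mono) auto
      also have "\<dots> = ennreal \<tau> * ennreal (\<tau> ^ k / fact k)" using \<tau> by (subst ennreal_mult[symmetric]) auto
      finally show ?thesis using False by simp
    qed
  qed auto
  also have "\<dots> = (\<Sum>k. if real k \<le> 4 * \<tau> then ?e k else 0) + (\<Sum>k. ennreal \<tau> * ennreal (if real k \<le> 4 * \<tau> then 0 else \<tau> ^ k / fact k))"
    by (rule suminf_add[symmetric]) auto
  also have "(\<Sum>k. if real k \<le> 4 * \<tau> then ?e k else 0) = (\<Sum>k\<in>{k. real k \<le> 4 * \<tau>}. ?e k)"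
  proof -
    have "(\<Sum>k. if real k \<le> 4 * \<tau> then ?e k else 0) = (\<Sum>k\<in>{k. real k \<le> 4 * \<tau>}. if real k \<le> 4 * \<tau> then ?e k else 0)"
      by (rule suminf_finite[OF fin]) auto
    then show ?thesis by simp
  qed
  also have "(\<Sum>k. ennreal \<tau> * ennreal (if real k \<le> 4 * \<tau> then 0 else \<tau> ^ k / fact k)) = ennreal \<tau> * ennreal (\<Sum>k. if real k \<le> 4 * \<tau> then 0 else \<tau> ^ k / fact k)"
    using \<tau> by (simp only: ennreal_suminf_cmult) (subst suminf_ennreal2, auto intro: poisson_weight_tail(2))
  also have "\<dots> \<le> ennreal \<tau> * ennreal (exp (- \<tau>))"
    using poisson_weight_tail(1)[OF \<tau>] by (intro mult_left_mono ennreal_leI) auto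
  also have "\<dots> = ennreal (\<tau> * exp (- \<tau>))" using \<tau> by (simp add: ennreal_mult)
  finally show ?thesis by (simp add: add_mono)
qed

text \<open>By \<open>local_limit\<close>, h times this is the limit of x times the mass of (x, x +
  h] at Poisson time s / W x.\<close>

definition kern :: "real \<Rightarrow> real" where "kern s = s powr (- 1/\<alpha>) * gc (s powr (- 1/\<alpha>))"

lemma kern_measurable [measurable]: "kern \<in> borel_measurable borel"
  unfolding kern_def by measurable

lemma kern_nonneg: "kern s \<ge> 0" unfolding kern_def using gc_nonneg by simp

text \<open>After the substitution t = s / W x this is dominated convergence in s. The majorant
  follows from the concentration bound D / a t and the growth of \<open>a\<close> relative to its
  value at \<delta> / W x, which is comparable to x.\<close>

lemma large_time_limit:
  assumes \<delta>: "\<delta> > 0"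
  shows "((\<lambda>x. ennreal (x * W x) * (\<integral>\<^sup>+t. pois_mass x t * indicator {\<delta> / W x<..} t \<partial>lborel)) \<longlongrightarrow> ennreal (h * (\<integral>s. indicator {\<delta><..} s * kern s \<partial>lborel))) at_top"
    and "integrable lborel (\<lambda>s. indicator {\<delta><..} s * kern s)"
proof -
  \<comment> \<open>With \<alpha> < \<beta> < 1 the function \<open>a\<close> grows at least like
    the power 1 / \<beta> > 1, so s^(-1/\<beta>) is integrable at infinity.\<close>
  define \<beta> where "\<beta> = (1 + \<alpha>) / 2"
  have b: "\<alpha> < \<beta>" "\<beta> < 1" "\<beta> > 0" using alpha_less_1 alpha_pos by (auto simp: \<beta>_def)
  obtain C where C: "C > 0" "\<And>s t. 1 \<le> s \<Longrightarrow> s \<le> t \<Longrightarrow> (t / s) powr (1 / \<beta>) * a s \<le> C * a t"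
    using a_potter_lower[OF b(1)] by blast
  obtain D where D: "D > 0" "\<And>t x. t \<ge> 1 \<Longrightarrow> measure (cpoisson F t) {x<..x+h} \<le> D / a t"
    using cpoisson_bound by blast
  have "((\<lambda>x. \<delta> / W x * W x) \<longlongrightarrow> \<delta>) at_top"
    using tail_pos by (auto intro!: tendsto_eventually always_eventually simp: less_imp_neq[THEN not_sym])
  from a_asymp[OF \<delta> this] have a_lim: "((\<lambda>x. a (\<delta> / W x) / x) \<longlongrightarrow> \<delta> powr (1/\<alpha>)) at_top" .
  define m where "m = \<delta> powr (1/\<alpha>) / 2"
  have m: "m > 0" "m < \<delta> powr (1/\<alpha>)" using \<delta> by (auto simp: m_def)
  define B where "B = D * C / m * \<delta> powr (1/\<beta>)"
  have evb: "eventually (\<lambda>x. \<forall>s>\<delta>. x * measure (cpoisson F (s / W x)) {x<..x+h} \<le> B * s powr (- (1/\<beta>))) at_top"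
    using order_tendstoD(1)[OF a_lim m(2)] recip_tail_at_top[OF \<delta>, unfolded filterlim_at_top, rule_format, of 1] eventually_gt_at_top[of 0]
  proof eventually_elim
    case (elim x)
    show ?case
    proof (intro allI impI)
      fix s assume s: "s > \<delta>"
      have sd: "\<delta> / W x \<le> s / W x" using s tail_pos[of x] by (intro divide_right_mono) auto
      have "x * measure (cpoisson F (s / W x)) {x<..x+h} \<le> x * (D / a (s / W x))"
        using elim sd by (intro mult_left_mono D) auto
      also have "\<dots> \<le> x * (D * C / ((s / \<delta>) powr (1/\<beta>) * a (\<delta> / W x)))"
      proof (intro mult_left_mono)
        have "(s / W x / (\<delta> / W x)) powr (1 / \<beta>) * a (\<delta> / W x) \<le> C * a (s / W x)"
          using elim sd by (intro C) auto
        then have "(s / \<delta>) powr (1/\<beta>) * a (\<delta> / W x) \<le> C * a (s / W x)" using tail_pos[of x] by simp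
        then have "D * ((s / \<delta>) powr (1/\<beta>) * a (\<delta> / W x)) \<le> D * (C * a (s / W x))" using D by (intro mult_left_mono) auto
        then show "D / a (s / W x) \<le> D * C / ((s / \<delta>) powr (1/\<beta>) * a (\<delta> / W x))"
          using s \<delta> by (simp add: field_simps)
      qed (use elim in simp)
      also have "\<dots> = D * C / (s / \<delta>) powr (1/\<beta>) * (x / a (\<delta> / W x))" by simp
      also have "\<dots> \<le> D * C / (s / \<delta>) powr (1/\<beta>) * (1 / m)"
        using elim m D C s \<delta> by (intro mult_left_mono) (auto simp: field_simps)
      also have "\<dots> = B * s powr (- (1/\<beta>))"
        using s \<delta> by (simp add: B_def powr_divide powr_minus field_simps)
      finally show "x * measure (cpoisson F (s / W x)) {x<..x+h} \<le> B * s powr (- (1/\<beta>))" .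
    qed
  qed
  have wint: "integrable lborel (\<lambda>s. indicator {\<delta><..} s * (B * s powr (- (1/\<beta>))))"
  proof -
    have "(\<lambda>s. s powr (- (1/\<beta>))) integrable_on {\<delta>..}"
      using has_integral_powr_to_inf[of "- (1/\<beta>)" \<delta>] b \<delta> by (auto simp: has_integral_integrable_integral)
    then have "(\<lambda>s. s powr (- (1/\<beta>))) absolutely_integrable_on {\<delta>..}"
      by (intro nonnegative_absolutely_integrable_1) auto
    then have "set_integrable lebesgue {\<delta>..} (\<lambda>s. s powr (- (1/\<beta>)))" .
    then have "integrable lebesgue (\<lambda>s. indicator {\<delta>..} s *\<^sub>R s powr (- (1/\<beta>)))" by (simp add: set_integrable_def)
    then have "integrable lborel (\<lambda>s. indicator {\<delta>..} s *\<^sub>R s powr (- (1/\<beta>)))"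
      by (subst (asm) integrable_completion) auto
    from integrable_mult_right[OF this, of B]
    show ?thesis
      by (rule Bochner_Integration.integrable_bound) (auto simp: indicator_def)
  qed
  define q where "q x s = indicator {\<delta><..} s * (x * enn2real (pois_mass x (s / W x)))" for x s
  have q_eq: "q x s = indicator {\<delta><..} s * (x * measure (cpoisson F (s / W x)) {x<..x+h})" for x s
  proof (cases "s > \<delta>")
    case True
    then have "s / W x > 0" using \<delta> tail_pos[of x] by simp
    then show ?thesis by (simp add: q_def pois_mass_eq_measure)
  qed (simp add: q_def)
  have [measurable]: "q x \<in> borel_measurable borel" for x unfolding q_def by measurable
  have lim: "((\<lambda>x. q x s) \<longlongrightarrow> h * (indicator {\<delta><..} s * kern s)) at_top" for s
  proof (cases "s > \<delta>")
    case True
    then show ?thesis using local_limit[of s] \<delta> by (simp add: q_eq kern_def)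
  next
    case False then show ?thesis by (simp add: q_eq)
  qed
  have qb: "eventually (\<lambda>x. AE s in lborel. norm (q x s) \<le> indicator {\<delta><..} s * (B * s powr (- (1/\<beta>)))) at_top"
    using evb eventually_gt_at_top[of 0]
    by eventually_elim (auto intro!: AE_I2 simp: q_eq indicator_def)
  have lim_int: "((\<lambda>x. \<integral>s. q x s \<partial>lborel) \<longlongrightarrow> (\<integral>s. h * (indicator {\<delta><..} s * kern s) \<partial>lborel)) at_top"
    by (rule integral_dominated_convergence_at_top[OF _ _ wint _ qb]) (auto intro: lim)
  have ki: "integrable lborel (\<lambda>s. h * (indicator {\<delta><..} s * kern s))"
    by (rule integrable_dominated_convergence_at_top[OF _ _ wint _ qb]) (auto intro: lim)
  have "integrable lborel (\<lambda>s. 1 / h * (h * (indicator {\<delta><..} s * kern s)))" by (rule integrable_mult_right[OF ki])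
  then show "integrable lborel (\<lambda>s. indicator {\<delta><..} s * kern s)" using h_pos by simp
  have "eventually (\<lambda>x. ennreal (\<integral>s. q x s \<partial>lborel) = ennreal (x * W x) * (\<integral>\<^sup>+t. pois_mass x t * indicator {\<delta> / W x<..} t \<partial>lborel)) at_top"
    using qb eventually_gt_at_top[of 0]
  proof eventually_elim
    case (elim x)
    have W: "W x > 0" by (rule tail_pos)
    have qi: "integrable lborel (q x)"
      by (rule Bochner_Integration.integrable_bound[OF wint]) (use elim in \<open>auto elim!: eventually_mono intro: order_trans[OF _ abs_ge_self]\<close>)
    have "(\<integral>\<^sup>+t. pois_mass x t * indicator {\<delta> / W x<..} t \<partial>lborel)
      = ennreal \<bar>1 / W x\<bar> * (\<integral>\<^sup>+s. pois_mass x (0 + 1 / W x * s) * indicator {\<delta> / W x<..} (0 + 1 / W x * s) \<partial>lborel)"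
      using W by (intro nn_integral_real_affine) auto
    also have "(\<integral>\<^sup>+s. pois_mass x (0 + 1 / W x * s) * indicator {\<delta> / W x<..} (0 + 1 / W x * s) \<partial>lborel)
      = (\<integral>\<^sup>+s. pois_mass x (s / W x) * indicator {\<delta><..} s \<partial>lborel)"
      using W by (intro nn_integral_cong) (auto simp: indicator_def field_simps)
    finally have 1: "(\<integral>\<^sup>+t. pois_mass x t * indicator {\<delta> / W x<..} t \<partial>lborel) = ennreal (1 / W x) * (\<integral>\<^sup>+s. pois_mass x (s / W x) * indicator {\<delta><..} s \<partial>lborel)"
      using W by simp
    have "ennreal (x * W x) * (\<integral>\<^sup>+t. pois_mass x t * indicator {\<delta> / W x<..} t \<partial>lborel) = ennreal x * (\<integral>\<^sup>+s. pois_mass x (s / W x) * indicator {\<delta><..} s \<partial>lborel)"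
      unfolding 1 mult.assoc[symmetric] using W elim(2) by (subst ennreal_mult[symmetric]) auto
    also have "\<dots> = (\<integral>\<^sup>+s. ennreal x * (pois_mass x (s / W x) * indicator {\<delta><..} s) \<partial>lborel)"
      by (rule nn_integral_cmult[symmetric]) measurable
    also have "\<dots> = (\<integral>\<^sup>+s. ennreal (q x s) \<partial>lborel)"
    proof (rule nn_integral_cong)
      fix s :: real
      show "ennreal x * (pois_mass x (s / W x) * indicator {\<delta><..} s) = ennreal (q x s)"
      proof (cases "s > \<delta>")
        case True
        then have "s / W x > 0" using \<delta> W by simp
        then show ?thesis using True elim(2) by (simp add: q_eq pois_mass_eq_measure ennreal_mult)
      qed (simp add: q_eq)
    qed
    also have "\<dots> = ennreal (\<integral>s. q x s \<partial>lborel)"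
      by (rule nn_integral_eq_integral[OF qi]) (use elim(2) in \<open>auto simp: q_eq\<close>)
    finally show ?case ..
  qed
  from Lim_transform_eventually[OF tendsto_ennrealI[OF lim_int] this]
  show "((\<lambda>x. ennreal (x * W x) * (\<integral>\<^sup>+t. pois_mass x t * indicator {\<delta> / W x<..} t \<partial>lborel)) \<longlongrightarrow> ennreal (h * (\<integral>s. indicator {\<delta><..} s * kern s \<partial>lborel))) at_top"
    by simp
qed

end

section \<open>Truncation and a single big jump\<close>

lemma finite_measure_conv_pow:
  assumes "finite_measure M" and [simp, measurable_cong]: "sets M = sets borel"
  shows "finite_measure (conv_pow M n)"
proof (induction n)
  case 0
  show ?case using prob_space_return[of 0 borel] by (auto simp: prob_space_def)
next
  case (Suc n) then show ?case using assms by (auto intro!: convolution_finite)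
qed

lemma convolution_return_0:
  assumes "finite_measure N" and [simp, measurable_cong]: "sets N = sets borel"
  shows "convolution (return borel (0::real)) N = N"
proof (rule measure_eqI)
  fix A assume "A \<in> sets (convolution (return borel (0::real)) N)"
  then have [measurable]: "A \<in> sets borel" by simp
  have "finite_measure (return borel (0::real))" using prob_space_return[of 0 borel] by (auto simp: prob_space_def)
  then have "emeasure (convolution (return borel 0) N) A = (\<integral>\<^sup>+x. (\<integral>\<^sup>+y. indicator A (x + y) \<partial>N) \<partial>return borel 0)"
    using assms by (intro convolution_emeasure') auto
  also have "\<dots> = (\<integral>\<^sup>+y. indicator A (0 + y) \<partial>N)"
    using finite_measure.sigma_finite_measure[OF assms(1)]
    by (intro nn_integral_return) (auto intro!: sigma_finite_measure.borel_measurable_nn_integral simp: split_beta')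
  also have "\<dots> = emeasure N A" by simp
  finally show "emeasure (convolution (return borel 0) N) A = emeasure N A" .
qed simp

lemma conv_pow_add:
  assumes fm: "finite_measure M" and [simp, measurable_cong]: "sets M = sets borel"
  shows "conv_pow M (k + l) = convolution (conv_pow M k) (conv_pow M l)"
proof (induction k)
  case 0
  then show ?case using convolution_return_0[OF finite_measure_conv_pow[OF assms]] by simp
next
  case (Suc k)
  then show ?case using finite_measure_conv_pow[OF assms] fm by (simp add: convolution_associative)
qed

lemma nn_integral_conv_pow_Suc:
  assumes "finite_measure M" "sets M = sets borel" "f \<in> borel_measurable borel"
  shows "(\<integral>\<^sup>+u. f u \<partial>conv_pow M (Suc n)) = (\<integral>\<^sup>+x. (\<integral>\<^sup>+y. f (x + y) \<partial>conv_pow M n) \<partial>M)"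
  using assms finite_measure_conv_pow[OF assms(1,2)] by (simp add: nn_integral_convolution)

context heavy_tail
begin

text \<open>Unnormalized restrictions of \<open>F\<close>: they add up to \<open>F\<close>, and
  convolution powers of the lower part are exactly the part of the convolution power where no jump
  exceeds c. Negative jumps are left uncut.\<close>

definition lowpart :: "real \<Rightarrow> real measure" where "lowpart c = density F (indicator {..c})"
definition highpart :: "real \<Rightarrow> real measure" where "highpart c = density F (indicator {c<..})"

lemma sets_parts [simp, measurable_cong]: "sets (lowpart c) = sets borel" "sets (highpart c) = sets borel"
  by (simp_all add: lowpart_def highpart_def)

lemma nn_integral_parts:
  assumes [measurable]: "f \<in> borel_measurable borel"
  shows "(\<integral>\<^sup>+x. f x \<partial>lowpart c) = (\<integral>\<^sup>+x. indicator {..c} x * f x \<partial>F)"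
    "(\<integral>\<^sup>+x. f x \<partial>highpart c) = (\<integral>\<^sup>+x. indicator {c<..} x * f x \<partial>F)"
    "(\<integral>\<^sup>+x. f x \<partial>F) = (\<integral>\<^sup>+x. f x \<partial>lowpart c) + (\<integral>\<^sup>+x. f x \<partial>highpart c)"
proof -
  show 1: "(\<integral>\<^sup>+x. f x \<partial>lowpart c) = (\<integral>\<^sup>+x. indicator {..c} x * f x \<partial>F)"
    unfolding lowpart_def by (rule nn_integral_density) auto
  show 2: "(\<integral>\<^sup>+x. f x \<partial>highpart c) = (\<integral>\<^sup>+x. indicator {c<..} x * f x \<partial>F)"
    unfolding highpart_def by (rule nn_integral_density) auto
  show "(\<integral>\<^sup>+x. f x \<partial>F) = (\<integral>\<^sup>+x. f x \<partial>lowpart c) + (\<integral>\<^sup>+x. f x \<partial>highpart c)"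
    unfolding 1 2 by (subst nn_integral_add[symmetric]) (auto intro!: nn_integral_cong simp: indicator_def)
qed

lemma finite_parts: "finite_measure (lowpart c)" "finite_measure (highpart c)"
proof -
  have "(\<integral>\<^sup>+x. 1 \<partial>lowpart c) + (\<integral>\<^sup>+x. 1 \<partial>highpart c) = (\<integral>\<^sup>+x. 1 \<partial>F)" by (rule nn_integral_parts(3)[symmetric]) simp
  also have "\<dots> = 1" using emeasure_space_1 by simp
  finally have "emeasure (lowpart c) (space (lowpart c)) + emeasure (highpart c) (space (highpart c)) = 1" by simp
  then have "emeasure (lowpart c) (space (lowpart c)) \<noteq> \<infinity>" "emeasure (highpart c) (space (highpart c)) \<noteq> \<infinity>"
    by (auto simp: top_unique)
  then show "finite_measure (lowpart c)" "finite_measure (highpart c)" by (auto intro: finite_measureI)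
qed

lemma finite_conv_pow_F: "finite_measure (conv_pow F n)"
  by (rule finite_measure_conv_pow[OF finite_measure_axioms F_sets])

lemma nn_integral_shift_measurable [measurable]:
  assumes [measurable]: "f \<in> borel_measurable borel"
  shows "(\<lambda>x::real. \<integral>\<^sup>+y. f (x + y) \<partial>conv_pow F n) \<in> borel_measurable borel"
proof -
  interpret K: sigma_finite_measure "conv_pow F n" by (rule finite_measure.sigma_finite_measure[OF finite_conv_pow_F])
  show ?thesis by (rule sigma_finite_measure.borel_measurable_nn_integral[OF K.sigma_finite_measure_axioms]) (simp add: split_beta', measurable)
qed

lemma nn_integral_lowpart_le:
  assumes [measurable]: "f \<in> borel_measurable borel"
  shows "(\<integral>\<^sup>+x. f x \<partial>conv_pow (lowpart c) n) \<le> (\<integral>\<^sup>+x. f x \<partial>conv_pow F n)"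
  using assms
proof (induction n arbitrary: f)
  case (Suc n)
  note [measurable] = Suc.prems
  have "(\<integral>\<^sup>+u. f u \<partial>conv_pow (lowpart c) (Suc n)) = (\<integral>\<^sup>+x. (\<integral>\<^sup>+y. f (x + y) \<partial>conv_pow (lowpart c) n) \<partial>lowpart c)"
    by (rule nn_integral_conv_pow_Suc[OF finite_parts(1)]) auto
  also have "\<dots> \<le> (\<integral>\<^sup>+x. (\<integral>\<^sup>+y. f (x + y) \<partial>conv_pow F n) \<partial>lowpart c)"
    by (intro nn_integral_mono Suc.IH) measurable
  also have "\<dots> \<le> (\<integral>\<^sup>+x. (\<integral>\<^sup>+y. f (x + y) \<partial>conv_pow F n) \<partial>F)"
    by (subst nn_integral_parts(3)[of _ c]) auto
  also have "\<dots> = (\<integral>\<^sup>+u. f u \<partial>conv_pow F (Suc n))"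
    by (rule nn_integral_conv_pow_Suc[symmetric, OF finite_measure_axioms]) auto
  finally show ?case .
qed simp

text \<open>A union bound over the position of a jump above c, with the other n - 1 jumps left free.
  The induction peels off the first jump: if it is low the hypothesis applies to the rest, and if it
  is high it supplies the one additional position.\<close>

lemma big_jump_decomposition:
  assumes "f \<in> borel_measurable borel"
  shows "(\<integral>\<^sup>+x. f x \<partial>conv_pow F n) \<le> (\<integral>\<^sup>+x. f x \<partial>conv_pow (lowpart c) n)
     + of_nat n * (\<integral>\<^sup>+y. (\<integral>\<^sup>+z. f (y + z) \<partial>conv_pow F (n - 1)) \<partial>highpart c)"
  using assms
proof (induction n arbitrary: f)
  case (Suc n)
  note [measurable] = Suc.prems
  define T where "T = (\<lambda>x. (\<integral>\<^sup>+y. (\<integral>\<^sup>+z. f (x + (y + z)) \<partial>conv_pow F (n - 1)) \<partial>highpart c))"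
  interpret Hp: sigma_finite_measure "highpart c" by (rule finite_measure.sigma_finite_measure[OF finite_parts(2)])
  interpret P: pair_sigma_finite F "highpart c" ..
  interpret K: sigma_finite_measure "conv_pow F (n - 1)" by (rule finite_measure.sigma_finite_measure[OF finite_conv_pow_F])
  have m2 [measurable]: "(\<lambda>p. \<integral>\<^sup>+z. f (fst p + (snd p + z)) \<partial>conv_pow F (n - 1)) \<in> borel_measurable (borel \<Otimes>\<^sub>M borel)"
    by (rule sigma_finite_measure.borel_measurable_nn_integral[OF K.sigma_finite_measure_axioms]) (simp add: split_beta', measurable)
  have Tm [measurable]: "T \<in> borel_measurable borel"
    unfolding T_def
  proof (rule sigma_finite_measure.borel_measurable_nn_integral[OF Hp.sigma_finite_measure_axioms])
    have "(\<lambda>p. \<integral>\<^sup>+z. f (fst p + (snd p + z)) \<partial>conv_pow F (n - 1)) \<in> borel_measurable (borel \<Otimes>\<^sub>M highpart c)"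
      using m2 by (subst measurable_cong_sets[OF sets_pair_measure_cong[OF refl sets_parts(2)] refl])
    then show "(\<lambda>(x, y). \<integral>\<^sup>+z. f (x + (y + z)) \<partial>conv_pow F (n - 1)) \<in> borel_measurable (borel \<Otimes>\<^sub>M highpart c)"
      by (simp add: split_beta')
  qed
  \<comment> \<open>The free first jump is moved past the high jump by Fubini and merges with the n
    - 1 others into an n-fold convolution.\<close>
  have T_le: "of_nat n * (\<integral>\<^sup>+x. T x \<partial>F) = of_nat n * (\<integral>\<^sup>+y. (\<integral>\<^sup>+z. f (y + z) \<partial>conv_pow F n) \<partial>highpart c)"
  proof (cases n)
    case (Suc m)
    have m3: "(\<lambda>(x, y). \<integral>\<^sup>+z. f (x + (y + z)) \<partial>conv_pow F (n - 1)) \<in> borel_measurable (F \<Otimes>\<^sub>M highpart c)"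
      using m2 by (subst measurable_cong_sets[OF sets_pair_measure_cong[OF F_sets sets_parts(2)] refl]) (simp add: split_beta')
    have "(\<integral>\<^sup>+x. T x \<partial>F) = (\<integral>\<^sup>+y. (\<integral>\<^sup>+x. (\<integral>\<^sup>+z. f (x + (y + z)) \<partial>conv_pow F (n - 1)) \<partial>F) \<partial>highpart c)"
      using P.Fubini'[OF m3] by (simp add: T_def)
    also have "\<dots> = (\<integral>\<^sup>+y. (\<integral>\<^sup>+z. f (y + z) \<partial>conv_pow F n) \<partial>highpart c)"
    proof (rule nn_integral_cong)
      fix y
      have "(\<integral>\<^sup>+z. f (y + z) \<partial>conv_pow F (Suc m)) = (\<integral>\<^sup>+x. (\<integral>\<^sup>+z. f (y + (x + z)) \<partial>conv_pow F m) \<partial>F)"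
        by (rule nn_integral_conv_pow_Suc[OF finite_measure_axioms]) auto
      then show "(\<integral>\<^sup>+x. (\<integral>\<^sup>+z. f (x + (y + z)) \<partial>conv_pow F (n - 1)) \<partial>F) = (\<integral>\<^sup>+z. f (y + z) \<partial>conv_pow F n)"
        using Suc by (simp add: add.left_commute)
    qed
    finally show ?thesis by simp
  qed simp
  have lm: "(\<lambda>x. \<integral>\<^sup>+y. f (x + y) \<partial>conv_pow (lowpart c) n) \<in> borel_measurable borel"
  proof -
    interpret L: sigma_finite_measure "conv_pow (lowpart c) n"
      by (rule finite_measure.sigma_finite_measure[OF finite_measure_conv_pow[OF finite_parts(1)]]) simp
    show ?thesis by (rule sigma_finite_measure.borel_measurable_nn_integral[OF L.sigma_finite_measure_axioms]) (simp add: split_beta', measurable)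
  qed
  note [measurable] = lm
  have "(\<integral>\<^sup>+u. f u \<partial>conv_pow F (Suc n)) = (\<integral>\<^sup>+x. (\<integral>\<^sup>+y. f (x + y) \<partial>conv_pow F n) \<partial>F)"
    by (rule nn_integral_conv_pow_Suc[OF finite_measure_axioms]) auto
  also have "\<dots> = (\<integral>\<^sup>+x. (\<integral>\<^sup>+y. f (x + y) \<partial>conv_pow F n) \<partial>lowpart c) + (\<integral>\<^sup>+x. (\<integral>\<^sup>+y. f (x + y) \<partial>conv_pow F n) \<partial>highpart c)"
    by (rule nn_integral_parts(3)) measurable
  also have "(\<integral>\<^sup>+x. (\<integral>\<^sup>+y. f (x + y) \<partial>conv_pow F n) \<partial>lowpart c)
      \<le> (\<integral>\<^sup>+x. (\<integral>\<^sup>+y. f (x + y) \<partial>conv_pow (lowpart c) n) + of_nat n * T x \<partial>lowpart c)"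
    unfolding T_def by (intro nn_integral_mono Suc.IH) measurable
  also have "\<dots> = (\<integral>\<^sup>+x. (\<integral>\<^sup>+y. f (x + y) \<partial>conv_pow (lowpart c) n) \<partial>lowpart c) + of_nat n * (\<integral>\<^sup>+x. T x \<partial>lowpart c)"
    by (subst nn_integral_add) (auto simp: nn_integral_cmult)
  also have "(\<integral>\<^sup>+x. (\<integral>\<^sup>+y. f (x + y) \<partial>conv_pow (lowpart c) n) \<partial>lowpart c) = (\<integral>\<^sup>+u. f u \<partial>conv_pow (lowpart c) (Suc n))"
    by (rule nn_integral_conv_pow_Suc[symmetric, OF finite_parts(1)]) auto
  also have "of_nat n * (\<integral>\<^sup>+x. T x \<partial>lowpart c) \<le> of_nat n * (\<integral>\<^sup>+x. T x \<partial>F)"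
    by (intro mult_left_mono) (subst nn_integral_parts(3)[of _ c], auto)
  finally have "(\<integral>\<^sup>+u. f u \<partial>conv_pow F (Suc n)) \<le> (\<integral>\<^sup>+u. f u \<partial>conv_pow (lowpart c) (Suc n))
     + of_nat n * (\<integral>\<^sup>+y. (\<integral>\<^sup>+z. f (y + z) \<partial>conv_pow F n) \<partial>highpart c) + (\<integral>\<^sup>+x. (\<integral>\<^sup>+y. f (x + y) \<partial>conv_pow F n) \<partial>highpart c)"
    unfolding T_le by (simp add: add_right_mono)
  then show ?case by (simp add: distrib_right ac_simps)
qed simp

text \<open>For u \<le> c the exponential lies below 1 + exp (l * c) * min 1 (|u| / c). The
  truncated moment at \<theta> = 1 / c then bounds one factor by 1 + B \<le> exp B with B = C * exp
  (l * c) * W c, and exponential moments multiply under convolution.\<close>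

lemma exp_moment_lowpart:
  obtains C where "C > 0" "\<And>c l k. c \<ge> 1 \<Longrightarrow> l \<ge> 0 \<Longrightarrow>
    (\<integral>\<^sup>+u. ennreal (exp (l * u)) \<partial>conv_pow (lowpart c) k) \<le> ennreal (exp (real k * (C * exp (l * c) * W c)))"
proof -
  obtain C where C: "C > 0" "\<And>\<theta>. 0 < \<theta> \<Longrightarrow> \<theta> \<le> 1 \<Longrightarrow> (\<integral>x. min 1 (\<theta> * \<bar>x\<bar>) \<partial>F) \<le> C * W (1 / \<theta>)"
    using truncated_moment by blast
  show ?thesis
  proof (rule that[OF C(1)])
    fix c l :: real and k :: nat assume c: "c \<ge> 1" and l: "l \<ge> 0"
    define m where "m = (\<integral>\<^sup>+u. ennreal (exp (l * u)) \<partial>lowpart c)"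
    define B where "B = C * exp (l * c) * W c"
    have B: "B \<ge> 0" using C by (simp add: B_def)
    have pow: "(\<integral>\<^sup>+u. ennreal (exp (l * u)) \<partial>conv_pow (lowpart c) k) = m ^ k"
    proof (induction k)
      case 0 show ?case by (simp add: nn_integral_return)
    next
      case (Suc k)
      have "(\<integral>\<^sup>+u. ennreal (exp (l * u)) \<partial>conv_pow (lowpart c) (Suc k)) = (\<integral>\<^sup>+x. (\<integral>\<^sup>+y. ennreal (exp (l * (x + y))) \<partial>conv_pow (lowpart c) k) \<partial>lowpart c)"
        by (rule nn_integral_conv_pow_Suc[OF finite_parts(1)]) auto
      also have "\<dots> = (\<integral>\<^sup>+x. ennreal (exp (l * x)) * m ^ k \<partial>lowpart c)"
      proof (rule nn_integral_cong)
        fix x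
        have "(\<integral>\<^sup>+y. ennreal (exp (l * (x + y))) \<partial>conv_pow (lowpart c) k) = (\<integral>\<^sup>+y. ennreal (exp (l * x)) * ennreal (exp (l * y)) \<partial>conv_pow (lowpart c) k)"
          by (intro nn_integral_cong) (simp add: distrib_left exp_add ennreal_mult)
        also have "\<dots> = ennreal (exp (l * x)) * m ^ k"
          by (subst nn_integral_cmult) (auto simp: Suc)
        finally show "(\<integral>\<^sup>+y. ennreal (exp (l * (x + y))) \<partial>conv_pow (lowpart c) k) = ennreal (exp (l * x)) * m ^ k" .
      qed
      also have "\<dots> = m * m ^ k" unfolding m_def by (rule nn_integral_multc) simp
      finally show ?case by simp
    qed
    have "m = (\<integral>\<^sup>+u. indicator {..c} u * ennreal (exp (l * u)) \<partial>F)"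
      unfolding m_def by (rule nn_integral_parts(1)) simp
    also have "\<dots> \<le> (\<integral>\<^sup>+u. ennreal (1 + exp (l * c) * min 1 (1 / c * \<bar>u\<bar>)) \<partial>F)"
    proof (rule nn_integral_mono)
      fix u
      show "indicator {..c} u * ennreal (exp (l * u)) \<le> ennreal (1 + exp (l * c) * min 1 (1 / c * \<bar>u\<bar>))"
      proof (cases "u \<le> c")
        case True
        have "exp (l * u) \<le> 1 + exp (l * c) * min 1 (1 / c * \<bar>u\<bar>)"
        proof (cases "u \<le> 0")
          case True
          then have "exp (l * u) \<le> 1" using l by (simp add: mult_nonneg_nonpos)
          moreover have "exp (l * c) * min 1 (1 / c * \<bar>u\<bar>) \<ge> 0" using c by simp
          ultimately show ?thesis by linarith
        next
          case False
          \<comment> \<open>l * u is the convex combination of 0 and l * c with weight q, so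
            convexity of exp puts it below the chord.\<close>
          define q where "q = u / c"
          have q: "0 \<le> q" "q \<le> 1" using False \<open>u \<le> c\<close> c by (auto simp: q_def)
          have "exp ((1 - q) *\<^sub>R 0 + q *\<^sub>R (l * c)) \<le> (1 - q) * exp 0 + q * exp (l * c)"
            by (rule convex_onD[OF exp_convex]) (use q in auto)
          moreover have "(1 - q) *\<^sub>R 0 + q *\<^sub>R (l * c) = l * u" using c by (simp add: q_def)
          ultimately have "exp (l * u) \<le> (1 - q) + q * exp (l * c)" by (simp only: exp_zero mult_1_right)
          also have "\<dots> \<le> 1 + exp (l * c) * q" using q by simp
          also have "q = min 1 (1 / c * \<bar>u\<bar>)" using q False c by (simp add: q_def)
          finally show ?thesis .
        qed
        then show ?thesis using True by (simp add: ennreal_leI)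
      qed simp
    qed
    also have "\<dots> = ennreal (\<integral>u. 1 + exp (l * c) * min 1 (1 / c * \<bar>u\<bar>) \<partial>F)"
      using c by (intro nn_integral_eq_integral integrable_const_bound[where B = "1 + exp (l * c)"])
         (auto simp: abs_le_iff intro!: add_nonneg_nonneg AE_I2)
    also have "(\<integral>u. 1 + exp (l * c) * min 1 (1 / c * \<bar>u\<bar>) \<partial>F) = 1 + exp (l * c) * (\<integral>u. min 1 (1 / c * \<bar>u\<bar>) \<partial>F)"
    proof -
      have "integrable F (\<lambda>u. min 1 (1 / c * \<bar>u\<bar>))"
        using c by (intro integrable_const_bound[where B = 1]) auto
      then show ?thesis using prob_space by (subst Bochner_Integration.integral_add) auto
    qed
    also have "ennreal \<dots> \<le> ennreal (1 + B)"
    proof (intro ennreal_leI add_left_mono)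
      have "(\<integral>u. min 1 (1 / c * \<bar>u\<bar>) \<partial>F) \<le> C * W (1 / (1 / c))" using c by (intro C) auto
      then have "exp (l * c) * (\<integral>u. min 1 (1 / c * \<bar>u\<bar>) \<partial>F) \<le> exp (l * c) * (C * W (1 / (1 / c)))"
        by (intro mult_left_mono) auto
      also have "\<dots> = B" by (simp add: B_def)
      finally show "exp (l * c) * (\<integral>u. min 1 (1 / c * \<bar>u\<bar>) \<partial>F) \<le> B" .
    qed
    also have "\<dots> \<le> ennreal (exp B)" by (intro ennreal_leI) (rule exp_ge_add_one_self)
    finally have "m ^ k \<le> ennreal (exp B) ^ k" by (rule power_mono) simp
    also have "\<dots> = ennreal (exp (real k * B))" by (simp add: ennreal_power exp_of_nat_mult)
    finally show "(\<integral>\<^sup>+u. ennreal (exp (l * u)) \<partial>conv_pow (lowpart c) k) \<le> ennreal (exp (real k * (C * exp (l * c) * W c)))"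
      unfolding pow B_def .
  qed
qed

text \<open>Fuk--Nagaev: exponential tilting by \<open>ln (1 / (n * W x)) / (b * x)\<close>.\<close>
lemma lowpart_tail:
  assumes b: "0 < b" "b \<le> 1"
  obtains K where "K > 0" "\<And>x n k. x \<ge> 1 / b \<Longrightarrow> 1 \<le> n \<Longrightarrow> k \<le> n \<Longrightarrow> real n * W x \<le> 1 \<Longrightarrow>
    emeasure (conv_pow (lowpart (b * x)) k) {x/2..} \<le> ennreal (K * (real n * W x) powr (1 / (2 * b)))"
proof -
  obtain C where C: "C > 0" "\<And>c l k. c \<ge> 1 \<Longrightarrow> l \<ge> 0 \<Longrightarrow>
    (\<integral>\<^sup>+u. ennreal (exp (l * u)) \<partial>conv_pow (lowpart c) k) \<le> ennreal (exp (real k * (C * exp (l * c) * W c)))"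
    using exp_moment_lowpart by blast
  obtain C1 where C1: "C1 > 0" "\<And>x y. 0 < y \<Longrightarrow> y \<le> x \<Longrightarrow> 1 \<le> x \<Longrightarrow> W y \<le> C1 * (x / y) powr 1 * W x"
    using tail_potter_upper[of 1] alpha_less_1 by blast
  show ?thesis
  proof (rule that[of "exp (C * (C1 / b))"])
    fix x :: real and n k :: nat assume x: "x \<ge> 1 / b" and n: "1 \<le> n" and k: "k \<le> n" and nW: "real n * W x \<le> 1"
    define R where "R = 1 / (real n * W x)"
    have nWp: "real n * W x > 0" using n tail_pos[of x] by simp
    have R: "R \<ge> 1" using nW nWp by (simp add: R_def)
    define c where "c = b * x"
    have c: "c \<ge> 1" using x b by (simp add: c_def field_simps)
    have x1: "x \<ge> 1" using x b by (smt (verit, best) le_divide_eq_1_pos)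
    define l where "l = ln R / c"
    have l: "l \<ge> 0" using R c by (simp add: l_def)
    have lc: "exp (l * c) = R" using R c by (simp add: l_def)
    have "emeasure (conv_pow (lowpart c) k) {x/2..} = (\<integral>\<^sup>+u. indicator {x/2..} u \<partial>conv_pow (lowpart c) k)"
      by simp
    also have "\<dots> \<le> (\<integral>\<^sup>+u. ennreal (exp (- l * (x/2))) * ennreal (exp (l * u)) \<partial>conv_pow (lowpart c) k)"
    proof (rule nn_integral_mono)
      fix u
      show "indicator {x/2..} u \<le> ennreal (exp (- l * (x/2))) * ennreal (exp (l * u))"
      proof (cases "u \<ge> x/2")
        case True
        have "l * (x/2) \<le> l * u" using True l by (intro mult_left_mono) auto
        then have "1 \<le> exp (- l * (x/2)) * exp (l * u)" by (simp add: exp_add[symmetric])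
        then show ?thesis using True by (simp add: ennreal_mult[symmetric] ennreal_leI flip: ennreal_1)
      qed simp
    qed
    also have "\<dots> = ennreal (exp (- l * (x/2))) * (\<integral>\<^sup>+u. ennreal (exp (l * u)) \<partial>conv_pow (lowpart c) k)"
      by (rule nn_integral_cmult) simp
    also have "\<dots> \<le> ennreal (exp (- l * (x/2))) * ennreal (exp (real k * (C * exp (l * c) * W c)))"
      by (intro mult_left_mono C c l) simp
    also have "\<dots> = ennreal (exp (- l * (x/2)) * exp (real k * (C * R * W c)))"
      unfolding lc by (simp add: ennreal_mult)
    also have "\<dots> \<le> ennreal ((real n * W x) powr (1 / (2 * b)) * exp (C * (C1 / b)))"
    proof (intro ennreal_leI mult_mono)
      have "l * (x/2) = ln R * (1 / (2 * b))" using b x1 by (simp add: l_def c_def field_simps)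
      then have "exp (- l * (x/2)) = R powr (- (1 / (2 * b)))" using R by (simp add: powr_def mult.commute)
      also have "\<dots> = (real n * W x) powr (1 / (2 * b))" using nWp by (simp add: R_def powr_minus powr_divide)
      finally show "exp (- l * (x/2)) \<le> (real n * W x) powr (1 / (2 * b))" by simp
      have "W c \<le> C1 * (x / c) powr 1 * W x"
        using b x1 c by (intro C1) (auto simp: c_def mult_left_le_one_le)
      then have "W c \<le> C1 / b * W x" using b x1 by (simp add: c_def)
      then have "real k * (C * R * W c) \<le> real n * (C * R * (C1 / b * W x))"
        using k C R by (intro mult_mono) auto
      also have "\<dots> = C * (C1 / b)" using nWp tail_pos[of x] n by (simp add: R_def)
      finally show "exp (real k * (C * R * W c)) \<le> exp (C * (C1 / b))" by simp
    qed auto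
    finally show "emeasure (conv_pow (lowpart (b * x)) k) {x/2..} \<le> ennreal (exp (C * (C1 / b)) * (real n * W x) powr (1 / (2 * b)))"
      by (simp add: c_def mult.commute)
  qed simp
qed

end

text \<open>A sum exceeding \<open>x\<close> has a summand exceeding \<open>x / 2\<close>; condition on it.\<close>
lemma convolution_halving:
  fixes A B :: "real measure"
  assumes fA: "finite_measure A" and fB: "finite_measure B"
    and sA [simp, measurable_cong]: "sets A = sets borel" and sB [simp, measurable_cong]: "sets B = sets borel"
    and A: "\<And>w. emeasure A {w<..w+h} \<le> \<sigma>A" and B: "\<And>w. emeasure B {w<..w+h} \<le> \<sigma>B"
  shows "emeasure (convolution A B) {x<..x+h} \<le> emeasure A {x/2..} * \<sigma>B + emeasure B {x/2..} * \<sigma>A"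
proof -
  interpret A: finite_measure A by fact
  interpret B: finite_measure B by fact
  interpret P: pair_sigma_finite A B ..
  let ?I = "\<lambda>u v. indicator {x<..x+h} (u + v) :: ennreal"
  have spA: "space A = UNIV" and spB: "space B = UNIV"
    using sets_eq_imp_space_eq[OF sA] sets_eq_imp_space_eq[OF sB] by auto
  have inner: "(\<integral>\<^sup>+v. ?I u v \<partial>N) \<le> \<sigma>" if [measurable_cong]: "sets N = sets borel" and N: "\<And>w. emeasure N {w<..w+h} \<le> \<sigma>" for u N \<sigma>
  proof -
    have "(\<integral>\<^sup>+v. ?I u v \<partial>N) = (\<integral>\<^sup>+v. indicator {x-u<..(x-u)+h} v \<partial>N)"
      by (intro nn_integral_cong) (auto simp: indicator_def)
    also have "\<dots> = emeasure N {x-u<..(x-u)+h}" by simp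
    finally show ?thesis using N[of "x-u"] by simp
  qed
  have m1: "(\<lambda>p. indicator {x/2..} (snd p) * ?I (fst p) (snd p)) \<in> borel_measurable (A \<Otimes>\<^sub>M B)"
    by measurable
  have "emeasure (convolution A B) {x<..x+h} = (\<integral>\<^sup>+u. (\<integral>\<^sup>+v. ?I u v \<partial>B) \<partial>A)"
    by (rule convolution_emeasure') (auto simp: fA fB)
  also have "\<dots> \<le> (\<integral>\<^sup>+u. (\<integral>\<^sup>+v. indicator {x/2..} u * ?I u v + indicator {x/2..} v * ?I u v \<partial>B) \<partial>A)"
    by (intro nn_integral_mono) (auto simp: indicator_def)
  also have "\<dots> = (\<integral>\<^sup>+u. indicator {x/2..} u * (\<integral>\<^sup>+v. ?I u v \<partial>B) + (\<integral>\<^sup>+v. indicator {x/2..} v * ?I u v \<partial>B) \<partial>A)"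
    by (intro nn_integral_cong) (simp add: nn_integral_add nn_integral_cmult)
  also have "\<dots> = (\<integral>\<^sup>+u. indicator {x/2..} u * (\<integral>\<^sup>+v. ?I u v \<partial>B) \<partial>A) + (\<integral>\<^sup>+u. (\<integral>\<^sup>+v. indicator {x/2..} v * ?I u v \<partial>B) \<partial>A)"
  proof (rule nn_integral_add)
    show "(\<lambda>u. indicator {x/2..} u * (\<integral>\<^sup>+v. ?I u v \<partial>B)) \<in> borel_measurable A"
      by (intro borel_measurable_times_ennreal B.borel_measurable_nn_integral) (simp_all add: split_beta', measurable)
    show "(\<lambda>u. \<integral>\<^sup>+v. indicator {x/2..} v * ?I u v \<partial>B) \<in> borel_measurable A"
      by (intro B.borel_measurable_nn_integral) (simp add: split_beta', measurable)
  qed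
  also have "(\<integral>\<^sup>+u. (\<integral>\<^sup>+v. indicator {x/2..} v * ?I u v \<partial>B) \<partial>A) = (\<integral>\<^sup>+v. (\<integral>\<^sup>+u. indicator {x/2..} v * ?I u v \<partial>A) \<partial>B)"
    using P.Fubini'[of "\<lambda>u v. indicator {x/2..} v * ?I u v"] m1 by (simp add: split_beta')
  also have "\<dots> = (\<integral>\<^sup>+v. indicator {x/2..} v * (\<integral>\<^sup>+u. ?I v u \<partial>A) \<partial>B)"
    by (intro nn_integral_cong) (simp add: nn_integral_cmult add.commute)
  also have "\<dots> \<le> (\<integral>\<^sup>+v. indicator {x/2..} v * \<sigma>A \<partial>B)"
    by (intro nn_integral_mono mult_left_mono inner sA A) auto
  also have "\<dots> = emeasure B {x/2..} * \<sigma>A" by (simp add: nn_integral_multc)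
  also have "(\<integral>\<^sup>+u. indicator {x/2..} u * (\<integral>\<^sup>+v. ?I u v \<partial>B) \<partial>A) \<le> (\<integral>\<^sup>+u. indicator {x/2..} u * \<sigma>B \<partial>A)"
    by (intro nn_integral_mono mult_left_mono inner sB B) auto
  also have "\<dots> = emeasure A {x/2..} * \<sigma>B" by (simp add: nn_integral_multc)
  finally show ?thesis by (simp add: add_mono)
qed

context stable_renewal
begin

lemma conv_pow_interval_bound:
  obtains D where "D > 0" "\<And>n w. n \<ge> 1 \<Longrightarrow> emeasure (conv_pow F (n - 1)) {w-h..w+h} \<le> ennreal (D / a (real n))"
proof -
  obtain D where D: "D > 0"
    "\<And>n x. n \<ge> 1 \<Longrightarrow> measure (conv_pow F n) {x-h..x+h} \<le> D / a (real n)"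
    "\<And>n t x. n \<ge> 1 \<Longrightarrow> t \<ge> real n \<Longrightarrow> measure (cpoisson F t) {x-h..x+h} \<le> D / a (real n)"
    using local_concentration[OF h_pos] by blast
  obtain C where C: "C > 0" "\<And>s t. 1 \<le> s \<Longrightarrow> s \<le> t \<Longrightarrow> a t \<le> C * (t / s) powr (1 / (\<alpha>/2)) * a s"
    using a_potter_upper[of "\<alpha>/2"] alpha_pos by auto
  \<comment> \<open>The summand \<open>a 1\<close> is for n = 1, where the law is the unit mass at 0
    and only the trivial bound 1 holds.\<close>
  define E where "E = D * (C * 2 powr (1 / (\<alpha>/2))) + a 1"
  show ?thesis
  proof (rule that[of E])
    show "E > 0" unfolding E_def using D C by (intro add_pos_pos mult_pos_pos) auto
    fix n :: nat and w assume n: "n \<ge> 1"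
    interpret P: real_distribution "conv_pow F (n - 1)" by (rule real_distribution_conv_pow[OF rdF])
    have "measure (conv_pow F (n - 1)) {w-h..w+h} \<le> E / a (real n)"
    proof (cases "n = 1")
      case True
      have "measure (conv_pow F (n - 1)) {w-h..w+h} \<le> 1" by (rule P.prob_le_1)
      also have "1 \<le> E / a (real n)" using True D C by (simp add: E_def)
      finally show ?thesis .
    next
      case False
      have "measure (conv_pow F (n - 1)) {w-h..w+h} \<le> D / a (real (n - 1))" using False n by (intro D) auto
      also have "\<dots> \<le> E / a (real n)"
      proof -
        have "a (real n) \<le> C * (real n / real (n - 1)) powr (1 / (\<alpha>/2)) * a (real (n - 1))" using False n by (intro C) auto
        also have "\<dots> \<le> C * 2 powr (1 / (\<alpha>/2)) * a (real (n - 1))"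
          using C n False alpha_pos by (intro mult_right_mono mult_left_mono powr_mono2) (auto simp: divide_le_eq of_nat_diff)
        finally have "D * a (real n) \<le> D * (C * 2 powr (1 / (\<alpha>/2)) * a (real (n - 1)))" using D by (intro mult_left_mono) auto
        also have "\<dots> \<le> E * a (real (n - 1))" by (simp add: E_def algebra_simps)
        finally show ?thesis by (simp add: field_simps)
      qed
      finally show ?thesis .
    qed
    then show "emeasure (conv_pow F (n - 1)) {w-h..w+h} \<le> ennreal (E / a (real n))"
      unfolding P.emeasure_eq_measure by (rule ennreal_leI)
  qed
qed

text \<open>With this truncation level the tilting bound gives \<open>(n * W x) powr (2 / \<alpha> + 1)\<close>, which absorbs
\<open>x / a n\<close> by the Potter bound with exponent \<open>2 / \<alpha>\<close> and leaves one factor \<open>n * W x \<le> \<delta>\<close>.\<close>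
definition bfrac :: real where "bfrac = 1 / (2 * (2 / \<alpha> + 1))"

lemma bfrac: "bfrac > 0" "bfrac < 1" "1 / (2 * bfrac) = 2 / \<alpha> + 1"
proof -
  have "2 / \<alpha> > 0" using alpha_pos by simp
  then show "bfrac > 0" "bfrac < 1" "1 / (2 * bfrac) = 2 / \<alpha> + 1"
    by (auto simp: bfrac_def divide_less_eq intro!: divide_pos_pos add_pos_pos)
qed

text \<open>The tilting bound controls a half-line and misses the local factor 1 / a n. Splitting
  the sum into two halves of comparable length provides both: one half exceeds x / 2 by tilting, and
  the other, conditionally, must fall into an interval of length h, which costs D * E / a n.\<close>

lemma lowpart_interval_tail:
  obtains K where "K > 0" "\<And>x n. x \<ge> 1 / bfrac \<Longrightarrow> n \<ge> 1 \<Longrightarrow> real n * W x \<le> 1 \<Longrightarrow>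
    emeasure (conv_pow (lowpart (bfrac * x)) n) {x<..x+h} \<le> ennreal (K / a (real n) * (real n * W x) powr (2 / \<alpha> + 1))"
proof -
  obtain K0 where K0: "K0 > 0" "\<And>x n k. x \<ge> 1 / bfrac \<Longrightarrow> 1 \<le> n \<Longrightarrow> k \<le> n \<Longrightarrow> real n * W x \<le> 1 \<Longrightarrow>
    emeasure (conv_pow (lowpart (bfrac * x)) k) {x/2..} \<le> ennreal (K0 * (real n * W x) powr (1 / (2 * bfrac)))"
    using lowpart_tail[of bfrac] bfrac by (metis less_imp_le)
  obtain D where D: "D > 0"
    "\<And>n x. n \<ge> 1 \<Longrightarrow> measure (conv_pow F n) {x-h..x+h} \<le> D / a (real n)"
    "\<And>n t x. n \<ge> 1 \<Longrightarrow> t \<ge> real n \<Longrightarrow> measure (cpoisson F t) {x-h..x+h} \<le> D / a (real n)"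
    using local_concentration[OF h_pos] by blast
  obtain C where C: "C > 0" "\<And>s t. 1 \<le> s \<Longrightarrow> s \<le> t \<Longrightarrow> a t \<le> C * (t / s) powr (1 / (\<alpha>/2)) * a s"
    using a_potter_upper[of "\<alpha>/2"] alpha_pos by auto
  define E where "E = C * 3 powr (1 / (\<alpha>/2))"
  have E: "E > 0" using C by (simp add: E_def)
  show ?thesis
  proof (rule that[of "2 * (K0 * (D * E))"])
    show "2 * (K0 * (D * E)) > 0" using K0 D E by simp
    fix x :: real and n :: nat assume x: "x \<ge> 1 / bfrac" and n: "n \<ge> 1" and nW: "real n * W x \<le> 1"
    define M where "M = lowpart (bfrac * x)"
    have fM: "finite_measure M" and sM [simp]: "sets M = sets borel" by (simp_all add: M_def finite_parts)
    define q where "q = (real n * W x) powr (2 / \<alpha> + 1)"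
    have q: "q \<ge> 0" by (simp add: q_def)
    have x0: "x > 0" using x bfrac by (smt (verit, best) divide_pos_pos)
    show "emeasure (conv_pow (lowpart (bfrac * x)) n) {x<..x+h} \<le> ennreal (2 * (K0 * (D * E)) / a (real n) * (real n * W x) powr (2 / \<alpha> + 1))"
    proof (cases "n = 1")
      \<comment> \<open>One summand cannot be split, but the truncated law lives below bfrac * x < x
        and gives the interval no mass.\<close>
      case True
      have lt: "bfrac * x < x" using bfrac x0 by simp
      have "emeasure (conv_pow M (Suc 0)) {x<..x+h} = (\<integral>\<^sup>+u. indicator {x<..x+h} u \<partial>conv_pow M (Suc 0))" by simp
      also have "\<dots> = (\<integral>\<^sup>+u. (\<integral>\<^sup>+v. indicator {x<..x+h} (u + v) \<partial>conv_pow M 0) \<partial>M)"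
        by (rule nn_integral_conv_pow_Suc[OF fM sM]) simp
      also have "\<dots> = (\<integral>\<^sup>+u. indicator {x<..x+h} u \<partial>M)"
        by (intro nn_integral_cong) (simp add: nn_integral_return)
      also have "\<dots> = (\<integral>\<^sup>+u. indicator {..bfrac * x} u * indicator {x<..x+h} u \<partial>F)"
        unfolding M_def by (rule nn_integral_parts(1)) simp
      also have "\<dots> = (\<integral>\<^sup>+u. 0 \<partial>F)"
        using lt by (intro nn_integral_cong) (auto simp: indicator_def)
      finally show ?thesis using True by (simp add: M_def)
    next
      case False
      define k where "k = n div 2"
      define l where "l = n - k"
      have kl: "k \<ge> 1" "l \<ge> 1" "k \<le> n" "l \<le> n" "n = k + l" "real n \<le> 3 * real k" "real n \<le> 3 * real l"
      proof -
        have "n \<ge> 2" using False n by simp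
        then have "n div 2 \<ge> 1" "n - n div 2 \<ge> 1" "n \<le> 3 * (n div 2)" "n \<le> 3 * (n - n div 2)" by presburger+
        then show "k \<ge> 1" "l \<ge> 1" "k \<le> n" "l \<le> n" "n = k + l" "real n \<le> 3 * real k" "real n \<le> 3 * real l"
          unfolding k_def l_def by linarith+
      qed
      have loc: "emeasure (conv_pow M j) {w<..w+h} \<le> ennreal (D * E / a (real n))" if j: "j \<ge> 1" "j \<le> n" "real n \<le> 3 * real j" for j w
      proof -
        interpret P: real_distribution "conv_pow F j" by (rule real_distribution_conv_pow[OF rdF])
        have "emeasure (conv_pow M j) {w<..w+h} = (\<integral>\<^sup>+u. indicator {w<..w+h} u \<partial>conv_pow M j)" by simp
        also have "\<dots> \<le> (\<integral>\<^sup>+u. indicator {w<..w+h} u \<partial>conv_pow F j)"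
          unfolding M_def by (rule nn_integral_lowpart_le) simp
        also have "\<dots> = ennreal (measure (conv_pow F j) {w<..w+h})" by (simp add: P.emeasure_eq_measure)
        also have "\<dots> \<le> ennreal (D / a (real j))"
        proof (rule ennreal_leI)
          have "measure (conv_pow F j) {w<..w+h} \<le> measure (conv_pow F j) {w-h..w+h}"
            using h_pos by (intro P.finite_measure_mono) auto
          also have "\<dots> \<le> D / a (real j)" by (rule D(2)[OF j(1)])
          finally show "measure (conv_pow F j) {w<..w+h} \<le> D / a (real j)" .
        qed
        also have "\<dots> \<le> ennreal (D * E / a (real n))"
        proof (rule ennreal_leI)
          have "a (real n) \<le> C * (real n / real j) powr (1 / (\<alpha>/2)) * a (real j)" using j by (intro C) auto
          also have "\<dots> \<le> E * a (real j)" unfolding E_def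
            using C j alpha_pos by (intro mult_right_mono mult_left_mono powr_mono2) (auto simp: divide_le_eq)
          finally have "D * a (real n) \<le> D * (E * a (real j))" using D by (intro mult_left_mono) auto
          then show "D / a (real j) \<le> D * E / a (real n)" by (simp add: field_simps)
        qed
        finally show ?thesis .
      qed
      have tl: "emeasure (conv_pow M j) {x/2..} \<le> ennreal (K0 * q)" if "j \<le> n" for j
        using K0(2)[OF x n that nW] by (simp add: M_def q_def bfrac(3))
      have "emeasure (conv_pow M n) {x<..x+h} = emeasure (convolution (conv_pow M k) (conv_pow M l)) {x<..x+h}"
        unfolding kl(5) by (simp add: conv_pow_add[OF fM sM])
      also have "\<dots> \<le> emeasure (conv_pow M k) {x/2..} * ennreal (D * E / a (real n)) + emeasure (conv_pow M l) {x/2..} * ennreal (D * E / a (real n))"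
        using kl by (intro convolution_halving finite_measure_conv_pow fM sM sets_conv_pow loc) auto
      also have "\<dots> \<le> ennreal (K0 * q) * ennreal (D * E / a (real n)) + ennreal (K0 * q) * ennreal (D * E / a (real n))"
        by (intro add_mono mult_right_mono tl kl) auto
      also have "\<dots> = ennreal (2 * (K0 * (D * E)) / a (real n) * q)"
        using K0 D E q by (simp add: ennreal_mult[symmetric] ennreal_plus[symmetric] mult_ac del: ennreal_plus)
      finally show ?thesis by (simp add: M_def q_def)
    qed
  qed
qed

lemma recip_tail_a: "eventually (\<lambda>x. x / 2 \<le> a (1 / W x)) at_top"
proof -
  have "((\<lambda>x. 1 / W x * W x) \<longlongrightarrow> 1) at_top"
    using tail_pos by (auto intro!: tendsto_eventually always_eventually simp: less_imp_neq[THEN not_sym])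
  from a_asymp[OF _ this] have "((\<lambda>x. a (1 / W x) / x) \<longlongrightarrow> 1) at_top" by simp
  then have "eventually (\<lambda>x. a (1 / W x) / x > 1/2) at_top" by (rule order_tendstoD) simp
  then show ?thesis using eventually_gt_at_top[of 0] by eventually_elim (simp add: field_simps)
qed

lemma lowpart_interval_bound:
  obtains K where "K > 0" "eventually (\<lambda>x. \<forall>n\<ge>1. \<forall>\<delta>. 0 < \<delta> \<longrightarrow> \<delta> \<le> 1 \<longrightarrow> real n * W x \<le> \<delta> \<longrightarrow>
    emeasure (conv_pow (lowpart (bfrac * x)) n) {x<..x+h} \<le> ennreal (K * \<delta> / x)) at_top"
proof -
  obtain K0 where K0: "K0 > 0" "\<And>x n. x \<ge> 1 / bfrac \<Longrightarrow> n \<ge> 1 \<Longrightarrow> real n * W x \<le> 1 \<Longrightarrow>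
    emeasure (conv_pow (lowpart (bfrac * x)) n) {x<..x+h} \<le> ennreal (K0 / a (real n) * (real n * W x) powr (2 / \<alpha> + 1))"
    using lowpart_interval_tail by blast
  obtain C where C: "C > 0" "\<And>s t. 1 \<le> s \<Longrightarrow> s \<le> t \<Longrightarrow> a t \<le> C * (t / s) powr (1 / (\<alpha>/2)) * a s"
    using a_potter_upper[of "\<alpha>/2"] alpha_pos by auto
  show ?thesis
  proof (rule that[of "2 * K0 * C"])
    show "2 * K0 * C > 0" using K0 C by simp
    show "eventually (\<lambda>x. \<forall>n\<ge>1. \<forall>\<delta>. 0 < \<delta> \<longrightarrow> \<delta> \<le> 1 \<longrightarrow> real n * W x \<le> \<delta> \<longrightarrow>
      emeasure (conv_pow (lowpart (bfrac * x)) n) {x<..x+h} \<le> ennreal (2 * K0 * C * \<delta> / x)) at_top"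
      using recip_tail_a eventually_ge_at_top[of "1 / bfrac"] eventually_gt_at_top[of 0]
    proof eventually_elim
      case (elim x)
      show ?case
      proof (intro allI impI)
        fix n :: nat and \<delta> :: real assume n: "n \<ge> 1" and \<delta>: "0 < \<delta>" "\<delta> \<le> 1" and nW: "real n * W x \<le> \<delta>"
        define z where "z = real n * W x"
        have Wp: "W x > 0" by (rule tail_pos)
        have z: "z > 0" "z \<le> \<delta>" "z \<le> 1" using n Wp nW \<delta> by (auto simp: z_def)
        have "a (1 / W x) \<le> C * (1 / W x / real n) powr (1 / (\<alpha>/2)) * a (real n)"
          using n z Wp by (intro C) (auto simp: z_def field_simps)
        also have "1 / W x / real n = 1 / z" using n Wp by (simp add: z_def)
        also have "(1 / z) powr (1 / (\<alpha>/2)) = 1 / z powr (2 / \<alpha>)" using z by (simp add: powr_divide)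
        finally have 1: "x / 2 \<le> C * (1 / z powr (2 / \<alpha>)) * a (real n)" using elim(1) by linarith
        have "K0 / a (real n) * z powr (2 / \<alpha> + 1) \<le> 2 * K0 * C * \<delta> / x"
        proof -
          have zp: "z powr (2/\<alpha>) > 0" using z by simp
          from 1 have "x * z powr (2/\<alpha>) \<le> 2 * C * a (real n)" using zp by (simp add: field_simps)
          then have "(K0 * z) * (x * z powr (2/\<alpha>)) \<le> (K0 * \<delta>) * (2 * C * a (real n))"
            by (rule mult_mono[rotated]) (use z K0 \<delta> elim(3) in \<open>auto intro: mult_left_mono\<close>)
          then have "(K0 * z * z powr (2/\<alpha>)) * x \<le> (2 * K0 * C * \<delta>) * a (real n)" by (simp add: mult_ac)
          then have "(K0 * z * z powr (2/\<alpha>)) / a (real n) \<le> (2 * K0 * C * \<delta>) / x"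
            using elim(3) a_pos[of "real n"] by (simp add: field_simps)
          then show ?thesis using z by (simp add: powr_add mult_ac)
        qed
        then have "ennreal (K0 / a (real n) * (real n * W x) powr (2 / \<alpha> + 1)) \<le> ennreal (2 * K0 * C * \<delta> / x)"
          unfolding z_def by (rule ennreal_leI)
        moreover have "emeasure (conv_pow (lowpart (bfrac * x)) n) {x<..x+h} \<le> ennreal (K0 / a (real n) * (real n * W x) powr (2 / \<alpha> + 1))"
          using elim n z by (intro K0) (auto simp: z_def)
        ultimately show "emeasure (conv_pow (lowpart (bfrac * x)) n) {x<..x+h} \<le> ennreal (2 * K0 * C * \<delta> / x)" by (rule order_trans[rotated])
      qed
    qed
  qed
qed

section \<open>The excess of omega over T and the cost of one big jump\<close>

lemma FI_eq: "FI F h w = W w - W (w + h)"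
proof -
  have "{w<..} = {w<..w+h} \<union> {w+h<..}" using h_pos by auto
  then have "W w = measure F ({w<..w+h} \<union> {w+h<..})" by (simp add: tail_eq)
  also have "\<dots> = measure F {w<..w+h} + W (w + h)"
    unfolding tail_eq by (rule finite_measure_Union) auto
  finally show ?thesis by (simp add: FI_def)
qed

lemma FI_measurable [measurable]: "FI F h \<in> borel_measurable borel"
  unfolding FI_eq[abs_def] by measurable

lemma omega_measurable [measurable]: "omega F h \<in> borel_measurable borel"
  unfolding omega_def[abs_def] by measurable

lemma FI_nonneg: "FI F h w \<ge> 0" by (simp add: FI_def)

text \<open>For w > 0, \<open>FI F h w\<close> is W w / w times \<open>omega F h w\<close>; this is
  the part of it above the level T * W w / w. The part below that level already has the order
  required of the local mass.\<close>

definition excess :: "real \<Rightarrow> real \<Rightarrow> real" where "excess T w = W w / w * max (omega F h w - T) 0"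

lemma excess_measurable [measurable]: "excess T \<in> borel_measurable borel"
  unfolding excess_def[abs_def] by measurable

lemma FI_excess: "w > 0 \<Longrightarrow> T \<ge> 0 \<Longrightarrow> FI F h w \<le> T * (W w / w) + excess T w"
proof -
  assume w: "w > 0" and T: "T \<ge> 0"
  have "FI F h w = W w / w * omega F h w" using w tail_pos[of w] by (simp add: omega_def)
  also have "\<dots> \<le> W w / w * (T + max (omega F h w - T) 0)" using w by (intro mult_left_mono) auto
  finally show ?thesis by (simp add: excess_def algebra_simps)
qed

lemma excess_nonneg: "w > 0 \<Longrightarrow> excess T w \<ge> 0" by (simp add: excess_def)

definition excess_tail :: "real \<Rightarrow> real \<Rightarrow> ennreal" where
  "excess_tail T y = (\<integral>\<^sup>+w. indicator {y<..} w * ennreal (excess T w) \<partial>lborel)"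

text \<open>For w in (v - h, v] the target interval is covered by (w, w + 2 * h]. Averaging over
  such w turns a local mass into a Lebesgue integral of \<open>FI\<close>, the only form in which
  \<open>Phi\<close> can control it.\<close>

lemma interval_mass_average:
  "ennreal h * emeasure F {v<..v+h} \<le> (\<integral>\<^sup>+w. indicator {v-h<..v+h} w * ennreal (FI F h w) \<partial>lborel)"
proof -
  have "ennreal h * emeasure F {v<..v+h} = (\<integral>\<^sup>+w. indicator {v-h<..v} w * ennreal (measure F {v<..v+h}) \<partial>lborel)"
    using h_pos by (subst nn_integral_multc) (auto simp: emeasure_eq_measure)
  also have "\<dots> \<le> (\<integral>\<^sup>+w. indicator {v-h<..v} w * ennreal (FI F h w) + indicator {v-h<..v} w * ennreal (FI F h (w + h)) \<partial>lborel)"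
  proof (rule nn_integral_mono)
    fix w :: real
    show "indicator {v-h<..v} w * ennreal (measure F {v<..v+h}) \<le> indicator {v-h<..v} w * ennreal (FI F h w) + indicator {v-h<..v} w * ennreal (FI F h (w + h))"
    proof (cases "w \<in> {v-h<..v}")
      case True
      have "measure F {v<..v+h} \<le> measure F ({w<..w+h} \<union> {w+h<..(w+h)+h})"
        using True by (intro finite_measure_mono) auto
      also have "\<dots> \<le> FI F h w + FI F h (w + h)" unfolding FI_def by (rule measure_Un_le) auto
      finally show ?thesis using True by (simp add: ennreal_plus[symmetric] FI_nonneg ennreal_leI del: ennreal_plus)
    qed simp
  qed
  also have "\<dots> = (\<integral>\<^sup>+w. indicator {v-h<..v} w * ennreal (FI F h w) \<partial>lborel) + (\<integral>\<^sup>+w. indicator {v-h<..v} w * ennreal (FI F h (w + h)) \<partial>lborel)"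
    by (rule nn_integral_add) measurable
  also have "(\<integral>\<^sup>+w. indicator {v-h<..v} w * ennreal (FI F h (w + h)) \<partial>lborel) = (\<integral>\<^sup>+w. indicator {v<..v+h} w * ennreal (FI F h w) \<partial>lborel)"
  proof -
    have "(\<integral>\<^sup>+w. indicator {v<..v+h} w * ennreal (FI F h w) \<partial>lborel) = ennreal \<bar>1\<bar> * (\<integral>\<^sup>+w. indicator {v<..v+h} (h + 1 * w) * ennreal (FI F h (h + 1 * w)) \<partial>lborel)"
      by (intro nn_integral_real_affine) auto
    also have "\<dots> = (\<integral>\<^sup>+w. indicator {v-h<..v} w * ennreal (FI F h (w + h)) \<partial>lborel)"
      by (simp, intro nn_integral_cong) (auto simp: indicator_def add.commute)
    finally show ?thesis ..
  qed
  also have "(\<integral>\<^sup>+w. indicator {v-h<..v} w * ennreal (FI F h w) \<partial>lborel) + (\<integral>\<^sup>+w. indicator {v<..v+h} w * ennreal (FI F h w) \<partial>lborel)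
     = (\<integral>\<^sup>+w. indicator {v-h<..v+h} w * ennreal (FI F h w) \<partial>lborel)"
    using h_pos by (subst nn_integral_add[symmetric]) (auto intro!: nn_integral_cong simp: indicator_def)
  finally show ?thesis .
qed

text \<open>If v + h > c then c \<ge> 4 * h puts all of (v - h, v + h] above c / 2. There the
  level-T part of \<open>FI\<close> is at most 2 * T * W (c/2) / c, and averaging over length 2 * h
  with weight 1 / h doubles the constant; the excess stays as an integral.\<close>

lemma highpart_interval:
  assumes c: "c \<ge> 4 * h" and T: "T \<ge> 0"
  shows "emeasure (highpart c) {v<..v+h} \<le> ennreal (4 * T * W (c/2) / c)
     + ennreal (1 / h) * (\<integral>\<^sup>+w. indicator {c/2<..} w * ennreal (excess T w) * indicator {v-h<..v+h} w \<partial>lborel)"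
proof -
  have c0: "c > 0" using c h_pos by simp
  have eq: "emeasure (highpart c) {v<..v+h} = (\<integral>\<^sup>+u. indicator {c<..} u * indicator {v<..v+h} u \<partial>F)"
    using nn_integral_parts(2)[of "indicator {v<..v+h}" c] by simp
  show ?thesis
  proof (cases "v + h \<le> c")
    case True
    have "(\<integral>\<^sup>+u. indicator {c<..} u * indicator {v<..v+h} u \<partial>F) = (\<integral>\<^sup>+u. 0 \<partial>F)"
      using True by (intro nn_integral_cong) (auto simp: indicator_def)
    then show ?thesis using eq by simp
  next
    case False
    have "emeasure (highpart c) {v<..v+h} \<le> (\<integral>\<^sup>+u. indicator {v<..v+h} u \<partial>F)"
      unfolding eq by (intro nn_integral_mono) (auto simp: indicator_def)
    also have "\<dots> = emeasure F {v<..v+h}" by simp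
    also have "\<dots> = ennreal (1 / h) * (ennreal h * emeasure F {v<..v+h})"
      using h_pos by (simp add: mult.assoc[symmetric] ennreal_mult[symmetric])
    also have "\<dots> \<le> ennreal (1 / h) * (\<integral>\<^sup>+w. indicator {v-h<..v+h} w * ennreal (FI F h w) \<partial>lborel)"
      by (intro mult_left_mono interval_mass_average) simp
    also have "\<dots> \<le> ennreal (1 / h) * (\<integral>\<^sup>+w. ennreal (2 * T * W (c/2) / c) * indicator {v-h<..v+h} w + indicator {c/2<..} w * ennreal (excess T w) * indicator {v-h<..v+h} w \<partial>lborel)"
    proof (intro mult_left_mono nn_integral_mono)
      fix w :: real
      show "indicator {v-h<..v+h} w * ennreal (FI F h w) \<le> ennreal (2 * T * W (c/2) / c) * indicator {v-h<..v+h} w + indicator {c/2<..} w * ennreal (excess T w) * indicator {v-h<..v+h} w"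
      proof (cases "w \<in> {v-h<..v+h}")
        case True
        then have w: "w > c/2" using False c by auto
        then have w0: "w > 0" using c0 by simp
        have "W w / w \<le> W (c/2) / (c/2)" using w c0 by (intro frac_le tail_antimono) auto
        then have "T * (W w / w) \<le> T * (W (c/2) / (c/2))" using T by (intro mult_left_mono)
        moreover have "T * (W (c/2) / (c/2)) = 2 * T * W (c/2) / c" by simp
        ultimately have "FI F h w \<le> 2 * T * W (c/2) / c + excess T w" using FI_excess[OF w0 T] by linarith
        then have "ennreal (FI F h w) \<le> ennreal (2 * T * W (c/2) / c + excess T w)" by (rule ennreal_leI)
        also have "\<dots> = ennreal (2 * T * W (c/2) / c) + ennreal (excess T w)"
          using T c0 excess_nonneg[OF w0] by (intro ennreal_plus) auto
        finally have "ennreal (FI F h w) \<le> ennreal (2 * T * W (c/2) / c) + ennreal (excess T w)" .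
        then show ?thesis using True w by simp
      qed simp
    qed simp
    also have "\<dots> = ennreal (1 / h) * (ennreal (2 * T * W (c/2) / c) * ennreal (2 * h) + (\<integral>\<^sup>+w. indicator {c/2<..} w * ennreal (excess T w) * indicator {v-h<..v+h} w \<partial>lborel))"
      using h_pos by (subst nn_integral_add) (auto simp: nn_integral_cmult_indicator)
    also have "\<dots> = ennreal (4 * T * W (c/2) / c) + ennreal (1 / h) * (\<integral>\<^sup>+w. indicator {c/2<..} w * ennreal (excess T w) * indicator {v-h<..v+h} w \<partial>lborel)"
    proof -
      have "ennreal (1 / h) * (ennreal (2 * T * W (c/2) / c) * ennreal (2 * h)) = ennreal (4 * T * W (c/2) / c)"
        using h_pos T c0 by (simp add: ennreal_mult[symmetric])
      then show ?thesis by (simp add: distrib_left)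
    qed
    finally show ?thesis .
  qed
qed

text \<open>Integrating over the big jump first leaves the excess at w with the constraint that the
  sum of the other n - 1 jumps is within h of x - w. This event costs at most D / a n uniformly in
  w, so the total excess beyond c / 2 factors out.\<close>

lemma big_jump_bound:
  obtains D where "D > 0" "\<And>c T n x. c \<ge> 4 * h \<Longrightarrow> T \<ge> 0 \<Longrightarrow> n \<ge> 1 \<Longrightarrow>
     (\<integral>\<^sup>+y. (\<integral>\<^sup>+z. indicator {x<..x+h} (y + z) \<partial>conv_pow F (n - 1)) \<partial>highpart c)
     \<le> ennreal (4 * T * W (c/2) / c) + ennreal (D / a (real n)) * excess_tail T (c/2)"
proof -
  obtain D where D: "D > 0" "\<And>n w. n \<ge> 1 \<Longrightarrow> emeasure (conv_pow F (n - 1)) {w-h..w+h} \<le> ennreal (D / a (real n))"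
    using conv_pow_interval_bound by blast
  show ?thesis
  proof (rule that[of "D / h"])
    show "D / h > 0" using D h_pos by simp
    fix c T x :: real and n :: nat assume c: "c \<ge> 4 * h" and T: "T \<ge> 0" and n: "n \<ge> 1"
    interpret P: real_distribution "conv_pow F (n - 1)" by (rule real_distribution_conv_pow[OF rdF])
    interpret H: finite_measure "highpart c" by (rule finite_parts)
    interpret HP: pair_sigma_finite "highpart c" "conv_pow F (n - 1)" ..
    interpret PL: pair_sigma_finite "conv_pow F (n - 1)" lborel ..
    let ?J = "\<lambda>z w. indicator {c/2<..} w * ennreal (excess T w) * indicator {x-z-h<..x-z+h} w"
    have m1: "(\<lambda>(y, z). indicator {x<..x+h} (y + z) :: ennreal) \<in> borel_measurable (highpart c \<Otimes>\<^sub>M conv_pow F (n - 1))"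
      by (simp add: split_beta', measurable)
    have m2: "(\<lambda>(z, w). ?J z w) \<in> borel_measurable (conv_pow F (n - 1) \<Otimes>\<^sub>M lborel)"
    proof -
      have "(\<lambda>(z, w). ?J z w) = (\<lambda>p. indicator {c/2<..} (snd p) * ennreal (excess T (snd p)) * indicator {p. x - fst p - h < snd p \<and> snd p \<le> x - fst p + h} p)"
        by (auto simp: fun_eq_iff indicator_def)
      also have "\<dots> \<in> borel_measurable (conv_pow F (n - 1) \<Otimes>\<^sub>M lborel)" by measurable
      finally show ?thesis .
    qed
    have mJ: "(\<lambda>z. \<integral>\<^sup>+w. ?J z w \<partial>lborel) \<in> borel_measurable (conv_pow F (n - 1))"
      using lborel.borel_measurable_nn_integral[OF m2] .
    have "(\<integral>\<^sup>+y. (\<integral>\<^sup>+z. indicator {x<..x+h} (y + z) \<partial>conv_pow F (n - 1)) \<partial>highpart c)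
       = (\<integral>\<^sup>+z. (\<integral>\<^sup>+y. indicator {x<..x+h} (y + z) \<partial>highpart c) \<partial>conv_pow F (n - 1))"
      using HP.Fubini'[OF m1] by simp
    also have "\<dots> = (\<integral>\<^sup>+z. emeasure (highpart c) {x-z<..(x-z)+h} \<partial>conv_pow F (n - 1))"
    proof (rule nn_integral_cong)
      fix z
      have "(\<integral>\<^sup>+y. indicator {x<..x+h} (y + z) \<partial>highpart c) = (\<integral>\<^sup>+y. indicator {x-z<..(x-z)+h} y \<partial>highpart c)"
        by (intro nn_integral_cong) (auto simp: indicator_def)
      then show "(\<integral>\<^sup>+y. indicator {x<..x+h} (y + z) \<partial>highpart c) = emeasure (highpart c) {x-z<..(x-z)+h}" by simp
    qed
    also have "\<dots> \<le> (\<integral>\<^sup>+z. ennreal (4 * T * W (c/2) / c) + ennreal (1 / h) * (\<integral>\<^sup>+w. ?J z w \<partial>lborel) \<partial>conv_pow F (n - 1))"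
      by (intro nn_integral_mono highpart_interval c T)
    also have "\<dots> = ennreal (4 * T * W (c/2) / c) + ennreal (1 / h) * (\<integral>\<^sup>+z. (\<integral>\<^sup>+w. ?J z w \<partial>lborel) \<partial>conv_pow F (n - 1))"
      using mJ P.emeasure_space_1 by (simp add: nn_integral_add nn_integral_cmult)
    also have "(\<integral>\<^sup>+z. (\<integral>\<^sup>+w. ?J z w \<partial>lborel) \<partial>conv_pow F (n - 1)) = (\<integral>\<^sup>+w. (\<integral>\<^sup>+z. ?J z w \<partial>conv_pow F (n - 1)) \<partial>lborel)"
      using PL.Fubini'[OF m2] by simp
    also have "\<dots> \<le> (\<integral>\<^sup>+w. (indicator {c/2<..} w * ennreal (excess T w)) * ennreal (D / a (real n)) \<partial>lborel)"
    proof (rule nn_integral_mono)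
      fix w :: real
      have "(\<integral>\<^sup>+z. ?J z w \<partial>conv_pow F (n - 1)) \<le> (\<integral>\<^sup>+z. (indicator {c/2<..} w * ennreal (excess T w)) * indicator {(x-w)-h..(x-w)+h} z \<partial>conv_pow F (n - 1))"
        by (intro nn_integral_mono) (auto simp: indicator_def)
      also have "\<dots> = (indicator {c/2<..} w * ennreal (excess T w)) * emeasure (conv_pow F (n - 1)) {(x-w)-h..(x-w)+h}"
        by (rule nn_integral_cmult_indicator) simp
      also have "\<dots> \<le> (indicator {c/2<..} w * ennreal (excess T w)) * ennreal (D / a (real n))"
        by (intro mult_left_mono D n) simp
      finally show "(\<integral>\<^sup>+z. ?J z w \<partial>conv_pow F (n - 1)) \<le> (indicator {c/2<..} w * ennreal (excess T w)) * ennreal (D / a (real n))" .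
    qed
    also have "\<dots> = excess_tail T (c/2) * ennreal (D / a (real n))"
      unfolding excess_tail_def by (rule nn_integral_multc) measurable
    also have "ennreal (1 / h) * (excess_tail T (c/2) * ennreal (D / a (real n))) = ennreal (D / h / a (real n)) * excess_tail T (c/2)"
    proof -
      have "ennreal (1 / h) * ennreal (D / a (real n)) = ennreal (D / h / a (real n))"
        using h_pos D by (simp add: ennreal_mult[symmetric])
      then show ?thesis by (metis mult.assoc mult.commute)
    qed
    finally show "(\<integral>\<^sup>+y. (\<integral>\<^sup>+z. indicator {x<..x+h} (y + z) \<partial>conv_pow F (n - 1)) \<partial>highpart c)
     \<le> ennreal (4 * T * W (c/2) / c) + ennreal (D / h / a (real n)) * excess_tail T (c/2)" by (simp add: mult_left_mono add_left_mono)
  qed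
qed

section \<open>Windows and geometric blocks\<close>

definition nrange :: "(real \<Rightarrow> real) \<Rightarrow> real \<Rightarrow> real \<Rightarrow> nat set" where
  "nrange L x \<delta> = {n. L x \<le> real n \<and> real n * W x \<le> \<delta>}"

definition ratio_sum :: "(real \<Rightarrow> real) \<Rightarrow> real \<Rightarrow> real \<Rightarrow> real" where
  "ratio_sum L x \<delta> = (\<Sum>n\<in>nrange L x \<delta>. real n / a (real n))"

lemma finite_nrange: "finite (nrange L x \<delta>)"
proof (rule finite_subset)
  show "nrange L x \<delta> \<subseteq> {..nat \<lfloor>\<delta> / W x\<rfloor>}"
    using tail_pos[of x] by (auto simp: nrange_def le_nat_floor pos_le_divide_eq)
qed simp

lemma card_nrange: "x > 0 \<Longrightarrow> (\<And>x. x > 0 \<Longrightarrow> L x \<ge> 1) \<Longrightarrow> \<delta> \<ge> 0 \<Longrightarrow> real (card (nrange L x \<delta>)) \<le> \<delta> / W x"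
proof -
  assume x: "x > 0" and L: "\<And>x. x > 0 \<Longrightarrow> L x \<ge> 1" and \<delta>: "\<delta> \<ge> 0"
  have "nrange L x \<delta> \<subseteq> {1..nat \<lfloor>\<delta> / W x\<rfloor>}"
    using tail_pos[of x] L[OF x] by (auto simp: nrange_def le_nat_floor pos_le_divide_eq)
  then have "card (nrange L x \<delta>) \<le> card {1..nat \<lfloor>\<delta> / W x\<rfloor>}" by (intro card_mono) auto
  then have "real (card (nrange L x \<delta>)) \<le> real (nat \<lfloor>\<delta> / W x\<rfloor>)" by simp
  also have "\<dots> \<le> \<delta> / W x" using \<delta> by simp
  finally show ?thesis .
qed

text \<open>There are at most \<delta> / W x indices. Each truncated term is O(\<delta> / x), and
  each level-T term is n * \<kappa> with \<kappa> = O(W x / x), so after multiplication by x * W x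
  both families contribute O(\<delta>^2). The excess terms add up to \<open>ratio_sum\<close> times
  \<open>excess_tail\<close>, which vanishes by \<open>key\<close>.\<close>

lemma moderate_n_sum:
  assumes L: "\<And>x. x > 0 \<Longrightarrow> L x \<ge> 1" and T: "T \<ge> 0" and \<delta>0: "0 < \<delta>0" "\<delta>0 \<le> 1"
    and key: "((\<lambda>x. ennreal (x * W x * ratio_sum L x \<delta>0) * excess_tail T (bfrac * x / 2)) \<longlongrightarrow> 0) at_top"
  obtains K where "K > 0" "\<And>\<delta>. 0 < \<delta> \<Longrightarrow> \<delta> \<le> \<delta>0 \<Longrightarrow> eventually (\<lambda>x. ennreal (x * W x) *
     (\<Sum>n\<in>nrange L x \<delta>. emeasure (conv_pow F n) {x<..x+h}) \<le> ennreal (K * \<delta>)) at_top"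
proof -
  obtain K1 where K1: "K1 > 0" "eventually (\<lambda>x. \<forall>n\<ge>1. \<forall>\<delta>. 0 < \<delta> \<longrightarrow> \<delta> \<le> 1 \<longrightarrow> real n * W x \<le> \<delta> \<longrightarrow>
    emeasure (conv_pow (lowpart (bfrac * x)) n) {x<..x+h} \<le> ennreal (K1 * \<delta> / x)) at_top"
    using lowpart_interval_bound by blast
  obtain D where D: "D > 0" "\<And>c T n x. c \<ge> 4 * h \<Longrightarrow> T \<ge> 0 \<Longrightarrow> n \<ge> 1 \<Longrightarrow>
     (\<integral>\<^sup>+y. (\<integral>\<^sup>+z. indicator {x<..x+h} (y + z) \<partial>conv_pow F (n - 1)) \<partial>highpart c)
     \<le> ennreal (4 * T * W (c/2) / c) + ennreal (D / a (real n)) * excess_tail T (c/2)"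
    using big_jump_bound by blast
  obtain C1 where C1: "C1 > 0" "\<And>x y. 0 < y \<Longrightarrow> y \<le> x \<Longrightarrow> 1 \<le> x \<Longrightarrow> W y \<le> C1 * (x / y) powr 1 * W x"
    using tail_potter_upper[of 1] alpha_less_1 by blast
  \<comment> \<open>From 4 * T * W (c/2) / c with c = bfrac * x, after the Potter bound W (c/2)
    \<le> C1 * (2 / bfrac) * W x.\<close>
  define K2 where "K2 = 8 * T * C1 / bfrac\<^sup>2"
  have K2: "K2 \<ge> 0" using T C1 by (simp add: K2_def)
  show ?thesis
  proof (rule that[of "K1 + K2 + 1"])
    show "K1 + K2 + 1 > 0" using K1 K2 by simp
    fix \<delta> :: real assume \<delta>: "0 < \<delta>" "\<delta> \<le> \<delta>0"
    \<comment> \<open>The excess enters with the factor D, so below this threshold it contributes at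
      most \<delta>.\<close>
    have "ennreal (\<delta> / D) > 0" using \<delta> D by simp
    from order_tendstoD(2)[OF key this]
    have "eventually (\<lambda>x. ennreal (x * W x * ratio_sum L x \<delta>0) * excess_tail T (bfrac * x / 2) < ennreal (\<delta> / D)) at_top" .
    then show "eventually (\<lambda>x. ennreal (x * W x) * (\<Sum>n\<in>nrange L x \<delta>. emeasure (conv_pow F n) {x<..x+h}) \<le> ennreal ((K1 + K2 + 1) * \<delta>)) at_top"
      using K1(2) eventually_ge_at_top[of "4 * h / bfrac"] eventually_ge_at_top[of 1]
    proof eventually_elim
      case (elim x)
      define c where "c = bfrac * x"
      define Ex where "Ex = excess_tail T (c/2)"
      have x: "x > 0" "x \<ge> 1" and c: "c \<ge> 4 * h" "c > 0" using elim bfrac by (auto simp: c_def field_simps)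
      have Wp: "W x > 0" by (rule tail_pos)
      define \<kappa> where "\<kappa> = 4 * T * W (c/2) / c"
      have kap: "\<kappa> \<ge> 0" "\<kappa> * x \<le> K2 * W x"
      proof -
        show "\<kappa> \<ge> 0" using T c by (simp add: \<kappa>_def)
        have "c / 2 \<le> 1 * x" using bfrac x unfolding c_def by (intro order_trans[OF _ mult_right_mono[of bfrac 1 x]]) auto
        then have "W (c/2) \<le> C1 * (x / (c/2)) powr 1 * W x" using c x by (intro C1) auto
        also have "(x / (c/2)) powr 1 = 2 / bfrac" using bfrac x by (simp add: c_def)
        finally have "4 * T * W (c/2) / c \<le> 4 * T * (C1 * (2 / bfrac) * W x) / c"
          using T c by (intro divide_right_mono mult_left_mono) auto
        then have "\<kappa> * x \<le> 4 * T * (C1 * (2 / bfrac) * W x) / c * x" unfolding \<kappa>_def using x by (intro mult_right_mono) auto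
        also have "\<dots> = K2 * W x" using bfrac x by (simp add: c_def K2_def power2_eq_square)
        finally show "\<kappa> * x \<le> K2 * W x" .
      qed
      have n1: "n \<ge> 1" if "n \<in> nrange L x \<delta>" for n
      proof -
        have "1 \<le> real n" using that L[OF x(1)] by (simp add: nrange_def)
        then show ?thesis by simp
      qed
      have each: "emeasure (conv_pow F n) {x<..x+h} \<le> ennreal (K1 * \<delta> / x + \<delta> / W x * \<kappa>) + ennreal (D * (real n / a (real n))) * Ex"
        if n: "n \<in> nrange L x \<delta>" for n
      proof -
        have nW: "real n * W x \<le> \<delta>" using n by (simp add: nrange_def)
        have "emeasure (conv_pow (lowpart c) n) {x<..x+h} \<le> ennreal (K1 * \<delta> / x)"
          using elim(2) n1[OF n] \<delta> \<delta>0 nW unfolding c_def by auto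
        then have p1: "(\<integral>\<^sup>+u. indicator {x<..x+h} u \<partial>conv_pow (lowpart c) n) \<le> ennreal (K1 * \<delta> / x)" by simp
        have "of_nat n * (\<integral>\<^sup>+y. (\<integral>\<^sup>+z. indicator {x<..x+h} (y + z) \<partial>conv_pow F (n - 1)) \<partial>highpart c)
          \<le> of_nat n * (ennreal \<kappa> + ennreal (D / a (real n)) * Ex)"
          unfolding \<kappa>_def Ex_def by (intro mult_left_mono D(2) c T n1[OF n]) simp
        also have "\<dots> = ennreal (real n * \<kappa>) + ennreal (D * (real n / a (real n))) * Ex"
        proof -
          have e1: "of_nat n * ennreal \<kappa> = ennreal (real n * \<kappa>)"
            using kap(1) by (simp add: ennreal_of_nat_eq_real_of_nat ennreal_mult)
          have "of_nat n * ennreal (D / a (real n)) = ennreal (real n * (D / a (real n)))"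
            using D(1) by (subst ennreal_mult) (auto simp: ennreal_of_nat_eq_real_of_nat)
          then have e2: "of_nat n * ennreal (D / a (real n)) = ennreal (D * (real n / a (real n)))" by (simp add: mult_ac)
          show ?thesis by (simp only: distrib_left mult.assoc[symmetric] e1 e2)
        qed
        also have "\<dots> \<le> ennreal (\<delta> / W x * \<kappa>) + ennreal (D * (real n / a (real n))) * Ex"
          using nW kap Wp by (intro add_right_mono ennreal_leI mult_right_mono) (auto simp: field_simps)
        finally have p2: "of_nat n * (\<integral>\<^sup>+y. (\<integral>\<^sup>+z. indicator {x<..x+h} (y + z) \<partial>conv_pow F (n - 1)) \<partial>highpart c)
          \<le> ennreal (\<delta> / W x * \<kappa>) + ennreal (D * (real n / a (real n))) * Ex" .
        have "emeasure (conv_pow F n) {x<..x+h} = (\<integral>\<^sup>+u. indicator {x<..x+h} u \<partial>conv_pow F n)" by simp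
        also have "\<dots> \<le> (\<integral>\<^sup>+u. indicator {x<..x+h} u \<partial>conv_pow (lowpart c) n)
           + of_nat n * (\<integral>\<^sup>+y. (\<integral>\<^sup>+z. indicator {x<..x+h} (y + z) \<partial>conv_pow F (n - 1)) \<partial>highpart c)"
          by (rule big_jump_decomposition) simp
        also have "\<dots> \<le> ennreal (K1 * \<delta> / x) + (ennreal (\<delta> / W x * \<kappa>) + ennreal (D * (real n / a (real n))) * Ex)"
          by (intro add_mono p1 p2)
        also have "\<dots> = ennreal (K1 * \<delta> / x + \<delta> / W x * \<kappa>) + ennreal (D * (real n / a (real n))) * Ex"
        proof -
          have "ennreal (K1 * \<delta> / x + \<delta> / W x * \<kappa>) = ennreal (K1 * \<delta> / x) + ennreal (\<delta> / W x * \<kappa>)"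
            using K1(1) \<delta> x kap Wp by (intro ennreal_plus) auto
          then show ?thesis by (simp only: add.assoc)
        qed
        finally show ?thesis .
      qed
      have cd: "real (card (nrange L x \<delta>)) \<le> \<delta> / W x" using x L \<delta> by (intro card_nrange) auto
      have "(\<Sum>n\<in>nrange L x \<delta>. emeasure (conv_pow F n) {x<..x+h})
         \<le> (\<Sum>n\<in>nrange L x \<delta>. ennreal (K1 * \<delta> / x + \<delta> / W x * \<kappa>) + ennreal (D * (real n / a (real n))) * Ex)"
        by (intro sum_mono each)
      also have "\<dots> = of_nat (card (nrange L x \<delta>)) * ennreal (K1 * \<delta> / x + \<delta> / W x * \<kappa>) + ennreal (D * ratio_sum L x \<delta>) * Ex"
      proof -
        have "(\<Sum>n\<in>nrange L x \<delta>. ennreal (D * (real n / a (real n)))) = ennreal (\<Sum>n\<in>nrange L x \<delta>. D * (real n / a (real n)))"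
          using D(1) by (intro sum_ennreal) auto
        also have "(\<Sum>n\<in>nrange L x \<delta>. D * (real n / a (real n))) = D * ratio_sum L x \<delta>"
          by (simp only: ratio_sum_def sum_distrib_left)
        finally show ?thesis by (simp only: sum.distrib sum_distrib_right[symmetric] sum_constant)
      qed
      also have "\<dots> \<le> ennreal (\<delta> / W x * (K1 * \<delta> / x + \<delta> / W x * \<kappa>)) + ennreal (D * ratio_sum L x \<delta>0) * Ex"
      proof (rule add_mono)
        have "of_nat (card (nrange L x \<delta>)) * ennreal (K1 * \<delta> / x + \<delta> / W x * \<kappa>) \<le> ennreal (\<delta> / W x) * ennreal (K1 * \<delta> / x + \<delta> / W x * \<kappa>)"
          using cd by (intro mult_right_mono) (auto simp: ennreal_of_nat_eq_real_of_nat ennreal_leI)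
        also have "\<dots> = ennreal (\<delta> / W x * (K1 * \<delta> / x + \<delta> / W x * \<kappa>))"
          using \<delta> Wp K1(1) x kap by (intro ennreal_mult[symmetric]) auto
        finally show "of_nat (card (nrange L x \<delta>)) * ennreal (K1 * \<delta> / x + \<delta> / W x * \<kappa>) \<le> ennreal (\<delta> / W x * (K1 * \<delta> / x + \<delta> / W x * \<kappa>))" .
        show "ennreal (D * ratio_sum L x \<delta>) * Ex \<le> ennreal (D * ratio_sum L x \<delta>0) * Ex"
          unfolding ratio_sum_def using D(1) \<delta> by (intro mult_right_mono ennreal_leI mult_left_mono sum_mono2 finite_nrange) (auto simp: nrange_def)
      qed
      finally have "ennreal (x * W x) * (\<Sum>n\<in>nrange L x \<delta>. emeasure (conv_pow F n) {x<..x+h})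
        \<le> ennreal (x * W x) * (ennreal (\<delta> / W x * (K1 * \<delta> / x + \<delta> / W x * \<kappa>)) + ennreal (D * ratio_sum L x \<delta>0) * Ex)"
        by (rule mult_left_mono) simp
      also have "\<dots> = ennreal (x * W x * (\<delta> / W x * (K1 * \<delta> / x + \<delta> / W x * \<kappa>))) + ennreal D * (ennreal (x * W x * ratio_sum L x \<delta>0) * Ex)"
      proof -
        have rs: "ratio_sum L x \<delta>0 \<ge> 0" unfolding ratio_sum_def by (intro sum_nonneg) auto
        have "ennreal (x * W x) * ennreal (\<delta> / W x * (K1 * \<delta> / x + \<delta> / W x * \<kappa>)) = ennreal (x * W x * (\<delta> / W x * (K1 * \<delta> / x + \<delta> / W x * \<kappa>)))"
          using x \<delta> Wp K1(1) kap by (intro ennreal_mult[symmetric]) auto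
        moreover have "ennreal (x * W x) * ennreal (D * ratio_sum L x \<delta>0) = ennreal (x * W x * (D * ratio_sum L x \<delta>0))"
          using x D(1) rs by (intro ennreal_mult[symmetric]) auto
        then have "ennreal (x * W x) * ennreal (D * ratio_sum L x \<delta>0) = ennreal (D * (x * W x * ratio_sum L x \<delta>0))"
          by (simp add: mult_ac)
        then have "ennreal (x * W x) * ennreal (D * ratio_sum L x \<delta>0) = ennreal D * ennreal (x * W x * ratio_sum L x \<delta>0)"
          using x D(1) rs by (subst (asm) ennreal_mult) auto
        ultimately show ?thesis by (simp only: distrib_left mult.assoc[symmetric])
      qed
      also have "\<dots> \<le> ennreal ((K1 + K2) * \<delta>) + ennreal D * ennreal (\<delta> / D)"
      proof (intro add_mono mult_left_mono ennreal_leI)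
        have "x * W x * (\<delta> / W x * (K1 * \<delta> / x + \<delta> / W x * \<kappa>)) = \<delta>\<^sup>2 * (K1 + \<kappa> * x / W x)"
          using x Wp by (simp add: field_simps power2_eq_square)
        also have "\<dots> \<le> \<delta>\<^sup>2 * (K1 + K2)"
          using kap Wp by (intro mult_left_mono add_left_mono) (auto simp: divide_le_eq)
        also have "\<dots> \<le> \<delta> * (K1 + K2)"
          using \<delta> \<delta>0 K1(1) K2 by (intro mult_right_mono) (auto simp: power2_eq_square mult_left_le_one_le)
        finally show "x * W x * (\<delta> / W x * (K1 * \<delta> / x + \<delta> / W x * \<kappa>)) \<le> (K1 + K2) * \<delta>" by (simp add: mult.commute)
        show "ennreal (x * W x * ratio_sum L x \<delta>0) * Ex \<le> ennreal (\<delta> / D)"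
          using elim(1) unfolding Ex_def c_def by (rule less_imp_le)
      qed simp
      also have "\<dots> = ennreal ((K1 + K2 + 1) * \<delta>)"
      proof -
        have "ennreal D * ennreal (\<delta> / D) = ennreal \<delta>" using D(1) \<delta> by (subst ennreal_mult[symmetric]) auto
        then have "ennreal ((K1 + K2) * \<delta>) + ennreal D * ennreal (\<delta> / D) = ennreal ((K1 + K2) * \<delta> + \<delta>)"
          using K1(1) K2 \<delta> by (subst ennreal_plus) auto
        then show ?thesis by (simp add: algebra_simps)
      qed
      finally show ?case .
    qed
  qed
qed

text \<open>On the window \<open>omega\<close> is bounded by x / W x, so the Bochner integral
  defining \<open>Phi\<close> is genuine and cannot be the default value 0. Hence a bound on
  \<open>Phi\<close> really bounds the excess.\<close>

lemma Phi_eq: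
  assumes eta: "0 < \<eta>" "\<eta> \<le> 1" and x: "x > 0"
  shows "ennreal (Phi F h \<eta> x T) = (\<integral>\<^sup>+y. indicator {(1-\<eta>)*x<..x} y * ennreal (max (omega F h y - T) 0) \<partial>lborel)"
proof -
  let ?f = "\<lambda>y. max (omega F h y - T) 0"
  have le: "(1 - \<eta>) * x \<le> x" "(1 - \<eta>) * x \<ge> 0" using eta x mult_right_mono[of "1 - \<eta>" 1 x] by auto
  define B where "B = x / W x + \<bar>T\<bar>"
  have bound: "?f y \<le> B" if "y \<in> {(1-\<eta>)*x<..<x}" for y
  proof -
    have y: "0 < y" "y < x" using that le by auto
    have "omega F h y = y * FI F h y / W y" by (simp add: omega_def)
    also have "\<dots> \<le> x * 1 / W x"
      using y tail_pos[of x] tail_antimono[of y x] by (intro frac_le mult_mono) (auto simp: FI_def)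
    finally show ?thesis using tail_pos[of x] x by (auto simp: B_def)
  qed
  have B: "B \<ge> 0" using x by (simp add: B_def)
  have int: "integrable lborel (\<lambda>y. indicator {(1-\<eta>)*x<..<x} y * ?f y)"
  proof (rule Bochner_Integration.integrable_bound)
    show "integrable lborel (\<lambda>y. B * indicator {(1-\<eta>)*x<..<x} y)"
      by (intro integrable_mult_right integrable_real_indicator) (use le in \<open>auto simp: emeasure_lborel_Ioo\<close>)
    show "AE y in lborel. norm (indicator {(1-\<eta>)*x<..<x} y * ?f y) \<le> norm (B * indicator {(1-\<eta>)*x<..<x} y)"
      using bound B by (intro AE_I2) (auto simp: indicator_def)
  qed measurable
  have "Phi F h \<eta> x T = (\<integral>y. indicator {(1-\<eta>)*x<..<x} y * ?f y \<partial>lborel)"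
    using le unfolding Phi_def interval_lebesgue_integral_def set_lebesgue_integral_def by simp
  then have "ennreal (Phi F h \<eta> x T) = (\<integral>\<^sup>+y. ennreal (indicator {(1-\<eta>)*x<..<x} y * ?f y) \<partial>lborel)"
    using nn_integral_eq_integral[OF int] by simp
  also have "\<dots> = (\<integral>\<^sup>+y. indicator {(1-\<eta>)*x<..x} y * ennreal (?f y) \<partial>lborel)"
  proof (rule nn_integral_cong_AE)
    have "AE y in lborel. y \<noteq> x" by (rule AE_lborel_singleton)
    then show "AE y in lborel. ennreal (indicator {(1-\<eta>)*x<..<x} y * ?f y) = indicator {(1-\<eta>)*x<..x} y * ennreal (?f y)"
      by eventually_elim (auto simp: indicator_def)
  qed
  finally show ?thesis .
qed

lemma excess_window:
  assumes eta: "0 < \<eta>" "\<eta> \<le> 1" and q: "1 - \<eta> \<le> q" "0 < q" "q < 1" and y: "y > 0"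
  shows "(\<integral>\<^sup>+w. indicator {q * y<..y} w * ennreal (excess T w) \<partial>lborel) \<le> ennreal (W (q * y) / (q * y)) * ennreal (Phi F h \<eta> y T)"
proof -
  have "(\<integral>\<^sup>+w. indicator {q * y<..y} w * ennreal (excess T w) \<partial>lborel)
     \<le> (\<integral>\<^sup>+w. ennreal (W (q * y) / (q * y)) * (indicator {(1-\<eta>)*y<..y} w * ennreal (max (omega F h w - T) 0)) \<partial>lborel)"
  proof (rule nn_integral_mono)
    fix w :: real
    show "indicator {q * y<..y} w * ennreal (excess T w) \<le> ennreal (W (q * y) / (q * y)) * (indicator {(1-\<eta>)*y<..y} w * ennreal (max (omega F h w - T) 0))"
    proof (cases "w \<in> {q * y<..y}")
      case True
      have qy: "q * y > 0" using q y by simp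
      have "(1 - \<eta>) * y \<le> q * y" using q y by (intro mult_right_mono) auto
      then have w2: "w \<in> {(1-\<eta>)*y<..y}" using True by auto
      have "excess T w \<le> W (q * y) / (q * y) * max (omega F h w - T) 0"
        unfolding excess_def using True qy by (intro mult_right_mono frac_le tail_antimono) auto
      then have "ennreal (excess T w) \<le> ennreal (W (q * y) / (q * y)) * ennreal (max (omega F h w - T) 0)"
        using qy by (subst ennreal_mult[symmetric]) (auto intro: ennreal_leI)
      then show ?thesis using True w2 by simp
    qed simp
  qed
  also have "\<dots> = ennreal (W (q * y) / (q * y)) * ennreal (Phi F h \<eta> y T)"
    unfolding Phi_eq[OF eta y] by (rule nn_integral_cmult) measurable
  finally show ?thesis .
qed

text \<open>The intervals (z / q^k, z / q^(k+1)] tile (z, \<infinity>), and each lies in a window of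
  \<open>Phi\<close> because q \<ge> 1 - \<eta>. At the right end y of the k-th one the contribution
  is of order Phi * W y / y, hence A * q^(-k*\<kappa>) / (y * W y) up to constants, and 1 / W y
  grows at most like q^(-k*\<beta>).\<close>

lemma excess_tail_bound:
  assumes eta: "0 < \<eta>" "\<eta> \<le> 1" and q: "1 - \<eta> \<le> q" "0 < q" "q < 1" and \<kappa>: "\<alpha> + \<kappa> < 1"
  obtains C where "C > 0" "\<And>z A. z \<ge> 1 \<Longrightarrow> A \<ge> 0 \<Longrightarrow>
     (\<And>k. k \<ge> 1 \<Longrightarrow> Phi F h \<eta> (z / q ^ k) T \<le> A * (1 / q ^ k) powr \<kappa> / (W (z / q ^ k))\<^sup>2) \<Longrightarrow> excess_tail T z \<le> ennreal (C * A / (z * W z))"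
proof -
  \<comment> \<open>Halfway between \<alpha> and 1 - \<kappa>: a valid Potter exponent that still
    gives \<beta> + \<kappa> < 1.\<close>
  define \<beta> where "\<beta> = \<alpha> + (1 - \<alpha> - \<kappa>) / 2"
  have b: "\<beta> > \<alpha>" "\<beta> + \<kappa> < 1" "\<beta> > \<alpha>" using \<kappa> by (auto simp: \<beta>_def field_simps)
  obtain C1 where C1: "C1 > 0" "\<And>x y. 0 < y \<Longrightarrow> y \<le> x \<Longrightarrow> 1 \<le> x \<Longrightarrow> W y \<le> C1 * (x / y) powr \<beta> * W x"
    using tail_potter_upper[OF b(1)] by blast
  \<comment> \<open>The ratio of the geometric series over the windows: 1 / y brings q, and \<kappa>
    and \<beta> are the growth allowed to \<open>Phi\<close> and to 1 / W.\<close>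
  define \<rho> where "\<rho> = q powr (1 - \<kappa> - \<beta>)"
  have rho: "0 < \<rho>" "\<rho> < 1"
  proof -
    show "\<rho> > 0" using q by (simp add: \<rho>_def)
    have "q powr (1 - \<kappa> - \<beta>) < q powr 0" using q b by (intro powr_less_mono') auto
    then show "\<rho> < 1" using q by (simp add: \<rho>_def)
  qed
  define C where "C = C1\<^sup>2 * (1/q) powr (\<beta> + \<kappa> + \<beta>)"
  have C: "C > 0" using C1 q by (simp add: C_def)
  show ?thesis
  proof (rule that[of "C / (1 - \<rho>)"])
    show "C / (1 - \<rho>) > 0" using C rho by simp
    fix z A :: real assume z: "z \<ge> 1" and A: "A \<ge> 0"
      and Ph: "\<And>k. k \<ge> 1 \<Longrightarrow> Phi F h \<eta> (z / q ^ k) T \<le> A * (1 / q ^ k) powr \<kappa> / (W (z / q ^ k))\<^sup>2"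
    have Wz: "W z > 0" by (rule tail_pos)
    define H where "H = C * A / (z * W z)"
    have H: "H \<ge> 0" using C A z Wz by (simp add: H_def)
    have qk: "q ^ k > 0" "q ^ k \<le> 1" for k :: nat using q by (auto simp: power_le_one)
    have window: "(\<integral>\<^sup>+w. indicator {z / q ^ k<..z / q ^ Suc k} w * ennreal (excess T w) \<partial>lborel) \<le> ennreal (H * \<rho> ^ k)" for k
    proof -
      define y where "y = z / q ^ Suc k"
      have yq: "q * y = z / q ^ k" using q by (simp add: y_def)
      have y0: "y > 0" using z qk[of "Suc k"] unfolding y_def by (intro divide_pos_pos) auto
      have zk: "z / q ^ k \<ge> z" using z qk[of k] by (simp add: le_divide_eq mult_left_le)
      have yz: "y \<ge> z" using z qk[of "Suc k"] by (simp add: y_def le_divide_eq mult_left_le del: power_Suc)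
      have y1: "y \<ge> 1" using yz z by simp
      have Wy: "W y > 0" by (rule tail_pos)
      define e where "e = (1/q) powr \<beta>"
      have e: "e > 0" using q by (simp add: e_def)
      have W1: "W (q * y) \<le> C1 * e * W y"
      proof -
        have "W (q * y) \<le> C1 * (y / (q * y)) powr \<beta> * W y"
          using q y0 y1 by (intro C1) (auto simp: mult_left_le_one_le)
        then show ?thesis using y0 by (simp add: e_def)
      qed
      have W2: "1 / W y \<le> C1 * (1 / q ^ Suc k) powr \<beta> / W z"
      proof -
        have "W z \<le> C1 * (y / z) powr \<beta> * W y" using z yz y1 by (intro C1) auto
        also have "y / z = 1 / q ^ Suc k" using z by (simp add: y_def)
        finally show ?thesis using Wy Wz by (simp add: field_simps)
      qed
      have Py: "Phi F h \<eta> y T \<le> A * (1 / q ^ Suc k) powr \<kappa> / (W y)\<^sup>2" unfolding y_def by (rule Ph) simp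
      have "(\<integral>\<^sup>+w. indicator {z / q ^ k<..z / q ^ Suc k} w * ennreal (excess T w) \<partial>lborel) \<le> ennreal (W (q * y) / (q * y)) * ennreal (Phi F h \<eta> y T)"
        using excess_window[OF eta q y0] by (simp only: yq) (simp only: y_def)
      also have "\<dots> \<le> ennreal (W (q * y) / (q * y)) * ennreal (A * (1 / q ^ Suc k) powr \<kappa> / (W y)\<^sup>2)"
        using Py by (intro mult_left_mono ennreal_leI) auto
      also have "\<dots> = ennreal (W (q * y) / (q * y) * (A * (1 / q ^ Suc k) powr \<kappa> / (W y)\<^sup>2))"
        using q y0 A by (intro ennreal_mult[symmetric]) auto
      also have "\<dots> \<le> ennreal (H * \<rho> ^ k)"
      proof (rule ennreal_leI)
        have "W (q * y) / (q * y) * (A * (1 / q ^ Suc k) powr \<kappa> / (W y)\<^sup>2) \<le> (C1 * e * W y) / (q * y) * (A * (1 / q ^ Suc k) powr \<kappa> / (W y)\<^sup>2)"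
          using W1 q y0 A by (intro mult_right_mono divide_right_mono) auto
        also have "\<dots> = C1 * e * A * (1 / q ^ Suc k) powr \<kappa> * (q ^ k / z) * (1 / W y)"
          unfolding yq using Wy z qk[of k] by (simp add: power2_eq_square)
        also have "\<dots> \<le> C1 * e * A * (1 / q ^ Suc k) powr \<kappa> * (q ^ k / z) * (C1 * (1 / q ^ Suc k) powr \<beta> / W z)"
          using W2 C1 e A z qk[of k] by (intro mult_left_mono) auto
        also have "\<dots> = C1\<^sup>2 * e * A / (z * W z) * (q ^ k * ((1 / q ^ Suc k) powr \<kappa> * (1 / q ^ Suc k) powr \<beta>))"
          by (simp add: power2_eq_square)
        also have "q ^ k * ((1 / q ^ Suc k) powr \<kappa> * (1 / q ^ Suc k) powr \<beta>) = (1/q) powr (\<kappa> + \<beta>) * \<rho> ^ k"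
        proof -
          have "(1 / q ^ Suc k) powr \<kappa> * (1 / q ^ Suc k) powr \<beta> = (1 / q ^ Suc k) powr (\<kappa> + \<beta>)"
            by (simp add: powr_add)
          also have "1 / q ^ Suc k = (1/q) * (1/q) ^ k" by (simp add: power_one_over)
          also have "((1/q) * (1/q) ^ k) powr (\<kappa> + \<beta>) = (1/q) powr (\<kappa> + \<beta>) * ((1/q) powr (\<kappa> + \<beta>)) ^ k"
          proof -
            have q1: "1 / q > 0" using q by simp
            have "((1/q) ^ k) powr (\<kappa> + \<beta>) = (1/q) powr (real k * (\<kappa> + \<beta>))"
              by (simp only: powr_realpow[OF q1, symmetric] powr_powr)
            also have "\<dots> = ((1/q) powr (\<kappa> + \<beta>)) powr real k" by (simp only: powr_powr mult.commute)
            also have "\<dots> = ((1/q) powr (\<kappa> + \<beta>)) ^ k" by (rule powr_realpow) (use q1 in simp)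
            finally show ?thesis by (simp only: powr_mult)
          qed
          finally have Z: "(1 / q ^ Suc k) powr \<kappa> * (1 / q ^ Suc k) powr \<beta> = (1/q) powr (\<kappa> + \<beta>) * ((1/q) powr (\<kappa> + \<beta>)) ^ k"
            by (simp only: power_Suc power_one_over times_divide_times_eq mult_1)
          have "q ^ k * ((1 / q ^ Suc k) powr \<kappa> * (1 / q ^ Suc k) powr \<beta>) = (1/q) powr (\<kappa> + \<beta>) * (q * (1/q) powr (\<kappa> + \<beta>)) ^ k"
            unfolding Z by (simp only: power_mult_distrib mult_ac)
          moreover have "q * (1/q) powr (\<kappa> + \<beta>) = \<rho>"
          proof -
            have "\<rho> = q powr 1 * q powr (- (\<kappa> + \<beta>))" unfolding \<rho>_def by (subst powr_add[symmetric]) (simp add: algebra_simps)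
            also have "q powr (- (\<kappa> + \<beta>)) = (1/q) powr (\<kappa> + \<beta>)" by (simp only: powr_minus_divide powr_divide powr_one_eq_one)
            finally show ?thesis using q by simp
          qed
          ultimately show ?thesis by simp
        qed
        also have "C1\<^sup>2 * e * A / (z * W z) * ((1/q) powr (\<kappa> + \<beta>) * \<rho> ^ k) = H * \<rho> ^ k"
        proof -
          have "(1/q) powr (\<beta> + \<kappa> + \<beta>) = e * (1/q) powr (\<kappa> + \<beta>)"
            unfolding e_def by (subst powr_add[symmetric]) (simp only: add.assoc)
          then have "H = C1\<^sup>2 * (e * (1/q) powr (\<kappa> + \<beta>)) * A / (z * W z)" by (simp only: H_def C_def)
          then show ?thesis by simp
        qed
        finally show "W (q * y) / (q * y) * (A * (1 / q ^ Suc k) powr \<kappa> / (W y)\<^sup>2) \<le> H * \<rho> ^ k" .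
      qed
      finally show ?thesis .
    qed
    have "excess_tail T z \<le> (\<integral>\<^sup>+w. (\<Sum>k. indicator {z / q ^ k<..z / q ^ Suc k} w * ennreal (excess T w)) \<partial>lborel)"
      unfolding excess_tail_def
    proof (rule nn_integral_mono)
      fix w :: real
      show "indicator {z<..} w * ennreal (excess T w) \<le> (\<Sum>k. indicator {z / q ^ k<..z / q ^ Suc k} w * ennreal (excess T w))"
      proof (cases "w > z")
        case True
        have "\<exists>k. w \<le> z / q ^ k"
        proof -
          obtain k where "q ^ k < z / w" using real_arch_pow_inv[of "z / w" q] True z q by auto
          then have "w \<le> z / q ^ k" using True z qk[of k] by (simp add: field_simps)
          then show ?thesis ..
        qed
        define k where "k = (LEAST k. w \<le> z / q ^ k)"
        have k1: "w \<le> z / q ^ k" unfolding k_def using \<open>\<exists>k. w \<le> z / q ^ k\<close> by (rule LeastI_ex)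
        have "k \<noteq> 0" using k1 True by (cases k) auto
        then obtain j where j: "k = Suc j" by (cases k) auto
        have "\<not> w \<le> z / q ^ j" using not_less_Least[of j "\<lambda>k. w \<le> z / q ^ k"] j by (simp add: k_def)
        then have wj: "w \<in> {z / q ^ j<..z / q ^ Suc j}" using k1 j by auto
        have "indicator {z<..} w * ennreal (excess T w) \<le> indicator {z / q ^ j<..z / q ^ Suc j} w * ennreal (excess T w)"
          using wj True by simp
        also have "\<dots> \<le> (\<Sum>k. indicator {z / q ^ k<..z / q ^ Suc k} w * ennreal (excess T w))"
        proof -
          define f where "f k = indicator {z / q ^ k<..z / q ^ Suc k} w * ennreal (excess T w)" for k
          have "f j \<le> suminf f" using sum_le_suminf[of f "{j}"] by (simp add: summableI)
          then show ?thesis unfolding f_def .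
        qed
        finally show ?thesis .
      qed simp
    qed
    also have "\<dots> = (\<Sum>k. \<integral>\<^sup>+w. indicator {z / q ^ k<..z / q ^ Suc k} w * ennreal (excess T w) \<partial>lborel)"
      by (rule nn_integral_suminf) measurable
    also have "\<dots> \<le> (\<Sum>k. ennreal (H * \<rho> ^ k))"
      by (intro suminf_le window) auto
    also have "\<dots> = ennreal (\<Sum>k. H * \<rho> ^ k)"
      using H rho by (intro suminf_ennreal2 summable_mult summable_geometric) auto
    also have "(\<Sum>k. H * \<rho> ^ k) = H * (1 / (1 - \<rho>))"
      using rho by (subst suminf_mult) (auto intro: summable_geometric simp: suminf_geometric)
    also have "\<dots> = C / (1 - \<rho>) * A / (z * W z)" by (simp add: H_def)
    finally show "excess_tail T z \<le> ennreal (C / (1 - \<rho>) * A / (z * W z))" .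
  qed
qed

lemma excess_tail_mono: "y \<le> z \<Longrightarrow> excess_tail T z \<le> excess_tail T y"
  unfolding excess_tail_def by (intro nn_integral_mono mult_right_mono) (auto simp: indicator_def)

text \<open>The block from K^i * l to K^(i+1) * l has at most K^(i+1) * l indices, each term being
  at most K^(i+1) * l / a (K^i * l); this is where K^2 comes from.\<close>

lemma ratio_block_sum:
  fixes K l :: real
  assumes K: "K \<ge> 1" and l: "l \<ge> 1"
  shows "(\<Sum>n\<in>{n::nat. l \<le> real n \<and> real n < K ^ m * l}. real n / a (real n)) \<le> (\<Sum>i<m. K\<^sup>2 * ((K ^ i * l)\<^sup>2 / a (K ^ i * l)))"
proof (induction m)
  case 0
  show ?case by (auto intro!: sum_nonpos)
next
  case (Suc m)
  let ?B = "{n::nat. K ^ m * l \<le> real n \<and> real n < K ^ Suc m * l}"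
  have fin: "finite {n::nat. real n < x}" for x
    by (rule finite_subset[of _ "{..nat \<lceil>x\<rceil>}"]) (auto, linarith)
  have tl: "K ^ m * l \<ge> 1" using mult_mono[of 1 "K ^ m" 1 l] K l by (simp add: one_le_power)
  have block: "(\<Sum>n\<in>?B. real n / a (real n)) \<le> K\<^sup>2 * ((K ^ m * l)\<^sup>2 / a (K ^ m * l))"
  proof -
    have "(\<Sum>n\<in>?B. real n / a (real n)) \<le> (\<Sum>n\<in>?B. K ^ Suc m * l / a (K ^ m * l))"
      by (intro sum_mono frac_le a_mono) auto
    also have "\<dots> = real (card ?B) * (K ^ Suc m * l / a (K ^ m * l))" by simp
    also have "\<dots> \<le> (K ^ Suc m * l) * (K ^ Suc m * l / a (K ^ m * l))"
    proof (rule mult_right_mono)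
      have "?B \<subseteq> {1..nat \<lfloor>K ^ Suc m * l\<rfloor>}"
      proof
        fix n assume n: "n \<in> ?B"
        then have "1 \<le> real n" using tl by simp
        then have "1 \<le> n" by simp
        moreover have "n \<le> nat \<lfloor>K ^ Suc m * l\<rfloor>" using n by (simp add: le_nat_floor)
        ultimately show "n \<in> {1..nat \<lfloor>K ^ Suc m * l\<rfloor>}" by simp
      qed
      then have "card ?B \<le> nat \<lfloor>K ^ Suc m * l\<rfloor>" using card_mono[of "{1..nat \<lfloor>K ^ Suc m * l\<rfloor>}" ?B] by simp
      then have "real (card ?B) \<le> real (nat \<lfloor>K ^ Suc m * l\<rfloor>)" by (simp only: of_nat_le_iff)
      also have "\<dots> \<le> K ^ Suc m * l" using K l by simp
      finally show "real (card ?B) \<le> K ^ Suc m * l" .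
    qed (use K l in simp)
    also have "\<dots> = K\<^sup>2 * ((K ^ m * l)\<^sup>2 / a (K ^ m * l))" by (simp add: power2_eq_square)
    finally show ?thesis .
  qed
  have "K ^ m * l \<le> K ^ Suc m * l" using K l by (intro mult_right_mono power_increasing) auto
  then have "{n::nat. l \<le> real n \<and> real n < K ^ Suc m * l} \<subseteq> {n::nat. l \<le> real n \<and> real n < K ^ m * l} \<union> ?B" by auto
  then have "(\<Sum>n\<in>{n::nat. l \<le> real n \<and> real n < K ^ Suc m * l}. real n / a (real n))
     \<le> (\<Sum>n\<in>{n::nat. l \<le> real n \<and> real n < K ^ m * l} \<union> ?B. real n / a (real n))"
    by (intro sum_mono2) (auto intro: finite_subset[OF _ fin])
  also have "\<dots> = (\<Sum>n\<in>{n::nat. l \<le> real n \<and> real n < K ^ m * l}. real n / a (real n)) + (\<Sum>n\<in>?B. real n / a (real n))"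
    by (intro sum.union_disjoint) (auto intro: finite_subset[OF _ fin])
  also have "\<dots> \<le> (\<Sum>i<Suc m. K\<^sup>2 * ((K ^ i * l)\<^sup>2 / a (K ^ i * l)))"
    using Suc block by simp
  finally show ?case .
qed

end

section \<open>Regular variation along a geometric grid\<close>

lemma power_powr_swap:
  fixes x :: real assumes "x > 0"
  shows "(x ^ k) powr p = (x powr p) ^ k"
proof -
  have "(x ^ k) powr p = x powr (real k * p)" by (simp only: powr_realpow[OF assms, symmetric] powr_powr)
  also have "\<dots> = (x powr p) powr real k" by (simp only: powr_powr mult.commute)
  also have "\<dots> = (x powr p) ^ k" by (rule powr_realpow) (use assms in simp)
  finally show ?thesis .
qed

lemma (in heavy_tail) recip_asymp:
  obtains s0 where "s0 \<ge> 1" "\<And>s. s \<ge> s0 \<Longrightarrow> 1 / 2 \<le> W s * r s \<and> W s * r s \<le> 2"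
proof -
  have "eventually (\<lambda>s. 1/2 < W s * r s \<and> W s * r s < 2) at_top"
    by (intro eventually_conj order_tendstoD[OF tail_r]) auto
  then obtain s1 where "\<And>s. s \<ge> s1 \<Longrightarrow> 1/2 < W s * r s \<and> W s * r s < 2"
    by (auto simp: eventually_at_top_linorder)
  then show ?thesis by (intro that[of "max 1 s1"]) (auto intro: less_imp_le)
qed

lemma reg_var_ratio: "reg_var \<gamma> f \<Longrightarrow> c > 0 \<Longrightarrow> ((\<lambda>x. f (c * x) / f x) \<longlongrightarrow> c powr \<gamma>) at_top"
  by (simp add: reg_var_def)

text \<open>Only the ratio limit at 1 / q is iterated. For a function that is not monotone, such as
  \<open>L\<close>, this says nothing between the grid points, so every later comparison of values
  of \<open>L\<close> is made along x / q^k.\<close>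

lemma reg_var_geometric:
  assumes f: "reg_var \<gamma> f" and q: "0 < q" "q < 1" and e: "\<epsilon> > 0"
  obtains x0 where "x0 > 0" "\<And>x k. x \<ge> x0 \<Longrightarrow> f (x / q ^ k) \<le> (1 / q ^ k) powr (\<gamma> + \<epsilon>) * f x"
    "\<And>x k. x \<ge> x0 \<Longrightarrow> (1 / q ^ k) powr (\<gamma> - \<epsilon>) * f x \<le> f (x / q ^ k)"
proof -
  have fpos: "f x > 0" if "x > 0" for x using f that by (auto simp: reg_var_def)
  have q1: "1 / q > 1" using q by simp
  have lim: "((\<lambda>x. f ((1/q) * x) / f x) \<longlongrightarrow> (1/q) powr \<gamma>) at_top"
    using q by (intro reg_var_ratio[OF f]) simp
  have "eventually (\<lambda>x. (1/q) powr (\<gamma> - \<epsilon>) < f ((1/q) * x) / f x \<and> f ((1/q) * x) / f x < (1/q) powr (\<gamma> + \<epsilon>)) at_top"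
    using q1 e by (intro eventually_conj order_tendstoD[OF lim] powr_less_mono) auto
  then obtain x1 where x1: "\<And>x. x \<ge> x1 \<Longrightarrow> (1/q) powr (\<gamma> - \<epsilon>) < f ((1/q) * x) / f x \<and> f ((1/q) * x) / f x < (1/q) powr (\<gamma> + \<epsilon>)"
    by (auto simp: eventually_at_top_linorder)
  define x0 where "x0 = max 1 x1"
  have step: "f (x / q) \<le> (1/q) powr (\<gamma> + \<epsilon>) * f x" "(1/q) powr (\<gamma> - \<epsilon>) * f x \<le> f (x / q)" if "x \<ge> x0" for x
    using x1[of x] fpos[of x] that by (auto simp: x0_def field_simps)
  have qk: "q ^ k > 0" "q ^ k \<le> 1" for k :: nat using q by (auto simp: power_le_one)
  have big: "x / q ^ k \<ge> x0" if "x \<ge> x0" for x k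
  proof -
    have "x0 * q ^ k \<le> x0 * 1" using qk[of k] by (intro mult_left_mono) (auto simp: x0_def)
    then show ?thesis using that qk[of k] by (simp add: le_divide_eq)
  qed
  have pw: "(1 / q ^ Suc k) powr p = (1/q) powr p * (1 / q ^ k) powr p" for k p
  proof -
    have "1 / q ^ Suc k = (1 / q) * (1 / q ^ k)" by simp
    then show ?thesis by (simp only: powr_mult)
  qed
  have eq: "x / q ^ Suc k = (x / q ^ k) / q" for x k by simp
  show ?thesis
  proof (rule that[of x0])
    show "x0 > 0" by (simp add: x0_def)
    fix x k assume x: "x \<ge> x0"
    show "f (x / q ^ k) \<le> (1 / q ^ k) powr (\<gamma> + \<epsilon>) * f x"
    proof (induction k)
      case (Suc k)
      have "f (x / q ^ Suc k) \<le> (1/q) powr (\<gamma> + \<epsilon>) * f (x / q ^ k)" unfolding eq by (rule step(1)[OF big[OF x]])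
      also have "\<dots> \<le> (1/q) powr (\<gamma> + \<epsilon>) * ((1 / q ^ k) powr (\<gamma> + \<epsilon>) * f x)" using Suc by (intro mult_left_mono) auto
      finally show ?case unfolding pw by (simp only: mult.assoc)
    qed simp
    show "(1 / q ^ k) powr (\<gamma> - \<epsilon>) * f x \<le> f (x / q ^ k)"
    proof (induction k)
      case (Suc k)
      have "(1/q) powr (\<gamma> - \<epsilon>) * ((1 / q ^ k) powr (\<gamma> - \<epsilon>) * f x) \<le> (1/q) powr (\<gamma> - \<epsilon>) * f (x / q ^ k)" using Suc by (intro mult_left_mono) auto
      also have "\<dots> \<le> f (x / q ^ Suc k)" unfolding eq by (rule step(2)[OF big[OF x]])
      finally show ?case unfolding pw by (simp only: mult.assoc)
    qed simp
  qed
qed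

text \<open>A negative index would drive L to 0 along powers of 2, against L \<ge> 1. An index above
  \<alpha> would make L / r eventually nondecreasing under doubling, against its limit 0.\<close>

lemma (in heavy_tail) L_index_bounds:
  assumes L: "reg_var \<gamma> L" and L1: "\<And>x. x > 0 \<Longrightarrow> L x \<ge> 1" and small: "((\<lambda>x. L x / r x) \<longlongrightarrow> 0) at_top"
  shows "0 \<le> \<gamma>" "\<gamma> \<le> \<alpha>"
proof -
  show "0 \<le> \<gamma>"
  proof (rule ccontr)
    assume "\<not> 0 \<le> \<gamma>"
    then have g: "\<gamma> + (- \<gamma> / 2) < 0" by simp
    obtain x0 where x0: "x0 > 0" "\<And>x k. x \<ge> x0 \<Longrightarrow> L (x / (1/2) ^ k) \<le> (1 / (1/2) ^ k) powr (\<gamma> + (- \<gamma> / 2)) * L x"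
      "\<And>x k. x \<ge> x0 \<Longrightarrow> (1 / (1/2) ^ k) powr (\<gamma> - (- \<gamma> / 2)) * L x \<le> L (x / (1/2) ^ k)"
      using reg_var_geometric[OF L, of "1/2" "- \<gamma> / 2"] \<open>\<not> 0 \<le> \<gamma>\<close> by (auto simp del: power_one_over)
    have "((\<lambda>k. (2 ^ k) powr (\<gamma> / 2) * L x0) \<longlonglongrightarrow> 0)"
    proof -
      have "(\<lambda>k. (2 powr (\<gamma> / 2)) ^ k) \<longlonglongrightarrow> 0"
        using \<open>\<not> 0 \<le> \<gamma>\<close> powr_less_mono[of "\<gamma> / 2" 0 2] by (intro LIMSEQ_realpow_zero) auto
      then have "(\<lambda>k. (2 ^ k) powr (\<gamma> / 2)) \<longlonglongrightarrow> (0::real)" by (simp only: power_powr_swap[of 2] zero_less_numeral)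
      then show ?thesis by (rule tendsto_mult_left_zero)
    qed
    from order_tendstoD(2)[OF this zero_less_one]
    obtain k where "(2 ^ k) powr (\<gamma> / 2) * L x0 < 1" by (auto simp: eventually_sequentially)
    moreover have "1 \<le> L (x0 / (1/2) ^ k)" using x0(1) by (intro L1) simp
    moreover have "L (x0 / (1/2) ^ k) \<le> (2 ^ k) powr (\<gamma> / 2) * L x0" using x0(2)[of x0 k] by (simp add: power_one_over)
    ultimately show False by linarith
  qed
  show "\<gamma> \<le> \<alpha>"
  proof (rule ccontr)
    assume ng: "\<not> \<gamma> \<le> \<alpha>"
    have rat: "((\<lambda>x. (L (2 * x) / L x) / (r (2 * x) / r x)) \<longlongrightarrow> 2 powr \<gamma> / 2 powr \<alpha>) at_top"
      by (intro tendsto_divide reg_var_ratio[OF L] reg_var_ratio[OF r_rv]) auto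
    have "2 powr \<gamma> / 2 powr \<alpha> > (1::real)" using ng by (simp add: less_divide_eq)
    from order_tendstoD(1)[OF rat this]
    obtain x1 where x1: "\<And>x. x \<ge> x1 \<Longrightarrow> 1 < (L (2 * x) / L x) / (r (2 * x) / r x)" by (auto simp: eventually_at_top_linorder)
    define x0 where "x0 = max 1 x1"
    have step: "L x / r x \<le> L (2 * x) / r (2 * x)" if "x \<ge> x0" for x
    proof -
      have p: "L x > 0" "r x > 0" "r (2 * x) > 0" using that L1[of x] r_pos[of x] r_pos[of "2 * x"] by (auto simp: x0_def)
      have "1 < (L (2 * x) / L x) / (r (2 * x) / r x)" using that by (intro x1) (simp add: x0_def)
      then show ?thesis using p by (simp add: field_simps)
    qed
    have it: "L x0 / r x0 \<le> L (2 ^ k * x0) / r (2 ^ k * x0)" for k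
    proof (induction k)
      case (Suc k)
      have "1 * x0 \<le> 2 ^ k * x0" by (intro mult_right_mono) (auto simp: x0_def)
      then show ?case using step[of "2 ^ k * x0"] Suc by (simp add: mult.assoc)
    qed simp
    have "x0 > 0" by (simp add: x0_def)
    then have p: "L x0 / r x0 > 0" using L1[of x0] r_pos[of x0] by (intro divide_pos_pos) auto
    have "filterlim (\<lambda>k. 2 ^ k * x0) at_top sequentially"
    proof -
      have "filterlim (\<lambda>k. (2::real) ^ k) at_top sequentially" by real_asymp
      from filterlim_at_top_mult_tendsto_pos[OF tendsto_const _ this, of x0] \<open>x0 > 0\<close> show ?thesis by simp
    qed
    from filterlim_compose[OF small this] have "(\<lambda>k. L (2 ^ k * x0) / r (2 ^ k * x0)) \<longlonglongrightarrow> 0" .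
    from order_tendstoD(2)[OF this p]
    obtain k where "L (2 ^ k * x0) / r (2 ^ k * x0) < L x0 / r x0" by (auto simp: eventually_sequentially)
    then show False using it[of k] by linarith
  qed
qed

context stable_renewal
begin

text \<open>Used to shrink \<eta> to at most 1/2, so that the window ratio q = 1 - \<eta>' is
  positive even when \<eta> = 1.\<close>

lemma Phi_mono_window:
  assumes "0 < \<eta>'" "\<eta>' \<le> \<eta>" "\<eta> \<le> 1" "x > 0"
  shows "Phi F h \<eta>' x T \<le> Phi F h \<eta> x T"
proof -
  have "(1 - \<eta>) * x \<le> (1 - \<eta>') * x" using assms by (intro mult_right_mono) auto
  then have "(\<integral>\<^sup>+y. indicator {(1-\<eta>')*x<..x} y * ennreal (max (omega F h y - T) 0) \<partial>lborel) \<le> (\<integral>\<^sup>+y. indicator {(1-\<eta>)*x<..x} y * ennreal (max (omega F h y - T) 0) \<partial>lborel)"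
    by (intro nn_integral_mono mult_right_mono) (auto simp: indicator_def)
  then have "ennreal (Phi F h \<eta>' x T) \<le> ennreal (Phi F h \<eta> x T)"
    using Phi_eq[of \<eta>' x T] Phi_eq[of \<eta> x T] assms by (simp only: less_le_trans[of 0 \<eta>' \<eta>] order_trans[of \<eta>' \<eta> 1])
  moreover have "Phi F h \<eta> x T \<ge> 0"
  proof -
    have "(1 - \<eta>) * x \<le> x" using assms mult_right_mono[of "1 - \<eta>" 1 x] by simp
    then show ?thesis unfolding Phi_def interval_lebesgue_integral_def set_lebesgue_integral_def
      by (auto intro!: Bochner_Integration.integral_nonneg)
  qed
  ultimately show ?thesis by (simp add: ennreal_le_iff)
qed

lemma ratio_sum_le_blocks:
  assumes K: "K > 1" and L: "L x \<ge> 1" and x: "x > 0" and \<delta>: "\<delta> > 0"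
  shows "nrange L x \<delta> = {} \<or> (\<exists>m. K ^ m * L x \<le> K * (\<delta> / W x) \<and> ratio_sum L x \<delta> \<le> (\<Sum>i<m. K\<^sup>2 * ((K ^ i * L x)\<^sup>2 / a (K ^ i * L x))))"
proof (cases "nrange L x \<delta> = {}")
  case False
  define B where "B = \<delta> / W x"
  have Wp: "W x > 0" by (rule tail_pos)
  obtain n where n: "n \<in> nrange L x \<delta>" using False by auto
  then have "L x \<le> real n" "real n \<le> B" using Wp by (auto simp: nrange_def B_def pos_le_divide_eq)
  then have lB: "L x \<le> B" by linarith
  have "\<exists>m. B < K ^ m * L x"
  proof -
    obtain m where "B < K ^ m" using real_arch_pow[OF K] by blast
    then have "B < K ^ m * L x" using L K mult_left_mono[of 1 "L x" "K ^ m"] by (simp add: less_le_trans)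
    then show ?thesis ..
  qed
  \<comment> \<open>The first block boundary beyond the range of n; by minimality it overshoots by a
    factor at most K.\<close>
  define m where "m = (LEAST m. B < K ^ m * L x)"
  have m1: "B < K ^ m * L x" unfolding m_def using \<open>\<exists>m. B < K ^ m * L x\<close> by (rule LeastI_ex)
  have "m \<noteq> 0" using m1 lB by (cases m) auto
  then obtain j where j: "m = Suc j" by (cases m) auto
  have "\<not> B < K ^ j * L x" using not_less_Least[of j "\<lambda>m. B < K ^ m * L x"] j by (simp add: m_def)
  then have "K * (K ^ j * L x) \<le> K * B" using K by (intro mult_left_mono) auto
  then have mB: "K ^ m * L x \<le> K * B" by (simp add: j mult.assoc)
  have "nrange L x \<delta> \<subseteq> {n::nat. L x \<le> real n \<and> real n < K ^ m * L x}"
  proof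
    fix n assume "n \<in> nrange L x \<delta>"
    then have "L x \<le> real n" "real n \<le> B" using Wp by (auto simp: nrange_def B_def pos_le_divide_eq)
    then show "n \<in> {n::nat. L x \<le> real n \<and> real n < K ^ m * L x}" using m1 by auto
  qed
  moreover have "finite {n::nat. L x \<le> real n \<and> real n < K ^ m * L x}"
    by (rule finite_subset[of _ "{..nat \<lceil>K ^ m * L x\<rceil>}"]) (auto, linarith)
  ultimately have "ratio_sum L x \<delta> \<le> (\<Sum>n\<in>{n::nat. L x \<le> real n \<and> real n < K ^ m * L x}. real n / a (real n))"
    unfolding ratio_sum_def by (intro sum_mono2) auto
  also have "\<dots> \<le> (\<Sum>i<m. K\<^sup>2 * ((K ^ i * L x)\<^sup>2 / a (K ^ i * L x)))"
    using K by (intro ratio_block_sum L) simp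
  finally show ?thesis using mB unfolding B_def by blast
qed simp

text \<open>For \<alpha> < 1/2 the block contributions t^2 / a t decay geometrically, since
  \<open>a\<close> grows faster than the square, so the first block at L x dominates.\<close>

lemma ratio_sum_small_alpha:
  assumes al: "\<alpha> < 1/2"
  obtains C where "C > 0" "\<And>L x \<delta>. L x \<ge> 1 \<Longrightarrow> x > 0 \<Longrightarrow> \<delta> > 0 \<Longrightarrow> ratio_sum L x \<delta> \<le> C * (L x)\<^sup>2 / a (L x)"
proof -
  \<comment> \<open>Between \<alpha> and 1/2, so that 1 / \<beta> > 2 and the ratio \<rho> = 4 /
    2^(1/\<beta>) is below 1.\<close>
  define \<beta> where "\<beta> = (\<alpha> + 1/2) / 2"
  have b: "\<alpha> < \<beta>" "\<beta> < 1/2" "\<beta> > 0" using al alpha_pos by (auto simp: \<beta>_def)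
  obtain C where C: "C > 0" "\<And>s t. 1 \<le> s \<Longrightarrow> s \<le> t \<Longrightarrow> (t / s) powr (1 / \<beta>) * a s \<le> C * a t"
    using a_potter_lower[OF b(1)] by blast
  define \<rho> where "\<rho> = 4 / (2::real) powr (1/\<beta>)"
  have "2 < 1 / \<beta>" using b by (simp add: less_divide_eq)
  then have "(2::real) powr 2 < 2 powr (1/\<beta>)" by (intro powr_less_mono) auto
  then have rho: "0 < \<rho>" "\<rho> < 1" by (auto simp: \<rho>_def)
  show ?thesis
  proof (rule that[of "4 * C / (1 - \<rho>)"])
    show "4 * C / (1 - \<rho>) > 0" using C rho by simp
    fix L :: "real \<Rightarrow> real" and x \<delta> :: real assume L: "L x \<ge> 1" and x: "x > 0" and \<delta>: "\<delta> > 0"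
    have nn: "0 \<le> 4 * C / (1 - \<rho>) * (L x)\<^sup>2 / a (L x)" using C rho by simp
    have term_le: "2\<^sup>2 * ((2 ^ i * L x)\<^sup>2 / a (2 ^ i * L x)) \<le> 4 * C * (L x)\<^sup>2 / a (L x) * \<rho> ^ i" for i
    proof -
      have "1 * L x \<le> 2 ^ i * L x" using L by (intro mult_right_mono) auto
      then have "(2 ^ i * L x / L x) powr (1 / \<beta>) * a (L x) \<le> C * a (2 ^ i * L x)" using L by (intro C) auto
      then have 1: "(2 powr (1/\<beta>)) ^ i * a (L x) \<le> C * a (2 ^ i * L x)"
        using L by (simp add: power_powr_swap)
      have "\<rho> ^ i = 4 ^ i / (2 powr (1/\<beta>)) ^ i" by (simp add: \<rho>_def power_divide)
      moreover have "(2 ^ i * L x)\<^sup>2 = 4 ^ i * (L x)\<^sup>2" by (simp add: power_mult_distrib power2_eq_square flip: power_mult_distrib)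
      ultimately have e12: "\<rho> ^ i = 4 ^ i / (2 powr (1/\<beta>)) ^ i" "(2 ^ i * L x)\<^sup>2 = 4 ^ i * (L x)\<^sup>2" by auto
      define P where "P = ((2::real) powr (1/\<beta>)) ^ i"
      have P: "P > 0" by (simp add: P_def)
      have "2\<^sup>2 * ((2 ^ i * L x)\<^sup>2 / a (2 ^ i * L x)) = 4 * (L x)\<^sup>2 * \<rho> ^ i * (P / a (2 ^ i * L x))"
        using P unfolding e12 P_def[symmetric] by simp
      also have "\<dots> \<le> 4 * (L x)\<^sup>2 * \<rho> ^ i * (C / a (L x))"
        using 1 rho unfolding P_def[symmetric] by (intro mult_left_mono) (auto simp: field_simps)
      finally show ?thesis by (simp add: mult_ac)
    qed
    from ratio_sum_le_blocks[of 2 L x \<delta>] L x \<delta>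
    consider "nrange L x \<delta> = {}" | m where "ratio_sum L x \<delta> \<le> (\<Sum>i<m. 2\<^sup>2 * ((2 ^ i * L x)\<^sup>2 / a (2 ^ i * L x)))" by auto
    then show "ratio_sum L x \<delta> \<le> 4 * C / (1 - \<rho>) * (L x)\<^sup>2 / a (L x)"
    proof cases
      case 1 then show ?thesis using nn by (simp add: ratio_sum_def)
    next
      case 2
      note 2
      also have "(\<Sum>i<m. 2\<^sup>2 * ((2 ^ i * L x)\<^sup>2 / a (2 ^ i * L x))) \<le> (\<Sum>i<m. 4 * C * (L x)\<^sup>2 / a (L x) * \<rho> ^ i)"
        by (rule sum_mono[OF term_le])
      also have "\<dots> = 4 * C * (L x)\<^sup>2 / a (L x) * (\<Sum>i<m. \<rho> ^ i)" by (rule sum_distrib_left[symmetric])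
      also have "\<dots> \<le> 4 * C * (L x)\<^sup>2 / a (L x) * (1 / (1 - \<rho>))"
      proof (intro mult_left_mono)
        have "(\<Sum>i<m. \<rho> ^ i) \<le> (\<Sum>i. \<rho> ^ i)" using rho by (intro sum_le_suminf summable_geometric) auto
        then show "(\<Sum>i<m. \<rho> ^ i) \<le> 1 / (1 - \<rho>)" using rho by (simp add: suminf_geometric)
      qed (use C in simp)
      finally show ?thesis by (simp add: mult.commute)
    qed
  qed
qed

text \<open>The function a l / l^2 has index 1 / \<alpha> - 2. If l' \<ge> l, the Potter bound for
  \<open>a\<close> gives the power of A; if l' < l, monotonicity of \<open>a\<close> leaves only the
  quotient of squares, at most B^2.\<close>

lemma a_over_square_growth:
  assumes b: "0 < \<beta>" "\<beta> < \<alpha>" "\<beta> < 1/2"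
  obtains C where "C > 0" "\<And>l l' A B. 1 \<le> l \<Longrightarrow> 1 \<le> l' \<Longrightarrow> A \<ge> 1 \<Longrightarrow> B \<ge> 1 \<Longrightarrow> l' \<le> A * l \<Longrightarrow> l \<le> B * l' \<Longrightarrow>
    a l' / l'\<^sup>2 \<le> C * A powr (1/\<beta> - 2) * B\<^sup>2 * (a l / l\<^sup>2)"
proof -
  obtain C where C: "C > 0" "\<And>s t. 1 \<le> s \<Longrightarrow> s \<le> t \<Longrightarrow> a t \<le> C * (t / s) powr (1 / \<beta>) * a s"
    using a_potter_upper[OF b(1,2)] by blast
  have ex: "1 / \<beta> - 2 > 0" using b by (simp add: less_divide_eq)
  show ?thesis
  proof (rule that[of "C + 1"])
    show "C + 1 > 0" using C by simp
    fix l l' A B :: real assume l: "1 \<le> l" "1 \<le> l'" and AB: "A \<ge> 1" "B \<ge> 1" "l' \<le> A * l" "l \<le> B * l'"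
    define X where "X = a l / l\<^sup>2"
    have X: "X > 0" using l by (simp add: X_def)
    have A1: "A powr (1/\<beta> - 2) \<ge> 1" using AB ex by (simp add: ge_one_powr_ge_zero)
    have B1: "B\<^sup>2 \<ge> 1" using AB by (simp add: one_le_power)
    show "a l' / l'\<^sup>2 \<le> (C + 1) * A powr (1/\<beta> - 2) * B\<^sup>2 * (a l / l\<^sup>2)"
    proof (cases "l \<le> l'")
      case True
      define t where "t = l' / l"
      have t: "t \<ge> 1" "t \<le> A" using True l AB by (auto simp: t_def divide_le_eq)
      have "a l' / l'\<^sup>2 \<le> C * t powr (1/\<beta>) * a l / l'\<^sup>2"
        using C(2)[OF l(1) True] l by (intro divide_right_mono) (auto simp: t_def)
      also have "\<dots> = C * (t powr (1/\<beta>) / t\<^sup>2) * X" using l by (simp add: t_def X_def power_divide)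
      also have "t powr (1/\<beta>) / t\<^sup>2 = t powr (1/\<beta> - 2)" using t by (simp add: powr_diff powr_numeral)
      also have "C * t powr (1/\<beta> - 2) * X \<le> C * A powr (1/\<beta> - 2) * X"
        using C X t ex by (intro mult_right_mono mult_left_mono powr_mono2) auto
      also have "\<dots> \<le> (C + 1) * A powr (1/\<beta> - 2) * B\<^sup>2 * X"
      proof (rule mult_right_mono)
        have "C * A powr (1/\<beta> - 2) * 1 \<le> (C + 1) * A powr (1/\<beta> - 2) * B\<^sup>2"
          using C A1 B1 by (intro mult_mono) auto
        then show "C * A powr (1/\<beta> - 2) \<le> (C + 1) * A powr (1/\<beta> - 2) * B\<^sup>2" by simp
      qed (use X in simp)
      finally show ?thesis by (simp add: X_def)
    next
      case False
      have "a l' / l'\<^sup>2 \<le> a l / l'\<^sup>2" using False by (intro divide_right_mono a_mono) auto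
      also have "\<dots> = (l / l')\<^sup>2 * X" using l by (simp add: X_def power_divide)
      also have "\<dots> \<le> B\<^sup>2 * X" using AB l X by (intro mult_right_mono power_mono) (auto simp: divide_le_eq)
      also have "\<dots> \<le> (C + 1) * A powr (1/\<beta> - 2) * B\<^sup>2 * X"
      proof (rule mult_right_mono)
        have "1 * 1 \<le> (C + 1) * A powr (1/\<beta> - 2)" using C A1 by (intro mult_mono) auto
        then show "B\<^sup>2 \<le> (C + 1) * A powr (1/\<beta> - 2) * B\<^sup>2" using B1 mult_right_mono[of 1 "(C + 1) * A powr (1/\<beta> - 2)" "B\<^sup>2"] by simp
      qed (use X in simp)
      finally show ?thesis by (simp add: X_def)
    qed
  qed
qed

end

lemma tendsto_0_ennrealI:
  assumes C: "C > 0" and ev: "\<And>\<epsilon>. \<epsilon> > 0 \<Longrightarrow> eventually (\<lambda>x. f x \<le> ennreal (C * \<epsilon>)) G"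
  shows "(f \<longlongrightarrow> 0) G"
proof (rule order_tendstoI)
  fix b :: ennreal assume "0 < b"
  then obtain e where e: "0 < e" "e < b" using dense by blast
  then obtain d where d: "e = ennreal d" "d > 0" by (cases e) (auto simp: top_unique)
  have "eventually (\<lambda>x. f x \<le> ennreal (C * (d / C))) G" using C d by (intro ev) simp
  then show "eventually (\<lambda>x. f x < b) G" by eventually_elim (use C d e in simp)
qed simp

section \<open>The excess term for alpha < 1/2\<close>

context stable_renewal
begin

lemma ex_power_le_bfrac:
  assumes q: "0 < q" "q < 1"
  obtains J where "q ^ J \<le> bfrac / 2"
  using real_arch_pow_inv[of "bfrac / 2" q] bfrac q by (metis half_gt_zero less_imp_le)

text \<open>Moves the start of the excess from bfrac * x / 2 down to q^J * x, so that x and all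
  windows share one grid. Since W x \<le> W (q^J * x), the move costs only the factor 1 /
  q^J.\<close>

lemma big_jump_term_bound:
  assumes x: "x > 0" and q: "0 < q" "q < 1" and J: "q ^ J \<le> bfrac / 2" and S: "S \<ge> 0" and Q: "Q \<ge> 0"
    and ex: "excess_tail T (q ^ J * x) \<le> ennreal (Q / (q ^ J * x * W (q ^ J * x)))"
  shows "ennreal (x * W x * S) * excess_tail T (bfrac * x / 2) \<le> ennreal (S * Q / q ^ J)"
proof -
  define z where "z = q ^ J * x"
  have qJ: "q ^ J > 0" "q ^ J \<le> 1" using q by (auto simp: power_le_one)
  have z: "z > 0" "z \<le> x" using qJ x by (auto simp: z_def mult_left_le_one_le)
  have Wz: "W z > 0" "W x \<le> W z" using z tail_pos tail_antimono by auto
  have "z \<le> bfrac / 2 * x" unfolding z_def using J x by (intro mult_right_mono) auto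
  then have "excess_tail T (bfrac * x / 2) \<le> excess_tail T z" by (intro excess_tail_mono) simp
  also have "\<dots> \<le> ennreal (Q / (z * W z))" using ex by (simp add: z_def)
  finally have "ennreal (x * W x * S) * excess_tail T (bfrac * x / 2) \<le> ennreal (x * W x * S) * ennreal (Q / (z * W z))"
    by (rule mult_left_mono) simp
  also have "\<dots> = ennreal (x * W x * S * (Q / (z * W z)))"
    using x S Q z by (intro ennreal_mult[symmetric]) auto
  also have "\<dots> \<le> ennreal (S * Q / q ^ J)"
  proof (rule ennreal_leI)
    have "x * W x * S * (Q / (z * W z)) = (S * Q / q ^ J) * (W x / W z)" using x qJ by (simp add: z_def)
    also have "\<dots> \<le> (S * Q / q ^ J) * 1"
      using S Q qJ Wz by (intro mult_left_mono) (auto simp: divide_le_eq)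
    finally show "x * W x * S * (Q / (z * W z)) \<le> S * Q / q ^ J" by simp
  qed
  finally show ?thesis .
qed

lemma power_scale_at_top: "0 < q \<Longrightarrow> filterlim (\<lambda>x::real. q ^ J * x) at_top at_top"
  by (rule filterlim_tendsto_pos_mult_at_top[OF tendsto_const _ filterlim_ident]) simp

lemma divide_power_ge:
  fixes z q :: real
  assumes "0 < q" "q < 1" "z \<ge> 0"
  shows "z / q ^ k \<ge> z"
proof -
  have "q ^ k > 0" "q ^ k \<le> 1" using assms by (auto simp: power_le_one)
  then show ?thesis using assms by (simp add: le_divide_eq mult_left_le)
qed

text \<open>Let M x = a (L x) / (L x)^2. By hypothesis \<open>Phi\<close> at a grid point y is
  \<epsilon> times O(M y / W(y)^2), and M grows along the grid at most like the power \<kappa>, so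
  the excess beyond z is \<epsilon> * O(M z / (z * W z)). \<open>ratio_sum\<close> is O(1 / M x),
  and M z is comparable to M x: only \<epsilon> remains.\<close>

lemma big_jump_term_tendsto_0_lt_half:
  assumes al: "\<alpha> < 1/2" and L: "reg_var \<gamma> L" and L1: "\<And>x. x > 0 \<Longrightarrow> L x \<ge> 1"
    and small: "((\<lambda>x. L x / r x) \<longlongrightarrow> 0) at_top" and eta: "0 < \<eta>" "\<eta> \<le> 1"
    and Ph: "(\<lambda>x. Phi F h \<eta> x T) \<in> o[at_top](\<lambda>x. (r x)\<^sup>2 * a (L x) / (L x)\<^sup>2)"
  shows "((\<lambda>x. ennreal (x * W x * ratio_sum L x 1) * excess_tail T (bfrac * x / 2)) \<longlongrightarrow> 0) at_top"
proof -
  have g: "0 \<le> \<gamma>" "\<gamma> \<le> \<alpha>" using L_index_bounds[OF L L1 small] by auto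
  \<comment> \<open>Small enough for (1 + \<theta>) / (1 - \<theta>) < 1 + \<alpha>, to which the
    inequality \<open>kap\<close> reduces.\<close>
  define \<theta> where "\<theta> = \<alpha> / 4"
  have th: "0 < \<theta>" "\<theta> < 1/2" using alpha_pos al by (auto simp: \<theta>_def)
  define \<beta> where "\<beta> = \<alpha> * (1 - \<theta>)"
  define e where "e = \<alpha> * \<theta>"
  have e: "e > 0" using alpha_pos th by (simp add: e_def)
  have b: "0 < \<beta>" "\<beta> < \<alpha>" using alpha_pos th by (auto simp: \<beta>_def)
  have b2: "\<beta> < 1/2" using b al by simp
  have ex: "1 / \<beta> - 2 > 0" using b b2 by (simp add: less_divide_eq)
  \<comment> \<open>The growth exponent of a (L) / L^2 with slack: \<open>L\<close> rises with
    exponent at most \<gamma> + e, which enters to the power 1 / \<beta> - 2, and since \<gamma>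
    \<ge> 0 it falls with exponent at most e, which enters squared. Without slack \<alpha> +
    \<kappa> would be \<alpha> + (1/\<alpha> - 2) * \<gamma> \<le> 1 - \<alpha>.\<close>
  define \<kappa> where "\<kappa> = (1/\<beta> - 2) * (\<gamma> + e) + 2 * e"
  have kap: "\<alpha> + \<kappa> < 1"
  proof -
    have "\<kappa> \<le> (1/\<beta> - 2) * (\<alpha> + e) + 2 * e" unfolding \<kappa>_def using ex g by (intro add_right_mono mult_left_mono) auto
    also have "\<dots> = (\<alpha> + e) / \<beta> - 2 * \<alpha>" by (simp add: algebra_simps)
    also have "(\<alpha> + e) / \<beta> = (1 + \<theta>) / (1 - \<theta>)"
    proof -
      have "\<alpha> + e = \<alpha> * (1 + \<theta>)" by (simp add: e_def distrib_left)
      then show ?thesis using alpha_pos by (simp add: \<beta>_def)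
    qed
    also have "(1 + \<theta>) / (1 - \<theta>) < 1 + \<alpha>"
    proof -
      have "1 + \<theta> < (1 + \<alpha>) * (1 - \<theta>)"
      proof -
        have "\<alpha> * \<alpha> < \<alpha> * 2" using alpha_pos al by (intro mult_strict_left_mono) auto
        then have "(\<alpha> * 2 - \<alpha> * \<alpha>) / 4 > 0" by simp
        moreover have "(1 + \<alpha>) * (1 - \<theta>) - (1 + \<theta>) = (\<alpha> * 2 - \<alpha> * \<alpha>) / 4" by (simp add: \<theta>_def field_simps)
        ultimately show ?thesis by (metis diff_gt_0_iff_gt)
      qed
      then show ?thesis using th by (simp add: divide_less_eq)
    qed
    finally show ?thesis by simp
  qed
  define \<eta>' where "\<eta>' = min \<eta> (1/2)"
  have eta': "0 < \<eta>'" "\<eta>' \<le> 1" "\<eta>' \<le> \<eta>" "\<eta>' \<le> 1/2" using eta by (auto simp: \<eta>'_def)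
  define q where "q = 1 - \<eta>'"
  have q: "1 - \<eta>' \<le> q" "0 < q" "q < 1" using eta' by (auto simp: q_def)
  obtain J where J: "q ^ J \<le> bfrac / 2" using ex_power_le_bfrac[OF q(2,3)] .
  obtain s0 where s0: "s0 \<ge> 1" "\<And>s. s \<ge> s0 \<Longrightarrow> 1 / 2 \<le> W s * r s \<and> W s * r s \<le> 2" using recip_asymp by blast
  obtain x0 where x0: "x0 > 0" "\<And>x k. x \<ge> x0 \<Longrightarrow> L (x / q ^ k) \<le> (1 / q ^ k) powr (\<gamma> + e) * L x"
    "\<And>x k. x \<ge> x0 \<Longrightarrow> (1 / q ^ k) powr (\<gamma> - e) * L x \<le> L (x / q ^ k)"
    using reg_var_geometric[OF L q(2,3) e] by blast
  obtain C3 where C3: "C3 > 0" "\<And>l l' A B. 1 \<le> l \<Longrightarrow> 1 \<le> l' \<Longrightarrow> A \<ge> 1 \<Longrightarrow> B \<ge> 1 \<Longrightarrow> l' \<le> A * l \<Longrightarrow> l \<le> B * l' \<Longrightarrow>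
    a l' / l'\<^sup>2 \<le> C3 * A powr (1/\<beta> - 2) * B\<^sup>2 * (a l / l\<^sup>2)"
    using a_over_square_growth[OF b b2] by blast
  obtain C4 where C4: "C4 > 0" "\<And>z A. z \<ge> 1 \<Longrightarrow> A \<ge> 0 \<Longrightarrow>
     (\<And>k. k \<ge> 1 \<Longrightarrow> Phi F h \<eta>' (z / q ^ k) T \<le> A * (1 / q ^ k) powr \<kappa> / (W (z / q ^ k))\<^sup>2) \<Longrightarrow> excess_tail T z \<le> ennreal (C4 * A / (z * W z))"
    using excess_tail_bound[OF eta'(1,2) q kap] by blast
  obtain C5 where C5: "C5 > 0" "\<And>L x \<delta>. L x \<ge> 1 \<Longrightarrow> x > 0 \<Longrightarrow> \<delta> > 0 \<Longrightarrow> ratio_sum L x \<delta> \<le> C5 * (L x)\<^sup>2 / a (L x)"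
    using ratio_sum_small_alpha[OF al] by blast
  have qk1: "1 / q ^ k \<ge> 1" for k :: nat using q power_le_one[of q k] by simp
  have lower: "L x \<le> (1 / q ^ k) powr e * L (x / q ^ k)" if x: "x \<ge> x0" for x k
  proof -
    have "(1 / q ^ k) powr (- e) * L x \<le> (1 / q ^ k) powr (\<gamma> - e) * L x"
      using x x0(1) L1[of x] g qk1[of k] by (intro mult_right_mono powr_mono) auto
    also have "\<dots> \<le> L (x / q ^ k)" by (rule x0(3)[OF x])
    finally show ?thesis using q by (simp add: powr_minus field_simps)
  qed
  define B where "B = (1 / q ^ J) powr (\<gamma> + e)"
  have B1: "B \<ge> 1" using qk1[of J] g e by (simp add: B_def ge_one_powr_ge_zero del: powr_one_eq_one)
  define Ct where "Ct = C5 * (C4 * (4 * C3 * (C3 * B powr (1/\<beta> - 2) * B\<^sup>2))) / q ^ J"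
  show ?thesis
  proof (rule tendsto_0_ennrealI)
    show "Ct > 0" using C5 C4 C3 q B1 by (simp add: Ct_def)
    fix \<epsilon> :: real assume eps: "\<epsilon> > 0"
    obtain Y where Y: "\<And>y. y \<ge> Y \<Longrightarrow> \<bar>Phi F h \<eta> y T\<bar> \<le> \<epsilon> * \<bar>(r y)\<^sup>2 * a (L y) / (L y)\<^sup>2\<bar>"
      using landau_o.smallD[OF Ph eps] by (auto simp: eventually_at_top_linorder)
    have "eventually (\<lambda>x. q ^ J * x \<ge> max (max Y 1) (max s0 x0)) at_top"
      using power_scale_at_top[OF q(2), of J] unfolding filterlim_at_top by blast
    then show "eventually (\<lambda>x. ennreal (x * W x * ratio_sum L x 1) * excess_tail T (bfrac * x / 2) \<le> ennreal (Ct * \<epsilon>)) at_top"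
      using eventually_gt_at_top[of 0]
    proof eventually_elim
      case (elim x)
      define z where "z = q ^ J * x"
      have z: "z \<ge> Y" "z \<ge> 1" "z \<ge> s0" "z \<ge> x0" using elim by (auto simp: z_def)
      \<comment> \<open>x is itself a point of the grid started at z, so the values of
        \<open>L\<close> at x and at z can be compared.\<close>
      have xz: "x = z / q ^ J" using q by (simp add: z_def)
      have Lz: "L z \<ge> 1" and Lx: "L x \<ge> 1" using z elim by (auto intro: L1)
      define M where "M = a (L z) / (L z)\<^sup>2"
      have M: "M > 0" using Lz by (simp add: M_def)
      have "excess_tail T z \<le> ennreal (C4 * (4 * \<epsilon> * C3 * M) / (z * W z))"
      proof (rule C4(2)[OF z(2)])
        show "4 * \<epsilon> * C3 * M \<ge> 0" using eps C3 M by simp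
        fix k :: nat assume "k \<ge> 1"
        define y where "y = z / q ^ k"
        have yz: "y \<ge> z" unfolding y_def using q z by (intro divide_power_ge) auto
        have y: "y > 0" "y \<ge> Y" "y \<ge> s0" using yz z by auto
        have Ly: "L y \<ge> 1" using y by (intro L1)
        have mm: "a (L y) / (L y)\<^sup>2 \<le> C3 * ((1 / q ^ k) powr (\<gamma> + e)) powr (1/\<beta> - 2) * ((1 / q ^ k) powr e)\<^sup>2 * M"
          unfolding M_def
        proof (rule C3(2)[OF Lz Ly])
          show "(1 / q ^ k) powr (\<gamma> + e) \<ge> 1" "(1 / q ^ k) powr e \<ge> 1"
            using qk1[of k] g e by (simp_all add: ge_one_powr_ge_zero del: powr_one_eq_one)
          show "L y \<le> (1 / q ^ k) powr (\<gamma> + e) * L z" unfolding y_def by (rule x0(2)[OF z(4)])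
          show "L z \<le> (1 / q ^ k) powr e * L y" unfolding y_def by (rule lower[OF z(4)])
        qed
        have pw: "((1 / q ^ k) powr (\<gamma> + e)) powr (1/\<beta> - 2) * ((1 / q ^ k) powr e)\<^sup>2 = (1 / q ^ k) powr \<kappa>"
        proof -
          have "((1 / q ^ k) powr e)\<^sup>2 = (1 / q ^ k) powr (2 * e)"
            by (simp only: power2_eq_square powr_add[symmetric] mult_2)
          moreover have "\<kappa> = (\<gamma> + e) * (1/\<beta> - 2) + 2 * e" by (simp only: \<kappa>_def mult.commute[of "1/\<beta> - 2"])
          ultimately show ?thesis by (simp only: powr_powr powr_add[symmetric])
        qed
        have "W y * r y \<le> 2" "W y * r y \<ge> 0" using s0(2)[OF y(3)] by auto
        then have "(W y * r y)\<^sup>2 \<le> 2\<^sup>2" by (intro power_mono) auto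
        then have ry: "(r y)\<^sup>2 \<le> 4 / (W y)\<^sup>2" using tail_pos[of y] by (simp add: power_mult_distrib field_simps)
        have "Phi F h \<eta>' y T \<le> Phi F h \<eta> y T" using eta eta' y by (intro Phi_mono_window) auto
        also have "\<dots> \<le> \<epsilon> * ((r y)\<^sup>2 * (a (L y) / (L y)\<^sup>2))" using Y[OF y(2)] by (simp add: abs_mult abs_divide)
        also have "\<dots> \<le> \<epsilon> * (4 / (W y)\<^sup>2 * (C3 * ((1 / q ^ k) powr (\<gamma> + e)) powr (1/\<beta> - 2) * ((1 / q ^ k) powr e)\<^sup>2 * M))"
          using eps ry mm by (intro mult_left_mono mult_mono) auto
        also have "\<dots> = 4 * \<epsilon> * C3 * M * (((1 / q ^ k) powr (\<gamma> + e)) powr (1/\<beta> - 2) * ((1 / q ^ k) powr e)\<^sup>2) / (W y)\<^sup>2"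
          by simp
        finally show "Phi F h \<eta>' (z / q ^ k) T \<le> 4 * \<epsilon> * C3 * M * (1 / q ^ k) powr \<kappa> / (W (z / q ^ k))\<^sup>2"
          unfolding pw by (simp only: y_def)
      qed
      then have "ennreal (x * W x * ratio_sum L x 1) * excess_tail T (bfrac * x / 2) \<le> ennreal (ratio_sum L x 1 * (C4 * (4 * \<epsilon> * C3 * M)) / q ^ J)"
        unfolding z_def using elim(2) q J C4 eps C3 M
        by (intro big_jump_term_bound) (auto simp: ratio_sum_def intro!: sum_nonneg)
      also have "\<dots> \<le> ennreal (Ct * \<epsilon>)"
      proof (rule ennreal_leI)
        define N where "N = a (L x) / (L x)\<^sup>2"
        have N: "N > 0" using Lx by (simp add: N_def)
        have MN: "M \<le> C3 * B powr (1/\<beta> - 2) * B\<^sup>2 * N"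
          unfolding M_def N_def
        proof (rule C3(2)[OF Lx Lz B1 B1])
          show "L x \<le> B * L z" unfolding xz B_def by (rule x0(2)[OF z(4)])
          have "L z \<le> (1 / q ^ J) powr e * L x" unfolding xz by (rule lower[OF z(4)])
          also have "\<dots> \<le> B * L x" unfolding B_def using qk1[of J] g Lx by (intro mult_right_mono powr_mono) auto
          finally show "L z \<le> B * L x" .
        qed
        have S: "ratio_sum L x 1 \<le> C5 / N" using C5(2)[of L x 1] Lx elim(2) by (simp add: N_def)
        have "ratio_sum L x 1 * (C4 * (4 * \<epsilon> * C3 * M)) / q ^ J \<le> (C5 / N) * (C4 * (4 * \<epsilon> * C3 * (C3 * B powr (1/\<beta> - 2) * B\<^sup>2 * N))) / q ^ J"
          using S MN C4 C3 eps q M N C5 by (intro divide_right_mono mult_mono mult_left_mono) auto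
        also have "\<dots> = Ct * \<epsilon>" using N by (simp add: Ct_def)
        finally show "ratio_sum L x 1 * (C4 * (4 * \<epsilon> * C3 * M)) / q ^ J \<le> Ct * \<epsilon>" .
      qed
      finally show ?case .
    qed
  qed
qed

section \<open>The excess term for alpha = 1/2\<close>

definition usum :: "real \<Rightarrow> real" where "usum x = (LBINT s=1..x. (r s / s)\<^sup>2)"

lemma usum_eq: "x \<ge> 1 \<Longrightarrow> usum x = (\<integral>s. indicator {1<..<x} s * (r s / s)\<^sup>2 \<partial>lborel)"
  unfolding usum_def interval_lebesgue_integral_def set_lebesgue_integral_def by (simp add: one_ereal_def)

text \<open>\<open>r\<close> is merely measurable, so its square may fail to be integrable over a
  bounded interval, and \<open>usum\<close> would then be 0 by default. The estimates here concern
  the integrable case; the other one is settled in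
  \<open>big_jump_term_tendsto_0_half\<close>.\<close>

context
  assumes usum_int: "\<And>x. x \<ge> 1 \<Longrightarrow> integrable lborel (\<lambda>s. indicator {1<..<x} s * (r s / s)\<^sup>2)"
begin

lemma usum_lower:
  assumes y: "1 \<le> y" "y \<le> x" and c: "c \<ge> 0" "\<And>s. y < s \<Longrightarrow> s < x \<Longrightarrow> c \<le> (r s / s)\<^sup>2"
  shows "usum y + c * (x - y) \<le> usum x"
proof -
  have ic: "integrable lborel (\<lambda>s. c * indicator {y<..<x} s)"
    using y by (intro integrable_mult_right integrable_real_indicator) (auto simp: emeasure_lborel_Ioo)
  have "usum y + c * (x - y) = (\<integral>s. indicator {1<..<y} s * (r s / s)\<^sup>2 \<partial>lborel) + (\<integral>s. c * indicator {y<..<x} s \<partial>lborel)"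
    using y by (simp add: usum_eq)
  also have "\<dots> = (\<integral>s. indicator {1<..<y} s * (r s / s)\<^sup>2 + c * indicator {y<..<x} s \<partial>lborel)"
    using y by (intro Bochner_Integration.integral_add[symmetric] usum_int ic)
  also have "\<dots> \<le> (\<integral>s. indicator {1<..<x} s * (r s / s)\<^sup>2 \<partial>lborel)"
  proof (rule integral_mono)
    show "integrable lborel (\<lambda>s. indicator {1<..<y} s * (r s / s)\<^sup>2 + c * indicator {y<..<x} s)"
      using y by (intro Bochner_Integration.integrable_add usum_int ic)
    show "integrable lborel (\<lambda>s. indicator {1<..<x} s * (r s / s)\<^sup>2)" using y by (intro usum_int) auto
    show "indicator {1<..<y} s * (r s / s)\<^sup>2 + c * indicator {y<..<x} s \<le> indicator {1<..<x} s * (r s / s)\<^sup>2" for s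
      using y c by (auto simp: indicator_def)
  qed
  also have "\<dots> = usum x" using y by (simp add: usum_eq)
  finally show ?thesis .
qed

lemma usum_mono: "1 \<le> y \<Longrightarrow> y \<le> x \<Longrightarrow> usum y \<le> usum x"
  using usum_lower[of y x 0] by simp

lemma usum_nonneg: "1 \<le> x \<Longrightarrow> usum x \<ge> 0"
  by (simp add: usum_eq Bochner_Integration.integral_nonneg)

lemma usum_upper:
  assumes y: "1 \<le> y" "y \<le> x" and c: "c \<ge> 0" "\<And>s. y \<le> s \<Longrightarrow> s < x \<Longrightarrow> (r s / s)\<^sup>2 \<le> c"
  shows "usum x \<le> usum y + c * (x - y)"
proof -
  have ic: "integrable lborel (\<lambda>s. c * indicator {y..<x} s)"
    using y by (intro integrable_mult_right integrable_real_indicator) (auto simp: emeasure_lborel_Ico)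
  have "usum x = (\<integral>s. indicator {1<..<x} s * (r s / s)\<^sup>2 \<partial>lborel)" using y by (simp add: usum_eq)
  also have "\<dots> \<le> (\<integral>s. indicator {1<..<y} s * (r s / s)\<^sup>2 + c * indicator {y..<x} s \<partial>lborel)"
  proof (rule integral_mono)
    show "integrable lborel (\<lambda>s. indicator {1<..<y} s * (r s / s)\<^sup>2 + c * indicator {y..<x} s)"
      using y by (intro Bochner_Integration.integrable_add usum_int ic)
    show "integrable lborel (\<lambda>s. indicator {1<..<x} s * (r s / s)\<^sup>2)" using y by (intro usum_int) auto
    show "indicator {1<..<x} s * (r s / s)\<^sup>2 \<le> indicator {1<..<y} s * (r s / s)\<^sup>2 + c * indicator {y..<x} s" for s
      using y c by (auto simp: indicator_def)
  qed
  also have "\<dots> = usum y + c * (x - y)"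
    using y by (subst Bochner_Integration.integral_add[OF usum_int ic]) (auto simp: usum_eq)
  finally show ?thesis .
qed

text \<open>Turns a block of \<open>ratio_sum\<close> into an increment of \<open>usum\<close>. Put
  A = a t. For A < s < 2 * A one has W s \<le> W A \<le> C2 / t and W s * r s \<ge> 1/2, so r s is
  at least t / (2 * C2). The integrand is thus of order (t / A)^2 over a length A.\<close>

lemma usum_block:
  obtains K C where "K > 1" "C > 0" "\<And>t. t \<ge> 1 \<Longrightarrow> t\<^sup>2 / a t \<le> C * (usum (a (K * t)) - usum (a t))"
proof -
  obtain s0 where s0: "s0 \<ge> 1" "\<And>s. s \<ge> s0 \<Longrightarrow> 1 / 2 \<le> W s * r s \<and> W s * r s \<le> 2" using recip_asymp by blast
  obtain C1 where C1: "C1 > 0" "\<And>s t. 1 \<le> s \<Longrightarrow> s \<le> t \<Longrightarrow> (t / s) powr (1 / 1) * a s \<le> C1 * a t"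
    using a_potter_lower[of 1] alpha_less_1 by blast
  obtain C2 where C2: "C2 > 0" "\<And>t. t \<ge> 1 \<Longrightarrow> W (a t) * t \<le> C2" "\<And>t. t \<ge> 1 \<Longrightarrow> 1 \<le> C2 * (W (a t) * t)"
    using tail_a_bounds by blast
  have "eventually (\<lambda>t. a t \<ge> s0 \<and> t \<ge> 1) at_top"
    using a_at_top eventually_ge_at_top[of 1] by (auto simp: filterlim_at_top intro!: eventually_conj)
  then obtain t0 where t0: "a t0 \<ge> s0" "t0 \<ge> 1" using eventually_happens by force
  define A0 where "A0 = a t0"
  have A0: "A0 \<ge> s0" "A0 \<ge> 1" using t0 a_ge_1 by (auto simp: A0_def)
  obtain t1 where t1: "\<And>t. t \<ge> t1 \<Longrightarrow> a t \<ge> A0 + 1"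
    using a_at_top by (auto simp: filterlim_at_top eventually_at_top_linorder)
  \<comment> \<open>K \<ge> 2 * C1 ensures \<open>a (K * t) \<ge> 2 * a t\<close>; K \<ge> t1
    ensures \<open>a (K * t) \<ge> A0 + 1\<close>, which serves the small t.\<close>
  define K where "K = max (max 2 (2 * C1)) t1"
  have K: "K \<ge> 2" "K \<ge> 2 * C1" "K \<ge> t1" by (auto simp: K_def)
  define c0 where "c0 = (1/2 / (A0 + 1))\<^sup>2"
  have c0: "c0 > 0" using A0 by (simp add: c0_def)
  have Kt: "a t \<le> a (K * t)" if "t \<ge> 1" for t
    using that K by (intro a_mono) (simp add: mult_le_cancel_right1)
  \<comment> \<open>The first summand is for t \<le> t0, where the increment contains the fixed mass
    c0 over (A0, A0 + 1); the second is for t > t0.\<close>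
  define C where "C = t0\<^sup>2 / c0 + 16 * C2\<^sup>2"
  have C: "C > 0" "C \<ge> t0\<^sup>2 / c0" "C \<ge> 16 * C2\<^sup>2" using t0 c0 C2 by (auto simp: C_def intro!: add_nonneg_pos)
  show ?thesis
  proof (rule that[of K C])
    show "K > 1" "C > 0" using K C by auto
    fix t :: real assume t: "t \<ge> 1"
    have du: "usum (a (K * t)) - usum (a t) \<ge> 0" using usum_mono[OF a_ge_1 Kt[OF t]] by simp
    show "t\<^sup>2 / a t \<le> C * (usum (a (K * t)) - usum (a t))"
    proof (cases "t \<le> t0")
      case True
      have "t\<^sup>2 / a t \<le> t\<^sup>2 / 1" using a_ge_1 by (intro divide_left_mono) auto
      also have "\<dots> \<le> t0\<^sup>2" using t True by (simp add: power_mono)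
      also have "\<dots> = t0\<^sup>2 / c0 * c0" using c0 by simp
      also have "\<dots> \<le> C * (usum (a (K * t)) - usum (a t))"
      proof (intro mult_mono C(2))
        have "usum (a t) \<le> usum A0" using True unfolding A0_def by (intro usum_mono a_ge_1 a_mono)
        moreover have "usum A0 + c0 * (A0 + 1 - A0) \<le> usum (A0 + 1)"
        proof (rule usum_lower)
          fix s assume s: "A0 < s" "s < A0 + 1"
          have "1/2 \<le> W s * r s" using s0(2)[of s] s A0 by auto
          also have "\<dots> \<le> 1 * r s" using tail_le_1 r_pos[of s] s A0 by (intro mult_right_mono) auto
          finally have "1/2 / (A0 + 1) \<le> r s / s" using s A0 by (intro frac_le) auto
          then have "(1/2 / (A0 + 1))\<^sup>2 \<le> (r s / s)\<^sup>2" using A0 by (intro power_mono) auto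
          then show "c0 \<le> (r s / s)\<^sup>2" by (simp only: c0_def)
        qed (use A0 c0 in auto)
        moreover have "usum (A0 + 1) \<le> usum (a (K * t))"
        proof (rule usum_mono)
          have "K * 1 \<le> K * t" using K t by (intro mult_left_mono) auto
          then have "t1 \<le> K * t" using K by linarith
          then show "A0 + 1 \<le> a (K * t)" by (rule t1)
        qed (use A0 in simp)
        ultimately show "c0 \<le> usum (a (K * t)) - usum (a t)" by simp
      qed (use C c0 in auto)
      finally show ?thesis .
    next
      case False
      define A where "A = a t"
      have A: "A \<ge> A0" "A > 0" using False unfolding A_def A0_def by (auto intro: a_mono)
      have gr: "2 * A \<le> a (K * t)"
      proof -
        have "(K * t / t) powr (1/1) * a t \<le> C1 * a (K * t)"
          using t K by (intro C1) (auto simp: mult_le_cancel_right1)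
        then have "K * A \<le> C1 * a (K * t)" using t K by (simp add: A_def)
        moreover have "2 * C1 * A \<le> K * A" using K A by (intro mult_right_mono) auto
        ultimately have "C1 * (2 * A) \<le> C1 * a (K * t)" by simp
        then show ?thesis using C1(1) by simp
      qed
      define c where "c = (t / (2 * C2) / (2 * A))\<^sup>2"
      have c: "c \<ge> 0" by (simp add: c_def)
      have "usum A + c * (2 * A - A) \<le> usum (2 * A)"
      proof (rule usum_lower[OF _ _ c])
        show "1 \<le> A" "A \<le> 2 * A" using A A0 by auto
        fix s assume s: "A < s" "s < 2 * A"
        have s0s: "s \<ge> s0" "s > 0" using s A A0 by auto
        have "t / (2 * C2) \<le> r s"
        proof -
          have rs: "r s > 0" using r_pos s0s by simp
          have "1/2 \<le> W s * r s" using s0(2)[OF s0s(1)] by simp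
          also have "\<dots> \<le> W A * r s" using s rs by (intro mult_right_mono tail_antimono) auto
          finally have "t * (1/2) \<le> t * (W A * r s)" using t by (intro mult_left_mono) auto
          also have "\<dots> = (W A * t) * r s" by simp
          also have "\<dots> \<le> C2 * r s" using C2(2)[OF t] rs unfolding A_def by (intro mult_right_mono) auto
          finally show ?thesis using C2(1) by (simp add: field_simps)
        qed
        then have "t / (2 * C2) / (2 * A) \<le> r s / s" using s A t C2(1) s0s r_pos[of s] by (intro frac_le) auto
        then have "(t / (2 * C2) / (2 * A))\<^sup>2 \<le> (r s / s)\<^sup>2" using A t C2(1) by (intro power_mono) auto
        then show "c \<le> (r s / s)\<^sup>2" by (simp only: c_def)
      qed
      moreover have "usum (2 * A) \<le> usum (a (K * t))" using gr A A0 by (intro usum_mono) auto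
      ultimately have "c * A \<le> usum (a (K * t)) - usum A" by simp
      moreover have "c * A = t\<^sup>2 / A / (16 * C2\<^sup>2)"
        using A C2(1) by (simp add: c_def power2_eq_square)
      ultimately have "t\<^sup>2 / A / (16 * C2\<^sup>2) \<le> usum (a (K * t)) - usum A" by linarith
      then have "t\<^sup>2 / A \<le> (usum (a (K * t)) - usum A) * (16 * C2\<^sup>2)" using C2(1) by (simp only: pos_divide_le_eq zero_less_mult_iff zero_less_numeral zero_less_power simp_thms)
      then have "t\<^sup>2 / A \<le> 16 * C2\<^sup>2 * (usum (a (K * t)) - usum A)" by (simp only: mult.commute)
      then have "t\<^sup>2 / a t \<le> 16 * C2\<^sup>2 * (usum (a (K * t)) - usum (a t))" by (simp add: A_def)
      also have "\<dots> \<le> C * (usum (a (K * t)) - usum (a t))" using du C by (intro mult_right_mono) auto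
      finally show ?thesis .
    qed
  qed
qed

text \<open>With z = q^J * x, the integrand over (z, x) and over (z/2, z) is of order 1 / (z * W
  x)^2, from above and from below respectively, and the two lengths are comparable. So the increment
  beyond z is at most a multiple of \<open>usum z\<close>.\<close>

lemma usum_scale:
  assumes q: "0 < q" "q < 1"
  obtains C where "C > 0" "eventually (\<lambda>x. usum x \<le> C * usum (q ^ J * x) \<and> usum (q ^ J * x) > 0) at_top"
proof -
  obtain s0 where s0: "s0 \<ge> 1" "\<And>s. s \<ge> s0 \<Longrightarrow> 1 / 2 \<le> W s * r s \<and> W s * r s \<le> 2" using recip_asymp by blast
  obtain C1 where C1: "C1 > 0" "\<And>x y. 0 < y \<Longrightarrow> y \<le> x \<Longrightarrow> 1 \<le> x \<Longrightarrow> W y \<le> C1 * (x / y) powr 1 * W x"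
    using tail_potter_upper[of 1] alpha_less_1 by blast
  have qJ: "q ^ J > 0" "q ^ J \<le> 1" using q by (auto simp: power_le_one)
  define D where "D = C1 * (2 / q ^ J)"
  have D: "D > 0" using C1 qJ by (simp add: D_def)
  define E where "E = 32 * D\<^sup>2 / q ^ J"
  have E: "E > 0" using D qJ by (simp add: E_def)
  show ?thesis
  proof (rule that[of "1 + E"])
    show "1 + E > 0" using E by simp
    have "eventually (\<lambda>x. q ^ J * x \<ge> 2 * s0) at_top"
      using power_scale_at_top[OF q(1), of J] unfolding filterlim_at_top by blast
    then show "eventually (\<lambda>x. usum x \<le> (1 + E) * usum (q ^ J * x) \<and> usum (q ^ J * x) > 0) at_top"
      using eventually_ge_at_top[of 1]
    proof eventually_elim
      case (elim x)
      define z where "z = q ^ J * x"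
      define w where "w = W x"
      have w: "w > 0" by (simp add: w_def tail_pos)
      have z: "z / 2 \<ge> s0" "z \<le> x" "z / 2 \<ge> 1" "z > 0"
        using elim s0 qJ by (auto simp: z_def mult_left_le_one_le)
      have up: "usum x \<le> usum z + (2 / w / z)\<^sup>2 * (x - z)"
      proof (rule usum_upper)
        fix s assume s: "z \<le> s" "s < x"
        have rs: "r s > 0" using s z by (intro r_pos) auto
        have "w * r s \<le> W s * r s" unfolding w_def using s rs by (intro mult_right_mono tail_antimono) auto
        also have "\<dots> \<le> 2" using s0(2)[of s] s z by auto
        finally have "r s \<le> 2 / w" using w by (simp add: field_simps)
        then have "r s / s \<le> 2 / w / z" using s z rs w by (intro frac_le) auto
        then show "(r s / s)\<^sup>2 \<le> (2 / w / z)\<^sup>2" using rs s z by (intro power_mono) auto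
      qed (use z in auto)
      have lo: "usum (z/2) + (1 / (2 * D * w) / z)\<^sup>2 * (z - z/2) \<le> usum z"
      proof (rule usum_lower)
        fix s assume s: "z/2 < s" "s < z"
        have rs: "r s > 0" using s z by (intro r_pos) auto
        have "W s \<le> W (z/2)" using s by (intro tail_antimono) auto
        also have "\<dots> \<le> C1 * (x / (z/2)) powr 1 * W x" using z elim by (intro C1) auto
        also have "\<dots> = D * w" using z elim qJ by (simp add: D_def w_def z_def)
        finally have "W s * r s \<le> D * w * r s" using rs by (intro mult_right_mono) auto
        moreover have "1/2 \<le> W s * r s" using s0(2)[of s] s z by auto
        ultimately have "1/2 \<le> D * w * r s" by linarith
        then have "1 / (2 * D * w) \<le> r s" using D w by (simp add: field_simps)
        then have "1 / (2 * D * w) / z \<le> r s / s" using s z rs D w by (intro frac_le) auto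
        then show "(1 / (2 * D * w) / z)\<^sup>2 \<le> (r s / s)\<^sup>2" using z D w by (intro power_mono) auto
      qed (use z in auto)
      define P where "P = (1 / (2 * D * w) / z)\<^sup>2 * (z / 2)"
      have P: "P > 0" using z D w by (simp add: P_def)
      have zp: "usum z \<ge> P" using lo usum_nonneg[of "z/2"] z by (simp add: P_def)
      have "(2 / w / z)\<^sup>2 * (x - z) \<le> (2 / w / z)\<^sup>2 * x" using z by (intro mult_left_mono) auto
      also have "\<dots> = E * P"
        using z D w qJ elim by (simp add: E_def P_def z_def power2_eq_square field_simps)
      also have "\<dots> \<le> E * usum z" using zp E by (intro mult_left_mono) auto
      finally have "usum x \<le> (1 + E) * usum z" using up by (simp add: algebra_simps)
      then show ?case using zp P by (simp add: z_def)
    qed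
  qed
qed

text \<open>At \<alpha> = 1/2 all blocks may count equally, so no single one dominates; by
  \<open>usum_block\<close> they telescope instead, between \<open>a (L x)\<close> and the last
  block boundary, which must not exceed x.\<close>

lemma ratio_sum_half:
  assumes L1: "\<And>x. x > 0 \<Longrightarrow> L x \<ge> 1" and small: "((\<lambda>x. L x / r x) \<longlongrightarrow> 0) at_top"
  obtains C \<delta> where "C > 0" "0 < \<delta>" "\<delta> \<le> 1" "eventually (\<lambda>x. ratio_sum L x \<delta> \<le> C * (usum x - usum (a (L x))) \<and> a (L x) \<le> x) at_top"
proof -
  obtain K C where K: "K > 1" "C > 0" "\<And>t. t \<ge> 1 \<Longrightarrow> t\<^sup>2 / a t \<le> C * (usum (a (K * t)) - usum (a t))"
    using usum_block by blast
  \<comment> \<open>The last boundary K^m * L x is at most K * \<delta> / W x = (1/2) / W x, and a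
    ((1/2) / W x) / x tends to (1/2)^(1/\<alpha>) < 1. This keeps the telescoped sum below
    \<open>usum x\<close>.\<close>
  define \<delta> where "\<delta> = 1 / (2 * K)"
  have d: "0 < \<delta>" "\<delta> \<le> 1" "K * \<delta> = 1/2" using K by (auto simp: \<delta>_def field_simps)
  show ?thesis
  proof (rule that[of "K\<^sup>2 * C" \<delta>])
    show "K\<^sup>2 * C > 0" "0 < \<delta>" "\<delta> \<le> 1" using K d by auto
    have "((\<lambda>x. (1/2) / W x * W x) \<longlongrightarrow> 1/2) at_top"
      using tail_pos by (auto intro!: tendsto_eventually always_eventually simp: less_imp_neq[THEN not_sym])
    from a_asymp[OF _ this] have "((\<lambda>x. a ((1/2) / W x) / x) \<longlongrightarrow> (1/2) powr (1/\<alpha>)) at_top" by simp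
    moreover have "(1/2) powr (1/\<alpha>) < (1::real)"
      using alpha_pos powr_less_mono'[of "1/2" 0 "1/\<alpha>"] by simp
    ultimately have "eventually (\<lambda>x. a ((1/2) / W x) / x < 1) at_top" by (rule order_tendstoD(2))
    moreover have "eventually (\<lambda>x. L x / r x < 1/4) at_top" by (rule order_tendstoD(2)[OF small]) simp
    moreover have "eventually (\<lambda>x. W x * r x < 2) at_top" by (rule order_tendstoD(2)[OF tail_r]) simp
    ultimately show "eventually (\<lambda>x. ratio_sum L x \<delta> \<le> K\<^sup>2 * C * (usum x - usum (a (L x))) \<and> a (L x) \<le> x) at_top"
      using eventually_ge_at_top[of 1]
    proof eventually_elim
      case (elim x)
      have x: "x > 0" "x \<ge> 1" using elim by auto
      have Lx: "L x \<ge> 1" by (rule L1[OF x(1)])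
      have ax: "a ((1/2) / W x) \<le> x" using elim(1) x by (simp add: divide_less_eq)
      have "L x < r x / 4" using elim(2) r_pos[OF x(1)] by (simp add: field_simps)
      moreover have "r x \<le> 2 / W x" using elim(3) tail_pos[of x] by (simp add: field_simps)
      ultimately have "L x \<le> (1/2) / W x" by simp
      then have aL: "a (L x) \<le> x" using a_mono ax order_trans by blast
      have "ratio_sum L x \<delta> \<le> K\<^sup>2 * C * (usum x - usum (a (L x)))"
        using ratio_sum_le_blocks[where L=L, OF K(1) Lx x(1) d(1)]
      proof
        assume "nrange L x \<delta> = {}"
        moreover have "usum (a (L x)) \<le> usum x" using aL by (intro usum_mono a_ge_1)
        ultimately show ?thesis using K(1,2) by (simp add: ratio_sum_def)
      next
        assume "\<exists>m. K ^ m * L x \<le> K * (\<delta> / W x) \<and> ratio_sum L x \<delta> \<le> (\<Sum>i<m. K\<^sup>2 * ((K ^ i * L x)\<^sup>2 / a (K ^ i * L x)))"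
        then obtain m where m: "K ^ m * L x \<le> K * (\<delta> / W x)" "ratio_sum L x \<delta> \<le> (\<Sum>i<m. K\<^sup>2 * ((K ^ i * L x)\<^sup>2 / a (K ^ i * L x)))" by blast
        define U where "U i = usum (a (K ^ i * L x))" for i
        note m(2)
        also have "(\<Sum>i<m. K\<^sup>2 * ((K ^ i * L x)\<^sup>2 / a (K ^ i * L x))) \<le> (\<Sum>i<m. K\<^sup>2 * (C * (U (Suc i) - U i)))"
        proof (intro sum_mono mult_left_mono)
          fix i
          have "1 \<le> K ^ i * L x" using K(1) Lx mult_mono[of 1 "K ^ i" 1 "L x"] by (simp add: one_le_power)
          from K(3)[OF this] show "(K ^ i * L x)\<^sup>2 / a (K ^ i * L x) \<le> C * (U (Suc i) - U i)"
            by (simp add: U_def mult.assoc)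
        qed simp
        also have "\<dots> = K\<^sup>2 * C * (\<Sum>i<m. U (Suc i) - U i)" by (simp add: sum_distrib_left mult.assoc)
        also have "(\<Sum>i<m. U (Suc i) - U i) = U m - U 0" by (rule sum_lessThan_telescope)
        also have "K\<^sup>2 * C * (U m - U 0) \<le> K\<^sup>2 * C * (usum x - usum (a (L x)))"
        proof (intro mult_left_mono diff_mono)
          have "K * (\<delta> / W x) = (1/2) / W x" by (simp only: times_divide_eq_right d(3))
          then have "a (K ^ m * L x) \<le> a ((1/2) / W x)" using m(1) by (intro a_mono) simp
          then have "a (K ^ m * L x) \<le> x" using ax by linarith
          then show "U m \<le> usum x" unfolding U_def by (intro usum_mono a_ge_1)
        qed (use K(1,2) in \<open>auto simp: U_def\<close>)
        finally show ?thesis .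
      qed
      then show ?case using aL by simp
    qed
  qed
qed

end

text \<open>\<open>ratio_sum\<close> is bounded by the increment usum x - usum (a (L x)), and the
  excess carries the factor M / usum x, where M is the constant in the bound on \<open>Phi\<close>.
  If the ratio in the hypothesis tends to 1, the relative increment vanishes and a fixed M suffices;
  otherwise it is at most 1 and M is arbitrarily small.\<close>

lemma big_jump_term_tendsto_0_half:
  assumes al: "\<alpha> = 1/2" and L1: "\<And>x. x > 0 \<Longrightarrow> L x \<ge> 1"
    and small: "((\<lambda>x. L x / r x) \<longlongrightarrow> 0) at_top" and eta: "0 < \<eta>" "\<eta> \<le> 1"
    and Ph: "if ((\<lambda>x. usum x / usum (a (L x))) \<longlongrightarrow> 1) at_top
           then (\<lambda>x. Phi F h \<eta> x T) \<in> O[at_top](\<lambda>x. (r x)\<^sup>2 / usum x)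
           else (\<lambda>x. Phi F h \<eta> x T) \<in> o[at_top](\<lambda>x. (r x)\<^sup>2 / usum x)"
  obtains \<delta> where "0 < \<delta>" "\<delta> \<le> 1"
    "((\<lambda>x. ennreal (x * W x * ratio_sum L x \<delta>) * excess_tail T (bfrac * x / 2)) \<longlongrightarrow> 0) at_top"
proof -
  define \<eta>' where "\<eta>' = min \<eta> (1/2)"
  have eta': "0 < \<eta>'" "\<eta>' \<le> 1" "\<eta>' \<le> \<eta>" "\<eta>' \<le> 1/2" using eta by (auto simp: \<eta>'_def)
  define q where "q = 1 - \<eta>'"
  have q: "1 - \<eta>' \<le> q" "0 < q" "q < 1" using eta' by (auto simp: q_def)
  obtain J where J: "q ^ J \<le> bfrac / 2" using ex_power_le_bfrac[OF q(2,3)] .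
  \<comment> \<open>The growth exponent is 0: \<open>usum\<close> is nondecreasing, so at later
    windows r^2 / usum grows no faster than 1 / W^2.\<close>
  have kap: "\<alpha> + 0 < 1" using al by simp
  obtain C4 where C4: "C4 > 0" "\<And>z A. z \<ge> 1 \<Longrightarrow> A \<ge> 0 \<Longrightarrow>
     (\<And>k. k \<ge> 1 \<Longrightarrow> Phi F h \<eta>' (z / q ^ k) T \<le> A * (1 / q ^ k) powr 0 / (W (z / q ^ k))\<^sup>2) \<Longrightarrow> excess_tail T z \<le> ennreal (C4 * A / (z * W z))"
    using excess_tail_bound[OF eta'(1,2) q kap] by blast
  have PhO: "(\<lambda>x. Phi F h \<eta> x T) \<in> O[at_top](\<lambda>x. (r x)\<^sup>2 / usum x)"
    using Ph landau_o.small_imp_big by (auto split: if_splits)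
  have rs0: "ratio_sum L x \<delta> \<ge> 0" for x \<delta> unfolding ratio_sum_def by (intro sum_nonneg) auto
  show ?thesis
  proof (cases "\<forall>x\<ge>1. integrable lborel (\<lambda>s. indicator {1<..<x} s * (r s / s)\<^sup>2)")
    case False
    \<comment> \<open>Junk value: the integral defining \<open>usum\<close> is eventually \<open>0\<close>, so is \<open>(r x)\<^sup>2 / usum x\<close>, and \<open>Phi\<close> vanishes.\<close>
    then obtain X where X: "X \<ge> 1" "\<not> integrable lborel (\<lambda>s. indicator {1<..<X} s * (r s / s)\<^sup>2)" by auto
    have u0: "usum x = 0" if "x \<ge> X" for x
    proof -
      have "\<not> integrable lborel (\<lambda>s. indicator {1<..<x} s * (r s / s)\<^sup>2)"
      proof
        assume "integrable lborel (\<lambda>s. indicator {1<..<x} s * (r s / s)\<^sup>2)"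
        then have "integrable lborel (\<lambda>s. indicator {1<..<X} s * (r s / s)\<^sup>2)"
          by (rule Bochner_Integration.integrable_bound) (use that in \<open>auto simp: indicator_def\<close>)
        then show False using X by simp
      qed
      then show ?thesis using X that by (simp add: usum_eq not_integrable_integral_eq)
    qed
    obtain c where c: "c > 0" "eventually (\<lambda>x. norm (Phi F h \<eta> x T) \<le> c * norm ((r x)\<^sup>2 / usum x)) at_top"
      using landau_o.bigE[OF PhO] by blast
    then obtain Y where Y: "\<And>y. y \<ge> Y \<Longrightarrow> norm (Phi F h \<eta> y T) \<le> c * norm ((r y)\<^sup>2 / usum y)"
      by (auto simp: eventually_at_top_linorder)
    have "eventually (\<lambda>x. q ^ J * x \<ge> max (max X Y) 1) at_top"
      using power_scale_at_top[OF q(2), of J] unfolding filterlim_at_top by blast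
    then have "eventually (\<lambda>x. ennreal (x * W x * ratio_sum L x 1) * excess_tail T (bfrac * x / 2) \<le> ennreal 0) at_top"
      using eventually_gt_at_top[of 0]
    proof eventually_elim
      case (elim x)
      define z where "z = q ^ J * x"
      have z: "z \<ge> X" "z \<ge> Y" "z \<ge> 1" using elim by (auto simp: z_def)
      have "excess_tail T z \<le> ennreal (C4 * 0 / (z * W z))"
      proof (rule C4(2)[OF z(3)])
        fix k :: nat
        have yz: "z / q ^ k \<ge> z" using q z by (intro divide_power_ge) auto
        have "Phi F h \<eta>' (z / q ^ k) T \<le> Phi F h \<eta> (z / q ^ k) T" using eta eta' yz z by (intro Phi_mono_window) auto
        also have "\<dots> \<le> 0" using Y[of "z / q ^ k"] u0[of "z / q ^ k"] yz z by simp
        finally show "Phi F h \<eta>' (z / q ^ k) T \<le> 0 * (1 / q ^ k) powr 0 / (W (z / q ^ k))\<^sup>2" by simp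
      qed simp
      then have "excess_tail T (q ^ J * x) \<le> ennreal (0 / (q ^ J * x * W (q ^ J * x)))" by (simp add: z_def)
      from big_jump_term_bound[OF elim(2) q(2,3) J rs0 _ this] show ?case by simp
    qed
    then have "((\<lambda>x. ennreal (x * W x * ratio_sum L x 1) * excess_tail T (bfrac * x / 2)) \<longlongrightarrow> 0) at_top"
      by (intro tendsto_eventually) (auto elim: eventually_mono)
    then show ?thesis by (intro that[of 1]) auto
  next
    case True
    then have usum_int: "\<And>x. x \<ge> 1 \<Longrightarrow> integrable lborel (\<lambda>s. indicator {1<..<x} s * (r s / s)\<^sup>2)" by blast
    obtain s0 where s0: "s0 \<ge> 1" "\<And>s. s \<ge> s0 \<Longrightarrow> 1 / 2 \<le> W s * r s \<and> W s * r s \<le> 2" using recip_asymp by blast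
    obtain C5 where C5: "C5 > 0" "eventually (\<lambda>x. usum x \<le> C5 * usum (q ^ J * x) \<and> usum (q ^ J * x) > 0) at_top"
      using usum_scale[OF usum_int q(2,3)] by blast
    obtain C6 \<delta> where C6: "C6 > 0" "0 < \<delta>" "\<delta> \<le> 1" "eventually (\<lambda>x. ratio_sum L x \<delta> \<le> C6 * (usum x - usum (a (L x))) \<and> a (L x) \<le> x) at_top"
      using ratio_sum_half[OF usum_int L1 small] by blast
    define Ct where "Ct = C6 * (C4 * (4 * C5)) / q ^ J"
    have Ct: "Ct > 0" using C4 C5 C6 q by (simp add: Ct_def)
    have main: "eventually (\<lambda>x. ennreal (x * W x * ratio_sum L x \<delta>) * excess_tail T (bfrac * x / 2) \<le> ennreal (Ct * (M * ((usum x - usum (a (L x))) / usum x)))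
       \<and> 0 \<le> usum (a (L x)) \<and> usum (a (L x)) \<le> usum x \<and> usum x > 0) at_top"
      if M: "M > 0" and ev: "eventually (\<lambda>x. norm (Phi F h \<eta> x T) \<le> M * norm ((r x)\<^sup>2 / usum x)) at_top" for M
    proof -
      obtain Y where Y: "\<And>y. y \<ge> Y \<Longrightarrow> norm (Phi F h \<eta> y T) \<le> M * norm ((r y)\<^sup>2 / usum y)"
        using ev by (auto simp: eventually_at_top_linorder)
      have "eventually (\<lambda>x. q ^ J * x \<ge> max (max s0 Y) 1) at_top"
        using power_scale_at_top[OF q(2), of J] unfolding filterlim_at_top by blast
      then show ?thesis using C5(2) C6(4) eventually_gt_at_top[of 0]
      proof eventually_elim
        case (elim x)
        define z where "z = q ^ J * x"
        have z: "z \<ge> s0" "z \<ge> Y" "z \<ge> 1" using elim by (auto simp: z_def)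
        have qJ: "q ^ J > 0" "q ^ J \<le> 1" using q by (auto simp: power_le_one)
        have zx: "z \<le> x" using qJ elim by (simp add: z_def mult_left_le_one_le)
        have uz: "usum z > 0" "usum x \<le> C5 * usum z" using elim by (auto simp: z_def)
        have ux: "usum x > 0" using usum_mono[OF usum_int z(3) zx] uz by linarith
        have "excess_tail T z \<le> ennreal (C4 * (4 * M / usum z) / (z * W z))"
        proof (rule C4(2)[OF z(3)])
          show "4 * M / usum z \<ge> 0" using M uz by simp
          fix k :: nat
          define y where "y = z / q ^ k"
          have yz: "y \<ge> z" unfolding y_def using q z by (intro divide_power_ge) auto
          have y: "y > 0" "y \<ge> Y" "y \<ge> s0" using yz z by auto
          have uy: "usum z \<le> usum y" by (rule usum_mono[OF usum_int z(3) yz])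
          have "W y * r y \<le> 2" "W y * r y \<ge> 0" using s0(2)[OF y(3)] by auto
          then have "(W y * r y)\<^sup>2 \<le> 2\<^sup>2" by (intro power_mono) auto
          then have ry: "(r y)\<^sup>2 \<le> 4 / (W y)\<^sup>2" using tail_pos[of y] by (simp add: power_mult_distrib field_simps)
          have "Phi F h \<eta>' y T \<le> Phi F h \<eta> y T" using eta eta' y by (intro Phi_mono_window) auto
          also have "\<dots> \<le> M * ((r y)\<^sup>2 / usum y)" using Y[OF y(2)] uy uz by (simp add: abs_mult abs_divide)
          also have "\<dots> \<le> M * (4 / (W y)\<^sup>2 / usum z)"
            using M ry uy uz by (intro mult_left_mono frac_le) auto
          finally show "Phi F h \<eta>' (z / q ^ k) T \<le> 4 * M / usum z * (1 / q ^ k) powr 0 / (W (z / q ^ k))\<^sup>2"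
            using q by (simp add: y_def mult_ac)
        qed
        then have "ennreal (x * W x * ratio_sum L x \<delta>) * excess_tail T (bfrac * x / 2) \<le> ennreal (ratio_sum L x \<delta> * (C4 * (4 * M / usum z)) / q ^ J)"
          unfolding z_def using elim q J C4(1) M uz
          by (intro big_jump_term_bound rs0) (auto simp: z_def)
        also have "\<dots> \<le> ennreal (Ct * (M * ((usum x - usum (a (L x))) / usum x)))"
        proof (rule ennreal_leI)
          have d0: "0 \<le> C6 * (usum x - usum (a (L x)))" using elim(3) rs0[of x \<delta>] by linarith
          have "1 / usum z \<le> C5 / usum x" using uz ux by (simp add: field_simps)
          then have "4 * M * (1 / usum z) \<le> 4 * M * (C5 / usum x)" using M by (intro mult_left_mono) auto
          then have "ratio_sum L x \<delta> * (C4 * (4 * M / usum z)) \<le> C6 * (usum x - usum (a (L x))) * (C4 * (4 * M * (C5 / usum x)))"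
            using elim(3) d0 C4(1) M uz by (intro mult_mono mult_left_mono) auto
          then have "ratio_sum L x \<delta> * (C4 * (4 * M / usum z)) / q ^ J \<le> C6 * (usum x - usum (a (L x))) * (C4 * (4 * M * (C5 / usum x))) / q ^ J"
            using qJ by (intro divide_right_mono) auto
          also have "\<dots> = Ct * (M * ((usum x - usum (a (L x))) / usum x))" by (simp add: Ct_def mult_ac)
          finally show "ratio_sum L x \<delta> * (C4 * (4 * M / usum z)) / q ^ J \<le> Ct * (M * ((usum x - usum (a (L x))) / usum x))" .
        qed
        finally show ?case
          using ux usum_nonneg[OF usum_int a_ge_1] usum_mono[OF usum_int a_ge_1] elim(3) by blast
      qed
    qed
    have "((\<lambda>x. ennreal (x * W x * ratio_sum L x \<delta>) * excess_tail T (bfrac * x / 2)) \<longlongrightarrow> 0) at_top"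
    proof (cases "((\<lambda>x. usum x / usum (a (L x))) \<longlongrightarrow> 1) at_top")
      case True
      obtain c where c: "c > 0" "eventually (\<lambda>x. norm (Phi F h \<eta> x T) \<le> c * norm ((r x)\<^sup>2 / usum x)) at_top"
        using landau_o.bigE[OF PhO] by blast
      show ?thesis
      proof (rule tendsto_0_ennrealI)
        show "Ct * c > 0" using Ct c by simp
        fix \<epsilon> :: real assume eps: "\<epsilon> > 0"
        from tendsto_inverse[OF True] have "((\<lambda>x. usum (a (L x)) / usum x) \<longlongrightarrow> 1) at_top" by simp
        from order_tendstoD(1)[OF this, of "1 - \<epsilon>"] eps have "eventually (\<lambda>x. 1 - \<epsilon> < usum (a (L x)) / usum x) at_top" by simp
        then show "eventually (\<lambda>x. ennreal (x * W x * ratio_sum L x \<delta>) * excess_tail T (bfrac * x / 2) \<le> ennreal (Ct * c * \<epsilon>)) at_top"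
          using main[OF c]
        proof eventually_elim
          case (elim x)
          have "(usum x - usum (a (L x))) / usum x = 1 - usum (a (L x)) / usum x" using elim by (simp add: diff_divide_distrib)
          then have "Ct * (c * ((usum x - usum (a (L x))) / usum x)) \<le> Ct * (c * \<epsilon>)"
            using Ct c elim by (intro mult_left_mono) auto
          then have "ennreal (Ct * (c * ((usum x - usum (a (L x))) / usum x))) \<le> ennreal (Ct * c * \<epsilon>)" by (intro ennreal_leI) (simp add: mult.assoc)
          then show ?case using elim(2) order_trans by blast
        qed
      qed
    next
      case False
      then have Pho: "(\<lambda>x. Phi F h \<eta> x T) \<in> o[at_top](\<lambda>x. (r x)\<^sup>2 / usum x)" using Ph by simp
      show ?thesis
      proof (rule tendsto_0_ennrealI[OF Ct])
        fix \<epsilon> :: real assume eps: "\<epsilon> > 0"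
        show "eventually (\<lambda>x. ennreal (x * W x * ratio_sum L x \<delta>) * excess_tail T (bfrac * x / 2) \<le> ennreal (Ct * \<epsilon>)) at_top"
          using main[OF eps landau_o.smallD[OF Pho eps]]
        proof eventually_elim
          case (elim x)
          have "(usum x - usum (a (L x))) / usum x \<le> 1" using elim by (simp add: divide_le_eq)
          then have "Ct * (\<epsilon> * ((usum x - usum (a (L x))) / usum x)) \<le> Ct * (\<epsilon> * 1)"
            using Ct eps by (intro mult_left_mono) auto
          then have "ennreal (Ct * (\<epsilon> * ((usum x - usum (a (L x))) / usum x))) \<le> ennreal (Ct * \<epsilon>)" by (intro ennreal_leI) simp
          then show ?case using elim order_trans by blast
        qed
      qed
    qed
    then show ?thesis by (intro that[OF C6(2,3)])
  qed
qed

section \<open>The limit constant\<close>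

lemma gc_integrable: "integrable lborel gc"
proof -
  have "(\<integral>\<^sup>+y. ennreal (g y) \<partial>lborel) = 1"
    using prob_space.emeasure_space_1[OF g_prob] by (simp add: emeasure_density)
  then have "integrable lborel g" using g_nonneg by (intro integrableI_nonneg) auto
  then show ?thesis using gc_AE by (subst (asm) integrable_cong_AE) auto
qed

text \<open>Near 0 the continuous density is bounded and y^(-\<alpha>) is integrable because
  \<alpha> < 1; beyond 1 the power is at most 1 and the density is integrable.\<close>

lemma negative_moment_integrable: "integrable lborel (\<lambda>y. indicator {0<..} y * (y powr (- \<alpha>) * gc y))"
proof -
  obtain B where B: "B > 0" "\<And>y. gc y \<le> B" using gc_bounded by blast
  have "(\<lambda>y::real. y powr (- \<alpha>)) absolutely_integrable_on {0..1}"
    using alpha_less_1 integrable_on_powr_from_0[of "- \<alpha>" 1]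
    by (intro nonnegative_absolutely_integrable_1) auto
  then have "integrable lebesgue (\<lambda>y::real. indicator {0..1} y * y powr (- \<alpha>))"
    by (simp add: set_integrable_def)
  then have "integrable lborel (\<lambda>y::real. indicator {0..1} y * y powr (- \<alpha>))"
    by (subst (asm) integrable_completion) auto
  then have "integrable lborel (\<lambda>y. B * (indicator {0..1} y * y powr (- \<alpha>)) + gc y)"
    by (intro Bochner_Integration.integrable_add gc_integrable integrable_mult_right)
  then show ?thesis
  proof (rule Bochner_Integration.integrable_bound)
    show "AE y in lborel. norm (indicator {0<..} y * (y powr (- \<alpha>) * gc y)) \<le> norm (B * (indicator {0..1} y * y powr (- \<alpha>)) + gc y)"
    proof (intro AE_I2)
      fix y :: real
      have nn: "0 \<le> B * (indicator {0..1} y * y powr (- \<alpha>)) + gc y" using B gc_nonneg by simp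
      have "indicator {0<..} y * (y powr (- \<alpha>) * gc y) \<le> B * (indicator {0..1} y * y powr (- \<alpha>)) + gc y"
      proof (cases "y \<le> 1")
        case True
        have "y powr (- \<alpha>) * gc y \<le> y powr (- \<alpha>) * B" using B by (intro mult_left_mono) auto
        then show ?thesis using True gc_nonneg[of y] nn by (auto simp: indicator_def mult.commute)
      next
        case False
        then have "y powr (- \<alpha>) \<le> y powr 0" using alpha_pos by (intro powr_mono) auto
        then have "y powr (- \<alpha>) * gc y \<le> 1 * gc y" using False gc_nonneg by (intro mult_right_mono) auto
        then show ?thesis using False by simp
      qed
      then show "norm (indicator {0<..} y * (y powr (- \<alpha>) * gc y)) \<le> norm (B * (indicator {0..1} y * y powr (- \<alpha>)) + gc y)"
        using nn gc_nonneg[of y] by (simp add: abs_mult)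
    qed
  qed auto
qed

text \<open>In s = y^(-\<alpha>) the Jacobian \<alpha> * y^(-\<alpha>-1) absorbs the factor y of the
  kernel. \<open>kern\<close> involves values of \<open>gc\<close>, so the change of variables is
  made for \<open>gc\<close>, and \<open>g\<close> replaces it only under the final
  integral.\<close>

lemma kern_integral:
  "integrable lborel (\<lambda>s. indicator {0<..} s * kern s)"
  "(\<integral>s. indicator {0<..} s * kern s \<partial>lborel) = \<alpha> * (LBINT x:{0<..}. x powr (- \<alpha>) * g x)"
proof -
  define f where "f y = \<alpha> * (y powr (- \<alpha>) * gc y)" for y
  have fm [measurable]: "f \<in> borel_measurable borel" unfolding f_def by measurable
  have f_int: "set_integrable lborel {0<..} f"
    using integrable_mult_right[OF negative_moment_integrable, of \<alpha>]
    by (simp add: set_integrable_def f_def mult_ac)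
  have feq: "\<bar>- \<alpha> * y powr (- \<alpha> - 1)\<bar> * kern (y powr (- \<alpha>)) = f y" if "y \<in> {0<..}" for y
  proof -
    have "(y powr (- \<alpha>)) powr (- 1 / \<alpha>) = y" using that alpha_pos by (simp add: powr_powr)
    moreover have "y powr (- \<alpha> - 1) * y = y powr (- \<alpha>)"
      using that powr_add[of y "- \<alpha> - 1" 1] by simp
    ultimately show ?thesis using alpha_pos by (simp add: kern_def f_def abs_mult mult_ac)
  qed
  have img: "(\<lambda>y::real. y powr (- \<alpha>)) ` {0<..} = {0<..}"
  proof (intro set_eqI iffI)
    fix s :: real assume "s \<in> {0<..}"
    then have "s = (s powr (- 1 / \<alpha>)) powr (- \<alpha>)" "s powr (- 1 / \<alpha>) \<in> {0<..}"
      using alpha_pos by (auto simp: powr_powr)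
    then show "s \<in> (\<lambda>y::real. y powr (- \<alpha>)) ` {0<..}" by blast
  qed auto
  have inj: "inj_on (\<lambda>y::real. y powr (- \<alpha>)) {0<..}"
  proof (rule inj_on_inverseI)
    fix y :: real assume "y \<in> {0<..}"
    then show "(y powr (- \<alpha>)) powr (- 1 / \<alpha>) = y" using alpha_pos by (simp add: powr_powr)
  qed
  have cv: "(\<lambda>y. \<bar>- \<alpha> * y powr (- \<alpha> - 1)\<bar> * kern (y powr (- \<alpha>))) absolutely_integrable_on {0<..} \<and>
     integral {0<..} (\<lambda>y. \<bar>- \<alpha> * y powr (- \<alpha> - 1)\<bar> * kern (y powr (- \<alpha>))) = b \<longleftrightarrow>
     kern absolutely_integrable_on {0<..} \<and> integral {0<..} kern = b" for b
  proof -
    have S: "{0<..} \<in> sets (lebesgue :: real measure)" by simp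
    have D: "((\<lambda>y. y powr (- \<alpha>)) has_field_derivative - \<alpha> * y powr (- \<alpha> - 1)) (at y within {0<..})"
      if "y \<in> {0<..}" for y
      using that by (intro has_field_derivative_at_within[OF has_real_derivative_powr]) auto
    show ?thesis
      using has_absolute_integral_change_of_variables_1'[OF S D inj, of kern b] by (simp only: img)
  qed
  have "f absolutely_integrable_on {0<..}"
    using f_int by (simp add: set_integrable_def integrable_completion)
  moreover have "(\<lambda>y. \<bar>- \<alpha> * y powr (- \<alpha> - 1)\<bar> * kern (y powr (- \<alpha>))) absolutely_integrable_on {0<..} \<longleftrightarrow> f absolutely_integrable_on {0<..}"
    by (intro set_integrable_cong feq) auto
  moreover have "integral {0<..} (\<lambda>y. \<bar>- \<alpha> * y powr (- \<alpha> - 1)\<bar> * kern (y powr (- \<alpha>))) = integral {0<..} f"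
    by (intro Henstock_Kurzweil_Integration.integral_cong feq)
  ultimately have k: "kern absolutely_integrable_on {0<..}" "integral {0<..} kern = integral {0<..} f"
    using cv[of "integral {0<..} f"] by auto
  have kb: "set_integrable lborel {0<..} kern"
    using k(1) by (simp add: set_integrable_def integrable_completion)
  then show "integrable lborel (\<lambda>s. indicator {0<..} s * kern s)" by (simp add: set_integrable_def)
  have "(\<integral>s. indicator {0<..} s * kern s \<partial>lborel) = integral {0<..} kern"
    using set_borel_integral_eq_integral(2)[OF kb] by (simp add: set_lebesgue_integral_def)
  also have "\<dots> = (LBINT y:{0<..}. f y)" using k(2) set_borel_integral_eq_integral(2)[OF f_int] by simp
  also have "\<dots> = \<alpha> * (LBINT y:{0<..}. y powr (- \<alpha>) * gc y)" by (simp add: f_def)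
  also have "(LBINT y:{0<..}. y powr (- \<alpha>) * gc y) = (LBINT y:{0<..}. y powr (- \<alpha>) * g y)"
    unfolding set_lebesgue_integral_def using gc_AE by (intro integral_cong_AE) auto
  finally show "(\<integral>s. indicator {0<..} s * kern s \<partial>lborel) = \<alpha> * (LBINT x:{0<..}. x powr (- \<alpha>) * g x)" .
qed

lemma kern_truncated_tendsto:
  "(\<lambda>n. (\<integral>s. indicator {inverse (real (Suc n))<..} s * kern s \<partial>lborel)) \<longlonglongrightarrow> (\<integral>s. indicator {0<..} s * kern s \<partial>lborel)"
proof (rule integral_dominated_convergence[where w="\<lambda>s. indicator {0<..} s * kern s"])
  show "AE s in lborel. (\<lambda>n. indicator {inverse (real (Suc n))<..} s * kern s) \<longlonglongrightarrow> indicator {0<..} s * kern s"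
  proof (intro AE_I2)
    fix s :: real
    have "eventually (\<lambda>n. indicator {inverse (real (Suc n))<..} s = (indicator {0<..} s :: real)) sequentially"
    proof (cases "s > 0")
      case True
      then have "eventually (\<lambda>n. inverse (real (Suc n)) < s) sequentially"
        by (rule order_tendstoD(2)[OF LIMSEQ_inverse_real_of_nat])
      then show ?thesis by eventually_elim (use True in simp)
    next
      case False
      have "\<not> inverse (real (Suc n)) < s" for n
        using False by (smt (verit) inverse_positive_iff_positive of_nat_0_less_iff zero_less_Suc)
      then show ?thesis using False by (simp add: indicator_def)
    qed
    then show "(\<lambda>n. indicator {inverse (real (Suc n))<..} s * kern s) \<longlonglongrightarrow> indicator {0<..} s * kern s"
      by (intro tendsto_eventually) (auto elim: eventually_mono)
  qed
  show "AE s in lborel. norm (indicator {inverse (real (Suc n))<..} s * kern s) \<le> indicator {0<..} s * kern s" for n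
  proof (intro AE_I2)
    fix s :: real
    have "s > 0" if "inverse (real (Suc n)) < s"
      using that by (rule less_trans[rotated]) simp
    then show "norm (indicator {inverse (real (Suc n))<..} s * kern s) \<le> indicator {0<..} s * kern s"
      using kern_nonneg[of s] by (auto simp: indicator_def)
  qed
qed (auto intro: kern_integral(1))

text \<open>The lower Potter bound gives 1 / W x at least a multiple of x^\<beta> with \<beta> > 0,
  so the exponential beats the remaining factor x.\<close>

lemma boundary_term_tendsto:
  assumes \<delta>: "\<delta> > 0"
  shows "((\<lambda>x. x * W x * (\<delta> / W x * exp (- (\<delta> / W x)))) \<longlongrightarrow> 0) at_top"
proof -
  define \<beta> where "\<beta> = \<alpha> / 2"
  have b: "0 < \<beta>" "\<beta> < \<alpha>" using alpha_pos by (auto simp: \<beta>_def)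
  obtain C where C: "C > 0" "\<And>x y. 1 \<le> y \<Longrightarrow> y \<le> x \<Longrightarrow> W x \<le> C * (y / x) powr \<beta> * W y"
    using tail_potter_lower[OF b] by blast
  define c where "c = \<delta> / C"
  have c: "c > 0" using \<delta> C by (simp add: c_def)
  have "((\<lambda>x::real. x * \<delta> * exp (- (c * x powr \<beta>))) \<longlongrightarrow> 0) at_top"
    using c b(1) \<delta> by real_asymp
  moreover have "eventually (\<lambda>x. norm (x * W x * (\<delta> / W x * exp (- (\<delta> / W x)))) \<le> x * \<delta> * exp (- (c * x powr \<beta>))) at_top"
    using eventually_ge_at_top[of 1]
  proof eventually_elim
    case (elim x)
    have "W x \<le> C * (1 / x) powr \<beta> * W 1" using C(2)[of 1 x] elim by simp
    also have "\<dots> \<le> C * (1 / x) powr \<beta> * 1" using C tail_le_1 by (intro mult_left_mono) auto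
    also have "\<dots> = C / x powr \<beta>" using elim by (simp add: powr_divide)
    finally have "W x * x powr \<beta> \<le> C" using elim by (simp add: field_simps)
    then have "\<delta> * (W x * x powr \<beta>) \<le> \<delta> * C" using \<delta> by simp
    then have "c * x powr \<beta> \<le> \<delta> / W x" using C tail_pos[of x] by (simp add: c_def field_simps)
    then have "exp (- (\<delta> / W x)) \<le> exp (- (c * x powr \<beta>))" by simp
    then have "x * \<delta> * exp (- (\<delta> / W x)) \<le> x * \<delta> * exp (- (c * x powr \<beta>))"
      using elim \<delta> by (intro mult_left_mono) auto
    then show ?case using elim tail_pos[of x] \<delta> by (simp add: abs_mult)
  qed
  ultimately show ?thesis by (rule Lim_null_comparison[rotated])
qed

text \<open>Both halves of the limit compare the renewal mass with its part after time \<delta> / W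
  x, and \<delta> tends to 0 only after x tends to infinity. Working in \<open>ennreal\<close> with
  order bounds yields finiteness of the renewal mass for large x along the way.\<close>

lemma strong_renewal:
  assumes L1: "\<And>x. x > 0 \<Longrightarrow> L x \<ge> 1" and T: "T \<ge> 0" and \<delta>0: "0 < \<delta>0" "\<delta>0 \<le> 1"
    and early: "((\<lambda>x. x / r x * (\<Sum>n\<in>{n::nat. real n < L x}. FI (conv_pow F n) h x)) \<longlongrightarrow> 0) at_top"
    and key: "((\<lambda>x. ennreal (x * W x * ratio_sum L x \<delta>0) * excess_tail T (bfrac * x / 2)) \<longlongrightarrow> 0) at_top"
  shows "((\<lambda>x. ennreal (x * W x) * renewal_I F h x) \<longlongrightarrow> ennreal (\<alpha> * h * (LBINT x:{0<..}. x powr (- \<alpha>) * g x))) at_top"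
proof -
  define I where "I \<delta> = (\<integral>s. indicator {\<delta><..} s * kern s \<partial>lborel)" for \<delta>
  define d where "d n = inverse (real (Suc n))" for n
  define late where "late \<delta> x = (\<integral>\<^sup>+t. pois_mass x t * indicator {\<delta> / W x<..} t \<partial>lborel)" for \<delta> x
  have d: "d n > 0" for n by (simp add: d_def)
  have I0: "h * I 0 = \<alpha> * h * (LBINT x:{0<..}. x powr (- \<alpha>) * g x)" by (simp add: I_def kern_integral(2))
  have I_nonneg: "I \<delta> \<ge> 0" for \<delta> unfolding I_def using kern_nonneg by (intro Bochner_Integration.integral_nonneg) auto
  have I_lim: "(\<lambda>n. I (d n)) \<longlonglongrightarrow> I 0" unfolding I_def d_def by (rule kern_truncated_tendsto)
  have I_le: "I (d n) \<le> I 0" for n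
    unfolding I_def using d[of n] kern_nonneg
    by (intro integral_mono large_time_limit(2)[OF d] kern_integral(1)) (auto simp: indicator_def)
  have late_lim: "((\<lambda>x. ennreal (x * W x) * late \<delta> x) \<longlongrightarrow> ennreal (h * I \<delta>)) at_top" if "\<delta> > 0" for \<delta>
    unfolding late_def I_def by (rule large_time_limit(1)[OF that])
  obtain K where K: "K > 0" "\<And>\<delta>. 0 < \<delta> \<Longrightarrow> \<delta> \<le> \<delta>0 \<Longrightarrow> eventually (\<lambda>x. ennreal (x * W x) *
     (\<Sum>n\<in>nrange L x \<delta>. emeasure (conv_pow F n) {x<..x+h}) \<le> ennreal (K * \<delta>)) at_top"
    using moderate_n_sum[OF L1 T \<delta>0 key] by blast
  have "((\<lambda>x. (W x * r x) * (x / r x * (\<Sum>n\<in>{n::nat. real n < L x}. FI (conv_pow F n) h x))) \<longlongrightarrow> 1 * 0) at_top"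
    by (intro tendsto_mult tail_r early)
  then have early': "((\<lambda>x. (W x * r x) * (x / r x * (\<Sum>n\<in>{n::nat. real n < L x}. FI (conv_pow F n) h x))) \<longlongrightarrow> 0) at_top"
    by simp
  have lower: "late \<delta> x \<le> renewal_I F h x" if "\<delta> > 0" for \<delta> x
  proof -
    have "\<delta> / W x > 0" using that tail_pos by simp
    then show ?thesis unfolding late_def renewal_eq
      by (intro nn_integral_mono) (auto simp: indicator_def)
  qed
  show ?thesis unfolding I0[symmetric]
  proof (rule order_tendstoI)
    \<comment> \<open>Lower bound: dropping the early times is free, and the late limits h * I (d n)
      tend to h * I 0.\<close>
    fix c assume c: "c < ennreal (h * I 0)"
    have "(\<lambda>n. ennreal (h * I (d n))) \<longlonglongrightarrow> ennreal (h * I 0)" by (intro tendsto_intros I_lim tendsto_ennrealI)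
    then have "eventually (\<lambda>n. c < ennreal (h * I (d n))) sequentially" using c by (rule order_tendstoD(1))
    then obtain n where "c < ennreal (h * I (d n))" using eventually_happens by force
    from order_tendstoD(1)[OF late_lim[OF d] this]
    show "eventually (\<lambda>x. c < ennreal (x * W x) * renewal_I F h x) at_top"
    proof eventually_elim
      case (elim x)
      have "ennreal (x * W x) * late (d n) x \<le> ennreal (x * W x) * renewal_I F h x"
        using lower[OF d] by (intro mult_left_mono) auto
      then show ?case using elim by order
    qed
  next
    fix c assume c: "ennreal (h * I 0) < c"
    then obtain b where b: "ennreal (h * I 0) < b" "b < c" using dense by blast
    then obtain b' where b': "b = ennreal b'" "b' \<ge> 0" by (cases b) (auto simp: top_unique)
    \<comment> \<open>A quarter of the gap each for the terms n < L x, for the remaining n up to 4 *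
      \<delta> / W x, for the Poisson remainder, and for the late part.\<close>
    define e where "e = (b' - h * I 0) / 4"
    have "h * I 0 < b'" using b b' h_pos I_nonneg by (simp add: ennreal_less_iff)
    then have e: "e > 0" "h * I 0 + e + e + e + e = b'" by (auto simp: e_def field_simps)
    have "(\<lambda>n. d n) \<longlonglongrightarrow> 0" unfolding d_def by (rule LIMSEQ_inverse_real_of_nat)
    then have "eventually (\<lambda>n. d n < min (\<delta>0 / 4) (e / (4 * K))) sequentially"
      by (rule order_tendstoD(2)) (use \<delta>0 e K in simp)
    then obtain n where "d n < min (\<delta>0 / 4) (e / (4 * K))" using eventually_happens by force
    then have n: "4 * d n \<le> \<delta>0" "K * (4 * d n) \<le> e" using K by (auto simp: field_simps)
    define \<delta> where "\<delta> = d n"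
    have \<delta>: "\<delta> > 0" by (simp add: \<delta>_def d)
    have "h * I \<delta> \<le> h * I 0" unfolding \<delta>_def using h_pos I_le by (intro mult_left_mono) auto
    then have "h * I \<delta> < h * I 0 + e" using e(1) by linarith
    then have "ennreal (h * I \<delta>) < ennreal (h * I 0 + e)" using h_pos I_nonneg by (intro ennreal_lessI) (auto intro: add_nonneg_pos e)
    from order_tendstoD(2)[OF late_lim[OF \<delta>] this]
    have "eventually (\<lambda>x. ennreal (x * W x) * late \<delta> x < ennreal (h * I 0 + e)) at_top" .
    moreover have "eventually (\<lambda>x. ennreal (x * W x) * (\<Sum>n\<in>nrange L x (4 * \<delta>). emeasure (conv_pow F n) {x<..x+h}) \<le> ennreal (K * (4 * \<delta>))) at_top"
      using n \<delta> by (intro K(2)) (auto simp: \<delta>_def)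
    moreover have "eventually (\<lambda>x. W x * r x * (x / r x * (\<Sum>n\<in>{n::nat. real n < L x}. FI (conv_pow F n) h x)) < e) at_top"
      by (rule order_tendstoD(2)[OF early' e(1)])
    moreover have "eventually (\<lambda>x. x * W x * (\<delta> / W x * exp (- (\<delta> / W x))) < e) at_top"
      by (rule order_tendstoD(2)[OF boundary_term_tendsto[OF \<delta>] e(1)])
    ultimately show "eventually (\<lambda>x. ennreal (x * W x) * renewal_I F h x < c) at_top"
      using eventually_gt_at_top[of 0]
    proof eventually_elim
      case (elim x)
      define N where "N = {n::nat. real n < L x}"
      define m where "m n = emeasure (conv_pow F n) {x<..x+h}" for n
      define \<tau> where "\<tau> = \<delta> / W x"
      have tau: "\<tau> > 0" using \<delta> tail_pos by (simp add: \<tau>_def)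
      have finN: "finite N"
        by (rule finite_subset[of _ "{..nat \<lceil>L x\<rceil>}"]) (auto simp: N_def, linarith)
      have "renewal_I F h x = (\<integral>\<^sup>+t. pois_mass x t * indicator {0<..\<tau>} t + pois_mass x t * indicator {\<tau><..} t \<partial>lborel)"
        unfolding renewal_eq using tau by (intro nn_integral_cong) (auto simp: indicator_def)
      also have "\<dots> = (\<integral>\<^sup>+t. pois_mass x t * indicator {0<..\<tau>} t \<partial>lborel) + late \<delta> x"
        unfolding late_def \<tau>_def[symmetric] by (intro nn_integral_add) auto
      also have "\<dots> \<le> (\<Sum>k\<in>{k. real k \<le> 4 * \<tau>}. m k) + ennreal (\<tau> * exp (- \<tau>)) + late \<delta> x"
        unfolding m_def using tau by (intro add_right_mono small_time_bound) auto
      also have "(\<Sum>k\<in>{k. real k \<le> 4 * \<tau>}. m k) \<le> (\<Sum>k\<in>N \<union> nrange L x (4 * \<delta>). m k)"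
      proof (rule sum_mono2)
        show "{k. real k \<le> 4 * \<tau>} \<subseteq> N \<union> nrange L x (4 * \<delta>)"
          using tail_pos[of x] by (auto simp: N_def nrange_def \<tau>_def field_simps)
      qed (use finN finite_nrange in auto)
      also have "\<dots> \<le> (\<Sum>k\<in>N. m k) + (\<Sum>k\<in>nrange L x (4 * \<delta>). m k)"
        using finN finite_nrange by (subst sum.union_inter[symmetric]) (auto)
      finally have "renewal_I F h x \<le> (\<Sum>k\<in>N. m k) + (\<Sum>k\<in>nrange L x (4 * \<delta>). m k) + ennreal (\<tau> * exp (- \<tau>)) + late \<delta> x"
        by (simp add: add_right_mono)
      then have "ennreal (x * W x) * renewal_I F h x \<le> ennreal (x * W x) * ((\<Sum>k\<in>N. m k) + (\<Sum>k\<in>nrange L x (4 * \<delta>). m k) + ennreal (\<tau> * exp (- \<tau>)) + late \<delta> x)"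
        by (rule mult_left_mono) simp
      also have "\<dots> = ennreal (x * W x) * (\<Sum>k\<in>N. m k) + ennreal (x * W x) * (\<Sum>k\<in>nrange L x (4 * \<delta>). m k)
          + ennreal (x * W x) * ennreal (\<tau> * exp (- \<tau>)) + ennreal (x * W x) * late \<delta> x"
        by (simp add: distrib_left)
      also have "\<dots> \<le> ennreal e + ennreal e + ennreal e + ennreal (h * I 0 + e)"
      proof (intro add_mono)
        have "(\<Sum>k\<in>N. m k) = ennreal (\<Sum>k\<in>N. FI (conv_pow F k) h x)"
          by (simp add: m_def FI_def finite_measure.emeasure_eq_measure[OF finite_conv_pow_F])
        then have "ennreal (x * W x) * (\<Sum>k\<in>N. m k) = ennreal (x * W x * (\<Sum>k\<in>N. FI (conv_pow F k) h x))"
          using elim by (simp add: ennreal_mult sum_nonneg FI_def)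
        also have "x * W x * (\<Sum>k\<in>N. FI (conv_pow F k) h x) = W x * r x * (x / r x * (\<Sum>k\<in>N. FI (conv_pow F k) h x))"
          using r_pos[OF elim(5)] by simp
        finally show "ennreal (x * W x) * (\<Sum>k\<in>N. m k) \<le> ennreal e" using elim(3) by (simp add: N_def ennreal_leI)
        show "ennreal (x * W x) * (\<Sum>k\<in>nrange L x (4 * \<delta>). m k) \<le> ennreal e"
          using elim(2) n(2) unfolding m_def \<delta>_def by (meson ennreal_leI order_trans)
        have "ennreal (x * W x) * ennreal (\<tau> * exp (- \<tau>)) = ennreal (x * W x * (\<tau> * exp (- \<tau>)))"
          using elim tau by (intro ennreal_mult[symmetric]) auto
        then show "ennreal (x * W x) * ennreal (\<tau> * exp (- \<tau>)) \<le> ennreal e"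
          using elim(4) unfolding \<tau>_def by (simp add: ennreal_leI)
        show "ennreal (x * W x) * late \<delta> x \<le> ennreal (h * I 0 + e)" using elim(1) by simp
      qed
      also have "\<dots> = b"
        using e h_pos I_nonneg[of 0] by (simp add: b'(1) ennreal_plus[symmetric] add_ac del: ennreal_plus)
      finally show ?case using b(2) by order
    qed
  qed
qed

end

theorem theorem1p1:
  fixes F :: "real measure" and \<alpha> h T \<eta> :: real
    and r L g :: "real \<Rightarrow> real"
  assumes F_prob: "prob_space F" and F_sets: "sets F = sets borel"
    and \<alpha>_range: "0 < \<alpha>" "\<alpha> \<le> 1/2"
    and r_rv: "reg_var \<alpha> r"
    and tail_i: "Ftail F \<sim>[at_top] (\<lambda>x. 1 / r x)"
    and tail_ii: "\<exists>c. ((\<lambda>x. Fdist F (- x) / Ftail F x) \<longlongrightarrow> c) at_top"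
    and h_pos: "h > 0" and h_span: "arithmetic F \<longrightarrow> is_span F h"
    and g_meas: "g \<in> borel_measurable borel" and g_nonneg: "\<And>x. g x \<ge> 0"
    and g_prob: "prob_space (density lborel g)"
    and g_limit: "weak_conv_m (\<lambda>n. distr (conv_pow F n) borel (\<lambda>x. x / ginv r (real n)))
                              (density lborel g)"
    and L_rv: "reg_var_any L" and L_ge1: "\<And>x. x > 0 \<Longrightarrow> L x \<ge> 1"
    and T_nonneg: "T \<ge> 0" and \<eta>_range: "0 < \<eta>" "\<eta> \<le> 1"
    and cond_a1: "((\<lambda>x. L x / r x) \<longlongrightarrow> 0) at_top"
    and cond_a2: "((\<lambda>x. x / r x * (\<Sum>n\<in>{n::nat. real n < L x}. FI (conv_pow F n) h x))
                    \<longlongrightarrow> 0) at_top"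
    and cond_b: "\<alpha> < 1/2 \<Longrightarrow>
        (\<lambda>x. Phi F h \<eta> x T) \<in> o[at_top](\<lambda>x. (r x)\<^sup>2 * ginv r (L x) / (L x)\<^sup>2)"
    and cond_c: "\<alpha> = 1/2 \<Longrightarrow>
        (let u = (\<lambda>x::real. LBINT s=1..x. (r s / s)\<^sup>2); k = (\<lambda>x. (r x)\<^sup>2 / u x) in
          (if ((\<lambda>x. u x / u (ginv r (L x))) \<longlongrightarrow> 1) at_top
           then (\<lambda>x. Phi F h \<eta> x T) \<in> O[at_top](k)
           else (\<lambda>x. Phi F h \<eta> x T) \<in> o[at_top](k)))"
  shows "((\<lambda>x. ennreal (x * Ftail F x) * renewal_I F h x)
           \<longlongrightarrow> ennreal (\<alpha> * h * (LBINT x:{0<..}. x powr (- \<alpha>) * g x))) at_top"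
proof -
  have "\<alpha> < 1" using \<alpha>_range by simp
  then interpret ht: heavy_tail F \<alpha> r
    by (intro heavy_tail.intro F_prob F_sets \<alpha>_range r_rv tail_i tail_ii)
  have "real_distribution (density lborel g)"
    by (intro real_distribution.intro real_distribution_axioms.intro g_prob) auto
  \<comment> \<open>Any weak limit that is a probability law rules out a bounded normalizer.\<close>
  then have "filterlim (ginv r) at_top at_top" using g_limit by (rule ht.normalizer_at_top)
  then interpret stable_renewal F \<alpha> r h g
    by (intro stable_renewal.intro stable_renewal_axioms.intro heavy_tail_norm.intro heavy_tail_norm_axioms.intro
        ht.heavy_tail_axioms h_pos h_span g_meas g_nonneg g_prob g_limit)
  obtain \<gamma> where L: "reg_var \<gamma> L" using L_rv by (auto simp: reg_var_any_def)
  obtain \<delta>0 where "0 < \<delta>0" "\<delta>0 \<le> 1"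
    "((\<lambda>x. ennreal (x * Ftail F x * ratio_sum L x \<delta>0) * excess_tail T (bfrac * x / 2)) \<longlongrightarrow> 0) at_top"
  proof (cases "\<alpha> < 1/2")
    case True
    from that[OF _ _ big_jump_term_tendsto_0_lt_half[OF True L L_ge1 cond_a1 \<eta>_range cond_b[OF True]]] show ?thesis by simp
  next
    case False
    then have half: "\<alpha> = 1/2" using \<alpha>_range by simp
    have "if ((\<lambda>x. usum x / usum (ginv r (L x))) \<longlongrightarrow> 1) at_top
           then (\<lambda>x. Phi F h \<eta> x T) \<in> O[at_top](\<lambda>x. (r x)\<^sup>2 / usum x)
           else (\<lambda>x. Phi F h \<eta> x T) \<in> o[at_top](\<lambda>x. (r x)\<^sup>2 / usum x)"
      using cond_c[OF half] by (simp only: Let_def usum_def)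
    from big_jump_term_tendsto_0_half[OF half L_ge1 cond_a1 \<eta>_range this] that show ?thesis by blast
  qed
  from strong_renewal[OF L_ge1 T_nonneg this(1,2) cond_a2 this(3)] show ?thesis .
qed

end
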